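(* Let $\nu\ge1$, let $\mathbf{N}$ be a $\nu\times\nu$ integer matrix with $|\det\mathbf{N}|=N\in\{2,3,\dots\}$ all of whose complex eigenvalues have modulus greater than $1$, let $D\subset\mathbb{Z}^\nu$ be finite, and let $m_j(z)=\sum_{n\in D}a_n^{(j)}z^n$, $j=0,\dots,N-1$, be polynomials on $\mathbb{T}^\nu$ satisfying the unitarity condition stated in the context. Put $a_n^{(j)}=0$ for $n\notin D$. Consider the associated polynomial representation $s_j\mapsto S_j$ of $\mathcal{O}_N$ on $L^2(\mathbb{T}^\nu)$, $(S_j\xi)(z)=m_j(z)\xi(z^{\mathbf{N}})$. Let $H$ be a minimal finite subset of $\mathbb{Z}^\nu$ with the property that for every $n\in\mathbb{Z}^\nu$ there is $M\in\mathbb{N}$ such that $S_I^*e_n\in\operatorname{span}\{e_m\mid m\in H\}$ for all multi-indices $I$ with $|I|\ge M$. Then: (i) $\mathcal{K}=\operatorname{span}\{e_m\mid m\in H\}$ is cyclic for the representation, and thus the representation is finitely correlated. (ii) Define $V_j^*\in\mathcal{B}(\mathcal{K})$ by $$V_j^*e_n=\sum_{m\in H}\overline{a^{(j)}_{n-\mathbf{N}m}}\,e_m=\sum_{\substack{p\in D:\ p=n\bmod\mathbf{N}\\ \sigma_p(n)\in H}}\overline{a_p^{(j)}}\,e_{\sigma_p(n)},\qquad n\in H.$$ Then the commutant of the representation is isometrically order isomorphic to $$\mathcal{B}(\mathcal{K})^{\boldsymbol\sigma}=\Bigl\{A\in\mathcal{B}(\mathcal{K})\Bigm|\boldsymbol\sigma(A):=\sum_{k=0}^{N-1}V_kAV_k^*=A\Bigr\}.$$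 (iii) In particular the representation is irreducible if and only if $\mathcal{B}(\mathcal{K})^{\boldsymbol\sigma}=\mathbb{C}1$. In this case the peripheral spectrum of $\boldsymbol\sigma$ (its spectrum intersected with $\mathbb{T}$) is a finite, necessarily cyclic, subgroup of $\mathbb{T}$, and if $k$ is the order of this subgroup, the restriction of the representation to $\mathrm{UHF}_N$ decomposes into the direct sum of $k$ mutually disjoint irreducible representations. (iv) If $s_i\mapsto T_i$ is another representation of $\mathcal{O}_N$ of this type, on the Hilbert space $\mathcal{H}_1$, with corresponding finite-dimensional space $\mathcal{K}_1$ and operators $W_i\in\mathcal{B}(\mathcal{K}_1)$ (playing the roles of $\mathcal{K}$ and $V_i$), and $P$, $P_1$ are the orthogonal projections of $L^2(\mathbb{T}^\nu)$ onto $\mathcal{K}$ and of $\mathcal{H}_1$ onto $\mathcal{K}_1$, then $U\mapsto P_1UP$ gives an isometric linear isomorphism from the space of bounded operators $U\colon L^2(\mathbb{T}^\nu)\to\mathcal{H}_1$ with $US_i=T_iU$ for all $i$ (the space of intertwiners) onto the space of $V\in\mathcal{B}(\mathcal{K},\mathcal{K}_1)$ with $\sum_{i=0}^{N-1}W_iVV_i^*=V$.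
   Context: $\mathcal{O}_N$ is the Cuntz algebra, the universal $C^*$-algebra generated by $s_0,\dots,s_{N-1}$ with $s_i^*s_j=\delta_{ij}1$, $\sum_js_js_j^*=1$. $\mathrm{UHF}_N\subset\mathcal{O}_N$ is the closed linear span of the monomials $s_{i_1}\cdots s_{i_k}s_{j_k}^*\cdots s_{j_1}^*$ (the fixed point algebra of the gauge action $s_i\mapsto zs_i$, $z\in\mathbb{T}$). For $z=(z_1,\dots,z_\nu)\in\mathbb{T}^\nu$, $n\in\mathbb{Z}^\nu$: $z^n=z_1^{n_1}\cdots z_\nu^{n_\nu}$, and $e_n\in L^2(\mathbb{T}^\nu)$ is $e_n(z)=z^n$. For $\mathbf{N}=[n_{ij}]$, $z^{\mathbf{N}}=(z_1^{n_{11}}\cdots z_\nu^{n_{\nu1}},\dots,z_1^{n_{1\nu}}\cdots z_\nu^{n_{\nu\nu}})$, so that $(z^{\mathbf{N}})^n=z^{\mathbf{N}n}$; the map $z\mapsto z^{\mathbf{N}}$ is $N$-to-$1$. "Polynomial" means a trigonometric polynomial with finite frequency set $D$ as displayed in the claim. Unitarity condition: for almost all $z\in\mathbb{T}^\nu$ the $N\times N$ matrix $\frac{1}{\sqrt N}\bigl(m_i(w)\bigr)_{i,w}$, with rows indexed by $i=0,\dots,N-1$ and columns by the $N$ solutions $w$ of $w^{\mathbf{N}}=z$, is unitary. It ensures that the $S_j$ satisfy the Cuntz relations. One has $S_j^*e_n=\sum_{m\in\mathbb{Z}^\nu}\overline{a^{(j)}_{n-\mathbf{N}m}}e_m$. For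 $p\in D$, $\sigma_p(x)=\mathbf{N}^{-1}(x-p)$; $p=n\bmod\mathbf{N}$ means $n-p\in\mathbf{N}\mathbb{Z}^\nu$. For a multi-index $I=(i_1,\dots,i_k)$, $i_l\in\{0,\dots,N-1\}$: $|I|=k$, $S_I=S_{i_1}\cdots S_{i_k}$. A representation $s_i\mapsto S_i\in\mathcal{B}(\mathcal{H})$ is called finitely correlated if there is a finite-dimensional subspace $\mathcal{K}\subset\mathcal{H}$ with $S_i^*\mathcal{K}\subset\mathcal{K}$ for all $i$ which is cyclic for the representation. Two representations are disjoint if the only bounded intertwiner between them is $0$.
   Formalization: Minimality of H does not imply S_i^*K ⊂ K, and without it the "iff" in (iii) and (iv) can fail; "irreducible implies B(K)^σ = C1" and (iv) are therefore stated assuming S_i^*K ⊂ K for all i (in (iv) for both K and K_1). *)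

theory Defs
  imports "HOL-Analysis.Analysis" "HOL-Algebra.Elementary_Groups"
begin

section \<open>Complex inner product spaces and operators between subspaces\<close>

class complex_inner = real_inner +
  fixes scaleC :: "complex \<Rightarrow> 'a \<Rightarrow> 'a" (infixr "*\<^sub>C" 75)
    and cinner :: "'a \<Rightarrow> 'a \<Rightarrow> complex"
  assumes scaleC_add_right: "c *\<^sub>C (x + y) = c *\<^sub>C x + c *\<^sub>C y"
    and scaleC_add_left: "(c + d) *\<^sub>C x = c *\<^sub>C x + d *\<^sub>C x"
    and scaleC_scaleC: "c *\<^sub>C d *\<^sub>C x = (c * d) *\<^sub>C x"
    and scaleR_scaleC: "r *\<^sub>R x = complex_of_real r *\<^sub>C x"
    and cinner_commute: "cinner x y = cnj (cinner y x)"
    and cinner_add_right: "cinner x (y + z) = cinner x y + cinner x z"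
    and cinner_scaleC_right: "cinner x (c *\<^sub>C y) = c * cinner x y"
    and inner_eq_Re_cinner: "inner x y = Re (cinner x y)"

global_interpretation complex_vector: vector_space "scaleC :: complex \<Rightarrow> 'a \<Rightarrow> 'a::complex_inner"
  defines csubspace = complex_vector.subspace
    and cspan = complex_vector.span
proof
  fix x :: 'a
  show "1 *\<^sub>C x = x"
    using scaleR_scaleC[of 1 x] by simp
qed (simp_all add: scaleC_add_right scaleC_add_left scaleC_scaleC)

text \<open>An operator between subspaces \<open>M\<close> and \<open>L\<close> is a function that is extensional
  (i.e. \<open>undefined\<close>) outside \<open>M\<close>, so that equality of operators is equality of functions.
  For \<open>M = UNIV\<close> there is no restriction.\<close>

definition bops :: "'a::complex_inner set \<Rightarrow> 'b::complex_inner set \<Rightarrow> ('a \<Rightarrow> 'b) set" where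
  "bops M L = {A \<in> M \<rightarrow>\<^sub>E L.
      (\<forall>x\<in>M. \<forall>y\<in>M. A (x + y) = A x + A y) \<and>
      (\<forall>c. \<forall>x\<in>M. A (c *\<^sub>C x) = c *\<^sub>C A x) \<and>
      (\<exists>B. \<forall>x\<in>M. norm (A x) \<le> B * norm x)}"

definition op_add :: "'a set \<Rightarrow> ('a \<Rightarrow> 'b::complex_inner) \<Rightarrow> ('a \<Rightarrow> 'b) \<Rightarrow> 'a \<Rightarrow> 'b" where
  "op_add M A B = (\<lambda>x\<in>M. A x + B x)"

definition op_scale :: "'a set \<Rightarrow> complex \<Rightarrow> ('a \<Rightarrow> 'b::complex_inner) \<Rightarrow> 'a \<Rightarrow> 'b" where
  "op_scale M c A = (\<lambda>x\<in>M. c *\<^sub>C A x)"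

definition op_norm :: "'a::complex_inner set \<Rightarrow> ('a \<Rightarrow> 'b::complex_inner) \<Rightarrow> real" where
  "op_norm M A = (SUP x\<in>M. norm (A x) / norm x)"

definition op_le :: "'a::complex_inner set \<Rightarrow> ('a \<Rightarrow> 'a) \<Rightarrow> ('a \<Rightarrow> 'a) \<Rightarrow> bool" where
  "op_le M A B \<longleftrightarrow> (\<forall>x\<in>M. cinner x (B x - A x) \<in> \<real>\<^sub>\<ge>\<^sub>0)"

definition op_adj :: "'a::complex_inner set \<Rightarrow> 'b::complex_inner set \<Rightarrow> ('a \<Rightarrow> 'b) \<Rightarrow> 'b \<Rightarrow> 'a" where
  "op_adj M L A = (THE B. B \<in> bops L M \<and> (\<forall>x\<in>M. \<forall>y\<in>L. cinner (A x) y = cinner x (B y)))"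

abbreviation hadj :: "('a::complex_inner \<Rightarrow> 'b::complex_inner) \<Rightarrow> 'b \<Rightarrow> 'a" where
  "hadj \<equiv> op_adj UNIV UNIV"

definition orth_proj :: "'a::complex_inner set \<Rightarrow> 'a \<Rightarrow> 'a" where
  "orth_proj K x = (THE y. y \<in> K \<and> (\<forall>v\<in>K. cinner v (x - y) = 0))"

definition isometric_linear_iso ::
  "'a::complex_inner set \<Rightarrow> ('a \<Rightarrow> 'b::complex_inner) set \<Rightarrow>
   'c::complex_inner set \<Rightarrow> ('c \<Rightarrow> 'd::complex_inner) set \<Rightarrow> (('a \<Rightarrow> 'b) \<Rightarrow> 'c \<Rightarrow> 'd) \<Rightarrow> bool" where
  "isometric_linear_iso M \<A> L \<B> \<phi> \<longleftrightarrow>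
     bij_betw \<phi> \<A> \<B> \<and>
     (\<forall>A\<in>\<A>. \<forall>B\<in>\<A>. \<phi> (op_add M A B) = op_add L (\<phi> A) (\<phi> B)) \<and>
     (\<forall>c. \<forall>A\<in>\<A>. \<phi> (op_scale M c A) = op_scale L c (\<phi> A)) \<and>
     (\<forall>A\<in>\<A>. op_norm L (\<phi> A) = op_norm M A)"


section \<open>Representations of the Cuntz algebra\<close>

text \<open>By universality a representation of the Cuntz algebra is a tuple \<open>S 0, \<dots>, S (N - 1)\<close> of bounded
  operators satisfying the Cuntz relations; \<open>\<O>\<^sub>N\<close> and its subalgebra \<open>UHF\<^sub>N\<close> enter through their
  images under the representation.\<close>

definition cuntz_rep :: "nat \<Rightarrow> (nat \<Rightarrow> 'a::complex_inner \<Rightarrow> 'a) \<Rightarrow> bool" where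
  "cuntz_rep N S \<longleftrightarrow>
     (\<forall>i<N. S i \<in> bops UNIV UNIV \<and> hadj (S i) \<in> bops UNIV UNIV) \<and>
     (\<forall>i<N. \<forall>j<N. \<forall>x. hadj (S i) (S j x) = (if i = j then x else 0)) \<and>
     (\<forall>x. (\<Sum>j<N. S j (hadj (S j) x)) = x)"

definition op_word :: "(nat \<Rightarrow> 'a \<Rightarrow> 'a) \<Rightarrow> nat list \<Rightarrow> 'a \<Rightarrow> 'a" where
  "op_word S I = foldr (\<circ>) (map S I) id"

text \<open>Closed linear span in the operator norm.\<close>

definition op_closed_span :: "('a::complex_inner \<Rightarrow> 'a) set \<Rightarrow> ('a \<Rightarrow> 'a) set" where
  "op_closed_span G = {A \<in> bops UNIV UNIV. \<forall>\<epsilon>>0. \<exists>F c. finite F \<and> F \<subseteq> G \<and>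
      op_norm UNIV (\<lambda>x. A x - (\<Sum>g\<in>F. c g *\<^sub>C g x)) < \<epsilon>}"

inductive_set star_words :: "nat \<Rightarrow> (nat \<Rightarrow> 'a::complex_inner \<Rightarrow> 'a) \<Rightarrow> ('a \<Rightarrow> 'a) set"
  for N :: nat and S :: "nat \<Rightarrow> 'a::complex_inner \<Rightarrow> 'a" where
  "id \<in> star_words N S"
| "i < N \<Longrightarrow> w \<in> star_words N S \<Longrightarrow> S i \<circ> w \<in> star_words N S"
| "i < N \<Longrightarrow> w \<in> star_words N S \<Longrightarrow> hadj (S i) \<circ> w \<in> star_words N S"

definition cuntz_image :: "nat \<Rightarrow> (nat \<Rightarrow> 'a::complex_inner \<Rightarrow> 'a) \<Rightarrow> ('a \<Rightarrow> 'a) set" where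
  "cuntz_image N S = op_closed_span (star_words N S)"

definition uhf_image :: "nat \<Rightarrow> (nat \<Rightarrow> 'a::complex_inner \<Rightarrow> 'a) \<Rightarrow> ('a \<Rightarrow> 'a) set" where
  "uhf_image N S = op_closed_span
     {op_word S I \<circ> hadj (op_word S J) | I J.
        set I \<subseteq> {..<N} \<and> set J \<subseteq> {..<N} \<and> length I = length J}"

definition cyclic_for :: "('a::complex_inner \<Rightarrow> 'a) set \<Rightarrow> 'a set \<Rightarrow> bool" where
  "cyclic_for \<A> K \<longleftrightarrow> closure (cspan {A x | A x. A \<in> \<A> \<and> x \<in> K}) = UNIV"

definition coinvariant :: "nat \<Rightarrow> (nat \<Rightarrow> 'a::complex_inner \<Rightarrow> 'a) \<Rightarrow> 'a set \<Rightarrow> bool" where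
  "coinvariant N S K \<longleftrightarrow> (\<forall>i<N. hadj (S i) ` K \<subseteq> K)"

definition finitely_correlated :: "nat \<Rightarrow> (nat \<Rightarrow> 'a::complex_inner \<Rightarrow> 'a) \<Rightarrow> bool" where
  "finitely_correlated N S \<longleftrightarrow> cuntz_rep N S \<and>
     (\<exists>B. finite B \<and> coinvariant N S (cspan B) \<and> cyclic_for (cuntz_image N S) (cspan B))"

definition commutant :: "('a::complex_inner \<Rightarrow> 'a) set \<Rightarrow> ('a \<Rightarrow> 'a) set" where
  "commutant \<A> = {X \<in> bops UNIV UNIV. \<forall>A\<in>\<A>. X \<circ> A = A \<circ> X}"

definition irreducible_on :: "('a::complex_inner \<Rightarrow> 'a) set \<Rightarrow> 'a set \<Rightarrow> bool" where
  "irreducible_on \<A> M \<longleftrightarrow> M \<noteq> {0} \<and>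
     (\<forall>L. csubspace L \<and> closed L \<and> L \<subseteq> M \<and> (\<forall>A\<in>\<A>. A ` L \<subseteq> L) \<longrightarrow> L = {0} \<or> L = M)"

definition disjoint_on :: "('a::complex_inner \<Rightarrow> 'a) set \<Rightarrow> 'a set \<Rightarrow> 'a set \<Rightarrow> bool" where
  "disjoint_on \<A> M L \<longleftrightarrow>
     (\<forall>X \<in> bops M L. (\<forall>A\<in>\<A>. \<forall>x\<in>M. X (A x) = A (X x)) \<longrightarrow> (\<forall>x\<in>M. X x = 0))"

definition splits_into_disjoint_irreducibles :: "('a::complex_inner \<Rightarrow> 'a) set \<Rightarrow> nat \<Rightarrow> bool" where
  "splits_into_disjoint_irreducibles \<A> k \<longleftrightarrow> (\<exists>M :: nat \<Rightarrow> 'a set.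
     (\<forall>i<k. csubspace (M i) \<and> closed (M i) \<and> (\<forall>A\<in>\<A>. A ` M i \<subseteq> M i) \<and> irreducible_on \<A> (M i)) \<and>
     (\<forall>i<k. \<forall>j<k. i \<noteq> j \<longrightarrow>
        (\<forall>x\<in>M i. \<forall>y\<in>M j. cinner x y = 0) \<and> disjoint_on \<A> (M i) (M j)) \<and>
     (\<forall>x. \<exists>y. (\<forall>i<k. y i \<in> M i) \<and> x = (\<Sum>i<k. y i)))"

definition intertwiners ::
  "nat \<Rightarrow> (nat \<Rightarrow> 'a::complex_inner \<Rightarrow> 'a) \<Rightarrow> (nat \<Rightarrow> 'b::complex_inner \<Rightarrow> 'b) \<Rightarrow> ('a \<Rightarrow> 'b) set" where
  "intertwiners N S T = {U \<in> bops UNIV UNIV. \<forall>i<N. U \<circ> S i = T i \<circ> U}"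

text \<open>The map \<open>A \<mapsto> \<Sum>\<^sub>k W\<^sub>k A V\<^sub>k\<^sup>*\<close> on operators defined on \<open>K\<close>; the second tuple is \<open>Vs k = V\<^sub>k\<^sup>*\<close>.\<close>

definition transfer_map ::
  "nat \<Rightarrow> 'a::complex_inner set \<Rightarrow> (nat \<Rightarrow> 'b::complex_inner \<Rightarrow> 'b) \<Rightarrow> (nat \<Rightarrow> 'a \<Rightarrow> 'a) \<Rightarrow>
   ('a \<Rightarrow> 'b) \<Rightarrow> 'a \<Rightarrow> 'b" where
  "transfer_map N K W Vs A = (\<lambda>x\<in>K. \<Sum>k<N. W k (A (Vs k x)))"

text \<open>Spectrum of a linear map \<open>\<Phi>\<close> of \<open>\<B>(K)\<close> into itself, for \<open>K\<close> of finite dimension: the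
  inverse of a bijective \<open>c - \<Phi>\<close> is then automatically bounded.\<close>

definition map_spectrum :: "'a::complex_inner set \<Rightarrow> (('a \<Rightarrow> 'a) \<Rightarrow> 'a \<Rightarrow> 'a) \<Rightarrow> complex set" where
  "map_spectrum K \<Phi> =
     {c. \<not> bij_betw (\<lambda>A. \<lambda>x\<in>K. c *\<^sub>C A x - \<Phi> A x) (bops K K) (bops K K)}"

definition peripheral_spectrum :: "'a::complex_inner set \<Rightarrow> (('a \<Rightarrow> 'a) \<Rightarrow> 'a \<Rightarrow> 'a) \<Rightarrow> complex set" where
  "peripheral_spectrum K \<Phi> = map_spectrum K \<Phi> \<inter> {c. cmod c = 1}"

definition circle_group :: "complex monoid" where
  "circle_group = \<lparr>carrier = {c. cmod c = 1}, mult = (*), one = 1\<rparr>"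


section \<open>The Hilbert space of square integrable functions on the torus\<close>

definition torus :: "(complex^'n) set" where
  "torus = {z. \<forall>i. cmod (z $ i) = 1}"

text \<open>Normalised Haar measure, as a measure on \<open>\<complex>\<^sup>\<nu>\<close> concentrated on the torus.\<close>

definition torus_measure :: "(complex^'n::finite) measure" where
  "torus_measure = distr (restrict_space lborel (cbox 0 1)) borel
     (\<lambda>t::real^'n. \<chi> i. cis (2 * pi * t $ i))"

definition square_integrable :: "'a measure \<Rightarrow> ('a \<Rightarrow> complex) \<Rightarrow> bool" where
  "square_integrable M f \<longleftrightarrow> f \<in> borel_measurable M \<and> integrable M (\<lambda>z. (cmod (f z))\<^sup>2)"

lemma square_integrable_zero: "square_integrable M (\<lambda>z. 0)"
  by (simp add: square_integrable_def)

lemma square_integrable_mult: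
  assumes "square_integrable M f" "square_integrable M g"
  shows "integrable M (\<lambda>z. cnj (f z) * g z)"
proof (rule Bochner_Integration.integrable_bound)
  show "integrable M (\<lambda>z. (cmod (f z))\<^sup>2 + (cmod (g z))\<^sup>2)"
    using assms by (simp add: square_integrable_def)
  have [measurable]: "f \<in> borel_measurable M" "g \<in> borel_measurable M"
    using assms by (simp_all add: square_integrable_def)
  show "(\<lambda>z. cnj (f z) * g z) \<in> borel_measurable M"
    by (intro borel_measurable_times borel_measurable_continuous_on[of cnj])
       (auto intro: continuous_intros)
  show "AE z in M. norm (cnj (f z) * g z) \<le> norm ((cmod (f z))\<^sup>2 + (cmod (g z))\<^sup>2)"
  proof (rule AE_I2)
    fix z
    have "0 \<le> (cmod (f z) - cmod (g z))\<^sup>2" by simp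
    then have "2 * (cmod (f z) * cmod (g z)) \<le> (cmod (f z))\<^sup>2 + (cmod (g z))\<^sup>2"
      by (simp add: power2_diff)
    moreover have "0 \<le> cmod (f z) * cmod (g z)" by simp
    ultimately have "cmod (f z) * cmod (g z) \<le> (cmod (f z))\<^sup>2 + (cmod (g z))\<^sup>2" by linarith
    then show "norm (cnj (f z) * g z) \<le> norm ((cmod (f z))\<^sup>2 + (cmod (g z))\<^sup>2)"
      by (simp add: norm_mult)
  qed
qed

lemma square_integrable_add:
  assumes "square_integrable M f" "square_integrable M g"
  shows "square_integrable M (\<lambda>z. f z + g z)"
proof -
  have [measurable]: "f \<in> borel_measurable M" "g \<in> borel_measurable M"
    using assms by (simp_all add: square_integrable_def)
  have "integrable M (\<lambda>z. (cmod (f z + g z))\<^sup>2)"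
  proof (rule Bochner_Integration.integrable_bound)
    show "integrable M (\<lambda>z. 2 * (cmod (f z))\<^sup>2 + 2 * (cmod (g z))\<^sup>2)"
      using assms by (simp add: square_integrable_def)
    show "AE z in M. norm ((cmod (f z + g z))\<^sup>2) \<le> norm (2 * (cmod (f z))\<^sup>2 + 2 * (cmod (g z))\<^sup>2)"
    proof (rule AE_I2)
      fix z
      have "(cmod (f z + g z))\<^sup>2 \<le> (cmod (f z) + cmod (g z))\<^sup>2"
        by (intro power_mono norm_triangle_ineq) simp
      also have "\<dots> \<le> 2 * (cmod (f z))\<^sup>2 + 2 * (cmod (g z))\<^sup>2"
        using zero_le_power2[of "cmod (f z) - cmod (g z)"] by (simp add: power2_diff power2_sum)
      finally show "norm ((cmod (f z + g z))\<^sup>2) \<le> norm (2 * (cmod (f z))\<^sup>2 + 2 * (cmod (g z))\<^sup>2)"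
        by simp
    qed
  qed simp
  then show ?thesis by (simp add: square_integrable_def)
qed

lemma square_integrable_cmult:
  assumes "square_integrable M f"
  shows "square_integrable M (\<lambda>z. c * f z)"
  using assms
  by (auto simp: square_integrable_def norm_mult power_mult_distrib intro: borel_measurable_times)

definition L2_rel :: "(complex^'n::finite \<Rightarrow> complex) \<Rightarrow> (complex^'n \<Rightarrow> complex) \<Rightarrow> bool" where
  "L2_rel f g \<longleftrightarrow> square_integrable torus_measure f \<and> square_integrable torus_measure g \<and>
     (AE z in torus_measure. f z = g z)"

quotient_type 'n torus_L2 = "complex^'n::finite \<Rightarrow> complex" / partial: L2_rel
proof (rule part_equivpI)
  show "\<exists>f. L2_rel f f"
    by (intro exI[of _ "\<lambda>z. 0"]) (simp add: L2_rel_def square_integrable_zero)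
  show "symp L2_rel"
    by (rule sympI) (auto simp: L2_rel_def elim: eventually_mono)
  show "transp L2_rel"
    by (rule transpI) (auto simp: L2_rel_def elim: eventually_elim2)
qed

instantiation torus_L2 :: (finite) complex_inner
begin

lift_definition zero_torus_L2 :: "'a torus_L2" is "\<lambda>z. 0"
  by (simp add: L2_rel_def square_integrable_zero)

lift_definition plus_torus_L2 :: "'a torus_L2 \<Rightarrow> 'a torus_L2 \<Rightarrow> 'a torus_L2"
  is "\<lambda>f g z. f z + g z"
  by (auto simp: L2_rel_def square_integrable_add elim: eventually_elim2)

lift_definition scaleC_torus_L2 :: "complex \<Rightarrow> 'a torus_L2 \<Rightarrow> 'a torus_L2"
  is "\<lambda>c f z. c * f z"
  by (auto simp: L2_rel_def square_integrable_cmult elim: eventually_mono)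

lift_definition cinner_torus_L2 :: "'a torus_L2 \<Rightarrow> 'a torus_L2 \<Rightarrow> complex"
  is "\<lambda>f g. \<integral>z. cnj (f z) * g z \<partial>torus_measure"
proof -
  fix f f' g g' :: "complex^'a \<Rightarrow> complex"
  assume a: "L2_rel f f'" "L2_rel g g'"
  have "AE z in torus_measure. f z = f' z" "AE z in torus_measure. g z = g' z"
    using a by (simp_all add: L2_rel_def)
  then have "AE z in torus_measure. cnj (f z) * g z = cnj (f' z) * g' z"
    by eventually_elim simp
  moreover have "(\<lambda>z. cnj (f z) * g z) \<in> borel_measurable torus_measure"
      "(\<lambda>z. cnj (f' z) * g' z) \<in> borel_measurable torus_measure"
    using a by (auto simp: L2_rel_def intro!: borel_measurable_integrable square_integrable_mult)
  ultimately show "(\<integral>z. cnj (f z) * g z \<partial>torus_measure) = (\<integral>z. cnj (f' z) * g' z \<partial>torus_measure)"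
    by (intro integral_cong_AE)
qed

definition uminus_torus_L2 :: "'a torus_L2 \<Rightarrow> 'a torus_L2" where
  "uminus_torus_L2 x = (- 1) *\<^sub>C x"

definition minus_torus_L2 :: "'a torus_L2 \<Rightarrow> 'a torus_L2 \<Rightarrow> 'a torus_L2" where
  "minus_torus_L2 x y = x + (- 1) *\<^sub>C y"

definition scaleR_torus_L2 :: "real \<Rightarrow> 'a torus_L2 \<Rightarrow> 'a torus_L2" where
  "scaleR_torus_L2 r x = complex_of_real r *\<^sub>C x"

definition inner_torus_L2 :: "'a torus_L2 \<Rightarrow> 'a torus_L2 \<Rightarrow> real" where
  "inner_torus_L2 x y = Re (cinner x y)"

definition norm_torus_L2 :: "'a torus_L2 \<Rightarrow> real" where
  "norm_torus_L2 x = sqrt (inner x x)"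

definition dist_torus_L2 :: "'a torus_L2 \<Rightarrow> 'a torus_L2 \<Rightarrow> real" where
  "dist_torus_L2 x y = norm (x - y)"

definition sgn_torus_L2 :: "'a torus_L2 \<Rightarrow> 'a torus_L2" where
  "sgn_torus_L2 x = inverse (norm x) *\<^sub>R x"

definition uniformity_torus_L2 :: "('a torus_L2 \<times> 'a torus_L2) filter" where
  "uniformity_torus_L2 = (INF e\<in>{0 <..}. principal {(x, y). dist x y < e})"

definition open_torus_L2 :: "'a torus_L2 set \<Rightarrow> bool" where
  "open_torus_L2 U \<longleftrightarrow> (\<forall>x\<in>U. eventually (\<lambda>(x', y). x' = x \<longrightarrow> y \<in> U) uniformity)"

instance
proof
  fix x y z :: "'a torus_L2" and c d :: complex and r s :: real
  show add_assoc: "x + y + z = x + (y + z)"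
    by transfer (simp add: L2_rel_def square_integrable_add add.assoc)
  show add_comm: "x + y = y + x"
    by transfer (simp add: L2_rel_def square_integrable_add add.commute)
  show "0 + x = x"
    by transfer (simp add: L2_rel_def)
  show "- x + x = 0"
    unfolding uminus_torus_L2_def
    by transfer (simp add: L2_rel_def square_integrable_zero)
  show "x - y = x + - y"
    by (simp add: minus_torus_L2_def uminus_torus_L2_def)
  have sc_add: "c *\<^sub>C (x + y) = c *\<^sub>C x + c *\<^sub>C y" for c and x y :: "'a torus_L2"
    by transfer (simp add: L2_rel_def square_integrable_add square_integrable_cmult distrib_left)
  show "c *\<^sub>C (x + y) = c *\<^sub>C x + c *\<^sub>C y"
    by (rule sc_add)
  have sc_add': "(c + d) *\<^sub>C x = c *\<^sub>C x + d *\<^sub>C x" for c d and x :: "'a torus_L2"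
    by transfer (simp add: L2_rel_def square_integrable_add square_integrable_cmult distrib_right)
  show "(c + d) *\<^sub>C x = c *\<^sub>C x + d *\<^sub>C x"
    by (rule sc_add')
  have sc_sc: "c *\<^sub>C d *\<^sub>C x = (c * d) *\<^sub>C x" for c d and x :: "'a torus_L2"
    by transfer (simp add: L2_rel_def square_integrable_cmult mult.assoc)
  show "c *\<^sub>C d *\<^sub>C x = (c * d) *\<^sub>C x"
    by (rule sc_sc)
  have sc_one: "1 *\<^sub>C x = x"
    by transfer (simp add: L2_rel_def)
  show "r *\<^sub>R x = complex_of_real r *\<^sub>C x"
    by (simp add: scaleR_torus_L2_def)
  show "r *\<^sub>R (x + y) = r *\<^sub>R x + r *\<^sub>R y" "(r + s) *\<^sub>R x = r *\<^sub>R x + s *\<^sub>R x"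
    "r *\<^sub>R s *\<^sub>R x = (r * s) *\<^sub>R x" "1 *\<^sub>R x = x"
    by (simp_all add: scaleR_torus_L2_def sc_add sc_add' sc_sc sc_one)
  show "dist x y = norm (x - y)" "sgn x = inverse (norm x) *\<^sub>R x"
    by (simp_all add: dist_torus_L2_def sgn_torus_L2_def)
  show "uniformity = (INF e\<in>{0 <..}. principal {(x, y :: 'a torus_L2). dist x y < e})"
    by (rule uniformity_torus_L2_def)
  show "open U \<longleftrightarrow> (\<forall>x\<in>U. \<forall>\<^sub>F (x', y) in uniformity. x' = x \<longrightarrow> y \<in> U)" for U :: "'a torus_L2 set"
    by (rule open_torus_L2_def)
  have ci_comm: "cinner x y = cnj (cinner y x)" for x y :: "'a torus_L2"
    by transfer (simp add: mult.commute flip: Bochner_Integration.integral_cnj)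
  show "cinner x y = cnj (cinner y x)"
    by (rule ci_comm)
  have ci_add: "cinner x (y + z) = cinner x y + cinner x z" for x y z :: "'a torus_L2"
    by transfer (simp add: L2_rel_def distrib_left square_integrable_mult)
  show "cinner x (y + z) = cinner x y + cinner x z"
    by (rule ci_add)
  have ci_sc: "cinner x (c *\<^sub>C y) = c * cinner x y" for c and x y :: "'a torus_L2"
    by transfer (simp add: mult.left_commute)
  show "cinner x (c *\<^sub>C y) = c * cinner x y"
    by (rule ci_sc)
  have in_comm: "inner x y = inner y x" for x y :: "'a torus_L2"
    unfolding inner_torus_L2_def by (subst ci_comm) simp
  show "inner x y = inner y x"
    by (rule in_comm)
  show "inner (x + y) z = inner x z + inner y z"
    unfolding in_comm[of _ z] by (simp add: inner_torus_L2_def ci_add)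
  show "inner (r *\<^sub>R x) y = r * inner x y"
    unfolding in_comm[of _ y] by (simp add: inner_torus_L2_def scaleR_torus_L2_def ci_sc)
  have self: "cnj w * w = complex_of_real ((cmod w)\<^sup>2)" for w
    by (metis complex_norm_square mult.commute of_real_power)
  show "0 \<le> inner x x"
    unfolding inner_torus_L2_def
    by transfer (simp only: self integral_complex_of_real Re_complex_of_real,
      simp add: Bochner_Integration.integral_nonneg)
  have "inner x x = 0 \<longleftrightarrow> x = 0"
    unfolding inner_torus_L2_def
  proof transfer
    fix f :: "complex^'a \<Rightarrow> complex"
    assume "L2_rel f f"
    then have f: "square_integrable torus_measure f" by (simp add: L2_rel_def)
    then have i: "integrable torus_measure (\<lambda>z. (cmod (f z))\<^sup>2)"
      by (simp add: square_integrable_def)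
    have "Re (\<integral>z. cnj (f z) * f z \<partial>torus_measure) = (\<integral>z. (cmod (f z))\<^sup>2 \<partial>torus_measure)"
      unfolding self by (simp only: integral_complex_of_real Re_complex_of_real)
    then show "Re (\<integral>z. cnj (f z) * f z \<partial>torus_measure) = 0 \<longleftrightarrow> L2_rel f (\<lambda>z. 0)"
      using integral_nonneg_eq_0_iff_AE[OF i] f
      by (simp add: L2_rel_def square_integrable_zero)
  qed
  then show "inner x x = 0 \<longleftrightarrow> x = 0" .
  show "norm x = sqrt (inner x x)"
    by (rule norm_torus_L2_def)
  show "inner x y = Re (cinner x y)"
    by (rule inner_torus_L2_def)
qed

end


section \<open>Polynomial representations\<close>

definition monomial_fun :: "int^'n \<Rightarrow> complex^'n \<Rightarrow> complex" where
  "monomial_fun n z = (\<Prod>i\<in>UNIV. (z $ i) powi (n $ i))"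

definition torus_power :: "complex^'n \<Rightarrow> int^'n^'n \<Rightarrow> complex^'n" where
  "torus_power z A = (\<chi> j. \<Prod>i\<in>UNIV. (z $ i) powi (A $ i $ j))"

definition fourier_vec :: "int^'n \<Rightarrow> 'n::finite torus_L2" where
  "fourier_vec n = abs_torus_L2 (monomial_fun n)"

definition trig_poly :: "(int^'n) set \<Rightarrow> (int^'n \<Rightarrow> complex) \<Rightarrow> complex^'n \<Rightarrow> complex" where
  "trig_poly D a z = (\<Sum>n\<in>D. a n * monomial_fun n z)"

definition unitary_matrix :: "'i set \<Rightarrow> 'j set \<Rightarrow> ('i \<Rightarrow> 'j \<Rightarrow> complex) \<Rightarrow> bool" where
  "unitary_matrix I J U \<longleftrightarrow> finite I \<and> finite J \<and>
     (\<forall>i\<in>I. \<forall>i'\<in>I. (\<Sum>j\<in>J. U i j * cnj (U i' j)) = (if i = i' then 1 else 0)) \<and>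
     (\<forall>j\<in>J. \<forall>j'\<in>J. (\<Sum>i\<in>I. cnj (U i j) * U i j') = (if j = j' then 1 else 0))"

definition unitarity_condition ::
  "nat \<Rightarrow> int^'n^'n \<Rightarrow> (int^'n::finite) set \<Rightarrow> (nat \<Rightarrow> int^'n \<Rightarrow> complex) \<Rightarrow> bool" where
  "unitarity_condition N A D a \<longleftrightarrow>
     (AE z in torus_measure.
        unitary_matrix {..<N} {w \<in> torus. torus_power w A = z}
          (\<lambda>i w. trig_poly D (a i) w / complex_of_real (sqrt (real N))))"

definition polynomial_data ::
  "nat \<Rightarrow> int^'n^'n \<Rightarrow> (int^'n::finite) set \<Rightarrow> (nat \<Rightarrow> int^'n \<Rightarrow> complex) \<Rightarrow> bool" where
  "polynomial_data N A D a \<longleftrightarrow>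
     2 \<le> N \<and> \<bar>det A\<bar> = int N \<and>
     (\<forall>c v. v \<noteq> 0 \<and> map_matrix complex_of_int A *v v = c *s v \<longrightarrow> 1 < cmod c) \<and>
     finite D \<and> (\<forall>j<N. \<forall>n. n \<notin> D \<longrightarrow> a j n = 0) \<and>
     unitarity_condition N A D a"

text \<open>\<open>(S\<^sub>j \<xi>)(z) = m\<^sub>j(z) \<xi>(z\<^sup>A)\<close>, computed on a representative of \<open>\<xi>\<close>. For \<open>det A \<noteq> 0\<close> the map
  \<open>z \<mapsto> z\<^sup>A\<close> preserves the Haar measure, so the class does not depend on the representative.\<close>

definition poly_rep ::
  "int^'n^'n \<Rightarrow> (int^'n::finite) set \<Rightarrow> (nat \<Rightarrow> int^'n \<Rightarrow> complex) \<Rightarrow> nat \<Rightarrow> 'n torus_L2 \<Rightarrow> 'n torus_L2" where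
  "poly_rep A D a j \<xi> =
     abs_torus_L2 (\<lambda>z. trig_poly D (a j) z * rep_torus_L2 \<xi> (torus_power z A))"

definition fourier_span :: "(int^'n) set \<Rightarrow> 'n::finite torus_L2 set" where
  "fourier_span H = cspan (fourier_vec ` H)"

definition absorbing :: "nat \<Rightarrow> (nat \<Rightarrow> 'n::finite torus_L2 \<Rightarrow> 'n torus_L2) \<Rightarrow> (int^'n) set \<Rightarrow> bool" where
  "absorbing N S H \<longleftrightarrow> finite H \<and>
     (\<forall>n. \<exists>M. \<forall>I. set I \<subseteq> {..<N} \<and> M \<le> length I \<longrightarrow>
        hadj (op_word S I) (fourier_vec n) \<in> fourier_span H)"

definition minimal_absorbing ::
  "nat \<Rightarrow> (nat \<Rightarrow> 'n::finite torus_L2 \<Rightarrow> 'n torus_L2) \<Rightarrow> (int^'n) set \<Rightarrow> bool" where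
  "minimal_absorbing N S H \<longleftrightarrow> absorbing N S H \<and> (\<forall>H'. H' \<subset> H \<longrightarrow> \<not> absorbing N S H')"

text \<open>\<open>sigma_inv A p n = A\<^sup>-\<^sup>1 (n - p)\<close>, meaningful when \<open>n - p\<close> lies in the range of the (injective)
  map \<open>A\<close> on the lattice, i.e. when \<open>p = n mod A\<close>.\<close>

definition sigma_inv :: "int^'n^'n \<Rightarrow> int^'n \<Rightarrow> int^'n \<Rightarrow> int^'n::finite" where
  "sigma_inv A p n = inv_into UNIV ((*v) A) (n - p)"

text \<open>\<open>V\<^sub>j\<^sup>*\<close>: the linear extension of \<open>e\<^sub>n \<mapsto> \<Sum>\<^sub>m cnj (a\<^sub>j (n - A m)) e\<^sub>m\<close> from the orthonormal basis
  \<open>(e\<^sub>n)\<close>, \<open>n \<in> H\<close>, to its span.\<close>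

definition V_adj ::
  "int^'n^'n \<Rightarrow> (nat \<Rightarrow> int^'n \<Rightarrow> complex) \<Rightarrow> (int^'n) set \<Rightarrow> nat \<Rightarrow> 'n::finite torus_L2 \<Rightarrow> 'n torus_L2" where
  "V_adj A a H j = (\<lambda>x \<in> fourier_span H. \<Sum>n\<in>H. cinner (fourier_vec n) x *\<^sub>C
      (\<Sum>m\<in>H. cnj (a j (n - A *v m)) *\<^sub>C fourier_vec m))"

definition V_op ::
  "int^'n^'n \<Rightarrow> (nat \<Rightarrow> int^'n \<Rightarrow> complex) \<Rightarrow> (int^'n) set \<Rightarrow> nat \<Rightarrow> 'n::finite torus_L2 \<Rightarrow> 'n torus_L2" where
  "V_op A a H j = op_adj (fourier_span H) (fourier_span H) (V_adj A a H j)"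

definition sigma_map ::
  "nat \<Rightarrow> int^'n^'n \<Rightarrow> (nat \<Rightarrow> int^'n \<Rightarrow> complex) \<Rightarrow> (int^'n) set \<Rightarrow>
   ('n::finite torus_L2 \<Rightarrow> 'n torus_L2) \<Rightarrow> 'n torus_L2 \<Rightarrow> 'n torus_L2" where
  "sigma_map N A a H = transfer_map N (fourier_span H) (V_op A a H) (V_adj A a H)"

definition sigma_fixed ::
  "nat \<Rightarrow> int^'n^'n \<Rightarrow> (nat \<Rightarrow> int^'n \<Rightarrow> complex) \<Rightarrow> (int^'n) set \<Rightarrow>
   ('n::finite torus_L2 \<Rightarrow> 'n torus_L2) set" where
  "sigma_fixed N A a H =
     {B \<in> bops (fourier_span H) (fourier_span H). sigma_map N A a H B = B}"

text \<open>A minimal absorbing \<open>H\<close> need not span a space \<open>K\<close> with \<open>S\<^sub>i\<^sup>* K \<subseteq> K\<close> (\<^const>\<open>coinvariant\<close>), although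
  this is implicit in \<open>V\<^sub>i\<^sup>* = S\<^sub>i\<^sup>*|K\<close>. Without it \<open>\<Sum>\<^sub>k V\<^sub>k V\<^sub>k\<^sup>* = 1\<close> fails and \<open>1\<close> is not a fixed point of
  \<open>\<sigma>\<close>, even for an irreducible representation. Example: \<open>\<nu> = 1\<close>, \<open>A = N = 13\<close>; put
  \<open>S\<^sub>i\<^sup>* e\<^sub>r\<^sub>+\<^sub>1\<^sub>3\<^sub>m = \<Sum>\<^sub>l v\<^sub>r\<^sub>,\<^sub>l(i) e\<^sub>m\<^sub>+\<^sub>l\<close> for \<open>-6 \<le> r \<le> 6\<close>, with \<open>(v\<^sub>r(z))\<^sub>r\<close> a pointwise orthonormal Laurent
  polynomial frame of \<open>\<complex>\<^sup>1\<^sup>3\<close> determined as follows. Let \<open>g\<^sub>0, \<dots>, g\<^sub>1\<^sub>2\<close> be the standard basis,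
  \<open>P\<^sub>i\<^sub>j = ((1+z) g\<^sub>i + z\<^sup>2(1-z) g\<^sub>j)/2\<close>, \<open>Q\<^sub>i\<^sub>j = (z\<^sup>-\<^sup>2(1-z) g\<^sub>i + (1+z) g\<^sub>j)/2\<close>;
  let \<open>v\<^sub>0 \<plusminus> v\<^sub>1 = \<surd>2 P\<^sub>0\<^sub>1, \<surd>2 z\<^sup>5 g\<^sub>4\<close>; \<open>v\<^sub>2 \<mp> v\<^sub>3 = \<surd>2 Q\<^sub>0\<^sub>1, \<surd>2 z\<^sup>5 g\<^sub>5\<close>; \<open>v\<^sub>-\<^sub>2 \<mp> v\<^sub>-\<^sub>1 = \<surd>2 P\<^sub>2\<^sub>3, \<surd>2 z\<^sup>5 g\<^sub>6\<close>;
  \<open>v\<^sub>5 = Q\<^sub>2\<^sub>3\<close>; the six remaining \<open>v\<^sub>r\<close> are \<open>P\<^sub>i\<^sub>j, Q\<^sub>i\<^sub>j\<close> for \<open>(i,j) = (7,8), (9,10), (11,12)\<close>.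
  All \<open>S\<^sub>I\<^sup>* e\<^sub>n\<close> with \<open>I\<close> long lie in \<open>L = span {e\<^sub>0 + e\<^sub>1, e\<^sub>2 - e\<^sub>3, e\<^sub>-\<^sub>2 - e\<^sub>-\<^sub>1}\<close>, so \<open>H = {-2, \<dots>, 3}\<close>;
  but \<open>S\<^sub>4\<^sup>* (e\<^sub>0 - e\<^sub>1) = \<surd>2 e\<^sub>5\<close> is not in \<open>K\<close>. The representation is irreducible, and the fixed points of
  \<open>\<sigma>\<close> are the multiples of the projection onto \<open>L\<close>. Hence the coinvariance premises in the
  criterion \<open>\<B>(K)\<^sup>\<sigma> = \<complex>1\<close> and in the description of the intertwiners.\<close>

end

theory Submission
  imports Defs "HOL-Computational_Algebra.Fundamental_Theorem_Algebra"
begin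

text \<open>
  By assumption every \<open>e\<^sub>n\<close>, hence every vector of a dense subspace, is absorbed: \<open>S\<^sub>I\<^sup>* x \<in> K\<close> as soon as
  \<open>I\<close> is long. If \<open>U S\<^sub>i = T\<^sub>i U\<close>, iterating \<open>\<langle>y, U x\<rangle> = \<Sum>\<^sub>i \<langle>T\<^sub>i\<^sup>* y, U S\<^sub>i\<^sup>* x\<rangle>\<close> therefore recovers \<open>U\<close>
  from its values on the largest coinvariant subspace \<open>K\<^sub>0\<close> of \<open>K\<close>. Since \<open>K\<close> itself need not be
  coinvariant, \<open>U\<close> is related to a fixed point \<open>V\<close> of the transfer map by agreement of the two forms
  on \<open>K\<^sub>0\<close>: from \<open>V\<close> one obtains \<open>U\<close> as the limit of the iterated forms, which are eventually
  stationary on absorbed vectors, and from \<open>U\<close> one obtains \<open>V\<close> as a limit of Cesaro means of iterated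
  compressions. The correspondence is isometric because a pair of vectors at which \<open>V\<close> attains its
  norm already lies in \<open>K\<^sub>0\<close>. Twisting the relation by a number \<open>\<gamma>\<close> of modulus one turns eigenvectors
  of \<open>\<sigma>\<close> with eigenvalue \<open>1/\<gamma>\<close> into eigenvectors of \<open>\<rho> Y = \<Sum>\<^sub>i S\<^sub>i Y S\<^sub>i\<^sup>*\<close>.

  In the irreducible case each of these eigenspaces consists of the multiples of one unitary, so the
  peripheral eigenvalues form a finite group. A generating unitary \<open>X\<close> with \<open>X\<^sup>k = 1\<close> commutes with \<open>UHF\<^sub>N\<close>, and
  a polynomial annihilating \<open>\<rho>\<close> on the ranges of all its powers shows that the commutant of \<open>UHF\<^sub>N\<close> is
  the span of the powers of \<open>X\<close>; the eigenspaces of \<open>X\<close> are the irreducible summands.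
\<close>

section \<open>Complex inner product spaces\<close>

text \<open>Intertwining relations are treated as invariance of bounded sesquilinear forms under
  \<open>\<theta>\<close>: a form can be evaluated at the pairs of \<open>Y.Sd i y\<close> and
  \<open>X.Sd i x\<close> even when these leave the spaces \<open>K\<close>, and iteration and
  pointwise limits keep its bound. Means are taken because the iterated compressions are only
  bounded; the transfer map may have further eigenvalues on the circle, and averaging leaves an
  error of order 1/n in the invariance. Uniqueness of the partner, on either side of the relation,
  follows from the isometry applied to differences. The polynomial annihilating
  \<open>\<rho>\<close> is found on \<open>Ab 0\<close> only; an operator needs preimages under all
  powers of \<open>\<rho>\<close> for the relation to spread to every absorbed vector. On the torus
  the unitarity condition holds almost everywhere, so it is turned into identities between the
  coefficients by integrating fibre sums against characters. One uniqueness theorem for Fourier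
  coefficients of measures gives both the totality of the \<open>fourier_vec n\<close> and the
  invariance of Haar measure that makes \<open>poly_rep\<close> well defined.\<close>

lemma cinner_zero_right [simp]: "cinner x 0 = 0"
  using cinner_scaleC_right[of x 0 0] by simp

lemma cinner_zero_left [simp]: "cinner 0 x = 0"
  by (subst cinner_commute) simp

lemma cinner_add_left: "cinner (x + y) z = cinner x z + cinner y z"
  by (metis cinner_add_right cinner_commute complex_cnj_add)

lemma cinner_scaleC_left: "cinner (c *\<^sub>C x) y = cnj c * cinner x y"
  by (metis cinner_scaleC_right cinner_commute complex_cnj_mult)

lemma cinner_minus_right [simp]: "cinner x (- y) = - cinner x y"
  using cinner_scaleC_right[of x "-1" y] by simp

lemma cinner_minus_left [simp]: "cinner (- x) y = - cinner x y"
  using cinner_scaleC_left[of "-1" x y] by simp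

lemma cinner_diff_right: "cinner x (y - z) = cinner x y - cinner x z"
  using cinner_add_right[of x y "- z"] by simp

lemma cinner_diff_left: "cinner (x - y) z = cinner x z - cinner y z"
  using cinner_add_left[of x "- y" z] by simp

lemma cinner_sum_right: "cinner x (\<Sum>i\<in>I. f i) = (\<Sum>i\<in>I. cinner x (f i))"
  by (induction I rule: infinite_finite_induct) (simp_all add: cinner_add_right)

lemma cinner_sum_left: "cinner (\<Sum>i\<in>I. f i) x = (\<Sum>i\<in>I. cinner (f i) x)"
  by (induction I rule: infinite_finite_induct) (simp_all add: cinner_add_left)

lemmas cinner_linear = cinner_add_left cinner_add_right cinner_diff_left cinner_diff_right
  cinner_scaleC_left cinner_scaleC_right cinner_sum_left cinner_sum_right

lemma cinner_self: "cinner x x = complex_of_real ((norm x)\<^sup>2)"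
proof (rule complex_eqI)
  show "Re (cinner x x) = Re (complex_of_real ((norm x)\<^sup>2))"
    by (simp add: inner_eq_Re_cinner[symmetric] power2_norm_eq_inner)
  have "Im (cinner x x) = - Im (cinner x x)"
    by (subst cinner_commute) simp
  then show "Im (cinner x x) = Im (complex_of_real ((norm x)\<^sup>2))" by simp
qed

lemma norm_scaleC [simp]: "norm (c *\<^sub>C x) = cmod c * norm x"
proof -
  have "complex_of_real ((norm (c *\<^sub>C x))\<^sup>2) = complex_of_real ((cmod c * norm x)\<^sup>2)"
    unfolding cinner_self[symmetric]
    unfolding cinner_scaleC_left cinner_scaleC_right
    by (simp add: cinner_self power_mult_distrib complex_norm_square mult_ac
        flip: of_real_power)
  then have "(norm (c *\<^sub>C x))\<^sup>2 = (cmod c * norm x)\<^sup>2"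
    by (simp only: of_real_eq_iff)
  then show ?thesis by simp
qed

lemma cmod_eq_phase: "\<exists>w. cmod w = 1 \<and> w * z = complex_of_real (cmod z)"
proof (cases "z = 0")
  case True then show ?thesis by (intro exI[of _ 1]) simp
next
  case False
  then show ?thesis
    by (intro exI[of _ "cnj z / cmod z"])
      (simp add: norm_divide complex_norm_square[symmetric] mult.commute power2_eq_square)
qed

text \<open>Multiplying \<open>y\<close> by the phase that makes \<open>cinner x y\<close> real and
  nonnegative reduces this to the real Cauchy-Schwarz inequality.\<close>

lemma cmod_cinner_le: "cmod (cinner x y) \<le> norm x * norm y"
proof -
  obtain w where w: "cmod w = 1" "w * cinner x y = complex_of_real (cmod (cinner x y))"
    using cmod_eq_phase by blast
  have "cmod (cinner x y) = inner x (w *\<^sub>C y)"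
    by (simp add: inner_eq_Re_cinner cinner_linear w)
  also have "\<dots> \<le> norm x * norm (w *\<^sub>C y)"
    by (rule norm_cauchy_schwarz)
  finally show ?thesis using w by simp
qed

lemma cinner_eqI:
  assumes "\<And>z. cinner z x = cinner z y"
  shows "x = y"
proof -
  have "cinner (x - y) (x - y) = 0"
    by (subst cinner_diff_right) (simp add: assms)
  then show ?thesis by (simp add: cinner_self)
qed

lemma bounded_linear_scaleC_right: "bounded_linear (\<lambda>x::'a::complex_inner. c *\<^sub>C x)"
  by (rule bounded_linear_intro[where K = "cmod c"])
    (simp_all add: scaleC_add_right scaleR_scaleC scaleC_scaleC mult.commute)

lemma bounded_linear_scaleC_left: "bounded_linear (\<lambda>c. c *\<^sub>C (x::'a::complex_inner))"
  by (rule bounded_linear_intro[where K = "norm x"])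
    (simp_all add: scaleC_add_left scaleR_scaleC scaleC_scaleC scaleR_conv_of_real)

lemma continuous_on_cinner:
  assumes "continuous_on X f" "continuous_on X g"
  shows "continuous_on X (\<lambda>x. cinner (f x) (g x))"
proof -
  interpret bounded_bilinear "cinner :: 'b \<Rightarrow> 'b \<Rightarrow> complex"
    by standard (auto simp: cinner_linear scaleR_scaleC scaleR_conv_of_real
      intro!: exI[of _ 1] cmod_cinner_le)
  show ?thesis using assms by (rule continuous_on)
qed

lemmas tendsto_scaleC_right = bounded_linear.tendsto[OF bounded_linear_scaleC_right]

lemma parallelogram: "(norm (x - y))\<^sup>2 + (norm (x + y))\<^sup>2 = 2 * (norm x)\<^sup>2 + 2 * (norm (y::'a::real_inner))\<^sup>2"
  by (simp add: power2_norm_eq_inner inner_diff_left inner_diff_right inner_add_left inner_add_right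
      inner_commute)

lemma csubspace_add: "csubspace L \<Longrightarrow> x \<in> L \<Longrightarrow> y \<in> L \<Longrightarrow> x + y \<in> L"
  and csubspace_scaleC: "csubspace L \<Longrightarrow> x \<in> L \<Longrightarrow> c *\<^sub>C x \<in> L"
  and csubspace_0: "csubspace L \<Longrightarrow> 0 \<in> L"
  and csubspace_sum: "csubspace L \<Longrightarrow> (\<And>i. i \<in> I \<Longrightarrow> f i \<in> L) \<Longrightarrow> sum f I \<in> L"
  by (auto simp: complex_vector.subspace_add complex_vector.subspace_scale complex_vector.subspace_0
      intro: complex_vector.subspace_sum)

lemma csubspace_scaleR: "csubspace L \<Longrightarrow> x \<in> L \<Longrightarrow> r *\<^sub>R x \<in> L"
  by (simp add: scaleR_scaleC csubspace_scaleC)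

lemma csubspace_diff: "csubspace L \<Longrightarrow> x \<in> L \<Longrightarrow> y \<in> L \<Longrightarrow> x - y \<in> L"
  by (rule complex_vector.subspace_diff)

lemma csubspace_UNIV [simp]: "csubspace UNIV"
  by (rule complex_vector.subspace_UNIV)

lemma csubspace_closure:
  assumes "csubspace (L :: 'a::complex_inner set)" shows "csubspace (closure L)"
proof (rule complex_vector.subspaceI)
  show "0 \<in> closure L" using assms csubspace_0 closure_subset by blast
next
  fix x y assume "x \<in> closure L" "y \<in> closure L"
  then obtain f g where "\<forall>n. f n \<in> L" "f \<longlonglongrightarrow> x" "\<forall>n. g n \<in> L" "g \<longlonglongrightarrow> y"
    unfolding closure_sequential by metis
  then have "(\<lambda>n. f n + g n) \<longlonglongrightarrow> x + y" "\<forall>n. f n + g n \<in> L"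
    using assms by (auto intro: tendsto_add csubspace_add)
  then show "x + y \<in> closure L"
    unfolding closure_sequential by (intro exI[of _ "\<lambda>n. f n + g n"]) simp
next
  fix c x assume "x \<in> closure L"
  then obtain f where "\<forall>n. f n \<in> L" "f \<longlonglongrightarrow> x"
    unfolding closure_sequential by blast
  then have "(\<lambda>n. c *\<^sub>C f n) \<longlonglongrightarrow> c *\<^sub>C x" "\<forall>n. c *\<^sub>C f n \<in> L"
    using assms by (auto intro: tendsto_scaleC_right csubspace_scaleC)
  then show "c *\<^sub>C x \<in> closure L"
    unfolding closure_sequential by (intro exI[of _ "\<lambda>n. c *\<^sub>C f n"]) simp
qed

text \<open>The representing vector is the minimiser of \<open>\<parallel>x\<parallel>\<^sup>2 - 2 Re (f x)\<close> on \<open>L\<close>.\<close>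

lemma riesz_representation:
  fixes L :: "'a::{complex_inner,complete_space} set" and f :: "'a \<Rightarrow> complex"
  assumes L: "csubspace L" "closed L"
    and add: "\<And>x y. x \<in> L \<Longrightarrow> y \<in> L \<Longrightarrow> f (x + y) = f x + f y"
    and scale: "\<And>c x. x \<in> L \<Longrightarrow> f (c *\<^sub>C x) = c * f x"
    and bound: "\<And>x. x \<in> L \<Longrightarrow> cmod (f x) \<le> C * norm x"
  shows "\<exists>y\<in>L. \<forall>x\<in>L. f x = cinner y x"
proof -
  define J where "J x = (norm x)\<^sup>2 - 2 * Re (f x)" for x
  have J_lower: "- C\<^sup>2 \<le> J x" if "x \<in> L" for x
  proof -
    have "Re (f x) \<le> C * norm x" using bound[OF that] complex_Re_le_cmod[of "f x"] by linarith
    moreover have "0 \<le> (norm x - C)\<^sup>2" by simp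
    ultimately show ?thesis unfolding J_def by (simp add: power2_diff algebra_simps)
  qed
  define m where "m = Inf (J ` L)"
  have bdd: "bdd_below (J ` L)" using J_lower by (auto intro!: bdd_belowI2)
  have m_le: "m \<le> J x" if "x \<in> L" for x
    unfolding m_def using that bdd by (intro cInf_lower) auto
  have "\<exists>x\<in>L. J x < m + 1 / Suc n" for n
  proof -
    have "J ` L \<noteq> {}" using csubspace_0[OF L(1)] by auto
    from cInf_lessD[OF this, of "m + 1 / Suc n"] show ?thesis by (auto simp: m_def)
  qed
  then obtain X where X: "\<And>n. X n \<in> L" "\<And>n. J (X n) < m + 1 / Suc n" by metis
  \<comment> \<open>The midpoint \<open>z\<close> still satisfies \<open>m \<le> J z\<close>. By the
    parallelogram law, near-minimality of both ends therefore bounds their distance, and the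
    minimising sequence is Cauchy.\<close>
  have dist: "(norm (X n - X k))\<^sup>2 \<le> 2 / Suc n + 2 / Suc k" for n k
  proof -
    define z where "z = (1/2::real) *\<^sub>R (X n + X k)"
    have z: "z \<in> L" using X L by (simp add: z_def csubspace_add csubspace_scaleR)
    have fz: "2 * Re (f z) = Re (f (X n)) + Re (f (X k))"
      using arg_cong[OF scale[of "X n + X k" "complex_of_real (1/2)"], of Re]
        add[OF X(1) X(1)] csubspace_add[OF L(1) X(1) X(1)]
      by (simp add: z_def scaleR_scaleC)
    have nz: "4 * (norm z)\<^sup>2 = (norm (X n + X k))\<^sup>2"
      by (simp add: z_def power_divide power_mult_distrib)
    have "(norm (X n - X k))\<^sup>2 = 2 * J (X n) + 2 * J (X k) - 4 * J z"
      using parallelogram[of "X n" "X k"] fz nz unfolding J_def right_diff_distrib by linarith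
    then show ?thesis using X(2)[of n] X(2)[of k] m_le[OF z] by simp
  qed
  have "Cauchy X"
  proof (rule metric_CauchyI)
    fix e :: real assume "e > 0"
    then obtain M where M: "inverse (real (Suc M)) < e\<^sup>2 / 4"
      using reals_Archimedean[of "e\<^sup>2 / 4"] by auto
    have "dist (X n) (X k) < e" if "n \<ge> M" "k \<ge> M" for n k
    proof -
      have "1 / real (Suc n) \<le> 1 / real (Suc M)" "1 / real (Suc k) \<le> 1 / real (Suc M)"
        using that by (simp_all add: field_simps)
      then have "(norm (X n - X k))\<^sup>2 < e\<^sup>2" using dist[of n k] M by (simp add: inverse_eq_divide)
      then show ?thesis using \<open>e > 0\<close> by (simp add: dist_norm power_less_imp_less_base)
    qed
    then show "\<exists>M. \<forall>n\<ge>M. \<forall>k\<ge>M. dist (X n) (X k) < e" by blast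
  qed
  then obtain y where y: "X \<longlonglongrightarrow> y" using Cauchy_convergent convergentD by blast
  have yL: "y \<in> L" using closed_sequentially[OF L(2)] X(1) y by blast
  have f_diff: "f (u - v) = f u - f v" if "u \<in> L" "v \<in> L" for u v
    using add[of "u - v" v] that L by (simp add: csubspace_diff)
  have fcont: "(\<lambda>n. f (X n)) \<longlonglongrightarrow> f y"
  proof (rule LIM_zero_cancel, rule Lim_null_comparison)
    show "\<forall>\<^sub>F n in sequentially. norm (f (X n) - f y) \<le> C * norm (X n - y)"
      using bound X(1) yL L by (auto simp: f_diff[symmetric] csubspace_diff)
    show "(\<lambda>n. C * norm (X n - y)) \<longlonglongrightarrow> 0"
      using tendsto_mult[OF tendsto_const[of C] tendsto_norm_zero[OF LIM_zero[OF y]]] by simp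
  qed
  have Jy: "J y \<le> m"
  proof (rule LIMSEQ_le)
    show "(\<lambda>n. J (X n)) \<longlonglongrightarrow> J y"
      unfolding J_def by (intro tendsto_intros y fcont)
    show "(\<lambda>n. m + 1 / Suc n) \<longlonglongrightarrow> m"
      using tendsto_add[OF tendsto_const[of m] LIMSEQ_inverse_real_of_nat]
      by (simp add: inverse_eq_divide)
    show "\<exists>N. \<forall>n\<ge>N. J (X n) \<le> m + 1 / real (Suc n)" using X(2) less_imp_le by blast
  qed
  have Re_eq: "Re (f v) = Re (cinner y v)" if v: "v \<in> L" for v
  proof -
    have f_real: "f (t *\<^sub>R v) = t * f v" for t :: real
      using scale[OF v, of "complex_of_real t"] by (simp add: scaleR_scaleC)
    have quad: "0 \<le> 2 * t * (Re (cinner y v) - Re (f v)) + t\<^sup>2 * (norm v)\<^sup>2" for t :: real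
    proof -
      have tv: "t *\<^sub>R v \<in> L" using v L by (simp add: csubspace_scaleR)
      have "J y \<le> J (y + t *\<^sub>R v)"
        using Jy m_le[of "y + t *\<^sub>R v"] csubspace_add[OF L(1) yL tv] by linarith
      moreover have "(norm (y + t *\<^sub>R v))\<^sup>2 = (norm y)\<^sup>2 + 2 * t * Re (cinner y v) + t\<^sup>2 * (norm v)\<^sup>2"
        unfolding power2_norm_eq_inner inner_eq_Re_cinner[of y v, symmetric]
        by (simp add: inner_add_left inner_add_right inner_commute power2_eq_square algebra_simps)
      ultimately show ?thesis using add[OF yL tv] by (simp add: J_def f_real algebra_simps)
    qed
    \<comment> \<open>A quadratic in \<open>t\<close> that vanishes at 0 and is nonnegative
      everywhere has no linear term. It is tested at \<open>t = - d / s\<close>; the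
      \<open>+ 1\<close> in \<open>s\<close> keeps the denominator positive when
      \<open>v = 0\<close>.\<close>
    define d where "d = Re (cinner y v) - Re (f v)"
    define s where "s = (norm v)\<^sup>2 + 1"
    have s: "s \<ge> 1" "(norm v)\<^sup>2 \<le> s" by (simp_all add: s_def)
    have "0 \<le> 2 * (- d / s) * d + (- d / s)\<^sup>2 * (norm v)\<^sup>2" using quad unfolding d_def by blast
    also have "\<dots> \<le> 2 * (- d / s) * d + (- d / s)\<^sup>2 * s"
      using s by (intro add_left_mono mult_left_mono) auto
    also have "\<dots> = - (d\<^sup>2 / s)" using s by (simp add: power2_eq_square field_simps)
    finally have "d\<^sup>2 / s \<le> 0" by simp
    then have "d = 0" using s by (simp add: divide_le_0_iff)
    then show ?thesis by (simp add: d_def)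
  qed
  have "f v = cinner y v" if "v \<in> L" for v
  proof (rule complex_eqI)
    show "Re (f v) = Re (cinner y v)" using that by (rule Re_eq)
    \<comment> \<open>The imaginary part at \<open>v\<close> is, up to sign, the real part at
      \<open>\<i> *\<^sub>C v\<close>.\<close>
    show "Im (f v) = Im (cinner y v)"
      using Re_eq[of "\<i> *\<^sub>C v"] scale[OF that, of \<i>] that L
      by (simp add: csubspace_scaleC cinner_linear)
  qed
  then show ?thesis using yL by blast
qed

section \<open>Bounded operators\<close>

lemma bopsI:
  assumes "\<And>x. x \<in> M \<Longrightarrow> A x \<in> L" "\<And>x. x \<notin> M \<Longrightarrow> A x = undefined"
    and "\<And>x y. x \<in> M \<Longrightarrow> y \<in> M \<Longrightarrow> A (x + y) = A x + A y"
    and "\<And>c x. x \<in> M \<Longrightarrow> A (c *\<^sub>C x) = c *\<^sub>C A x"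
    and "\<And>x. x \<in> M \<Longrightarrow> norm (A x) \<le> C * norm x"
  shows "A \<in> bops M L"
  using assms unfolding bops_def by (auto simp: PiE_iff extensional_def intro!: exI[of _ C])

lemma bops_restrictI:
  assumes M: "csubspace M"
    and "\<And>x. x \<in> M \<Longrightarrow> A x \<in> L"
    and "\<And>x y. x \<in> M \<Longrightarrow> y \<in> M \<Longrightarrow> A (x + y) = A x + A y"
    and "\<And>c x. x \<in> M \<Longrightarrow> A (c *\<^sub>C x) = c *\<^sub>C A x"
    and "\<And>x. x \<in> M \<Longrightarrow> norm (A x) \<le> C * norm x"
  shows "restrict A M \<in> bops M L"
  by (rule bopsI[where C = C]) (use assms in \<open>auto simp: csubspace_add csubspace_scaleC\<close>)

lemma bops_in: "A \<in> bops M L \<Longrightarrow> x \<in> M \<Longrightarrow> A x \<in> L"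
  and bops_undefined: "A \<in> bops M L \<Longrightarrow> x \<notin> M \<Longrightarrow> A x = undefined"
  and bops_add: "A \<in> bops M L \<Longrightarrow> x \<in> M \<Longrightarrow> y \<in> M \<Longrightarrow> A (x + y) = A x + A y"
  and bops_scaleC: "A \<in> bops M L \<Longrightarrow> x \<in> M \<Longrightarrow> A (c *\<^sub>C x) = c *\<^sub>C A x"
  by (auto simp: bops_def PiE_iff extensional_def)

lemma bops_bound:
  assumes "A \<in> bops M L"
  obtains C where "C \<ge> 0" "\<And>x. x \<in> M \<Longrightarrow> norm (A x) \<le> C * norm x"
proof -
  obtain C where C: "\<forall>x\<in>M. norm (A x) \<le> C * norm x" using assms by (auto simp: bops_def)
  show thesis
  proof (rule that[of "\<bar>C\<bar>"])
    fix x assume "x \<in> M"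
    then have "norm (A x) \<le> C * norm x" using C by blast
    also have "\<dots> \<le> \<bar>C\<bar> * norm x" by (intro mult_right_mono) auto
    finally show "norm (A x) \<le> \<bar>C\<bar> * norm x" .
  qed simp
qed

lemma bops_eqI:
  assumes "A \<in> bops M L" "B \<in> bops M L'" "\<And>x. x \<in> M \<Longrightarrow> A x = B x"
  shows "A = B"
proof
  fix x show "A x = B x"
    using assms(3) bops_undefined[OF assms(1)] bops_undefined[OF assms(2)] by (cases "x \<in> M") simp_all
qed

lemma bops_0: "A \<in> bops M L \<Longrightarrow> csubspace M \<Longrightarrow> A 0 = 0"
  using bops_scaleC[of A M L 0 0] csubspace_0[of M] by simp

lemma bops_minus: "A \<in> bops M L \<Longrightarrow> x \<in> M \<Longrightarrow> A (- x) = - A x"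
  using bops_scaleC[of A M L x "-1"] by simp

lemma bops_diff:
  "A \<in> bops M L \<Longrightarrow> csubspace M \<Longrightarrow> x \<in> M \<Longrightarrow> y \<in> M \<Longrightarrow> A (x - y) = A x - A y"
  using bops_add[of A M L x "- y"] csubspace_scaleC[of M y "-1"] by (simp add: bops_minus)

lemma bops_sum:
  assumes "A \<in> bops M L" "csubspace M" "\<And>i. i \<in> I \<Longrightarrow> f i \<in> M"
  shows "A (\<Sum>i\<in>I. f i) = (\<Sum>i\<in>I. A (f i))"
  using assms(3)
  by (induction I rule: infinite_finite_induct)
    (auto simp: bops_0[OF assms(1,2)] bops_add[OF assms(1)] csubspace_sum[OF assms(2)])

lemma bops_add_op:
  assumes "A \<in> bops M L" "B \<in> bops M L" "csubspace M" "csubspace L"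
  shows "op_add M A B \<in> bops M L"
proof -
  obtain a b where a: "\<And>x. x \<in> M \<Longrightarrow> norm (A x) \<le> a * norm x"
    and b: "\<And>x. x \<in> M \<Longrightarrow> norm (B x) \<le> b * norm x"
    using bops_bound[OF assms(1)] bops_bound[OF assms(2)] by metis
  have "norm (A x + B x) \<le> (a + b) * norm x" if "x \<in> M" for x
    using norm_triangle_ineq[of "A x" "B x"] a[OF that] b[OF that] by (simp add: distrib_right)
  then show ?thesis unfolding op_add_def
    using assms by (intro bops_restrictI[where C = "a + b"])
      (auto simp: bops_in bops_add bops_scaleC csubspace_add scaleC_add_right)
qed

lemma bops_scale_op:
  assumes "A \<in> bops M L" "csubspace M" "csubspace L"
  shows "op_scale M c A \<in> bops M L"
proof -
  obtain a where a: "\<And>x. x \<in> M \<Longrightarrow> norm (A x) \<le> a * norm x"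
    using bops_bound[OF assms(1)] by metis
  have "norm (c *\<^sub>C A x) \<le> (cmod c * a) * norm x" if "x \<in> M" for x
    using mult_left_mono[OF a[OF that], of "cmod c"] by (simp add: mult_ac)
  then show ?thesis unfolding op_scale_def
    using assms by (intro bops_restrictI[where C = "cmod c * a"])
      (auto simp: bops_in bops_add bops_scaleC csubspace_scaleC scaleC_add_right scaleC_scaleC
        mult.commute)
qed

lemma bops_UNIV_add: "A \<in> bops UNIV UNIV \<Longrightarrow> B \<in> bops UNIV UNIV \<Longrightarrow> (\<lambda>x. A x + B x) \<in> bops UNIV UNIV"
    using bops_add_op[of A UNIV UNIV B] by (simp add: op_add_def restrict_def)

lemma bops_UNIV_scaleC: "A \<in> bops UNIV UNIV \<Longrightarrow> (\<lambda>x. c *\<^sub>C A x) \<in> bops UNIV UNIV"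
  using bops_scale_op[of A UNIV UNIV c] by (simp add: op_scale_def restrict_def)

lemma bops_UNIV_diff: "A \<in> bops UNIV UNIV \<Longrightarrow> B \<in> bops UNIV UNIV \<Longrightarrow> (\<lambda>x. A x - B x) \<in> bops UNIV UNIV"
  using bops_UNIV_add[of A "\<lambda>x. (-1) *\<^sub>C B x"] bops_UNIV_scaleC[of B "-1"] by simp

lemma bops_UNIV_zero: "(\<lambda>x. 0) \<in> bops UNIV UNIV"
  by (rule bopsI[where C = 0]) auto

lemma bops_UNIV_sum:
  "(\<And>i. i \<in> I \<Longrightarrow> A i \<in> bops UNIV UNIV) \<Longrightarrow> (\<lambda>x. \<Sum>i\<in>I. A i x) \<in> bops UNIV UNIV"
  by (induction I rule: infinite_finite_induct) (auto intro: bops_UNIV_add bops_UNIV_zero)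

lemma bops_comp:
  assumes "A \<in> bops L R" "B \<in> bops UNIV L"
  shows "A \<circ> B \<in> bops UNIV R"
proof -
  obtain a b where a: "a \<ge> 0" "\<And>x. x \<in> L \<Longrightarrow> norm (A x) \<le> a * norm x"
    and b: "\<And>x. norm (B x) \<le> b * norm x"
    using bops_bound[OF assms(1)] bops_bound[OF assms(2)] by (metis UNIV_I)
  have "norm (A (B x)) \<le> (a * b) * norm x" for x
    using a(2)[OF bops_in[OF assms(2)], of x] mult_left_mono[OF b a(1), of x] by (simp add: mult_ac)
  then show ?thesis
    using assms by (intro bopsI[where C = "a * b"]) (auto simp: bops_in bops_add bops_scaleC)
qed

lemma bops_id: "id \<in> bops UNIV UNIV" and bops_ident: "(\<lambda>x. x) \<in> bops UNIV UNIV"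
  by (rule bopsI[where C = 1]; simp)+

lemma bops_funpow:
  fixes A :: "'a::complex_inner \<Rightarrow> 'a"
  shows "A \<in> bops UNIV UNIV \<Longrightarrow> (A ^^ n) \<in> bops UNIV UNIV"
  by (induction n) (auto simp: bops_id intro: bops_comp)

lemma bops_bounded_linear:
  assumes "A \<in> bops UNIV UNIV" shows "bounded_linear A"
proof -
  obtain C where "\<And>x. norm (A x) \<le> C * norm x" using bops_bound[OF assms] by (metis UNIV_I)
  then show ?thesis
    by (intro bounded_linear_intro[where K = C])
      (auto simp: bops_add[OF assms] scaleR_scaleC bops_scaleC[OF assms] mult.commute)
qed

lemma bops_continuous: "A \<in> bops UNIV UNIV \<Longrightarrow> continuous_on X A"
  by (rule bounded_linear.continuous_on[OF bops_bounded_linear]) (auto intro: continuous_on_id)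

lemma bops_eq_on_dense:
  assumes "A \<in> bops UNIV UNIV" "B \<in> bops UNIV UNIV" "closure X = UNIV" "\<And>x. x \<in> X \<Longrightarrow> A x = B x"
  shows "A = B"
proof
  fix x
  have "closed {x. A x = B x}"
    using closed_Collect_eq[OF bops_continuous[OF assms(1)] bops_continuous[OF assms(2)]] .
  then have "closure X \<subseteq> {x. A x = B x}" using assms(4) by (intro closure_minimal) auto
  then show "A x = B x" using assms(3) by auto
qed

lemma bops_cspan:
  assumes "A \<in> bops UNIV UNIV" "x \<in> cspan X" "\<And>x. x \<in> X \<Longrightarrow> A x \<in> L" "csubspace L"
  shows "A x \<in> L"
  using assms(2)
proof (induction rule: complex_vector.span_induct_alt)
  case base then show ?case using bops_0[OF assms(1)] csubspace_0[OF assms(4)] by simp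
next
  case (step c x y)
  then show ?case
    using assms by (simp add: bops_add[OF assms(1)] bops_scaleC[OF assms(1)] csubspace_add csubspace_scaleC)
qed

section \<open>The operator norm on a subspace\<close>

lemma op_norm_bdd:
  assumes "A \<in> bops M L" shows "bdd_above ((\<lambda>x. norm (A x) / norm x) ` M)"
proof -
  obtain C where "C \<ge> 0" "\<And>x. x \<in> M \<Longrightarrow> norm (A x) \<le> C * norm x" using bops_bound[OF assms] by metis
  then show ?thesis by (intro bdd_aboveI2[where M = C]) (auto simp: divide_le_eq)
qed

lemma op_norm_bound:
  assumes "A \<in> bops M L" "csubspace M" "x \<in> M"
  shows "norm (A x) \<le> op_norm M A * norm x"
proof (cases "x = 0")
  case True then show ?thesis using bops_0[OF assms(1,2)] by simp
next
  case False
  have "norm (A x) / norm x \<le> op_norm M A"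
    unfolding op_norm_def using assms op_norm_bdd[OF assms(1)] by (intro cSUP_upper)
  then show ?thesis using False by (simp add: divide_le_eq)
qed

lemma op_norm_least:
  assumes "csubspace M" "0 \<le> C" "\<And>x. x \<in> M \<Longrightarrow> norm (A x) \<le> C * norm x"
  shows "op_norm M A \<le> C"
  unfolding op_norm_def using assms csubspace_0[OF assms(1)]
  by (intro cSUP_least) (auto simp: divide_le_eq)

text \<open>The quotient at the vector 0 is 0 by the convention \<open>x / 0 = 0\<close>, and 0 lies
  in every subspace.\<close>

lemma op_norm_nonneg:
  assumes "A \<in> bops M L" "csubspace M" shows "0 \<le> op_norm M A"
  unfolding op_norm_def
  using cSUP_upper[OF csubspace_0[OF assms(2)] op_norm_bdd[OF assms(1)]] by simp

lemma op_norm_eq_0: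
  assumes "A \<in> bops M L" "csubspace M" "op_norm M A = 0" "x \<in> M"
  shows "A x = 0"
  using op_norm_bound[OF assms(1,2,4)] assms(3) by simp

section \<open>Orthogonal projections and adjoints\<close>

lemma orth_proj_eqI:
  assumes K: "csubspace K" and "y \<in> K" "\<And>v. v \<in> K \<Longrightarrow> cinner v (x - y) = 0"
  shows "orth_proj K x = y"
  unfolding orth_proj_def
proof (rule the_equality)
  show "y \<in> K \<and> (\<forall>v\<in>K. cinner v (x - y) = 0)" using assms by blast
next
  fix z assume z: "z \<in> K \<and> (\<forall>v\<in>K. cinner v (x - z) = 0)"
  then have yz: "y - z \<in> K" using assms csubspace_diff by blast
  have "cinner (y - z) (y - z) = cinner (y - z) (x - z) - cinner (y - z) (x - y)"
    by (simp add: cinner_diff_right)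
  also have "\<dots> = 0" using z assms(3) yz by simp
  finally show "z = y" by (simp add: cinner_self)
qed

locale closed_csubspace =
  fixes K :: "'a::{complex_inner,complete_space} set"
  assumes csub [simp]: "csubspace K" and closed_K: "closed K"
begin

abbreviation P where "P \<equiv> orth_proj K"

lemma proj_in [simp]: "P x \<in> K" and cinner_proj: "v \<in> K \<Longrightarrow> cinner v (P x) = cinner v x"
proof -
  \<comment> \<open>The projection of \<open>x\<close> is the Riesz vector on \<open>K\<close> of
    the functional \<open>cinner x\<close>.\<close>
  have "\<exists>y\<in>K. \<forall>v\<in>K. cinner x v = cinner y v"
    by (rule riesz_representation[where C = "norm x"])
      (auto simp: cinner_linear cmod_cinner_le closed_K)
  then obtain y where y: "y \<in> K" "\<And>v. v \<in> K \<Longrightarrow> cinner x v = cinner y v" by blast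
  have "cinner v (x - y) = 0" if "v \<in> K" for v
    using y(2)[OF that] by (simp add: cinner_diff_right cinner_commute[of v])
  then have eq: "P x = y" using y by (intro orth_proj_eqI) auto
  show "P x \<in> K" using eq y by simp
  show "v \<in> K \<Longrightarrow> cinner v (P x) = cinner v x"
    using eq y(2)[of v] by (simp add: cinner_commute[of v])
qed

lemma cinner_proj': "v \<in> K \<Longrightarrow> cinner (P x) v = cinner x v"
  using cinner_proj[of v x] by (metis cinner_commute)

lemma proj_eqI: "y \<in> K \<Longrightarrow> (\<And>v. v \<in> K \<Longrightarrow> cinner v x = cinner v y) \<Longrightarrow> P x = y"
  by (rule orth_proj_eqI) (auto simp: cinner_diff_right)

lemma proj_ident [simp]: "x \<in> K \<Longrightarrow> P x = x"
  by (rule proj_eqI) auto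

lemma proj_self_adjoint: "cinner y (P x) = cinner (P y) x"
  using cinner_proj'[of "P x" y] cinner_proj[of "P y" x] by simp

lemma proj_add: "P (x + y) = P x + P y"
  by (rule proj_eqI) (auto simp: cinner_linear cinner_proj csubspace_add)

lemma proj_scaleC: "P (c *\<^sub>C x) = c *\<^sub>C P x"
  by (rule proj_eqI) (auto simp: cinner_linear cinner_proj csubspace_scaleC)

lemma proj_pythagoras: "(norm x)\<^sup>2 = (norm (P x))\<^sup>2 + (norm (x - P x))\<^sup>2"
proof -
  have "cinner (P x) (x - P x) = 0" by (simp add: cinner_diff_right cinner_proj)
  then have "inner (P x) (x - P x) = 0" by (simp add: inner_eq_Re_cinner)
  then show ?thesis
    using norm_add_Pythagorean[of "P x" "x - P x"] by (simp add: orthogonal_def)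
qed

lemma proj_norm_le: "norm (P x) \<le> norm x"
  using proj_pythagoras[of x] by (simp add: power2_le_imp_le)

text \<open>By Pythagoras the discarded component has norm zero. This is the test by which
  \<open>maximal_pair_step\<close> recognises vectors of \<open>K\<close>.\<close>

lemma proj_norm_eq: "norm (P x) = norm x \<Longrightarrow> P x = x"
  using proj_pythagoras[of x] by simp

lemma proj_bops: "P \<in> bops UNIV K"
  by (rule bopsI[where C = 1]) (auto simp: proj_add proj_scaleC proj_norm_le)

lemma proj_bops_UNIV: "P \<in> bops UNIV UNIV"
  by (rule bopsI[where C = 1]) (auto simp: proj_add proj_scaleC proj_norm_le)

end

text \<open>What the projection onto the closure leaves over, \<open>x - P x\<close>, is orthogonal
  to \<open>L\<close> and hence zero.\<close>

lemma closure_eq_UNIV_if_orthogonal_trivial: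
  fixes L :: "'a::{complex_inner,complete_space} set"
  assumes "csubspace L" "\<And>x. (\<And>v. v \<in> L \<Longrightarrow> cinner v x = 0) \<Longrightarrow> x = 0"
  shows "closure L = UNIV"
proof -
  interpret closed_csubspace "closure L"
    by standard (auto simp: csubspace_closure assms(1))
  have "x \<in> closure L" for x
  proof -
    have "x - P x = 0"
      by (rule assms(2)) (simp add: cinner_diff_right cinner_proj subsetD[OF closure_subset])
    then show ?thesis using proj_in[of x] by simp
  qed
  then show ?thesis by auto
qed

lemma op_adj_eqI:
  assumes M: "csubspace M" and B: "B \<in> bops L M"
    and eq: "\<And>x y. x \<in> M \<Longrightarrow> y \<in> L \<Longrightarrow> cinner (A x) y = cinner x (B y)"
  shows "op_adj M L A = B"
  unfolding op_adj_def
proof (rule the_equality)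
  show "B \<in> bops L M \<and> (\<forall>x\<in>M. \<forall>y\<in>L. cinner (A x) y = cinner x (B y))" using B eq by blast
next
  fix C assume C: "C \<in> bops L M \<and> (\<forall>x\<in>M. \<forall>y\<in>L. cinner (A x) y = cinner x (C y))"
  show "C = B"
  proof (rule bops_eqI)
    fix y assume y: "y \<in> L"
    then have "C y - B y \<in> M" using C B M by (auto intro: csubspace_diff bops_in)
    then have "cinner (C y - B y) (C y - B y) = 0"
      using C eq y by (simp add: cinner_diff_right)
    then show "C y = B y" by (simp add: cinner_self)
  qed (use C B in auto)
qed

lemma adjoint_exists:
  fixes A :: "'a::{complex_inner,complete_space} \<Rightarrow> 'b::complex_inner"
  assumes M: "csubspace M" "closed M" and L: "csubspace L" and A: "A \<in> bops M L"
  shows "\<exists>B\<in>bops L M. \<forall>x\<in>M. \<forall>y\<in>L. cinner (A x) y = cinner x (B y)"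
proof -
  obtain C where C: "C \<ge> 0" "\<And>x. x \<in> M \<Longrightarrow> norm (A x) \<le> C * norm x" using bops_bound[OF A] by metis
  have "\<exists>z\<in>M. \<forall>x\<in>M. cinner y (A x) = cinner z x" for y
  proof (rule riesz_representation[where C = "norm y * C"])
    fix x assume "x \<in> M"
    have "cmod (cinner y (A x)) \<le> norm y * norm (A x)" by (rule cmod_cinner_le)
    also have "\<dots> \<le> norm y * (C * norm x)" using C(2)[OF \<open>x \<in> M\<close>] by (intro mult_left_mono) auto
    finally show "cmod (cinner y (A x)) \<le> norm y * C * norm x" by (simp add: mult_ac)
  qed (use M A in \<open>auto simp: bops_add bops_scaleC cinner_linear\<close>)
  then obtain B where B: "\<And>y. B y \<in> M" "\<And>x y. x \<in> M \<Longrightarrow> cinner y (A x) = cinner (B y) x" by metis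
  have B': "cinner (A x) y = cinner x (B y)" if "x \<in> M" for x y
    using B(2)[OF that, of y] by (metis cinner_commute)
  have ext: "u = v" if "u \<in> M" "v \<in> M" "\<And>x. x \<in> M \<Longrightarrow> cinner x u = cinner x v" for u v
    using that(3)[of "u - v"] that M cinner_self[of "u - v"] by (simp add: csubspace_diff cinner_diff_right)
  have "restrict B L \<in> bops L M"
  proof (rule bops_restrictI[where C = C, OF L])
    show "B (x + y) = B x + B y" for x y
      by (rule ext) (auto simp: B M csubspace_add cinner_add_right B'[symmetric])
    show "B (c *\<^sub>C x) = c *\<^sub>C B x" for c x
      by (rule ext) (auto simp: B M csubspace_scaleC cinner_scaleC_right B'[symmetric])
    \<comment> \<open>Testing the adjoint relation at \<open>x = B y\<close> bounds the square of
      \<open>norm (B y)\<close> by \<open>C * norm (B y) * norm y\<close>.\<close>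
    show "norm (B y) \<le> C * norm y" for y
    proof (cases "B y = 0")
      case False
      have "complex_of_real ((norm (B y))\<^sup>2) = cinner (A (B y)) y"
        using B'[OF B(1)] by (simp add: cinner_self)
      then have "(norm (B y))\<^sup>2 = cmod (cinner (A (B y)) y)"
        by (metis abs_of_nonneg norm_of_real zero_le_power2)
      also have "\<dots> \<le> norm (A (B y)) * norm y" by (rule cmod_cinner_le)
      also have "\<dots> \<le> C * norm (B y) * norm y" using C(2)[OF B(1)] by (intro mult_right_mono) auto
      finally show ?thesis using False by (simp add: power2_eq_square)
    qed (use C in auto)
  qed (use B in auto)
  then show ?thesis using B' by (intro bexI[of _ "restrict B L"]) auto
qed

lemma op_adj:
  fixes A :: "'a::{complex_inner,complete_space} \<Rightarrow> 'b::complex_inner"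
  assumes M: "csubspace M" "closed M" and L: "csubspace L" and A: "A \<in> bops M L"
  shows op_adj_bops: "op_adj M L A \<in> bops L M"
    and cinner_op_adj: "\<And>x y. x \<in> M \<Longrightarrow> y \<in> L \<Longrightarrow> cinner (A x) y = cinner x (op_adj M L A y)"
proof -
  obtain B where B: "B \<in> bops L M" "\<And>x y. x \<in> M \<Longrightarrow> y \<in> L \<Longrightarrow> cinner (A x) y = cinner x (B y)"
    using adjoint_exists[OF assms] by blast
  have "op_adj M L A = B" using B by (intro op_adj_eqI[OF M(1)])
  then show "op_adj M L A \<in> bops L M"
    "\<And>x y. x \<in> M \<Longrightarrow> y \<in> L \<Longrightarrow> cinner (A x) y = cinner x (op_adj M L A y)" using B by auto
qed

lemma hadj_bops: "A \<in> bops UNIV UNIV \<Longrightarrow> hadj (A :: 'a::{complex_inner,complete_space} \<Rightarrow> 'b::complex_inner) \<in> bops UNIV UNIV"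
  by (rule op_adj_bops) auto

lemma cinner_hadj:
  "A \<in> bops UNIV UNIV \<Longrightarrow> cinner (A x) y = cinner (x :: 'a::{complex_inner,complete_space}) (hadj A y)"
  by (rule cinner_op_adj[of UNIV UNIV]) auto

lemma cinner_hadj':
  "A \<in> bops UNIV UNIV \<Longrightarrow> cinner y (A x) = cinner (hadj A y) (x :: 'a::{complex_inner,complete_space})"
  using cinner_hadj[of A x y] by (metis cinner_commute)

lemma hadj_eqI:
  assumes "B \<in> bops UNIV UNIV" "\<And>x y. cinner (A x) y = cinner x (B y)"
  shows "hadj A = B"
  by (rule op_adj_eqI) (use assms in auto)

lemma hadj_comp:
  fixes A :: "'b::{complex_inner,complete_space} \<Rightarrow> 'c::complex_inner"
    and B :: "'a::{complex_inner,complete_space} \<Rightarrow> 'b"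
  assumes "A \<in> bops UNIV UNIV" "B \<in> bops UNIV UNIV"
  shows "hadj (A \<circ> B) = hadj B \<circ> hadj A"
  by (rule hadj_eqI) (use assms in \<open>auto intro: bops_comp hadj_bops simp: cinner_hadj\<close>)

lemma hadj_id: "hadj id = (id :: 'a::complex_inner \<Rightarrow> 'a)"
  by (rule hadj_eqI) (auto simp: bops_id)

section \<open>Finite orthonormal systems\<close>

definition orthonormal :: "'a::complex_inner set \<Rightarrow> bool" where
  "orthonormal B \<longleftrightarrow> (\<forall>b\<in>B. \<forall>b'\<in>B. cinner b b' = (if b = b' then 1 else 0))"

lemma orthonormal_expand:
  assumes "finite B" "orthonormal B" "x \<in> cspan B"
  shows "(\<Sum>b\<in>B. cinner b x *\<^sub>C b) = x"
  using assms(3)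
proof (induction rule: complex_vector.span_induct_alt)
  case base then show ?case by simp
next
  case (step c y x)
  have "(\<Sum>b\<in>B. cinner b y *\<^sub>C b) = (\<Sum>b\<in>B. if b = y then y else 0)"
    using assms(2) step(1) by (intro sum.cong) (auto simp: orthonormal_def)
  also have "\<dots> = y" using step(1) assms(1) by simp
  finally have y: "(\<Sum>b\<in>B. cinner b y *\<^sub>C b) = y" .
  have "(\<Sum>b\<in>B. cinner b (c *\<^sub>C y + x) *\<^sub>C b) =
      c *\<^sub>C (\<Sum>b\<in>B. cinner b y *\<^sub>C b) + (\<Sum>b\<in>B. cinner b x *\<^sub>C b)"
    by (simp add: cinner_linear scaleC_add_left sum.distrib complex_vector.scale_sum_right)
  then show ?case using y step by simp
qed

lemma orthonormal_norm: "orthonormal B \<Longrightarrow> b \<in> B \<Longrightarrow> norm b = 1"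
  using cinner_self[of b] norm_ge_zero[of b]
  by (auto simp: orthonormal_def power2_eq_1_iff simp flip: of_real_power simp del: norm_ge_zero dest!: bspec)

text \<open>The span is the fixed point set of the continuous map that sends \<open>x\<close> to its
  expansion along \<open>B\<close>.\<close>

lemma closed_cspan_orthonormal:
  fixes B :: "'a::complex_inner set"
  assumes "finite B" "orthonormal B"
  shows "closed (cspan B)"
proof -
  have "cspan B = {x. (\<Sum>b\<in>B. cinner b x *\<^sub>C b) = x}"
  proof (intro Set.set_eqI iffI CollectI)
    fix x assume "x \<in> {x. (\<Sum>b\<in>B. cinner b x *\<^sub>C b) = x}"
    then have "x = (\<Sum>b\<in>B. cinner b x *\<^sub>C b)" by simp
    also have "\<dots> \<in> cspan B"
      by (intro csubspace_sum csubspace_scaleC complex_vector.span_base) auto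
    finally show "x \<in> cspan B" .
  qed (use orthonormal_expand[OF assms] in auto)
  moreover have "closed {x. (\<Sum>b\<in>B. cinner b x *\<^sub>C b) = x}"
    by (intro closed_Collect_eq continuous_intros bounded_linear.continuous_on[OF bounded_linear_scaleC_left]
        continuous_on_cinner)
  ultimately show ?thesis by simp
qed

text \<open>The image of the coefficient polydisc is built up one vector at a time, as the Minkowski
  sum of the disc of multiples of \<open>b\<close> and the image for \<open>B\<close>.\<close>

lemma compact_complex_combinations:
  fixes B :: "'a::complex_inner set"
  assumes "finite B"
  shows "compact ((\<lambda>c. \<Sum>b\<in>B. c b *\<^sub>C b) ` {c. \<forall>b. cmod (c b) \<le> 1})"
  using assms
proof induction
  case empty
  have "(\<lambda>c. \<Sum>b\<in>{}. c b *\<^sub>C b) ` {c. \<forall>b. cmod (c b) \<le> 1} \<subseteq> {0::'a}" by auto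
  then show ?case by (meson finite_subset finite_imp_compact finite.intros)
next
  case (insert b B)
  let ?L = "(\<lambda>c. \<Sum>b\<in>B. c b *\<^sub>C b) ` {c. \<forall>b. cmod (c b) \<le> 1}"
  let ?l = "(\<lambda>c. c *\<^sub>C b) ` cball 0 1"
  have "compact ?l"
    by (intro compact_continuous_image bounded_linear.continuous_on[OF bounded_linear_scaleC_left]
        continuous_on_id compact_cball)
  then have "compact {x + y | x y. x \<in> ?l \<and> y \<in> ?L}" using insert by (intro compact_sums)
  moreover have "{x + y | x y. x \<in> ?l \<and> y \<in> ?L} =
      (\<lambda>c. \<Sum>b\<in>insert b B. c b *\<^sub>C b) ` {c. \<forall>b. cmod (c b) \<le> 1}"
  proof (intro Set.set_eqI iffI)
    fix z assume "z \<in> {x + y | x y. x \<in> ?l \<and> y \<in> ?L}"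
    then obtain c d where cd: "z = c *\<^sub>C b + (\<Sum>b\<in>B. d b *\<^sub>C b)" "cmod c \<le> 1" "\<forall>b. cmod (d b) \<le> 1"
      by auto
    have s: "(\<Sum>b'\<in>B. (d(b := c)) b' *\<^sub>C b') = (\<Sum>b\<in>B. d b *\<^sub>C b)"
    proof (rule sum.cong)
      fix b' assume "b' \<in> B"
      then have "b' \<noteq> b" using insert.hyps(2) by blast
      then show "(d(b := c)) b' *\<^sub>C b' = d b' *\<^sub>C b'" by simp
    qed simp
    have "z = (\<Sum>b'\<in>insert b B. (d(b := c)) b' *\<^sub>C b')"
      unfolding sum.insert[OF insert(1,2)] s cd(1) by simp
    then show "z \<in> (\<lambda>c. \<Sum>b\<in>insert b B. c b *\<^sub>C b) ` {c. \<forall>b. cmod (c b) \<le> 1}"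
      using cd(2,3) by (rule_tac image_eqI[where x = "d(b := c)"]) simp_all
  next
    fix z assume "z \<in> (\<lambda>c. \<Sum>b\<in>insert b B. c b *\<^sub>C b) ` {c. \<forall>b. cmod (c b) \<le> 1}"
    then obtain c where c: "z = c b *\<^sub>C b + (\<Sum>b\<in>B. c b *\<^sub>C b)" "\<forall>b. cmod (c b) \<le> 1"
      using insert by auto
    then have "c b *\<^sub>C b \<in> ?l" "(\<Sum>b\<in>B. c b *\<^sub>C b) \<in> ?L" by auto
    then show "z \<in> {x + y | x y. x \<in> ?l \<and> y \<in> ?L}" using c(1) by blast
  qed
  ultimately show ?case by simp
qed

text \<open>Needed so that an operator on the span attains its norm. Coefficients of a unit vector
  have modulus at most 1, so the sphere is a closed part of a compact set.\<close>

lemma compact_sphere_cspan: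
  fixes B :: "'a::complex_inner set"
  assumes "finite B" "orthonormal B"
  shows "compact {x \<in> cspan B. norm x = 1}"
proof -
  let ?C = "(\<lambda>c. \<Sum>b\<in>B. c b *\<^sub>C b) ` {c. \<forall>b. cmod (c b) \<le> 1}"
  have "x \<in> ?C" if "x \<in> cspan B" "norm x = 1" for x
  proof (rule image_eqI)
    let ?c = "\<lambda>b. if b \<in> B then cinner b x else 0"
    have "cmod (cinner b x) \<le> 1" if "b \<in> B" for b
      using cmod_cinner_le[of b x] orthonormal_norm[OF assms(2) that] \<open>norm x = 1\<close> by simp
    then show "?c \<in> {c. \<forall>b. cmod (c b) \<le> 1}" by auto
    have "(\<Sum>b\<in>B. ?c b *\<^sub>C b) = (\<Sum>b\<in>B. cinner b x *\<^sub>C b)" by (intro sum.cong) auto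
    then show "x = (\<Sum>b\<in>B. ?c b *\<^sub>C b)" using orthonormal_expand[OF assms that(1)] by simp
  qed
  then have "{x \<in> cspan B. norm x = 1} = ?C \<inter> (cspan B \<inter> {x. norm x = 1})" by auto
  then show ?thesis
    using compact_Int_closed[OF compact_complex_combinations[OF assms(1)]
        closed_Int[OF closed_cspan_orthonormal[OF assms]
          closed_Collect_eq[OF continuous_on_norm_id continuous_on_const]]] by simp
qed

text \<open>Bolzano-Weierstrass in one coordinate at a time, each time thinning the subsequence
  already found.\<close>

lemma convergent_subsequence_finite:
  fixes f :: "nat \<Rightarrow> 'x \<Rightarrow> complex"
  assumes "finite X" "\<And>n x. x \<in> X \<Longrightarrow> cmod (f n x) \<le> C x"
  shows "\<exists>r. strict_mono r \<and> (\<forall>x\<in>X. convergent (\<lambda>n. f (r n) x))"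
  using assms
proof (induction X)
  case empty then show ?case by (intro exI[of _ id]) (auto simp: strict_mono_def)
next
  case (insert a X)
  then obtain r where r: "strict_mono r" "\<And>x. x \<in> X \<Longrightarrow> convergent (\<lambda>n. f (r n) x)" by auto
  have "compact (cball (0::complex) (C a))" by (rule compact_cball)
  moreover have "\<forall>n. f (r n) a \<in> cball 0 (C a)" using insert by simp
  ultimately obtain l s where s: "strict_mono s" "((\<lambda>n. f (r n) a) \<circ> s) \<longlonglongrightarrow> l"
    unfolding compact_def by metis
  have "convergent (\<lambda>n. f ((r \<circ> s) n) x)" if "x \<in> insert a X" for x
  proof (cases "x = a")
    case True then show ?thesis using s(2) by (auto simp: o_def convergent_def)
  next
    case False
    then have "convergent ((\<lambda>n. f (r n) x) \<circ> s)"
      using r that s(1) by (auto intro: convergent_subseq_convergent)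
    then show ?thesis by (simp add: o_def)
  qed
  then show ?case using strict_mono_o[OF r(1) s(1)] by blast
qed

section \<open>Bounded sesquilinear forms\<close>

text \<open>Conjugate linear in the first variable, like \<open>cinner\<close>. The bound belongs to
  the predicate so that pointwise limits of forms with a common bound stay bounded, and so that
  \<open>sesq_riesz\<close> returns an operator with the same constant.\<close>

definition sesq :: "real \<Rightarrow> ('b::complex_inner \<Rightarrow> 'a::complex_inner \<Rightarrow> complex) \<Rightarrow> bool" where
  "sesq C q \<longleftrightarrow> (\<forall>y y' x. q (y + y') x = q y x + q y' x) \<and> (\<forall>y x x'. q y (x + x') = q y x + q y x') \<and>
     (\<forall>c y x. q (c *\<^sub>C y) x = cnj c * q y x) \<and> (\<forall>c y x. q y (c *\<^sub>C x) = c * q y x) \<and>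
     (\<forall>y x. cmod (q y x) \<le> C * norm y * norm x)"

lemma sesqD:
  assumes "sesq C q"
  shows "q (y + y') x = q y x + q y' x" "q y (x + x') = q y x + q y x'"
    "q (c *\<^sub>C y) x = cnj c * q y x" "q y (c *\<^sub>C x) = c * q y x" "cmod (q y x) \<le> C * norm y * norm x"
  using assms by (simp_all add: sesq_def)

lemma sesq_0: assumes "sesq C q" shows "q 0 x = 0" "q y 0 = 0"
  using sesqD(3)[OF assms, of 0 0 x] sesqD(4)[OF assms, of y 0 0] by simp_all

lemma sesq_diff:
  assumes "sesq C q" shows "q (y - y') x = q y x - q y' x" "q y (x - x') = q y x - q y x'"
  using sesqD(1)[OF assms, of "y - y'" y' x] by simp (use sesqD(2)[OF assms, of y "x - x'" x'] in simp)

lemma sesq_sum: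
  assumes "sesq C q"
  shows "q (\<Sum>i\<in>I. f i) x = (\<Sum>i\<in>I. q (f i) x)" "q y (\<Sum>i\<in>I. g i) = (\<Sum>i\<in>I. q y (g i))"
  by (induction I rule: infinite_finite_induct) (simp_all add: sesq_0[OF assms] sesqD[OF assms])

lemma sesq_operator_form:
  assumes "\<And>x y. A (x + y) = A x + A y" "\<And>c x. A (c *\<^sub>C x) = c *\<^sub>C A x" "\<And>x. norm (A x) \<le> C * norm x"
  shows "sesq C (\<lambda>y x. cinner y (A x))"
proof -
  have "cmod (cinner y (A x)) \<le> C * norm y * norm x" for x y
    using cmod_cinner_le[of y "A x"] mult_left_mono[OF assms(3)[of x], of "norm y"] by (simp add: mult_ac)
  then show ?thesis using assms by (simp add: sesq_def cinner_linear)
qed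

lemma sesq_bops:
  assumes "A \<in> bops UNIV UNIV" shows "sesq (op_norm UNIV A) (\<lambda>y x. cinner y (A x))"
  by (rule sesq_operator_form)
    (use op_norm_bound[OF assms] in \<open>auto simp: bops_add[OF assms] bops_scaleC[OF assms]\<close>)

lemma sesq_tendsto:
  assumes q: "sesq C q" and y: "(f \<longlongrightarrow> y) F" and x: "(g \<longlongrightarrow> x) F"
  shows "((\<lambda>n. q (f n) (g n)) \<longlongrightarrow> q y x) F"
proof (rule LIM_zero_cancel, rule Lim_null_comparison)
  have "q (f n) (g n) - q y x = q (f n - y) (g n) + q y (g n - x)" for n
    by (simp add: sesq_diff[OF q])
  then have "cmod (q (f n) (g n) - q y x) \<le> C * norm (f n - y) * norm (g n) + C * norm y * norm (g n - x)" for n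
    by (simp only: order_trans[OF norm_triangle_ineq add_mono[OF sesqD(5)[OF q] sesqD(5)[OF q]]])
  then show "\<forall>\<^sub>F n in F. cmod (q (f n) (g n) - q y x)
      \<le> C * norm (f n - y) * norm (g n) + C * norm y * norm (g n - x)" by simp
  have "((\<lambda>n. C * norm (f n - y) * norm (g n) + C * norm y * norm (g n - x)) \<longlongrightarrow>
      C * norm (y - y) * norm x + C * norm y * norm (x - x)) F"
    by (intro tendsto_intros x y)
  then show "((\<lambda>n. C * norm (f n - y) * norm (g n) + C * norm y * norm (g n - x)) \<longlongrightarrow> 0) F" by simp
qed

lemma sesq_bound_on_dense:
  assumes q: "sesq C q" and dense: "closure Y = UNIV" "closure X = UNIV"
    and le: "\<And>y x. y \<in> Y \<Longrightarrow> x \<in> X \<Longrightarrow> cmod (q y x) \<le> D * norm y * norm x"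
  shows "cmod (q y x) \<le> D * norm y * norm x"
proof -
  have "y \<in> closure Y" "x \<in> closure X" using dense by auto
  then obtain f g where f: "\<And>n. f n \<in> Y" "f \<longlonglongrightarrow> y" and g: "\<And>n. g n \<in> X" "g \<longlonglongrightarrow> x"
    unfolding closure_sequential by metis
  show ?thesis
  proof (rule LIMSEQ_le)
    show "(\<lambda>n. cmod (q (f n) (g n))) \<longlonglongrightarrow> cmod (q y x)"
      by (intro tendsto_norm sesq_tendsto[OF q] f g)
    show "(\<lambda>n. D * norm (f n) * norm (g n)) \<longlonglongrightarrow> D * norm y * norm x"
      by (intro tendsto_intros f g)
  qed (use le f g in auto)
qed

text \<open>The common bound makes the error of replacing \<open>(y, x)\<close> by a nearby
  \<open>(f k, g k)\<close> uniform in \<open>n\<close>, so an \<epsilon>/3 argument transfers the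
  Cauchy property.\<close>

lemma sesq_convergent_on_dense:
  assumes q: "\<And>n. sesq C (q n)" and dense: "closure Y = UNIV" "closure X = UNIV"
    and conv: "\<And>y x. y \<in> Y \<Longrightarrow> x \<in> X \<Longrightarrow> convergent (\<lambda>n. q n y x)"
  shows "convergent (\<lambda>n. q n y x)"
proof -
  have "y \<in> closure Y" "x \<in> closure X" using dense by auto
  then obtain f g where f: "\<And>n. f n \<in> Y" "f \<longlonglongrightarrow> y" and g: "\<And>n. g n \<in> X" "g \<longlonglongrightarrow> x"
    unfolding closure_sequential by metis
  define err where "err k = C * norm (f k - y) * norm (g k) + C * norm y * norm (g k - x)" for k
  have err: "cmod (q n (f k) (g k) - q n y x) \<le> err k" for n k
  proof -
    have "q n (f k) (g k) - q n y x = q n (f k - y) (g k) + q n y (g k - x)"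
      by (simp add: sesq_diff[OF q])
    then show ?thesis unfolding err_def
      by (simp only: order_trans[OF norm_triangle_ineq add_mono[OF sesqD(5)[OF q] sesqD(5)[OF q]]])
  qed
  have "err \<longlonglongrightarrow> C * norm (y - y) * norm x + C * norm y * norm (x - x)"
    unfolding err_def by (intro tendsto_intros f g)
  then have err0: "err \<longlonglongrightarrow> 0" by simp
  have "Cauchy (\<lambda>n. q n y x)"
  proof (rule metric_CauchyI)
    fix e :: real assume "e > 0"
    then have "\<forall>\<^sub>F k in sequentially. err k < e / 3" by (intro order_tendstoD(2)[OF err0]) simp
    then obtain k where k: "err k < e / 3" by (auto simp: eventually_sequentially)
    have "Cauchy (\<lambda>n. q n (f k) (g k))" using conv f g by (auto intro: convergent_Cauchy)
    then obtain M where M: "\<And>m n. m \<ge> M \<Longrightarrow> n \<ge> M \<Longrightarrow> dist (q m (f k) (g k)) (q n (f k) (g k)) < e / 3"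
      using metric_CauchyD[of _ "e / 3"] \<open>e > 0\<close> by (metis zero_less_divide_iff zero_less_numeral)
    have "dist (q m y x) (q n y x) < e" if "m \<ge> M" "n \<ge> M" for m n
    proof -
      have "dist (q m y x) (q n y x) \<le> dist (q m y x) (q m (f k) (g k)) +
          dist (q m (f k) (g k)) (q n (f k) (g k)) + dist (q n (f k) (g k)) (q n y x)"
        using dist_triangle[of "q m y x" "q n y x" "q m (f k) (g k)"]
          dist_triangle[of "q m (f k) (g k)" "q n y x" "q n (f k) (g k)"] by linarith
      also have "\<dots> < e"
        using err[of m k] err[of n k] k M[OF that] by (simp add: dist_norm norm_minus_commute)
      finally show ?thesis .
    qed
    then show "\<exists>M. \<forall>m\<ge>M. \<forall>n\<ge>M. dist (q m y x) (q n y x) < e" by blast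
  qed
  then show ?thesis by (rule Cauchy_convergent)
qed

lemma sesq_limit:
  assumes q: "\<And>n. sesq C (q n)" and lim: "\<And>y x. (\<lambda>n. q n y x) \<longlonglongrightarrow> v y x"
  shows "sesq C v"
  unfolding sesq_def
proof (intro conjI allI)
  fix y y' x x' c
  have "(\<lambda>n. q n (y + y') x) \<longlonglongrightarrow> v y x + v y' x" "(\<lambda>n. q n y (x + x')) \<longlonglongrightarrow> v y x + v y x'"
    "(\<lambda>n. q n (c *\<^sub>C y) x) \<longlonglongrightarrow> cnj c * v y x" "(\<lambda>n. q n y (c *\<^sub>C x)) \<longlonglongrightarrow> c * v y x"
    by (simp_all only: sesqD(1-4)[OF q]) (intro tendsto_intros lim)+
  then show "v (y + y') x = v y x + v y' x" "v y (x + x') = v y x + v y x'"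
    "v (c *\<^sub>C y) x = cnj c * v y x" "v y (c *\<^sub>C x) = c * v y x"
    by (auto intro: LIMSEQ_unique lim)
  show "cmod (v y x) \<le> C * norm y * norm x"
    by (rule LIMSEQ_le_const2[OF tendsto_norm[OF lim]]) (use sesqD(5)[OF q] in auto)
qed

lemma sesq_riesz:
  fixes q :: "'b::{complex_inner,complete_space} \<Rightarrow> 'a::complex_inner \<Rightarrow> complex"
  assumes q: "sesq C q" and "C \<ge> 0"
  obtains A where "A \<in> bops UNIV UNIV" "\<And>y x. cinner y (A x) = q y x" "\<And>x. norm (A x) \<le> C * norm x"
proof -
  have "\<exists>z\<in>UNIV. \<forall>y\<in>UNIV. cnj (q y x) = cinner z y" for x
    by (rule riesz_representation[where C = "C * norm x"])
      (use sesqD[OF q] in \<open>auto simp: mult_ac\<close>)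
  then obtain A where "\<And>y x. cnj (q y x) = cinner (A x) y" by (metis UNIV_I)
  then have A: "cinner y (A x) = q y x" for y x by (metis cinner_commute complex_cnj_cnj)
  have bound: "norm (A x) \<le> C * norm x" for x
  proof (cases "A x = 0")
    case True then show ?thesis using \<open>C \<ge> 0\<close> by simp
  next
    case False
    have "complex_of_real ((norm (A x))\<^sup>2) = q (A x) x" using A cinner_self by metis
    then have "(norm (A x))\<^sup>2 \<le> C * norm (A x) * norm x"
      using sesqD(5)[OF q, of "A x" x] by (metis abs_of_nonneg norm_of_real zero_le_power2)
    then show ?thesis using False by (simp add: power2_eq_square)
  qed
  have "A \<in> bops UNIV UNIV"
  proof (rule bopsI[where C = C])
    show "A (x + y) = A x + A y" "A (c *\<^sub>C x) = c *\<^sub>C A x" for x y c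
      by (rule cinner_eqI; simp add: A cinner_linear sesqD[OF q])+
  qed (use bound in auto)
  then show thesis using that A bound by blast
qed

section \<open>Cuntz families and absorbed vectors\<close>

lemma bops_codomain_mono: "A \<in> bops M L \<Longrightarrow> L \<subseteq> L' \<Longrightarrow> A \<in> bops M L'"
  by (auto simp: bops_def PiE_iff)

text \<open>Cauchy-Schwarz over the index \<open>i\<close>, in the shape that shows in
  \<open>sesq_\<theta>\<close> that summing a form over pairs of adjoint images does not worsen its
  bound.\<close>

lemma bdd_form_sum:
  fixes f :: "nat \<Rightarrow> 'b::real_normed_vector" and g :: "nat \<Rightarrow> 'a::real_normed_vector"
  assumes "C \<ge> 0" "\<And>i. i < N \<Longrightarrow> cmod (q i) \<le> C * norm (f i) * norm (g i)"
    and "(\<Sum>i<N. (norm (f i))\<^sup>2) \<le> F\<^sup>2" "(\<Sum>i<N. (norm (g i))\<^sup>2) \<le> G\<^sup>2" "F \<ge> 0" "G \<ge> 0"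
  shows "cmod (\<Sum>i<N. q i) \<le> C * F * G"
proof -
  have "cmod (\<Sum>i<N. q i) \<le> (\<Sum>i<N. C * (norm (f i) * norm (g i)))"
    using assms(2) by (intro sum_norm_le) (auto simp: mult_ac)
  also have "\<dots> = C * (\<Sum>i<N. \<bar>norm (f i)\<bar> * \<bar>norm (g i)\<bar>)" by (simp add: sum_distrib_left)
  also have "\<dots> \<le> C * (L2_set (\<lambda>i. norm (f i)) {..<N} * L2_set (\<lambda>i. norm (g i)) {..<N})"
    using assms(1) by (intro mult_left_mono L2_set_mult_ineq)
  also have "\<dots> \<le> C * (F * G)"
    using assms by (intro mult_left_mono mult_mono)
      (auto simp: L2_set_def real_le_lsqrt sum_nonneg)
  finally show ?thesis by (simp add: mult_ac)
qed

locale cuntz_family =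
  fixes N :: nat and S :: "nat \<Rightarrow> 'a::{complex_inner,complete_space} \<Rightarrow> 'a"
  assumes cuntz: "cuntz_rep N S"
begin

abbreviation Sd where "Sd i \<equiv> hadj (S i)"

lemma S_bops: "i < N \<Longrightarrow> S i \<in> bops UNIV UNIV"
  and Sd_bops: "i < N \<Longrightarrow> Sd i \<in> bops UNIV UNIV"
  and Sd_S: "i < N \<Longrightarrow> j < N \<Longrightarrow> Sd i (S j x) = (if i = j then x else 0)"
  and sum_S_Sd: "(\<Sum>j<N. S j (Sd j x)) = x"
  using cuntz by (auto simp: cuntz_rep_def)

lemma cinner_S: "i < N \<Longrightarrow> cinner (S i x) y = cinner x (Sd i y)"
  and cinner_S': "i < N \<Longrightarrow> cinner y (S i x) = cinner (Sd i y) x"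
  by (rule cinner_hadj cinner_hadj'; rule S_bops; assumption)+

lemma cinner_Sd: "i < N \<Longrightarrow> cinner (Sd i y) x = cinner y (S i x)"
  using cinner_S' by auto

lemma sum_cinner_Sd: "(\<Sum>i<N. cinner (Sd i y) (Sd i x)) = cinner y x"
proof -
  have "(\<Sum>i<N. cinner (Sd i y) (Sd i x)) = cinner y (\<Sum>i<N. S i (Sd i x))"
    by (simp add: cinner_sum_right cinner_Sd)
  then show ?thesis by (simp add: sum_S_Sd)
qed

lemma sum_norm_Sd: "(\<Sum>i<N. (norm (Sd i x))\<^sup>2) = (norm x)\<^sup>2"
proof -
  have "complex_of_real (\<Sum>i<N. (norm (Sd i x))\<^sup>2) = complex_of_real ((norm x)\<^sup>2)"
    using sum_cinner_Sd[of x x] by (simp add: cinner_self)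
  then show ?thesis by (simp only: of_real_eq_iff)
qed

lemma Sd_sum_S: "j < N \<Longrightarrow> Sd j (\<Sum>i<N. S i (v i)) = v j"
proof -
  assume j: "j < N"
  have "Sd j (\<Sum>i<N. S i (v i)) = (\<Sum>i<N. Sd j (S i (v i)))" by (rule bops_sum[OF Sd_bops[OF j]]) auto
  also have "\<dots> = (\<Sum>i<N. if i = j then v i else 0)" using j by (intro sum.cong) (auto simp: Sd_S)
  finally show ?thesis using j by simp
qed

lemma norm_sum_S: "(norm (\<Sum>i<N. S i (v i)))\<^sup>2 = (\<Sum>i<N. (norm (v i))\<^sup>2)"
  using sum_norm_Sd[of "\<Sum>i<N. S i (v i)"] by (simp add: Sd_sum_S cong: sum.cong_simp)

lemma norm_S: "i < N \<Longrightarrow> norm (S i x) = norm x"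
proof -
  assume i: "i < N"
  have "cinner (S i x) (S i x) = cinner x x" by (simp add: cinner_S i Sd_S)
  then have "(norm (S i x))\<^sup>2 = (norm x)\<^sup>2" unfolding cinner_self by (simp only: of_real_eq_iff)
  then show ?thesis by simp
qed

definition absorbed :: "'a set \<Rightarrow> nat \<Rightarrow> 'a set" where
  "absorbed K M = {x. \<forall>I. set I \<subseteq> {..<N} \<and> M \<le> length I \<longrightarrow> foldl (\<lambda>x i. Sd i x) x I \<in> K}"

lemma absorbed_mono: "M \<le> M' \<Longrightarrow> absorbed K M \<subseteq> absorbed K M'"
  unfolding absorbed_def by auto

lemma absorbed_0_subset: "absorbed K 0 \<subseteq> K"
  unfolding absorbed_def by (auto dest: spec[of _ "[]"])

lemma absorbed_Suc_iff: "x \<in> absorbed K (Suc M) \<longleftrightarrow> (\<forall>i<N. Sd i x \<in> absorbed K M)"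
proof
  assume "x \<in> absorbed K (Suc M)"
  then have *: "\<And>I. set I \<subseteq> {..<N} \<Longrightarrow> Suc M \<le> length I \<Longrightarrow> foldl (\<lambda>x i. Sd i x) x I \<in> K"
    unfolding absorbed_def by auto
  show "\<forall>i<N. Sd i x \<in> absorbed K M"
    unfolding absorbed_def using *[of "_ # _"] by auto
next
  assume *: "\<forall>i<N. Sd i x \<in> absorbed K M"
  show "x \<in> absorbed K (Suc M)"
    unfolding absorbed_def
  proof safe
    fix I assume I: "set I \<subseteq> {..<N}" "Suc M \<le> length I"
    then obtain i J where "I = i # J" by (cases I) auto
    then show "foldl (\<lambda>x i. Sd i x) x I \<in> K" using * I by (auto simp: absorbed_def)
  qed
qed

lemma absorbed_0_Sd: "x \<in> absorbed K 0 \<Longrightarrow> i < N \<Longrightarrow> Sd i x \<in> absorbed K 0"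
proof -
  assume x: "x \<in> absorbed K 0" and i: "i < N"
  have "foldl (\<lambda>x i. Sd i x) x (i # I) \<in> K" if "set I \<subseteq> {..<N}" for I
  proof -
    have "set (i # I) \<subseteq> {..<N}" using that i by simp
    then show ?thesis using x unfolding absorbed_def by blast
  qed
  then show ?thesis by (auto simp: absorbed_def)
qed

lemma absorbed_0_I:
  assumes "x \<in> L" "L \<subseteq> K" "\<And>i x. i < N \<Longrightarrow> x \<in> L \<Longrightarrow> Sd i x \<in> L"
  shows "x \<in> absorbed K 0"
proof -
  have "foldl (\<lambda>x i. Sd i x) x I \<in> L" if "set I \<subseteq> {..<N}" for I
    using that assms(1)
  proof (induction I arbitrary: x)
    case (Cons i I)
    then show ?case using assms(3)[of i x] by simp
  qed simp
  then show ?thesis using assms(2) by (auto simp: absorbed_def)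
qed

lemma csubspace_absorbed:
  assumes "csubspace K" shows "csubspace (absorbed K M)"
proof (rule complex_vector.subspaceI)
  have 0: "foldl (\<lambda>x i. Sd i x) 0 I = 0" if "set I \<subseteq> {..<N}" for I
    using that by (induction I) (auto simp: bops_0[OF Sd_bops])
  have add: "foldl (\<lambda>x i. Sd i x) (x + y) I = foldl (\<lambda>x i. Sd i x) x I + foldl (\<lambda>x i. Sd i x) y I"
    if "set I \<subseteq> {..<N}" for I x y
    using that by (induction I arbitrary: x y) (auto simp: bops_add[OF Sd_bops])
  have scale: "foldl (\<lambda>x i. Sd i x) (c *\<^sub>C x) I = c *\<^sub>C foldl (\<lambda>x i. Sd i x) x I"
    if "set I \<subseteq> {..<N}" for I x c
    using that by (induction I arbitrary: x) (auto simp: bops_scaleC[OF Sd_bops])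
  show "0 \<in> absorbed K M" using assms by (auto simp: absorbed_def 0 csubspace_0)
  show "x + y \<in> absorbed K M" if "x \<in> absorbed K M" "y \<in> absorbed K M" for x y
    using that assms by (auto simp: absorbed_def add csubspace_add)
  show "c *\<^sub>C x \<in> absorbed K M" if "x \<in> absorbed K M" for x c
    using that assms by (auto simp: absorbed_def scale csubspace_scaleC)
qed

end

text \<open>All that the operator theory takes from the torus: an orthonormal basis of
  \<open>K\<close>, and density of the vectors that long words of adjoints send into
  \<open>K\<close>.\<close>

locale absorbed_family = cuntz_family +
  fixes B :: "'a set"
  assumes finite_B: "finite B" and orthonormal_B: "orthonormal B"
    and dense: "closure (\<Union>M. absorbed (cspan B) M) = UNIV"

sublocale absorbed_family \<subseteq> closed_csubspace "cspan B"
  by standard (simp_all add: closed_cspan_orthonormal finite_B orthonormal_B)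

context absorbed_family
begin

abbreviation K where "K \<equiv> cspan B"
abbreviation Ab where "Ab \<equiv> absorbed K"

lemma Ab_0_K: "x \<in> Ab 0 \<Longrightarrow> x \<in> K"
  using absorbed_0_subset by blast

lemma proj_expand: "P x = (\<Sum>b\<in>B. cinner b x *\<^sub>C b)"
  using orthonormal_expand[OF finite_B orthonormal_B proj_in[of x]]
  by (simp add: cinner_proj complex_vector.span_base cong: sum.cong_simp)

end

section \<open>Intertwiners and fixed points of the transfer map\<close>

locale absorbed_pair =
  X: absorbed_family N S B + Y: absorbed_family N T B\<^sub>1
  for N and S :: "nat \<Rightarrow> 'a::{complex_inner,complete_space} \<Rightarrow> 'a" and B
    and T :: "nat \<Rightarrow> 'b::{complex_inner,complete_space} \<Rightarrow> 'b" and B\<^sub>1 +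
  fixes \<gamma> :: complex
  assumes \<gamma>: "cmod \<gamma> = 1"
begin

definition \<theta> :: "('b \<Rightarrow> 'a \<Rightarrow> complex) \<Rightarrow> 'b \<Rightarrow> 'a \<Rightarrow> complex" where
  "\<theta> q y x = \<gamma> * (\<Sum>i<N. q (Y.Sd i y) (X.Sd i x))"

text \<open>The relation \<open>U (S i x) = \<gamma> *\<^sub>C T i (U x)\<close> expressed through
  the form of \<open>U\<close>; the translation is \<open>Intw_iff\<close>.\<close>

definition Intw :: "('a \<Rightarrow> 'b) set" where
  "Intw = {U \<in> bops UNIV UNIV. \<forall>y x. \<theta> (\<lambda>y x. cinner y (U x)) y x = cinner y (U x)}"

text \<open>\<open>X.P\<close> is there because \<open>X.Sd i x\<close> may leave
  \<open>X.K\<close>, where \<open>V\<close> is \<open>undefined\<close>. In the first slot the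
  values of \<open>V\<close> lie in \<open>Y.K\<close>, so only the component of
  \<open>Y.Sd i y\<close> in \<open>Y.K\<close> is seen.\<close>

definition Fix :: "('a \<Rightarrow> 'b) set" where
  "Fix = {V \<in> bops X.K Y.K. \<forall>y\<in>Y.K. \<forall>x\<in>X.K. \<theta> (\<lambda>y x. cinner y (V (X.P x))) y x = cinner y (V x)}"

text \<open>A relation and not a map: the forms are compared only on the coinvariant parts, which
  may be much smaller than the spaces \<open>K\<close>. That each side determines the other is
  proved later from \<open>matches_op_norm\<close>.\<close>

definition matches :: "('a \<Rightarrow> 'b) \<Rightarrow> ('a \<Rightarrow> 'b) \<Rightarrow> bool" where
  "matches U V \<longleftrightarrow> (\<forall>y\<in>Y.Ab 0. \<forall>x\<in>X.Ab 0. cinner y (U x) = cinner y (V x))"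

lemma \<theta>_apply: "\<theta> q y x = \<gamma> * (\<Sum>i<N. q (Y.Sd i y) (X.Sd i x))"
  by (simp add: \<theta>_def)

text \<open>The constant does not grow: the squared norms of the \<open>Sd i x\<close> add up to
  that of \<open>x\<close>, so Cauchy-Schwarz over \<open>i\<close> costs nothing, and
  \<open>\<gamma>\<close> has modulus one.\<close>

lemma sesq_\<theta>:
  assumes q: "sesq C q" and C: "C \<ge> 0" shows "sesq C (\<theta> q)"
  unfolding sesq_def
proof (intro conjI allI)
  fix x x' :: 'a and y y' :: 'b and c
  show "\<theta> q (y + y') x = \<theta> q y x + \<theta> q y' x" "\<theta> q y (x + x') = \<theta> q y x + \<theta> q y x'"
    by (simp_all add: \<theta>_apply bops_add[OF X.Sd_bops] bops_add[OF Y.Sd_bops] sesqD(1,2)[OF q]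
        sum.distrib distrib_left cong: sum.cong_simp)
  show "\<theta> q (c *\<^sub>C y) x = cnj c * \<theta> q y x" "\<theta> q y (c *\<^sub>C x) = c * \<theta> q y x"
    by (simp_all add: \<theta>_apply bops_scaleC[OF X.Sd_bops] bops_scaleC[OF Y.Sd_bops] sesqD(3,4)[OF q]
        sum_distrib_left mult_ac cong: sum.cong_simp)
  show "cmod (\<theta> q y x) \<le> C * norm y * norm x"
    using bdd_form_sum[OF C, of N "\<lambda>i. q (Y.Sd i y) (X.Sd i x)" "\<lambda>i. Y.Sd i y" "\<lambda>i. X.Sd i x"
        "norm y" "norm x"] sesqD(5)[OF q]
    by (simp add: \<theta>_apply norm_mult \<gamma> X.sum_norm_Sd Y.sum_norm_Sd)
qed

lemma sesq_\<theta>_pow: "sesq C q \<Longrightarrow> C \<ge> 0 \<Longrightarrow> sesq C ((\<theta> ^^ n) q)"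
  by (induction n) (auto intro: sesq_\<theta>)

text \<open>Each application of \<open>\<theta>\<close> lowers the absorption level of the arguments
  by one, so the \<open>M\<close>-th iterate evaluates the form on level 0 only.\<close>

lemma \<theta>_pow_cong:
  assumes "\<And>y x. y \<in> Y.Ab 0 \<Longrightarrow> x \<in> X.Ab 0 \<Longrightarrow> q y x = q' y x"
  shows "y \<in> Y.Ab M \<Longrightarrow> x \<in> X.Ab M \<Longrightarrow> (\<theta> ^^ M) q y x = (\<theta> ^^ M) q' y x"
proof (induction M arbitrary: y x)
  case (Suc M)
  then show ?case unfolding X.absorbed_Suc_iff Y.absorbed_Suc_iff by (simp add: \<theta>_apply cong: sum.cong_simp)
qed (use assms in auto)

text \<open>After \<open>M\<close> steps the arguments have entered the coinvariant parts and stay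
  there; further steps see only the invariance of \<open>q\<close>.\<close>

lemma \<theta>_pow_stable:
  assumes "\<And>y x. y \<in> Y.Ab 0 \<Longrightarrow> x \<in> X.Ab 0 \<Longrightarrow> \<theta> q y x = q y x"
  shows "y \<in> Y.Ab M \<Longrightarrow> x \<in> X.Ab M \<Longrightarrow> (\<theta> ^^ (M + n)) q y x = (\<theta> ^^ M) q y x"
proof (induction M arbitrary: y x)
  case 0
  then show ?case
  proof (induction n arbitrary: y x)
    case (Suc n)
    have "\<theta> ((\<theta> ^^ n) q) y x = \<theta> q y x"
      unfolding \<theta>_apply[of _ y x]
      using Suc.IH Suc.prems X.absorbed_0_Sd Y.absorbed_0_Sd by (intro arg_cong2[of _ _ _ _ "(*)"] sum.cong) auto
    then show ?case using assms Suc.prems by simp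
  qed simp
next
  case (Suc M)
  then show ?case unfolding X.absorbed_Suc_iff Y.absorbed_Suc_iff by (simp add: \<theta>_apply cong: sum.cong_simp)
qed

lemma common_level:
  assumes "y \<in> (\<Union>M. Y.Ab M)" "x \<in> (\<Union>M. X.Ab M)"
  obtains M where "y \<in> Y.Ab M" "x \<in> X.Ab M"
proof -
  obtain m n where "y \<in> Y.Ab m" "x \<in> X.Ab n" using assms by auto
  then show thesis
    using that[of "max m n"] X.absorbed_mono[of n "max m n"] Y.absorbed_mono[of m "max m n"] by auto
qed

lemma sesq_vform:
  assumes "V \<in> bops X.K Y.K"
  shows "sesq (op_norm X.K V) (\<lambda>y x. cinner y (V (X.P x)))"
proof (rule sesq_operator_form)
  fix x y c
  show "V (X.P (x + y)) = V (X.P x) + V (X.P y)" "V (X.P (c *\<^sub>C x)) = c *\<^sub>C V (X.P x)"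
    using assms by (simp_all add: X.proj_add X.proj_scaleC bops_add bops_scaleC)
  have "norm (V (X.P x)) \<le> op_norm X.K V * norm (X.P x)" using assms by (intro op_norm_bound) auto
  also have "\<dots> \<le> op_norm X.K V * norm x"
    using assms op_norm_nonneg X.proj_norm_le by (intro mult_left_mono) auto
  finally show "norm (V (X.P x)) \<le> op_norm X.K V * norm x" .
qed

lemma Intw_pow: "U \<in> Intw \<Longrightarrow> (\<theta> ^^ n) (\<lambda>y x. cinner y (U x)) = (\<lambda>y x. cinner y (U x))"
proof (induction n)
  case (Suc n)
  then have "(\<theta> ^^ Suc n) (\<lambda>y x. cinner y (U x)) = \<theta> (\<lambda>y x. cinner y (U x))" by simp
  also have "\<dots> = (\<lambda>y x. cinner y (U x))" using Suc.prems by (intro ext) (simp add: Intw_def)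
  finally show ?case .
qed simp

text \<open>Invariance of \<open>U\<close> moves the arguments down to level 0, where
  \<open>U\<close> may be exchanged for \<open>V\<close>. Thus \<open>V\<close> determines
  \<open>U\<close> on a dense set.\<close>

lemma matches_pow:
  assumes "U \<in> Intw" "matches U V" "y \<in> Y.Ab M" "x \<in> X.Ab M"
  shows "cinner y (U x) = (\<theta> ^^ M) (\<lambda>y x. cinner y (V (X.P x))) y x"
proof -
  have "cinner y (U x) = (\<theta> ^^ M) (\<lambda>y x. cinner y (U x)) y x" using assms by (simp add: Intw_pow)
  also have "\<dots> = (\<theta> ^^ M) (\<lambda>y x. cinner y (V (X.P x))) y x"
    by (rule \<theta>_pow_cong) (use assms in \<open>auto simp: matches_def X.Ab_0_K\<close>)
  finally show ?thesis .
qed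

text \<open>On absorbed vectors the form of \<open>U\<close> is an iterate of the form of
  \<open>V\<close>, and iterating does not increase the bound; density does the rest.\<close>

lemma op_norm_Intw_le:
  assumes U: "U \<in> Intw" and V: "V \<in> bops X.K Y.K" and m: "matches U V"
  shows "op_norm UNIV U \<le> op_norm X.K V"
proof (rule op_norm_least)
  show nonneg: "0 \<le> op_norm X.K V" using V op_norm_nonneg by auto
  have q: "sesq (op_norm UNIV U) (\<lambda>y x. cinner y (U x))" using U by (intro sesq_bops) (auto simp: Intw_def)
  have le: "cmod (cinner y (U x)) \<le> op_norm X.K V * norm y * norm x" for y x
  proof (rule sesq_bound_on_dense[OF q Y.dense X.dense])
    fix y x assume "y \<in> (\<Union>M. Y.Ab M)" "x \<in> (\<Union>M. X.Ab M)"
    then obtain M where M: "y \<in> Y.Ab M" "x \<in> X.Ab M" by (rule common_level)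
    show "cmod (cinner y (U x)) \<le> op_norm X.K V * norm y * norm x"
      unfolding matches_pow[OF U m M] by (rule sesqD(5)[OF sesq_\<theta>_pow[OF sesq_vform[OF V] nonneg]])
  qed
  show "norm (U x) \<le> op_norm X.K V * norm x" for x
  proof (cases "U x = 0")
    case False
    have "(norm (U x))\<^sup>2 = cmod (cinner (U x) (U x))" by (simp add: cinner_self norm_power)
    also have "\<dots> \<le> op_norm X.K V * norm (U x) * norm x" by (rule le)
    finally show ?thesis using False by (simp add: power2_eq_square)
  qed (simp add: nonneg)
qed simp

text \<open>A pair of vectors of equal norm at which \<open>V\<close> attains its norm is mapped by every
  \<open>(T\<^sub>i\<^sup>*, S\<^sub>i\<^sup>*)\<close> to such a pair: this is the equality case of the arithmetic-geometric mean
  inequality. Hence no mass leaves \<open>K\<close> along such a pair.\<close>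

lemma maximal_pair_step:
  assumes V: "V \<in> Fix" and c: "c = op_norm X.K V" "c > 0"
    and yx: "y \<in> Y.K" "x \<in> X.K" "norm y = norm x" "cmod (cinner y (V x)) = c * (norm x)\<^sup>2"
    and i: "i < N"
  shows "Y.Sd i y \<in> Y.K \<and> X.Sd i x \<in> X.K \<and> norm (Y.Sd i y) = norm (X.Sd i x) \<and>
    cmod (cinner (Y.Sd i y) (V (X.Sd i x))) = c * (norm (X.Sd i x))\<^sup>2"
proof -
  have Vb: "V \<in> bops X.K Y.K" using V by (simp add: Fix_def)
  \<comment> \<open>\<open>f i\<close> is the modulus of the i-th term of the form and
    \<open>g i\<close> its arithmetic mean bound. Between them lie \<open>c\<close> times the
    product of the projected lengths \<open>a i\<close>, \<open>b i\<close> and \<open>c\<close>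
    times the product of the full lengths.\<close>
  define f where "f i = cmod (cinner (Y.Sd i y) (V (X.P (X.Sd i x))))" for i
  define g where "g i = c * ((norm (Y.Sd i y))\<^sup>2 + (norm (X.Sd i x))\<^sup>2) / 2" for i
  define a b where "a i = norm (Y.P (Y.Sd i y))" and "b i = norm (X.P (X.Sd i x))" for i
  have f_ab: "f i \<le> c * (a i * b i)" for i
  proof -
    have "f i = cmod (cinner (Y.P (Y.Sd i y)) (V (X.P (X.Sd i x))))"
      unfolding f_def by (simp add: Y.cinner_proj' bops_in[OF Vb])
    also have "\<dots> \<le> a i * norm (V (X.P (X.Sd i x)))" unfolding a_def by (rule cmod_cinner_le)
    also have "\<dots> \<le> a i * (c * b i)"
      unfolding b_def c(1) a_def by (intro mult_left_mono op_norm_bound[OF Vb]) auto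
    finally show ?thesis by (simp add: mult_ac)
  qed
  have a_le: "0 \<le> a i" "a i \<le> norm (Y.Sd i y)" and b_le: "0 \<le> b i" "b i \<le> norm (X.Sd i x)" for i
    by (simp_all add: a_def b_def X.proj_norm_le Y.proj_norm_le)
  have ab: "a i * b i \<le> norm (Y.Sd i y) * norm (X.Sd i x)" for i
    using a_le b_le by (intro mult_mono) auto
  have amgm: "norm (Y.Sd i y) * norm (X.Sd i x) \<le> ((norm (Y.Sd i y))\<^sup>2 + (norm (X.Sd i x))\<^sup>2) / 2" for i
    using zero_le_power2[of "norm (Y.Sd i y) - norm (X.Sd i x)"] by (simp add: power2_diff)
  have fg: "f i \<le> g i" for i
  proof -
    have "c * (a i * b i) \<le> c * (((norm (Y.Sd i y))\<^sup>2 + (norm (X.Sd i x))\<^sup>2) / 2)"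
      using c(2) ab[of i] amgm[of i] by (intro mult_left_mono) linarith+
    then show ?thesis using f_ab[of i] by (simp add: g_def)
  qed
  have "\<theta> (\<lambda>y x. cinner y (V (X.P x))) y x = cinner y (V x)" using V yx(1,2) unfolding Fix_def by blast
  then have "cmod (cinner y (V x)) = cmod (\<Sum>i<N. cinner (Y.Sd i y) (V (X.P (X.Sd i x))))"
    unfolding \<theta>_apply[of _ y x] by (metis \<gamma> mult_1 norm_mult)
  then have lower: "c * (norm x)\<^sup>2 \<le> sum f {..<N}"
    unfolding yx(4) f_def by (simp add: norm_sum)
  have "sum g {..<N} = c * ((\<Sum>i<N. (norm (Y.Sd i y))\<^sup>2) + (\<Sum>i<N. (norm (X.Sd i x))\<^sup>2)) / 2"
    unfolding g_def sum_divide_distrib[symmetric] sum_distrib_left[symmetric] sum.distrib ..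
  then have "sum g {..<N} = c * (norm x)\<^sup>2" by (simp add: X.sum_norm_Sd Y.sum_norm_Sd yx(3))
  \<comment> \<open>The total of \<open>g\<close> is at most that of \<open>f\<close>, so the
    termwise inequality is an equality and the whole chain between \<open>f i\<close> and
    \<open>g i\<close> collapses.\<close>
  then have "sum f {..<N} = sum g {..<N}" using lower sum_mono[of "{..<N}" f g] fg by simp
  then have fgi: "f i = g i" using sum_mono_inv[of f "{..<N}" g i] fg i by auto
  then have "c * (((norm (Y.Sd i y))\<^sup>2 + (norm (X.Sd i x))\<^sup>2) / 2) \<le> c * (a i * b i)"
    using f_ab[of i] by (simp add: g_def)
  then have le: "((norm (Y.Sd i y))\<^sup>2 + (norm (X.Sd i x))\<^sup>2) / 2 \<le> a i * b i" using c(2) by simp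
  then have "(norm (Y.Sd i y) - norm (X.Sd i x))\<^sup>2 \<le> 0" using ab[of i] by (simp add: power2_diff)
  then have eq: "norm (Y.Sd i y) = norm (X.Sd i x)" by simp
  let ?t = "norm (X.Sd i x)"
  have t: "?t\<^sup>2 \<le> a i * b i" using le eq by simp
  \<comment> \<open>Two numbers between 0 and \<open>?t\<close> have product at least the square of
    \<open>?t\<close> only if both equal \<open>?t\<close>. So the projections lose no norm.\<close>
  have "a i = ?t \<and> b i = ?t"
  proof (cases "?t = 0")
    case True then show ?thesis using a_le[of i] b_le[of i] eq by auto
  next
    case False
    have "?t * ?t \<le> a i * ?t"
      using t b_le[of i] a_le[of i] by (simp add: power2_eq_square) (meson mult_left_mono order_trans)
    moreover have "?t * ?t \<le> b i * ?t"
      using t mult_right_mono[OF a_le(2)[of i] b_le(1)[of i]] eq by (simp add: power2_eq_square mult.commute)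
    ultimately show ?thesis using False a_le[of i] b_le[of i] eq
      by (metis antisym mult_right_le_imp_le norm_ge_zero order_le_less)
  qed
  then have "Y.P (Y.Sd i y) = Y.Sd i y" "X.P (X.Sd i x) = X.Sd i x"
    using eq unfolding a_def b_def by (auto intro: X.proj_norm_eq Y.proj_norm_eq)
  moreover from this have "Y.Sd i y \<in> Y.K" "X.Sd i x \<in> X.K" by (metis Y.proj_in, metis X.proj_in)
  ultimately show ?thesis using fgi eq by (simp add: f_def g_def)
qed

lemma maximal_pair_absorbed:
  assumes V: "V \<in> Fix" and c: "c = op_norm X.K V" "c > 0"
    and yx: "y \<in> Y.K" "x \<in> X.K" "norm y = norm x" "cmod (cinner y (V x)) = c * (norm x)\<^sup>2"
  shows "y \<in> Y.Ab 0" "x \<in> X.Ab 0"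
proof -
  have "foldl (\<lambda>y i. Y.Sd i y) y I \<in> Y.K \<and> foldl (\<lambda>x i. X.Sd i x) x I \<in> X.K" if "set I \<subseteq> {..<N}" for I
    using that yx
  proof (induction I arbitrary: y x)
    case (Cons i I)
    then have i: "i < N" and I: "set I \<subseteq> {..<N}" by auto
    show ?case
      using Cons.IH[OF I, of "Y.Sd i y" "X.Sd i x"] maximal_pair_step[OF V c Cons.prems(2-5) i] by simp
  qed simp
  then show "y \<in> Y.Ab 0" "x \<in> X.Ab 0" by (auto simp: X.absorbed_def Y.absorbed_def)
qed

text \<open>A unit vector where \<open>V\<close> attains its norm and its normalised image form a
  maximal pair. It lies in the coinvariant parts, where \<open>U\<close> has the same form as
  \<open>V\<close>, so \<open>U\<close> is at least as large.\<close>

lemma op_norm_Fix_le: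
  assumes U: "U \<in> Intw" and V: "V \<in> Fix" and m: "matches U V"
  shows "op_norm X.K V \<le> op_norm UNIV U"
proof (cases "op_norm X.K V > 0")
  case False
  moreover have "U \<in> bops UNIV UNIV" using U by (simp add: Intw_def)
  then have "0 \<le> op_norm UNIV U" by (rule op_norm_nonneg) simp
  ultimately show ?thesis by simp
next
  case True
  define c where "c = op_norm X.K V"
  have Vb: "V \<in> bops X.K Y.K" using V by (simp add: Fix_def)
  have Ub: "U \<in> bops UNIV UNIV" using U by (simp add: Intw_def)
  let ?S = "{x \<in> X.K. norm x = 1}"
  have scale: "norm (V x) = norm (V ((1 / norm x) *\<^sub>C x)) * norm x" if "x \<in> X.K" "x \<noteq> 0" for x
    using that by (simp add: bops_scaleC[OF Vb] norm_divide)
  \<comment> \<open>The supremum is attained only on a nonempty sphere; a trivial \<open>K\<close>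
    is excluded by the positive norm of \<open>V\<close>.\<close>
  have "?S \<noteq> {}"
  proof
    assume "?S = {}"
    have "x = 0" if "x \<in> X.K" for x
    proof (rule ccontr)
      assume "x \<noteq> 0"
      then have "(1 / norm x) *\<^sub>C x \<in> ?S" using that by (simp add: csubspace_scaleC norm_divide)
      then show False using \<open>?S = {}\<close> by blast
    qed
    then have "op_norm X.K V \<le> 0"
      by (intro op_norm_least) (use bops_0[OF Vb] in auto)
    then show False using True by simp
  qed
  moreover have "continuous_on ?S (\<lambda>x. norm (V x))"
  proof -
    \<comment> \<open>\<open>V\<close> is \<open>undefined\<close> off \<open>X.K\<close>, so
      continuity is taken from the bounded operator \<open>V \<circ> X.P\<close> on the whole
      space.\<close>
    have "continuous_on ?S (V \<circ> X.P)"
      by (rule continuous_on_subset[OF bounded_linear.continuous_on[OF bops_bounded_linear[OF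
              bops_codomain_mono[OF bops_comp[OF Vb X.proj_bops] subset_UNIV]] continuous_on_id[of UNIV]]]) simp
    then have "continuous_on ?S V"
      by (rule continuous_on_cong[THEN iffD1, rotated -1]) auto
    then show ?thesis by (rule continuous_on_norm)
  qed
  ultimately obtain x where x: "x \<in> X.K" "norm x = 1" "\<And>x'. x' \<in> ?S \<Longrightarrow> norm (V x') \<le> norm (V x)"
    using continuous_attains_sup[OF compact_sphere_cspan[OF X.finite_B X.orthonormal_B]] by auto
  have "c \<le> norm (V x)"
    unfolding c_def
  proof (rule op_norm_least)
    fix z assume z: "z \<in> X.K"
    show "norm (V z) \<le> norm (V x) * norm z"
    proof (cases "z = 0")
      case True then show ?thesis using bops_0[OF Vb] by simp
    next
      case False
      then have "(1 / norm z) *\<^sub>C z \<in> ?S" using z by (simp add: csubspace_scaleC norm_divide)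
      then show ?thesis unfolding scale[OF z False] using x(3) by (intro mult_right_mono) auto
    qed
  qed auto
  moreover have "norm (V x) \<le> c" using op_norm_bound[OF Vb _ x(1)] x(2) by (simp add: c_def)
  ultimately have c: "norm (V x) = c" "c > 0" using True by (auto simp: c_def)
  define y where "y = (1 / c) *\<^sub>C V x"
  have y: "y \<in> Y.K" "norm y = 1"
    using c bops_in[OF Vb x(1)] by (auto simp: y_def csubspace_scaleC norm_divide)
  have yV: "cinner y (V x) = c"
    using c by (simp add: y_def cinner_linear cinner_self power2_eq_square)
  have "y \<in> Y.Ab 0" "x \<in> X.Ab 0"
    using maximal_pair_absorbed[OF V c_def c(2) y(1) x(1)] x(2) y(2) yV c by auto
  then have "cinner y (U x) = c" using m yV by (auto simp: matches_def)
  then have "c \<le> norm y * norm (U x)" using cmod_cinner_le[of y "U x"] c by simp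
  also have "\<dots> \<le> op_norm UNIV U" using op_norm_bound[OF Ub, of x] x y by simp
  finally show ?thesis by (simp add: c_def)
qed

lemma matches_op_norm:
  assumes "U \<in> Intw" "V \<in> Fix" "matches U V"
  shows "op_norm X.K V = op_norm UNIV U"
  using op_norm_Fix_le[OF assms] op_norm_Intw_le[OF assms(1) _ assms(3)] assms(2) by (auto simp: Fix_def)

lemma Fix_matched:
  assumes V: "V \<in> Fix"
  shows "\<exists>U\<in>Intw. matches U V"
proof -
  define v where "v y x = cinner y (V (X.P x))" for y x
  let ?C = "op_norm X.K V"
  have Vb: "V \<in> bops X.K Y.K" using V by (simp add: Fix_def)
  have C: "?C \<ge> 0" using Vb op_norm_nonneg by auto
  have v: "sesq ?C ((\<theta> ^^ n) v)" for n
    using sesq_\<theta>_pow[OF sesq_vform[OF Vb] C] by (simp add: v_def[abs_def])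
  have stable: "\<theta> v y x = v y x" if "y \<in> Y.Ab 0" "x \<in> X.Ab 0" for y x
    using V that(2)[THEN X.Ab_0_K] that(1)[THEN Y.Ab_0_K] by (auto simp: Fix_def v_def[abs_def])
  have lim: "(\<lambda>n. (\<theta> ^^ n) v y x) \<longlonglongrightarrow> (\<theta> ^^ M) v y x" if "y \<in> Y.Ab M" "x \<in> X.Ab M" for y x M
    using \<theta>_pow_stable[of v, OF stable that]
    by (intro tendsto_eventually eventually_sequentiallyI[of M]) (metis le_Suc_ex)
  \<comment> \<open>The iterates become stationary from a level that depends on \<open>y\<close> and
    \<open>x\<close>. The common bound \<open>?C\<close> extends convergence, though not
    stationarity, to all vectors.\<close>
  have conv: "convergent (\<lambda>n. (\<theta> ^^ n) v y x)" for y x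
  proof (rule sesq_convergent_on_dense[OF v Y.dense X.dense])
    fix y x assume "y \<in> (\<Union>M. Y.Ab M)" "x \<in> (\<Union>M. X.Ab M)"
    then show "convergent (\<lambda>n. (\<theta> ^^ n) v y x)"
      by (rule common_level) (use lim convergentI in blast)
  qed
  define u where "u y x = lim (\<lambda>n. (\<theta> ^^ n) v y x)" for y x
  have u_lim: "(\<lambda>n. (\<theta> ^^ n) v y x) \<longlonglongrightarrow> u y x" for y x
    using conv by (simp add: u_def convergent_LIMSEQ_iff)
  have u: "sesq ?C u" using sesq_limit[OF v u_lim] .
  obtain U where U: "U \<in> bops UNIV UNIV" "\<And>y x. cinner y (U x) = u y x" using sesq_riesz[OF u C] by metis
  have "\<theta> u y x = u y x" for y x
  proof (rule LIMSEQ_unique)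
    show "(\<lambda>n. (\<theta> ^^ Suc n) v y x) \<longlonglongrightarrow> u y x" by (rule LIMSEQ_Suc[OF u_lim])
    have "(\<lambda>n. \<theta> ((\<theta> ^^ n) v) y x) \<longlonglongrightarrow> \<theta> u y x"
      unfolding \<theta>_def[of _ y x] by (intro tendsto_intros u_lim)
    then show "(\<lambda>n. (\<theta> ^^ Suc n) v y x) \<longlonglongrightarrow> \<theta> u y x" by simp
  qed
  then have "U \<in> Intw" using U by (simp add: Intw_def U(2)[abs_def])
  moreover have "matches U V"
    unfolding matches_def
  proof (intro ballI)
    fix y x assume yx: "y \<in> Y.Ab 0" "x \<in> X.Ab 0"
    have "u y x = v y x" using LIMSEQ_unique[OF u_lim lim[OF yx]] by simp
    then show "cinner y (U x) = cinner y (V x)" using yx by (simp add: U v_def X.Ab_0_K)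
  qed
  ultimately show ?thesis by blast
qed

text \<open>On \<open>K\<close> these are the forms of the iterates of \<open>\<gamma>\<close> times
  the transfer map, started at the compression of \<open>U\<close>. Cutting down after every step
  keeps them determined by finitely many matrix entries.\<close>

primrec compressed :: "('a \<Rightarrow> 'b) \<Rightarrow> nat \<Rightarrow> 'b \<Rightarrow> 'a \<Rightarrow> complex" where
  "compressed U 0 y x = cinner (Y.P y) (U (X.P x))"
| "compressed U (Suc m) y x = \<theta> (compressed U m) (Y.P y) (X.P x)"

definition cesaro :: "('a \<Rightarrow> 'b) \<Rightarrow> nat \<Rightarrow> 'b \<Rightarrow> 'a \<Rightarrow> complex" where
  "cesaro U n y x = (\<Sum>m\<le>n. compressed U m y x) / of_nat (Suc n)"

lemma sesq_proj:
  assumes q: "sesq C q" and C: "C \<ge> 0" shows "sesq C (\<lambda>y x. q (Y.P y) (X.P x))"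
  unfolding sesq_def
proof (intro conjI allI)
  fix y x
  have "cmod (q (Y.P y) (X.P x)) \<le> C * norm (Y.P y) * norm (X.P x)" by (rule sesqD(5)[OF q])
  also have "\<dots> \<le> C * norm y * norm x"
    using C by (intro mult_mono) (auto simp: X.proj_norm_le Y.proj_norm_le)
  finally show "cmod (q (Y.P y) (X.P x)) \<le> C * norm y * norm x" .
qed (simp_all add: X.proj_add X.proj_scaleC Y.proj_add Y.proj_scaleC sesqD[OF q])

text \<open>On the coinvariant parts every iterated compression already equals the form of
  \<open>U\<close>, hence so does every limit of means. The sequence of means is exported because
  positivity of \<open>V\<close> is read off from it.\<close>

lemma Intw_matched:
  assumes U: "U \<in> Intw"
  shows "\<exists>V\<in>Fix. matches U V \<and> (\<exists>r. \<forall>y\<in>Y.K. \<forall>x\<in>X.K. (\<lambda>n. cesaro U (r n) y x) \<longlonglongrightarrow> cinner y (V x))"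
proof -
  have Ub: "U \<in> bops UNIV UNIV" using U by (simp add: Intw_def)
  let ?C = "op_norm UNIV U"
  have C: "?C \<ge> 0" using op_norm_nonneg[OF Ub] by simp
  have w: "sesq ?C (compressed U m)" for m
  proof (induction m)
    case 0
    show ?case using sesq_proj[OF sesq_bops[OF Ub] C] by (simp add: sesq_def)
  next
    case (Suc m)
    show ?case using sesq_proj[OF sesq_\<theta>[OF Suc C] C] by (simp add: sesq_def)
  qed
  have w_proj: "compressed U m (Y.P y) (X.P x) = compressed U m y x" for m y x by (cases m) simp_all
  have wU: "compressed U m y x = cinner y (U x)" if "y \<in> Y.Ab 0" "x \<in> X.Ab 0" for m y x
    using that
  proof (induction m arbitrary: y x)
    case 0 then show ?case by (simp add: X.Ab_0_K Y.Ab_0_K)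
  next
    case (Suc m)
    then have "compressed U (Suc m) y x = \<theta> (\<lambda>y x. cinner y (U x)) y x"
      using X.absorbed_0_Sd Y.absorbed_0_Sd by (simp add: X.Ab_0_K Y.Ab_0_K \<theta>_apply cong: sum.cong_simp)
    then show ?case using U by (simp add: Intw_def)
  qed
  have c: "sesq ?C (cesaro U n)" for n
    unfolding sesq_def
  proof (intro conjI allI)
    fix y x
    have "cmod (\<Sum>m\<le>n. compressed U m y x) \<le> of_nat (card {..n}) * (?C * norm y * norm x)"
      by (rule sum_norm_bound) (rule sesqD(5)[OF w])
    then show "cmod (cesaro U n y x) \<le> ?C * norm y * norm x"
      by (simp add: cesaro_def norm_divide divide_le_eq mult_ac del: of_nat_Suc)
  qed (simp_all add: cesaro_def sesqD(1-4)[OF w] sum.distrib add_divide_distrib sum_distrib_left del: of_nat_Suc)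
  \<comment> \<open>All values are combinations of the finitely many entries at basis vectors, so a
    single subsequence serves all \<open>y\<close> and \<open>x\<close>.\<close>
  have c_expand: "cesaro U n y x = (\<Sum>(b, b')\<in>B\<^sub>1 \<times> B. cinner y b * cesaro U n b b' * cinner b' x)" for n y x
  proof -
    have "cesaro U n y x = cesaro U n (Y.P y) (X.P x)" by (simp add: cesaro_def w_proj)
    also have "\<dots> = (\<Sum>b\<in>B\<^sub>1. \<Sum>b'\<in>B. cnj (cinner b y) * (cinner b' x * cesaro U n b b'))"
      unfolding X.proj_expand Y.proj_expand
      by (simp add: sesq_sum[OF c] sesqD(3,4)[OF c] sum_distrib_left)
        (subst sum.swap, simp add: mult_ac)
    also have "\<dots> = (\<Sum>(b, b')\<in>B\<^sub>1 \<times> B. cinner y b * cesaro U n b b' * cinner b' x)"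
      by (simp add: sum.cartesian_product mult_ac cinner_commute[of y])
    finally show ?thesis .
  qed
  obtain r where r: "strict_mono r" "\<And>p. p \<in> B\<^sub>1 \<times> B \<Longrightarrow> convergent (\<lambda>n. cesaro U (r n) (fst p) (snd p))"
  proof -
    have "finite (B\<^sub>1 \<times> B)" using X.finite_B Y.finite_B by simp
    moreover have "cmod (cesaro U n (fst p) (snd p)) \<le> ?C * norm (fst p) * norm (snd p)" for n p
      by (rule sesqD(5)[OF c])
    ultimately show thesis
      using convergent_subsequence_finite[of "B\<^sub>1 \<times> B" "\<lambda>n p. cesaro U n (fst p) (snd p)"
          "\<lambda>p. ?C * norm (fst p) * norm (snd p)"] that by blast
  qed
  have conv: "convergent (\<lambda>n. cesaro U (r n) y x)" for y x
    unfolding c_expand[of _ y x]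
    by (intro convergent_sum) (use r(2) in \<open>auto intro!: convergent_mult convergent_const\<close>)
  define v where "v y x = lim (\<lambda>n. cesaro U (r n) y x)" for y x
  have v_lim: "(\<lambda>n. cesaro U (r n) y x) \<longlonglongrightarrow> v y x" for y x
    using conv by (simp add: v_def convergent_LIMSEQ_iff)
  have v: "sesq ?C v" using sesq_limit[OF c v_lim] .
  have v_proj: "v (Y.P y) x = v y x" "v y (X.P x) = v y x" for y x
  proof -
    have eqs: "cesaro U n (Y.P y) x = cesaro U n y x" "cesaro U n y (X.P x) = cesaro U n y x" for n
      unfolding cesaro_def by (subst (1 2) w_proj[symmetric], simp)+
    have "(\<lambda>n. cesaro U (r n) (Y.P y) x) \<longlonglongrightarrow> v y x" "(\<lambda>n. cesaro U (r n) y (X.P x)) \<longlonglongrightarrow> v y x"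
      unfolding eqs by (rule v_lim)+
    then show "v (Y.P y) x = v y x" "v y (X.P x) = v y x" by (auto intro: LIMSEQ_unique[OF v_lim])
  qed
  have v_fix: "\<theta> v y x = v y x" if "y \<in> Y.K" "x \<in> X.K" for y x
  proof (rule LIMSEQ_unique)
    show "(\<lambda>n. \<theta> (cesaro U (r n)) y x) \<longlonglongrightarrow> \<theta> v y x"
      unfolding \<theta>_def by (intro tendsto_intros v_lim)
    have shift: "\<theta> (cesaro U n) y x = (\<Sum>m\<le>n. compressed U (Suc m) y x) / of_nat (Suc n)" for n
      using that by (simp add: \<theta>_apply cesaro_def sum_distrib_left flip: sum_divide_distrib del: of_nat_Suc)
        (subst sum.swap, simp)
    \<comment> \<open>On \<open>K\<close> one application of \<open>\<theta>\<close> advances every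
      term of the mean by one, so the difference telescopes to two bounded terms divided by
      \<open>Suc n\<close>.\<close>
    have "\<theta> (cesaro U n) y x - cesaro U n y x =
        (compressed U (Suc n) y x - compressed U 0 y x) / of_nat (Suc n)" for n
      unfolding shift cesaro_def diff_divide_distrib[symmetric] sum_subtractf[symmetric]
      by (subst sum_Suc_diff'[of 0 "Suc n" "\<lambda>m. compressed U m y x", symmetric])
        (simp_all add: atLeast0LessThan lessThan_Suc_atMost del: compressed.simps of_nat_Suc)
    moreover have "(\<lambda>n. (compressed U (Suc n) y x - compressed U 0 y x) / of_nat (Suc n)) \<longlonglongrightarrow> 0"
    proof (rule Lim_null_comparison)
      show "\<forall>\<^sub>F n in sequentially. norm ((compressed U (Suc n) y x - compressed U 0 y x) / of_nat (Suc n))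
          \<le> (2 * (?C * norm y * norm x)) * inverse (real (Suc n))"
      proof (rule always_eventually, rule allI)
        fix n
        have "norm (compressed U (Suc n) y x - compressed U 0 y x) \<le> 2 * (?C * norm y * norm x)"
          using norm_triangle_ineq4[of "compressed U (Suc n) y x" "compressed U 0 y x"]
            sesqD(5)[OF w, of "Suc n" y x] sesqD(5)[OF w, of 0 y x] by linarith
        then have "norm (compressed U (Suc n) y x - compressed U 0 y x) * inverse (real (Suc n))
            \<le> (2 * (?C * norm y * norm x)) * inverse (real (Suc n))" by (intro mult_right_mono) auto
        then show "norm ((compressed U (Suc n) y x - compressed U 0 y x) / of_nat (Suc n))
          \<le> (2 * (?C * norm y * norm x)) * inverse (real (Suc n))"
          by (simp only: divide_inverse norm_mult norm_inverse norm_of_nat)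
      qed
      show "(\<lambda>n. (2 * (?C * norm y * norm x)) * inverse (real (Suc n))) \<longlonglongrightarrow> 0"
        using tendsto_mult[OF tendsto_const LIMSEQ_inverse_real_of_nat] by simp
    qed
    ultimately have "(\<lambda>n. \<theta> (cesaro U n) y x - cesaro U n y x) \<longlonglongrightarrow> 0" by simp
    from LIMSEQ_subseq_LIMSEQ[OF this r(1)]
    have "(\<lambda>n. \<theta> (cesaro U (r n)) y x - cesaro U (r n) y x) \<longlonglongrightarrow> 0" by (simp add: o_def)
    from tendsto_add[OF this v_lim[of y x]]
    show "(\<lambda>n. \<theta> (cesaro U (r n)) y x) \<longlonglongrightarrow> v y x" by simp
  qed
  obtain W where W: "W \<in> bops UNIV UNIV" "\<And>y x. cinner y (W x) = v y x" "\<And>x. norm (W x) \<le> ?C * norm x"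
    using sesq_riesz[OF v C] by metis
  have WK: "W x \<in> Y.K" for x
  proof -
    have "Y.P (W x) = W x" by (rule cinner_eqI) (simp add: Y.proj_self_adjoint W v_proj)
    then show ?thesis by (metis Y.proj_in)
  qed
  define V where "V = restrict W X.K"
  have Vb: "V \<in> bops X.K Y.K"
    unfolding V_def using W WK
    by (intro bops_restrictI[where C = ?C]) (auto simp: bops_add[OF W(1)] bops_scaleC[OF W(1)])
  have vV: "cinner y (V (X.P x)) = v y x" for y x by (simp add: V_def W v_proj)
  have "V \<in> Fix"
    using Vb v_fix vV by (auto simp: Fix_def) (metis X.proj_ident vV)
  moreover have "matches U V"
    unfolding matches_def
  proof (intro ballI)
    fix y x assume yx: "y \<in> Y.Ab 0" "x \<in> X.Ab 0"
    have "cesaro U n y x = cinner y (U x)" for n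
      using wU[OF yx] by (simp add: cesaro_def del: of_nat_Suc)
    then have "v y x = cinner y (U x)" using v_lim[of y x] by (simp add: LIMSEQ_const_iff)
    then show "cinner y (U x) = cinner y (V x)" using vV[of y x] yx by (simp add: X.Ab_0_K)
  qed
  moreover have "\<forall>y\<in>Y.K. \<forall>x\<in>X.K. (\<lambda>n. cesaro U (r n) y x) \<longlonglongrightarrow> cinner y (V x)"
    using v_lim vV by (metis X.proj_ident)
  ultimately show ?thesis by blast
qed

end

lemma bops_zero_op: "csubspace M \<Longrightarrow> csubspace L \<Longrightarrow> (\<lambda>x\<in>M. 0) \<in> bops M L"
  by (rule bops_restrictI[where C = 0]) (auto simp: csubspace_0)

lemma nonneg_Reals_sum:
  "(\<And>i. i \<in> I \<Longrightarrow> f i \<in> \<real>\<^sub>\<ge>\<^sub>0) \<Longrightarrow> sum f I \<in> (\<real>\<^sub>\<ge>\<^sub>0 :: complex set)"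
  by (induction I rule: infinite_finite_induct) auto

section \<open>The correspondence as an isometric linear isomorphism\<close>

context absorbed_pair
begin

lemma \<theta>_add: "\<theta> (\<lambda>y x. q y x + q' y x) y x = \<theta> q y x + \<theta> q' y x"
  unfolding \<theta>_apply[of _ y x] by (simp add: sum.distrib distrib_left)

lemma \<theta>_mult: "\<theta> (\<lambda>y x. c * q y x) y x = c * \<theta> q y x"
  unfolding \<theta>_apply[of _ y x] by (simp add: sum_distrib_left mult_ac)

lemma Intw_bops: "U \<in> Intw \<Longrightarrow> U \<in> bops UNIV UNIV"
  and Fix_bops: "V \<in> Fix \<Longrightarrow> V \<in> bops X.K Y.K"
  by (simp_all add: Intw_def Fix_def)

lemma Intw_add: "U \<in> Intw \<Longrightarrow> U' \<in> Intw \<Longrightarrow> op_add UNIV U U' \<in> Intw"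
  using bops_add_op[of U UNIV UNIV U'] by (auto simp: Intw_def op_add_def cinner_add_right \<theta>_add)

lemma Intw_scale: "U \<in> Intw \<Longrightarrow> op_scale UNIV c U \<in> Intw"
  using bops_scale_op[of U UNIV UNIV c] by (auto simp: Intw_def op_scale_def cinner_scaleC_right \<theta>_mult)

lemma Fix_add: "V \<in> Fix \<Longrightarrow> V' \<in> Fix \<Longrightarrow> op_add X.K V V' \<in> Fix"
  using bops_add_op[of V X.K Y.K V'] by (auto simp: Fix_def op_add_def cinner_add_right \<theta>_add)

lemma Fix_scale: "V \<in> Fix \<Longrightarrow> op_scale X.K c V \<in> Fix"
  using bops_scale_op[of V X.K Y.K c] by (auto simp: Fix_def op_scale_def cinner_scaleC_right \<theta>_mult)

lemma matches_add:
  "matches U V \<Longrightarrow> matches U' V' \<Longrightarrow> matches (op_add UNIV U U') (op_add X.K V V')"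
  by (simp add: matches_def op_add_def cinner_add_right X.Ab_0_K)

lemma matches_scale: "matches U V \<Longrightarrow> matches (op_scale UNIV c U) (op_scale X.K c V)"
  by (simp add: matches_def op_scale_def cinner_scaleC_right X.Ab_0_K)

text \<open>Matching is linear, so the isometry applies to differences: if one of the two
  differences vanishes, so does the other. This is the source of uniqueness in both
  directions.\<close>

lemma matches_diff_norm:
  assumes "U \<in> Intw" "V \<in> Fix" "matches U V" "U' \<in> Intw" "V' \<in> Fix" "matches U' V'"
  shows "op_norm X.K (op_add X.K V (op_scale X.K (-1) V')) = op_norm UNIV (op_add UNIV U (op_scale UNIV (-1) U'))"
  by (intro matches_op_norm Intw_add Intw_scale Fix_add Fix_scale matches_add matches_scale assms)

lemma op_norm_diff_self:
  assumes "csubspace M" "A \<in> bops M L" "csubspace L"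
  shows "op_norm M (op_add M A (op_scale M (-1) A)) = 0"
proof (rule antisym)
  show "op_norm M (op_add M A (op_scale M (-1) A)) \<le> 0"
    by (rule op_norm_least) (auto simp: assms op_add_def op_scale_def)
  show "0 \<le> op_norm M (op_add M A (op_scale M (-1) A))"
    by (rule op_norm_nonneg) (auto intro: bops_add_op bops_scale_op assms)
qed

lemma op_norm_diff_eq_0D:
  assumes "csubspace M" "A \<in> bops M L" "A' \<in> bops M L" "csubspace L"
    and "op_norm M (op_add M A (op_scale M (-1) A')) = 0"
  shows "A = A'"
proof (rule bops_eqI[OF assms(2,3)])
  fix x assume "x \<in> M"
  have "op_add M A (op_scale M (-1) A') \<in> bops M L" by (intro bops_add_op bops_scale_op assms)
  then have "op_add M A (op_scale M (-1) A') x = 0"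
    by (rule op_norm_eq_0) (use assms \<open>x \<in> M\<close> in auto)
  then show "A x = A' x" using \<open>x \<in> M\<close> by (simp add: op_add_def op_scale_def)
qed

lemma matches_unique_Fix:
  assumes "U \<in> Intw" "V \<in> Fix" "matches U V" "V' \<in> Fix" "matches U V'"
  shows "V = V'"
  using matches_diff_norm[OF assms(1-3) assms(1,4,5)] assms
  by (intro op_norm_diff_eq_0D[of X.K _ Y.K]) (auto simp: Fix_bops op_norm_diff_self[OF _ Intw_bops])

lemma matches_unique_Intw:
  assumes "U \<in> Intw" "V \<in> Fix" "matches U V" "U' \<in> Intw" "matches U' V"
  shows "U = U'"
  using matches_diff_norm[OF assms(1-3) assms(4,2,5)] assms
  by (intro op_norm_diff_eq_0D[of UNIV _ UNIV]) (auto simp: Intw_bops op_norm_diff_self[OF _ Fix_bops])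

text \<open>The matching fixed point, which need not be the cut-down
  \<open>Y.P \<circ> U \<circ> X.P\<close>; the two agree for coinvariant spaces by
  \<open>compression_coinvariant\<close>.\<close>

definition compression :: "('a \<Rightarrow> 'b) \<Rightarrow> 'a \<Rightarrow> 'b" where
  "compression U = (THE V. V \<in> Fix \<and> matches U V)"

lemma compression_eqI:
  assumes "U \<in> Intw" "V \<in> Fix" "matches U V" shows "compression U = V"
  unfolding compression_def using assms matches_unique_Fix by (intro the_equality) auto

lemma compression_Fix: "U \<in> Intw \<Longrightarrow> compression U \<in> Fix"
  and matches_compression: "U \<in> Intw \<Longrightarrow> matches U (compression U)"
  using Intw_matched compression_eqI by metis+

theorem compression_iso: "isometric_linear_iso UNIV Intw X.K Fix compression"
  unfolding isometric_linear_iso_def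
proof (intro conjI ballI allI)
  show "bij_betw compression Intw Fix"
  proof (rule bij_betw_imageI)
    show "inj_on compression Intw"
      by (rule inj_onI) (metis compression_Fix matches_compression matches_unique_Intw)
    show "compression ` Intw = Fix"
      using compression_Fix Fix_matched compression_eqI by (auto simp: image_iff) metis
  qed
  show "compression (op_add UNIV U U') = op_add X.K (compression U) (compression U')"
    if "U \<in> Intw" "U' \<in> Intw" for U U'
    using that by (intro compression_eqI Intw_add Fix_add matches_add compression_Fix matches_compression)
  show "compression (op_scale UNIV c U) = op_scale X.K c (compression U)" if "U \<in> Intw" for U c
    using that by (intro compression_eqI Intw_scale Fix_scale matches_scale compression_Fix matches_compression)
  show "op_norm X.K (compression U) = op_norm UNIV U" if "U \<in> Intw" for U
    using that by (intro matches_op_norm compression_Fix matches_compression)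
qed

text \<open>When the coinvariant parts are the whole spaces \<open>K\<close>, \<open>matches\<close>
  prescribes every matrix entry of the partner of \<open>U\<close>.\<close>

lemma compression_coinvariant:
  assumes co: "X.K \<subseteq> X.Ab 0" "Y.K \<subseteq> Y.Ab 0" and U: "U \<in> Intw"
  shows "compression U = restrict (Y.P \<circ> U \<circ> X.P) X.K"
proof (rule bops_eqI)
  show V: "compression U \<in> bops X.K Y.K" using compression_Fix[OF U] by (rule Fix_bops)
  have "Y.P \<circ> (U \<circ> X.P) \<in> bops UNIV Y.K"
    by (intro bops_comp[OF Y.proj_bops] bops_comp[OF Intw_bops[OF U]] X.proj_bops_UNIV)
  then obtain C where C: "\<And>x. norm ((Y.P \<circ> (U \<circ> X.P)) x) \<le> C * norm x" by (metis bops_bound UNIV_I)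
  have "norm (Y.P (U x)) \<le> C * norm x" if "x \<in> X.K" for x using C[of x] that by simp
  then show "restrict (Y.P \<circ> U \<circ> X.P) X.K \<in> bops X.K Y.K"
    by (intro bops_restrictI[where C = C])
      (auto simp: X.proj_add X.proj_scaleC Y.proj_add Y.proj_scaleC bops_add[OF Intw_bops[OF U]]
        bops_scaleC[OF Intw_bops[OF U]])
  fix x assume x: "x \<in> X.K"
  have "Y.P (U x) = compression U x"
    using matches_compression[OF U] co x by (intro Y.proj_eqI bops_in[OF V]) (auto simp: matches_def)
  then show "compression U x = restrict (Y.P \<circ> U \<circ> X.P) X.K x" using x by simp
qed

text \<open>At \<open>S i x\<close> only the term with index \<open>i\<close> of
  \<open>\<theta>\<close> survives the Cuntz relations; conversely the ranges of the
  \<open>S i\<close> reassemble \<open>x\<close>.\<close>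

lemma Intw_iff: "U \<in> Intw \<longleftrightarrow> U \<in> bops UNIV UNIV \<and> (\<forall>i<N. \<forall>x. U (S i x) = \<gamma> *\<^sub>C T i (U x))"
proof (intro iffI conjI allI impI)
  assume U: "U \<in> Intw"
  then show "U \<in> bops UNIV UNIV" by (rule Intw_bops)
  fix i x assume i: "i < N"
  show "U (S i x) = \<gamma> *\<^sub>C T i (U x)"
  proof (rule cinner_eqI)
    fix y
    have "cinner y (U (S i x)) = \<theta> (\<lambda>y x. cinner y (U x)) y (S i x)" using U by (simp add: Intw_def)
    also have "\<dots> = \<gamma> * (\<Sum>j<N. if j = i then cinner (Y.Sd i y) (U x) else 0)"
      unfolding \<theta>_apply[of _ y "S i x"] using i
      by (intro arg_cong2[of _ _ _ _ "(*)"] sum.cong)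
        (auto simp: X.Sd_S bops_0[OF Intw_bops[OF U]])
    also have "\<dots> = cinner y (\<gamma> *\<^sub>C T i (U x))" using i by (simp add: cinner_scaleC_right Y.cinner_Sd)
    finally show "cinner y (U (S i x)) = cinner y (\<gamma> *\<^sub>C T i (U x))" .
  qed
next
  assume U: "U \<in> bops UNIV UNIV \<and> (\<forall>i<N. \<forall>x. U (S i x) = \<gamma> *\<^sub>C T i (U x))"
  have "\<theta> (\<lambda>y x. cinner y (U x)) y x = cinner y (U x)" for y x
  proof -
    have "\<theta> (\<lambda>y x. cinner y (U x)) y x = (\<Sum>i<N. cinner y (U (S i (X.Sd i x))))"
      unfolding \<theta>_apply[of _ y x] sum_distrib_left using U
      by (intro sum.cong) (auto simp: Y.cinner_Sd cinner_scaleC_right)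
    also have "\<dots> = cinner y (U (\<Sum>i<N. S i (X.Sd i x)))"
      using U by (subst bops_sum[of U UNIV UNIV]) (auto simp: cinner_sum_right)
    finally show ?thesis by (simp add: X.sum_S_Sd)
  qed
  then show "U \<in> Intw" using U by (simp add: Intw_def)
qed

text \<open>On \<open>K\<close> the form \<open>\<theta>\<close> produces from \<open>V\<close> is
  that of \<open>\<gamma>\<close> times the transfer map, because \<open>W i\<close> is adjoint to
  the compression of \<open>Y.Sd i\<close>.\<close>

lemma Fix_iff_transfer:
  assumes V: "V \<in> bops X.K Y.K"
    and Vs: "\<And>i x. i < N \<Longrightarrow> x \<in> X.K \<Longrightarrow> Vs i x = X.P (X.Sd i x)"
    and W: "\<And>i k. i < N \<Longrightarrow> k \<in> Y.K \<Longrightarrow> W i k \<in> Y.K"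
    and W': "\<And>i y k. i < N \<Longrightarrow> y \<in> Y.K \<Longrightarrow> k \<in> Y.K \<Longrightarrow> cinner y (W i k) = cinner (Y.Sd i y) k"
  shows "V \<in> Fix \<longleftrightarrow> (\<forall>x\<in>X.K. \<gamma> *\<^sub>C transfer_map N X.K W Vs V x = V x)"
proof -
  have in_K: "transfer_map N X.K W Vs V x \<in> Y.K" if "x \<in> X.K" for x
    using that by (auto simp: transfer_map_def Vs intro!: csubspace_sum W bops_in[OF V])
  have eq: "\<theta> (\<lambda>y x. cinner y (V (X.P x))) y x = cinner y (\<gamma> *\<^sub>C transfer_map N X.K W Vs V x)"
    if "x \<in> X.K" "y \<in> Y.K" for x y
    unfolding \<theta>_apply[of _ y x] using that
    by (simp add: transfer_map_def cinner_scaleC_right cinner_sum_right Vs W' bops_in[OF V] cong: sum.cong_simp)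
  show ?thesis
  proof
    assume F: "V \<in> Fix"
    show "\<forall>x\<in>X.K. \<gamma> *\<^sub>C transfer_map N X.K W Vs V x = V x"
    proof
      fix x assume x: "x \<in> X.K"
      have "Y.P (\<gamma> *\<^sub>C transfer_map N X.K W Vs V x) = V x"
        using F x by (intro Y.proj_eqI bops_in[OF V x]) (simp add: Fix_def flip: eq)
      then show "\<gamma> *\<^sub>C transfer_map N X.K W Vs V x = V x"
        using in_K[OF x] by (simp add: csubspace_scaleC)
    qed
  next
    assume "\<forall>x\<in>X.K. \<gamma> *\<^sub>C transfer_map N X.K W Vs V x = V x"
    then show "V \<in> Fix" using V by (simp add: Fix_def eq)
  qed
qed

end

section \<open>Positivity and the order on the commutant\<close>

context absorbed_family
begin

lemma absorbed_pair_self: "cmod c = 1 \<Longrightarrow> absorbed_pair N S B S B c"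
  by (intro absorbed_pair.intro absorbed_pair_axioms.intro absorbed_family_axioms)

interpretation self: absorbed_pair N S B S B 1
  by (rule absorbed_pair_self) simp

text \<open>With twist 1, \<open>\<theta>\<close> evaluated at \<open>(x, x)\<close> sums the form
  over the diagonal pairs \<open>(Sd i x, Sd i x)\<close> and so preserves positivity. One direction
  passes to the limit of means, the other goes through iterates at absorbed vectors.\<close>

lemma commutant_form_nonneg:
  assumes U: "U \<in> self.Intw"
  shows "(\<forall>x. cinner x (U x) \<in> \<real>\<^sub>\<ge>\<^sub>0) \<longleftrightarrow> (\<forall>x\<in>K. cinner x (self.compression U x) \<in> \<real>\<^sub>\<ge>\<^sub>0)"
proof
  assume pos: "\<forall>x. cinner x (U x) \<in> \<real>\<^sub>\<ge>\<^sub>0"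
  have w: "self.compressed U m x x \<in> \<real>\<^sub>\<ge>\<^sub>0" for m x
  proof (induction m arbitrary: x)
    case 0 then show ?case using pos by simp
  next
    case (Suc m)
    then show ?case unfolding self.compressed.simps self.\<theta>_apply by (auto intro: nonneg_Reals_sum)
  qed
  have c: "self.cesaro U n x x \<in> \<real>\<^sub>\<ge>\<^sub>0" for n x
    unfolding self.cesaro_def using w by (intro nonneg_Reals_divide_I nonneg_Reals_sum) auto
  obtain V r where V: "V \<in> self.Fix" "self.matches U V"
    "\<And>x. x \<in> K \<Longrightarrow> (\<lambda>n. self.cesaro U (r n) x x) \<longlonglongrightarrow> cinner x (V x)"
    using self.Intw_matched[OF U] by metis
  have "cinner x (V x) \<in> \<real>\<^sub>\<ge>\<^sub>0" if "x \<in> K" for x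
    by (rule closed_sequentially[OF closed_nonneg_Reals_complex _ V(3)[OF that]]) (rule c)
  then show "\<forall>x\<in>K. cinner x (self.compression U x) \<in> \<real>\<^sub>\<ge>\<^sub>0"
    using self.compression_eqI[OF U V(1,2)] by simp
next
  let ?V = "self.compression U"
  assume pos: "\<forall>x\<in>K. cinner x (?V x) \<in> \<real>\<^sub>\<ge>\<^sub>0"
  have V: "?V \<in> bops K K" using self.Fix_bops[OF self.compression_Fix[OF U]] .
  have w: "(self.\<theta> ^^ m) (\<lambda>y x. cinner y (?V (P x))) x x \<in> \<real>\<^sub>\<ge>\<^sub>0" for m x
  proof (induction m arbitrary: x)
    case 0
    have "cinner x (?V (P x)) = cinner (P x) (?V (P x))" by (simp add: cinner_proj' bops_in[OF V])
    then show ?case using pos by simp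
  next
    case (Suc m)
    have "(self.\<theta> ^^ Suc m) (\<lambda>y x. cinner y (?V (P x))) x x
      = (\<Sum>i<N. (self.\<theta> ^^ m) (\<lambda>y x. cinner y (?V (P x))) (Sd i x) (Sd i x))"
      unfolding funpow.simps o_def self.\<theta>_apply[of _ x x] by simp
    then show ?case using Suc by (simp only:) (intro nonneg_Reals_sum)
  qed
  have sesq: "sesq (op_norm UNIV U) (\<lambda>y x. cinner y (U x))" by (rule sesq_bops[OF self.Intw_bops[OF U]])
  show "\<forall>x. cinner x (U x) \<in> \<real>\<^sub>\<ge>\<^sub>0"
  proof
    fix x
    have "x \<in> closure (\<Union>M. Ab M)" using dense by simp
    then obtain f where f: "\<And>n. f n \<in> (\<Union>M. Ab M)" "f \<longlonglongrightarrow> x" unfolding closure_sequential by metis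
    have "cinner (f n) (U (f n)) \<in> \<real>\<^sub>\<ge>\<^sub>0" for n
    proof -
      obtain M where "f n \<in> Ab M" using f(1) by blast
      then show ?thesis using self.matches_pow[OF U self.matches_compression[OF U]] w by simp
    qed
    then show "cinner x (U x) \<in> \<real>\<^sub>\<ge>\<^sub>0"
      using closed_sequentially[OF closed_nonneg_Reals_complex _ sesq_tendsto[OF sesq f(2) f(2)]] by blast
  qed
qed

lemma compression_order_iso:
  assumes "U \<in> self.Intw" "U' \<in> self.Intw"
  shows "op_le UNIV U U' \<longleftrightarrow> op_le K (self.compression U) (self.compression U')"
proof -
  let ?D = "op_add UNIV U' (op_scale UNIV (-1) U)"
  have D: "?D \<in> self.Intw" by (intro self.Intw_add self.Intw_scale assms)
  have "self.compression ?D = op_add K (self.compression U') (op_scale K (-1) (self.compression U))"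
    using assms by (intro self.compression_eqI D self.Fix_add self.Fix_scale self.matches_add
        self.matches_scale self.compression_Fix self.matches_compression)
  then show ?thesis
    using commutant_form_nonneg[OF D] by (simp add: op_le_def op_add_def op_scale_def)
qed

end

section \<open>Polynomial relations\<close>

text \<open>Gaussian elimination: a nonzero \<open>f j a\<close> serves as pivot and removes one
  index together with one equation.\<close>

lemma exists_linear_relation:
  fixes f :: "'i \<Rightarrow> 'x \<Rightarrow> complex"
  assumes "finite X" "finite I" "card X < card I"
  shows "\<exists>c. (\<exists>i\<in>I. c i \<noteq> 0) \<and> (\<forall>x\<in>X. (\<Sum>i\<in>I. c i * f i x) = 0)"
  using assms
proof (induction X arbitrary: I f)
  case empty
  then have "I \<noteq> {}" by auto
  then show ?case by (intro exI[of _ "\<lambda>_. 1"]) auto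
next
  case (insert a X)
  show ?case
  proof (cases "\<exists>j\<in>I. f j a \<noteq> 0")
    case False
    obtain c where "\<exists>i\<in>I. c i \<noteq> 0" "\<forall>x\<in>X. (\<Sum>i\<in>I. c i * f i x) = 0"
      using insert.IH[OF insert.prems(1), of f] insert.prems(2) insert.hyps by auto
    then show ?thesis using False by (intro exI[of _ c]) auto
  next
    case True
    then obtain j where j: "j \<in> I" "f j a \<noteq> 0" by blast
    define g where "g i x = f i x - f i a / f j a * f j x" for i x
    have "card X < card (I - {j})" using insert j by simp
    then obtain c where c: "\<exists>i\<in>I - {j}. c i \<noteq> 0" "\<And>x. x \<in> X \<Longrightarrow> (\<Sum>i\<in>I - {j}. c i * g i x) = 0"
      using insert.IH[of "I - {j}" g] insert.prems(1) by auto
    \<comment> \<open>The coefficient at the pivot is chosen so that the combination of all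
      \<open>f i\<close> equals the combination of the reduced \<open>g i\<close>, which vanish at
      \<open>a\<close>.\<close>
    define d where "d = c(j := - (\<Sum>i\<in>I - {j}. c i * (f i a / f j a)))"
    have d: "(\<Sum>i\<in>I. d i * f i x) = (\<Sum>i\<in>I - {j}. c i * g i x)" for x
    proof -
      have "(\<Sum>i\<in>I. d i * f i x) = d j * f j x + (\<Sum>i\<in>I - {j}. d i * f i x)"
        using insert.prems(1) j(1) by (rule sum.remove)
      also have "(\<Sum>i\<in>I - {j}. d i * f i x) = (\<Sum>i\<in>I - {j}. c i * f i x)"
        by (intro sum.cong) (auto simp: d_def)
      also have "d j * f j x = - (\<Sum>i\<in>I - {j}. c i * (f i a / f j a * f j x))"
        unfolding d_def fun_upd_same mult_minus_left sum_distrib_right by (simp add: mult.assoc)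
      finally show ?thesis by (simp add: g_def right_diff_distrib sum_subtractf)
    qed
    have "g i a = 0" for i using j(2) by (simp add: g_def)
    then have "\<forall>x\<in>insert a X. (\<Sum>i\<in>I. d i * f i x) = 0" using c(2) by (auto simp: d)
    moreover have "\<exists>i\<in>I. d i \<noteq> 0" using c(1) by (auto simp: d_def)
    ultimately show ?thesis by blast
  qed
qed

text \<open>If \<open>s k\<close> is the k-th iterate of a linear map at a vector, this is the
  polynomial in that map. The abstract sequence covers powers of an operator and powers of
  \<open>\<rho>\<close> alike.\<close>

definition poly_sum :: "complex poly \<Rightarrow> (nat \<Rightarrow> 'a::complex_inner) \<Rightarrow> 'a" where
  "poly_sum q s = (\<Sum>k\<le>degree q. coeff q k *\<^sub>C s k)"

lemma poly_sum_upto: "degree q \<le> n \<Longrightarrow> poly_sum q s = (\<Sum>k\<le>n. coeff q k *\<^sub>C s k)"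
  unfolding poly_sum_def by (rule sum.mono_neutral_left) (auto simp: coeff_eq_0)

text \<open>For the iterates of a linear map the new sequence starts at the image of the vector
  minus \<open>r\<close> times the vector: a linear factor moves from the polynomial to the
  argument.\<close>

lemma poly_sum_mult_root:
  "poly_sum ([:- r, 1:] * q) s = poly_sum q (\<lambda>k. s (Suc k) - r *\<^sub>C s k)"
proof -
  let ?n = "degree q"
  have "degree ([:- r, 1:] * q) \<le> Suc ?n" using degree_mult_le[of "[:- r, 1:]" q] by simp
  then have "poly_sum ([:- r, 1:] * q) s = (\<Sum>k\<le>Suc ?n. coeff ([:- r, 1:] * q) k *\<^sub>C s k)"
    by (rule poly_sum_upto)
  also have "\<dots> = (\<Sum>k\<le>Suc ?n. coeff (pCons 0 q) k *\<^sub>C s k - (r * coeff q k) *\<^sub>C s k)"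
    by (simp add: complex_vector.scale_left_diff_distrib)
  also have "\<dots> = (\<Sum>k\<le>Suc ?n. coeff (pCons 0 q) k *\<^sub>C s k) - (\<Sum>k\<le>Suc ?n. (r * coeff q k) *\<^sub>C s k)"
    by (rule sum_subtractf)
  also have "(\<Sum>k\<le>Suc ?n. coeff (pCons 0 q) k *\<^sub>C s k) = (\<Sum>k\<le>?n. coeff q k *\<^sub>C s (Suc k))"
    by (subst sum.atMost_Suc_shift) simp
  also have "(\<Sum>k\<le>Suc ?n. (r * coeff q k) *\<^sub>C s k) = (\<Sum>k\<le>?n. coeff q k *\<^sub>C r *\<^sub>C s k)"
    by (simp add: coeff_eq_0 mult.commute)
  finally show ?thesis
    by (simp add: poly_sum_def complex_vector.scale_right_diff_distrib sum_subtractf)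
qed

lemma exists_polynomial_relation:
  fixes f :: "nat \<Rightarrow> 'x \<Rightarrow> complex"
  assumes "finite X"
  shows "\<exists>q. q \<noteq> 0 \<and> (\<forall>x\<in>X. (\<Sum>k\<le>degree q. coeff q k * f k x) = 0)"
proof -
  let ?n = "card X"
  obtain c where c: "\<exists>i\<in>{..?n}. c i \<noteq> 0" "\<And>x. x \<in> X \<Longrightarrow> (\<Sum>i\<le>?n. c i * f i x) = 0"
    using exists_linear_relation[OF assms, of "{..?n}" f] by auto
  define q where "q = (\<Sum>k\<le>?n. monom (c k) k)"
  have q: "coeff q k = (if k \<le> ?n then c k else 0)" for k
    by (simp add: q_def coeff_sum)
  have "(\<Sum>k\<le>degree q. coeff q k * f k x) = (\<Sum>k\<le>?n. c k * f k x)" for x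
  proof -
    have "degree q \<le> ?n" by (rule degree_le) (simp add: q)
    then have "(\<Sum>k\<le>degree q. coeff q k * f k x) = (\<Sum>k\<le>?n. coeff q k * f k x)"
      by (intro sum.mono_neutral_left) (auto simp: coeff_eq_0)
    then show ?thesis by (simp add: q)
  qed
  moreover have "q \<noteq> 0"
  proof
    assume "q = 0"
    then have "coeff q k = 0" for k by simp
    then show False using c(1) q by (metis atMost_iff)
  qed
  ultimately show ?thesis using c(2) by auto
qed

text \<open>The fundamental theorem of algebra splits off one linear factor at a time.\<close>

lemma nonzero_poly_induct [consumes 1, case_names const root]:
  fixes q :: "complex poly"
  assumes "q \<noteq> 0"
    and "\<And>c. c \<noteq> 0 \<Longrightarrow> Q [:c:]"
    and "\<And>r q. q \<noteq> 0 \<Longrightarrow> Q q \<Longrightarrow> Q ([:- r, 1:] * q)"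
  shows "Q q"
  using assms(1)
proof (induction "degree q" arbitrary: q)
  case 0
  then obtain c where "q = [:c:]" using degree_eq_zeroE by metis
  then show ?case using 0 assms(2) by auto
next
  case (Suc n)
  then have "\<not> constant (poly q)" by (simp add: constant_degree)
  then obtain r where "poly q r = 0" using fundamental_theorem_of_algebra by blast
  then obtain p where p: "q = [:- r, 1:] * p" by (auto simp: poly_eq_0_iff_dvd elim: dvdE)
  then have "p \<noteq> 0" using Suc.prems by auto
  then have "degree q = Suc (degree p)" unfolding p by (subst degree_mult_eq) auto
  then show ?case using Suc p \<open>p \<noteq> 0\<close> assms(3) by simp
qed

text \<open>Powers of the matrix \<open>C\<close> are determined by their entries, which number
  \<open>card X * card X\<close>, so finitely many powers are linearly dependent. One polynomial
  then serves all vectors \<open>g\<close> by expansion in the unit vectors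
  \<open>\<delta>\<close>.\<close>

lemma matrix_annihilator:
  fixes C :: "'x \<Rightarrow> 'x \<Rightarrow> complex"
  assumes X: "finite X"
  shows "\<exists>q. q \<noteq> 0 \<and> (\<forall>g. \<forall>p\<in>X.
    (\<Sum>k\<le>degree q. coeff q k * ((\<lambda>g p. \<Sum>p'\<in>X. C p p' * g p') ^^ k) g p) = 0)"
proof -
  define \<Phi> where "\<Phi> = (\<lambda>g p. \<Sum>p'\<in>X. C p p' * g p')"
  define \<delta> :: "'x \<Rightarrow> 'x \<Rightarrow> complex" where "\<delta> p' p = (if p = p' then 1 else 0)" for p' p
  have expand: "(\<Phi> ^^ k) g p = (\<Sum>p'\<in>X. g p' * (\<Phi> ^^ k) (\<delta> p') p)" if "p \<in> X" for k g p
    using that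
  proof (induction k arbitrary: p)
    case 0
    then show ?case using X by (simp add: \<delta>_def if_distrib cong: if_cong)
  next
    case (Suc k)
    have "(\<Phi> ^^ Suc k) g p = (\<Sum>r\<in>X. C p r * (\<Phi> ^^ k) g r)" by (simp add: \<Phi>_def)
    also have "\<dots> = (\<Sum>r\<in>X. C p r * (\<Sum>p'\<in>X. g p' * (\<Phi> ^^ k) (\<delta> p') r))"
      by (intro sum.cong refl) (simp only: Suc.IH)
    also have "\<dots> = (\<Sum>p'\<in>X. g p' * (\<Sum>r\<in>X. C p r * (\<Phi> ^^ k) (\<delta> p') r))"
      by (simp only: sum_distrib_left, subst sum.swap) (simp add: mult_ac)
    also have "\<dots> = (\<Sum>p'\<in>X. g p' * (\<Phi> ^^ Suc k) (\<delta> p') p)" by (simp add: \<Phi>_def)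
    finally show ?case .
  qed
  obtain q where q: "q \<noteq> 0"
    "\<And>p p'. p \<in> X \<Longrightarrow> p' \<in> X \<Longrightarrow> (\<Sum>k\<le>degree q. coeff q k * (\<Phi> ^^ k) (\<delta> p') p) = 0"
    using exists_polynomial_relation[of "X \<times> X" "\<lambda>k (p, p'). (\<Phi> ^^ k) (\<delta> p') p"] X by auto
  have "(\<Sum>k\<le>degree q. coeff q k * (\<Phi> ^^ k) g p) = 0" if p: "p \<in> X" for g p
  proof -
    have "(\<Sum>k\<le>degree q. coeff q k * (\<Phi> ^^ k) g p) =
        (\<Sum>p'\<in>X. g p' * (\<Sum>k\<le>degree q. coeff q k * (\<Phi> ^^ k) (\<delta> p') p))"
      by (simp only: expand[OF p, of _ g] sum_distrib_left, subst sum.swap) (simp add: mult_ac)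
    then show ?thesis using q(2) p by simp
  qed
  then show ?thesis using q(1) unfolding \<Phi>_def by blast
qed

section \<open>Operator algebras generated by a Cuntz family\<close>

lemma op_closed_span_base:
  assumes "G \<subseteq> bops UNIV UNIV" "g \<in> G" shows "g \<in> op_closed_span G"
proof -
  have "\<exists>F c. finite F \<and> F \<subseteq> G \<and> op_norm UNIV (\<lambda>x. g x - (\<Sum>g\<in>F. c g *\<^sub>C g x)) < \<epsilon>" if "\<epsilon> > 0" for \<epsilon> :: real
    using assms(2) that by (intro exI[of _ "{g}"] exI[of _ "\<lambda>_. 1"]) (simp add: op_norm_def)
  then show ?thesis using assms by (auto simp: op_closed_span_def)
qed

text \<open>Commutation passes to linear combinations, and the remainder \<open>R\<close> of the
  approximation contributes at most \<open>2 * ?C * \<epsilon>\<close> to the commutator.\<close>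

lemma op_closed_span_commute:
  assumes G: "G \<subseteq> bops UNIV UNIV" and X: "X \<in> bops UNIV UNIV"
    and comm: "\<And>g x. g \<in> G \<Longrightarrow> X (g x) = g (X x)" and A: "A \<in> op_closed_span G"
  shows "X (A x) = A (X x)"
proof -
  have Ab: "A \<in> bops UNIV UNIV" using A by (simp add: op_closed_span_def)
  let ?C = "op_norm UNIV X"
  have C: "?C \<ge> 0" using op_norm_nonneg[OF X] by simp
  have "norm (X (A x) - A (X x)) \<le> \<epsilon> * (2 * ?C * norm x)" if "\<epsilon> > 0" for \<epsilon> :: real
  proof -
    have "\<exists>F c. finite F \<and> F \<subseteq> G \<and> op_norm UNIV (\<lambda>x. A x - (\<Sum>g\<in>F. c g *\<^sub>C g x)) < \<epsilon>"
      using A that by (simp add: op_closed_span_def)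
    then obtain F c where F: "finite F" "F \<subseteq> G"
      and lt: "op_norm UNIV (\<lambda>x. A x - (\<Sum>g\<in>F. c g *\<^sub>C g x)) < \<epsilon>"
      by (elim exE conjE)
    define R where "R x = A x - (\<Sum>g\<in>F. c g *\<^sub>C g x)" for x
    have Rb: "R \<in> bops UNIV UNIV"
      unfolding R_def using F G by (intro bops_UNIV_diff bops_UNIV_sum bops_UNIV_scaleC Ab) auto
    have R: "norm (R x) \<le> \<epsilon> * norm x" for x
    proof -
      have "norm (R x) \<le> op_norm UNIV R * norm x" using op_norm_bound[OF Rb] by simp
      also have "\<dots> \<le> \<epsilon> * norm x" using lt by (intro mult_right_mono) (auto simp: R_def[abs_def])
      finally show ?thesis .
    qed
    have "X (\<Sum>g\<in>F. c g *\<^sub>C g x) = (\<Sum>g\<in>F. c g *\<^sub>C g (X x))"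
      using F comm by (subst bops_sum[OF X]) (auto simp: bops_scaleC[OF X] intro!: sum.cong)
    moreover have "A x = R x + (\<Sum>g\<in>F. c g *\<^sub>C g x)" for x by (simp add: R_def)
    ultimately have "X (A x) - A (X x) = X (R x) - R (X x)"
      by (simp add: bops_add[OF X])
    then have "norm (X (A x) - A (X x)) \<le> norm (X (R x)) + norm (R (X x))"
      by (simp add: norm_triangle_ineq4)
    also have "\<dots> \<le> ?C * (\<epsilon> * norm x) + \<epsilon> * (?C * norm x)"
    proof (rule add_mono)
      have "norm (X (R x)) \<le> ?C * norm (R x)" using op_norm_bound[OF X] by simp
      also have "\<dots> \<le> ?C * (\<epsilon> * norm x)" using R C by (intro mult_left_mono)
      finally show "norm (X (R x)) \<le> ?C * (\<epsilon> * norm x)" .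
      have "norm (R (X x)) \<le> \<epsilon> * norm (X x)" by (rule R)
      also have "\<dots> \<le> \<epsilon> * (?C * norm x)"
        using op_norm_bound[OF X, of x] that by (intro mult_left_mono) auto
      finally show "norm (R (X x)) \<le> \<epsilon> * (?C * norm x)" .
    qed
    finally show ?thesis by (simp add: algebra_simps)
  qed
  moreover define c where "c = 2 * ?C * norm x"
  ultimately have eps: "norm (X (A x) - A (X x)) \<le> \<epsilon> * c" if "\<epsilon> > 0" for \<epsilon> :: real using that by simp
  have c: "c \<ge> 0" using C by (simp add: c_def)
  have "norm (X (A x) - A (X x)) \<le> 0 + e" if "e > 0" for e :: real
  proof -
    \<comment> \<open>\<open>c + 1\<close> in the denominator covers the case
      \<open>c = 0\<close>.\<close>
    have "norm (X (A x) - A (X x)) \<le> e / (c + 1) * c" using that c by (intro eps) simp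
    also have "\<dots> \<le> e" using that c by (simp add: field_simps)
    finally show ?thesis by simp
  qed
  then have "norm (X (A x) - A (X x)) \<le> 0" by (rule field_le_epsilon)
  then show ?thesis by simp
qed

text \<open>Invariance under the adjoint makes the orthogonal complement of \<open>L\<close>
  invariant as well.\<close>

lemma commute_orth_proj:
  fixes L :: "'a::{complex_inner,complete_space} set"
  assumes L: "csubspace L" "closed L" and A: "A \<in> bops UNIV UNIV"
    and inv: "A ` L \<subseteq> L" "hadj A ` L \<subseteq> L"
  shows "orth_proj L (A x) = A (orth_proj L x)"
proof -
  interpret L: closed_csubspace L by standard (use L in auto)
  show ?thesis
    using inv by (intro L.proj_eqI) (auto simp: cinner_hadj'[OF A] L.cinner_proj image_subset_iff)
qed

lemma op_word_Nil [simp]: "op_word S [] = id"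
  and op_word_Cons [simp]: "op_word S (i # I) = S i \<circ> op_word S I"
  by (simp_all add: op_word_def)

definition uhf_words :: "nat \<Rightarrow> (nat \<Rightarrow> 'a::complex_inner \<Rightarrow> 'a) \<Rightarrow> ('a \<Rightarrow> 'a) set" where
  "uhf_words N S = {op_word S I \<circ> hadj (op_word S J) | I J.
        set I \<subseteq> {..<N} \<and> set J \<subseteq> {..<N} \<and> length I = length J}"

lemma uhf_image_eq: "uhf_image N S = op_closed_span (uhf_words N S)"
  by (simp add: uhf_image_def uhf_words_def)

context cuntz_family
begin

lemma star_words_bops: "w \<in> star_words N S \<Longrightarrow> w \<in> bops UNIV UNIV"
  by (induction rule: star_words.induct) (blast intro: bops_id bops_comp S_bops Sd_bops)+

lemma op_word_bops: "set I \<subseteq> {..<N} \<Longrightarrow> op_word S I \<in> bops UNIV UNIV"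
  by (induction I) (auto intro: bops_id bops_comp S_bops)

lemma hadj_op_word_Cons: "set (i # I) \<subseteq> {..<N} \<Longrightarrow> hadj (op_word S (i # I)) = hadj (op_word S I) \<circ> Sd i"
  unfolding op_word_Cons by (intro hadj_comp S_bops op_word_bops) auto

lemma hadj_op_word: "set I \<subseteq> {..<N} \<Longrightarrow> hadj (op_word S I) x = foldl (\<lambda>x i. Sd i x) x I"
proof (induction I arbitrary: x)
  case Nil then show ?case by (simp add: hadj_id[unfolded id_def] id_def)
next
  case (Cons i I)
  then show ?case unfolding hadj_op_word_Cons[OF Cons.prems] by simp
qed

lemma uhf_words_bops: "uhf_words N S \<subseteq> bops UNIV UNIV"
  unfolding uhf_words_def by (auto intro!: bops_comp op_word_bops hadj_bops)

lemma hadj_hadj: "A \<in> bops UNIV UNIV \<Longrightarrow> hadj (hadj A) = (A :: 'a \<Rightarrow> 'a)"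
  by (rule hadj_eqI) (simp_all add: cinner_hadj')

lemma hadj_uhf_words: "g \<in> uhf_words N S \<Longrightarrow> hadj g \<in> uhf_words N S"
proof -
  assume "g \<in> uhf_words N S"
  then obtain I J where IJ: "g = op_word S I \<circ> hadj (op_word S J)"
    "set I \<subseteq> {..<N}" "set J \<subseteq> {..<N}" "length I = length J" by (auto simp: uhf_words_def)
  then have "hadj g = op_word S J \<circ> hadj (op_word S I)"
    by (simp add: hadj_comp op_word_bops hadj_bops hadj_hadj)
  then show ?thesis using IJ(2-4) unfolding uhf_words_def mem_Collect_eq by metis
qed

lemma star_words_subset: "star_words N S \<subseteq> cuntz_image N S"
  unfolding cuntz_image_def using star_words_bops by (intro subsetI op_closed_span_base) auto

lemma S_in_cuntz_image: "i < N \<Longrightarrow> S i \<in> cuntz_image N S"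
  and Sd_in_cuntz_image: "i < N \<Longrightarrow> Sd i \<in> cuntz_image N S"
  using star_words.intros(2,3)[OF _ star_words.intros(1), of i N S] star_words_subset by auto

text \<open>The component of \<open>U x\<close> in the range of \<open>S i\<close> is
  \<open>S i (U (Sd i x))\<close>; applying \<open>Sd j\<close> reads it off.\<close>

lemma commutes_Sd:
  assumes U: "U \<in> bops UNIV UNIV" "\<And>i x. i < N \<Longrightarrow> U (S i x) = S i (U x)" and j: "j < N"
  shows "U (Sd j x) = Sd j (U x)"
proof -
  have "U x = (\<Sum>i<N. S i (U (Sd i x)))"
    using bops_sum[OF U(1) csubspace_UNIV, of "{..<N}" "\<lambda>i. S i (Sd i x)"] U(2)
    by (simp add: sum_S_Sd cong: sum.cong_simp)
  then show ?thesis using Sd_sum_S[OF j] by metis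
qed

lemma commutant_cuntz_image:
  "commutant (cuntz_image N S) = {U \<in> bops UNIV UNIV. \<forall>i<N. \<forall>x. U (S i x) = S i (U x)}"
proof (intro Set.set_eqI iffI)
  fix U assume "U \<in> commutant (cuntz_image N S)"
  then show "U \<in> {U \<in> bops UNIV UNIV. \<forall>i<N. \<forall>x. U (S i x) = S i (U x)}"
    using S_in_cuntz_image by (auto simp: commutant_def fun_eq_iff)
next
  fix U assume U: "U \<in> {U \<in> bops UNIV UNIV. \<forall>i<N. \<forall>x. U (S i x) = S i (U x)}"
  have "U (w x) = w (U x)" if "w \<in> star_words N S" for w x
    using that by (induction arbitrary: x rule: star_words.induct) (use U commutes_Sd[of U] in auto)
  then have "U (A x) = A (U x)" if "A \<in> cuntz_image N S" for A x
    using op_closed_span_commute[of "star_words N S" U A x] that U star_words_bops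
    by (auto simp: cuntz_image_def)
  then show "U \<in> commutant (cuntz_image N S)" using U by (auto simp: commutant_def)
qed

lemma commutant_uhf_image:
  "commutant (uhf_image N S) = {U \<in> bops UNIV UNIV. \<forall>g\<in>uhf_words N S. \<forall>x. U (g x) = g (U x)}"
proof (intro Set.set_eqI iffI)
  fix U assume "U \<in> commutant (uhf_image N S)"
  then show "U \<in> {U \<in> bops UNIV UNIV. \<forall>g\<in>uhf_words N S. \<forall>x. U (g x) = g (U x)}"
    using op_closed_span_base[OF uhf_words_bops] by (auto simp: commutant_def fun_eq_iff uhf_image_eq)
next
  fix U assume U: "U \<in> {U \<in> bops UNIV UNIV. \<forall>g\<in>uhf_words N S. \<forall>x. U (g x) = g (U x)}"
  then have "U (A x) = A (U x)" if "A \<in> uhf_image N S" for A x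
    using op_closed_span_commute[OF uhf_words_bops, of U A x] that by (auto simp: uhf_image_eq)
  then show "U \<in> commutant (uhf_image N S)" using U by (auto simp: commutant_def)
qed

section \<open>The canonical endomorphism of the bounded operators and its eigenvectors\<close>

definition \<rho> :: "('a \<Rightarrow> 'a) \<Rightarrow> 'a \<Rightarrow> 'a" where
  "\<rho> Y x = (\<Sum>i<N. S i (Y (Sd i x)))"

lemma \<rho>_bops: "Y \<in> bops UNIV UNIV \<Longrightarrow> \<rho> Y \<in> bops UNIV UNIV"
proof -
  assume Y: "Y \<in> bops UNIV UNIV"
  have "(\<lambda>x. S i (Y (Sd i x))) \<in> bops UNIV UNIV" if "i < N" for i
    using bops_comp[OF S_bops[OF that] bops_comp[OF Y Sd_bops[OF that]]] by (simp add: o_def)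
  then have "(\<lambda>x. \<Sum>i<N. S i (Y (Sd i x))) \<in> bops UNIV UNIV" by (intro bops_UNIV_sum) auto
  then show ?thesis by (simp add: \<rho>_def[abs_def])
qed

lemma \<rho>_bound:
  assumes "C \<ge> 0" "\<And>x. norm (Y x) \<le> C * norm x" shows "norm (\<rho> Y x) \<le> C * norm x"
proof -
  have "(norm (\<rho> Y x))\<^sup>2 = (\<Sum>i<N. (norm (Y (Sd i x)))\<^sup>2)" unfolding \<rho>_def by (rule norm_sum_S)
  also have "\<dots> \<le> (\<Sum>i<N. C\<^sup>2 * (norm (Sd i x))\<^sup>2)"
    by (intro sum_mono) (metis assms(2) norm_ge_zero power_mono power_mult_distrib)
  also have "\<dots> = (C * norm x)\<^sup>2" by (simp add: sum_norm_Sd power_mult_distrib flip: sum_distrib_left)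
  finally show ?thesis by (rule power2_le_imp_le) (simp add: assms(1))
qed

lemma \<rho>_S: "i < N \<Longrightarrow> Y \<in> bops UNIV UNIV \<Longrightarrow> \<rho> Y (S i x) = S i (Y x)"
proof -
  assume i: "i < N" and Y: "Y \<in> bops UNIV UNIV"
  have "\<rho> Y (S i x) = (\<Sum>j<N. if j = i then S i (Y x) else 0)"
    unfolding \<rho>_def using i by (intro sum.cong) (auto simp: Sd_S bops_0[OF Y] bops_0[OF S_bops])
  then show ?thesis using i by simp
qed

lemma Sd_\<rho>: "i < N \<Longrightarrow> Sd i (\<rho> Y x) = Y (Sd i x)"
  unfolding \<rho>_def by (rule Sd_sum_S)

lemma \<rho>_comp: "\<rho> (X \<circ> Y) = \<rho> X \<circ> \<rho> Y"
proof
  fix x show "\<rho> (X \<circ> Y) x = (\<rho> X \<circ> \<rho> Y) x"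
    unfolding o_def \<rho>_def[of X "\<rho> Y x"] by (simp add: \<rho>_def[of "\<lambda>x. X (Y x)" x] Sd_\<rho> cong: sum.cong_simp)
qed

lemma \<rho>_id: "\<rho> id = id"
  by (rule ext) (simp add: \<rho>_def sum_S_Sd)

lemma cinner_\<rho>: "cinner y (\<rho> Y x) = (\<Sum>i<N. cinner (Sd i y) (Y (Sd i x)))"
  by (simp add: \<rho>_def cinner_sum_right cinner_S')

lemma \<rho>_hadj: "Y \<in> bops UNIV UNIV \<Longrightarrow> hadj (\<rho> Y) = \<rho> (hadj Y)"
proof (rule hadj_eqI)
  fix x y assume Y: "Y \<in> bops UNIV UNIV"
  have "cinner (\<rho> Y x) y = (\<Sum>i<N. cinner (Y (Sd i x)) (Sd i y))"
    by (simp add: \<rho>_def cinner_sum_left cinner_S)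
  also have "\<dots> = cinner x (\<rho> (hadj Y) y)" by (simp add: cinner_\<rho> cinner_hadj[OF Y])
  finally show "cinner (\<rho> Y x) y = cinner x (\<rho> (hadj Y) y)" .
qed (auto intro: \<rho>_bops hadj_bops)

lemma \<rho>_scale: "\<rho> (\<lambda>x. c *\<^sub>C Y x) x = c *\<^sub>C \<rho> Y x"
  by (simp add: \<rho>_def bops_scaleC[OF S_bops] complex_vector.scale_sum_right cong: sum.cong_simp)

lemma \<rho>_add: "\<rho> (\<lambda>x. Y x + Z x) x = \<rho> Y x + \<rho> Z x"
  by (simp add: \<rho>_def bops_add[OF S_bops] sum.distrib cong: sum.cong_simp)

lemma \<rho>_diff: "\<rho> (\<lambda>x. Y x - Z x) x = \<rho> Y x - \<rho> Z x"
  by (simp add: \<rho>_def bops_diff[OF S_bops] sum_subtractf cong: sum.cong_simp)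

lemma \<rho>_sum: "\<rho> (\<lambda>x. \<Sum>k\<in>I. Y k x) x = (\<Sum>k\<in>I. \<rho> (Y k) x)"
  unfolding \<rho>_def by (subst sum.swap) (simp add: bops_sum[OF S_bops] cong: sum.cong_simp)

lemma \<rho>_pow_bops: "Y \<in> bops UNIV UNIV \<Longrightarrow> (\<rho> ^^ n) Y \<in> bops UNIV UNIV"
  by (induction n) (auto intro: \<rho>_bops)

lemma \<rho>_pow_lincomb:
  "(\<rho> ^^ n) (\<lambda>x. \<Sum>k\<in>I. c k *\<^sub>C Y k x) = (\<lambda>x. \<Sum>k\<in>I. c k *\<^sub>C (\<rho> ^^ n) (Y k) x)"
proof (induction n)
  case (Suc n)
  have "(\<rho> ^^ Suc n) (\<lambda>x. \<Sum>k\<in>I. c k *\<^sub>C Y k x) = \<rho> (\<lambda>x. \<Sum>k\<in>I. c k *\<^sub>C (\<rho> ^^ n) (Y k) x)"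
    using Suc by simp
  also have "\<dots> = (\<lambda>x. \<Sum>k\<in>I. c k *\<^sub>C (\<rho> ^^ Suc n) (Y k) x)"
    by (rule ext, subst \<rho>_sum) (simp add: \<rho>_scale)
  finally show ?case .
qed simp

text \<open>For \<open>c \<noteq> 0\<close> these are the operators that commute with the
  \<open>S i\<close> up to the factor \<open>inverse c\<close> (\<open>Eig_iff\<close>).
  \<open>Eig 1\<close> is the commutant of the representation, and eigenvalues multiply under
  composition because \<open>\<rho>\<close> is multiplicative.\<close>

definition Eig :: "complex \<Rightarrow> ('a \<Rightarrow> 'a) set" where
  "Eig c = {X \<in> bops UNIV UNIV. \<rho> X = (\<lambda>x. c *\<^sub>C X x)}"

lemma Eig_bops: "X \<in> Eig c \<Longrightarrow> X \<in> bops UNIV UNIV"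
  and Eig_\<rho>: "X \<in> Eig c \<Longrightarrow> \<rho> X x = c *\<^sub>C X x"
  by (simp_all add: Eig_def)

lemma Eig_S: "X \<in> Eig c \<Longrightarrow> i < N \<Longrightarrow> S i (X x) = c *\<^sub>C X (S i x)"
  using \<rho>_S[of i X x] by (simp add: Eig_def)

lemma Eig_Sd: "X \<in> Eig c \<Longrightarrow> i < N \<Longrightarrow> X (Sd i x) = c *\<^sub>C Sd i (X x)"
  using Sd_\<rho>[of i X x] by (simp add: Eig_def bops_scaleC[OF Sd_bops])

lemma Eig_comp: "X \<in> Eig c \<Longrightarrow> Y \<in> Eig d \<Longrightarrow> X \<circ> Y \<in> Eig (c * d)"
  by (auto simp: Eig_def \<rho>_comp bops_scaleC intro: bops_comp)

lemma Eig_id: "id \<in> Eig 1"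
  by (auto simp: Eig_def bops_id \<rho>_id)

lemma Eig_funpow: "X \<in> Eig c \<Longrightarrow> X ^^ n \<in> Eig (c ^ n)"
  by (induction n) (auto intro: Eig_comp Eig_id)

lemma Eig_hadj: "X \<in> Eig c \<Longrightarrow> hadj X \<in> Eig (cnj c)"
proof -
  assume X: "X \<in> Eig c"
  have "hadj (\<rho> X) = (\<lambda>x. cnj c *\<^sub>C hadj X x)"
    using X by (intro hadj_eqI) (auto simp: Eig_\<rho> Eig_bops cinner_linear cinner_hadj
        intro!: bops_UNIV_scaleC hadj_bops)
  then show ?thesis using X \<rho>_hadj[of X] by (auto simp: Eig_def hadj_bops)
qed

lemma Eig_scale: "X \<in> Eig c \<Longrightarrow> (\<lambda>x. d *\<^sub>C X x) \<in> Eig c"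
  by (auto simp: Eig_def \<rho>_scale scaleC_scaleC mult.commute intro: bops_UNIV_scaleC)

lemma Eig_iff:
  assumes "c \<noteq> 0"
  shows "X \<in> Eig c \<longleftrightarrow> X \<in> bops UNIV UNIV \<and> (\<forall>i<N. \<forall>x. X (S i x) = inverse c *\<^sub>C S i (X x))"
proof
  assume "X \<in> Eig c"
  then show "X \<in> bops UNIV UNIV \<and> (\<forall>i<N. \<forall>x. X (S i x) = inverse c *\<^sub>C S i (X x))"
    using assms by (simp add: Eig_S Eig_bops scaleC_scaleC)
next
  assume X: "X \<in> bops UNIV UNIV \<and> (\<forall>i<N. \<forall>x. X (S i x) = inverse c *\<^sub>C S i (X x))"
  have "\<rho> X x = c *\<^sub>C X x" for x
  proof -
    have "inverse c *\<^sub>C \<rho> X x = (\<Sum>i<N. X (S i (Sd i x)))"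
      unfolding \<rho>_def complex_vector.scale_sum_right using X by (intro sum.cong) auto
    also have "\<dots> = X (\<Sum>i<N. S i (Sd i x))" using X by (subst bops_sum[of X UNIV UNIV]) auto
    also have "\<dots> = X x" by (simp add: sum_S_Sd)
    finally have "c *\<^sub>C inverse c *\<^sub>C \<rho> X x = c *\<^sub>C X x" by simp
    then show ?thesis using assms by (simp add: scaleC_scaleC)
  qed
  then show "X \<in> Eig c" using X by (auto simp: Eig_def)
qed

lemma commutant_eq_Eig: "commutant (cuntz_image N S) = Eig 1"
  by (auto simp: commutant_cuntz_image Eig_iff)

end

section \<open>Irreducible representations\<close>

context absorbed_family
begin

lemma finite_basis_Ab_0: "\<exists>B\<^sub>0. finite B\<^sub>0 \<and> B\<^sub>0 \<subseteq> Ab 0 \<and> cspan B\<^sub>0 = Ab 0"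
proof -
  have sub: "csubspace (Ab 0)" by (simp add: csubspace_absorbed)
  obtain B\<^sub>0 where B\<^sub>0: "B\<^sub>0 \<subseteq> Ab 0" "\<not> complex_vector.dependent B\<^sub>0" "Ab 0 \<subseteq> cspan B\<^sub>0"
    using complex_vector.maximal_independent_subset[of "Ab 0"] by metis
  have "B\<^sub>0 \<subseteq> cspan B" using B\<^sub>0(1) absorbed_0_subset by blast
  then have "finite B\<^sub>0" using complex_vector.independent_span_bound[OF finite_B B\<^sub>0(2)] by blast
  moreover have "cspan B\<^sub>0 \<subseteq> Ab 0" using B\<^sub>0(1) sub by (rule complex_vector.span_minimal)
  ultimately show ?thesis using B\<^sub>0 by blast
qed

lemma coinvariant_Ab_0: "coinvariant N S (Ab 0)"
  by (auto simp: coinvariant_def absorbed_0_Sd)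

text \<open>The identity \<open>sum_S_Sd\<close> writes a vector of \<open>Ab (Suc M)\<close>
  through the \<open>S i\<close> applied to vectors of \<open>Ab M\<close>; words applied to
  \<open>Ab 0\<close> thus reach every absorbed vector.\<close>

lemma cyclic_if_Ab_0_subset:
  assumes "Ab 0 \<subseteq> L" shows "cyclic_for (cuntz_image N S) L"
proof -
  let ?Z = "cspan {w x | w x. w \<in> star_words N S \<and> x \<in> L}"
  have S_Z: "S i z \<in> ?Z" if "i < N" "z \<in> ?Z" for i z
    using S_bops[OF that(1)] that(2)
  proof (rule bops_cspan)
    fix y assume "y \<in> {w x | w x. w \<in> star_words N S \<and> x \<in> L}"
    then obtain w x where "y = w x" "w \<in> star_words N S" "x \<in> L" by blast
    moreover from this have "S i \<circ> w \<in> star_words N S" using that(1) by (intro star_words.intros)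
    ultimately have "\<exists>w x'. S i y = w x' \<and> w \<in> star_words N S \<and> x' \<in> L"
      by (intro exI[of _ "S i \<circ> w"] exI[of _ x]) simp
    then show "S i y \<in> ?Z" by (intro complex_vector.span_base) blast
  qed simp
  have "x \<in> ?Z" if "x \<in> Ab M" for x M
    using that
  proof (induction M arbitrary: x)
    case 0
    then have "\<exists>w x'. x = w x' \<and> w \<in> star_words N S \<and> x' \<in> L"
      using assms star_words.intros(1) by (intro exI[of _ id] exI[of _ x]) auto
    then show ?case by (intro complex_vector.span_base) blast
  next
    case (Suc M)
    have "(\<Sum>i<N. S i (Sd i x)) \<in> ?Z"
      using Suc by (intro csubspace_sum S_Z) (auto simp: absorbed_Suc_iff)
    then show ?case by (simp add: sum_S_Sd)
  qed
  then have "(\<Union>M. Ab M) \<subseteq> ?Z" by blast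
  also have "?Z \<subseteq> cspan {A x | A x. A \<in> cuntz_image N S \<and> x \<in> L}"
    by (rule complex_vector.span_mono) (use star_words_subset in blast)
  finally show ?thesis
    unfolding cyclic_for_def using dense closure_mono by blast
qed

text \<open>\<open>K\<close> itself need not be coinvariant, so its coinvariant part
  \<open>Ab 0\<close> serves as the finite-dimensional cyclic space.\<close>

lemma finitely_correlated: "finitely_correlated N S"
proof -
  obtain B\<^sub>0 where "finite B\<^sub>0" "cspan B\<^sub>0 = Ab 0" using finite_basis_Ab_0 by blast
  then show ?thesis
    unfolding finitely_correlated_def
    using cuntz coinvariant_Ab_0 cyclic_if_Ab_0_subset[of "Ab 0"] by (intro conjI exI[of _ B\<^sub>0]) auto
qed

section \<open>A polynomial annihilating the canonical endomorphism\<close>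

lemma \<rho>_pow_vanish:
  assumes "\<And>y x. y \<in> Ab 0 \<Longrightarrow> x \<in> Ab 0 \<Longrightarrow> cinner y (Z x) = 0"
  shows "y \<in> Ab n \<Longrightarrow> x \<in> Ab n \<Longrightarrow> cinner y ((\<rho> ^^ n) Z x) = 0"
  by (induction n arbitrary: y x) (use assms in \<open>auto simp: cinner_\<rho> absorbed_Suc_iff\<close>)

lemma form_vanish:
  assumes "Y \<in> bops UNIV UNIV" "\<And>n y x. y \<in> Ab n \<Longrightarrow> x \<in> Ab n \<Longrightarrow> cinner y (Y x) = 0"
  shows "Y x = 0"
proof -
  have "cmod (cinner (Y x) (Y x)) \<le> 0 * norm (Y x) * norm x"
  proof (rule sesq_bound_on_dense[OF sesq_bops[OF assms(1)] dense dense])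
    fix y x assume "y \<in> (\<Union>M. Ab M)" "x \<in> (\<Union>M. Ab M)"
    then obtain m n where "y \<in> Ab m" "x \<in> Ab n" by auto
    then have "y \<in> Ab (max m n)" "x \<in> Ab (max m n)"
      using absorbed_mono[of m "max m n"] absorbed_mono[of n "max m n"] by auto
    then show "cmod (cinner y (Y x)) \<le> 0 * norm y * norm x" using assms(2) by simp
  qed
  then show ?thesis by (simp add: cinner_self)
qed

lemma cspan_form_vanish:
  assumes "Z \<in> bops UNIV UNIV" "\<And>b b'. b \<in> B\<^sub>0 \<Longrightarrow> b' \<in> B\<^sub>0 \<Longrightarrow> cinner b (Z b') = 0"
    and "y \<in> cspan B\<^sub>0" "x \<in> cspan B\<^sub>0"
  shows "cinner y (Z x) = 0"
proof -
  have *: "cinner b (Z x) = 0" if "b \<in> B\<^sub>0" for b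
    using assms(4)
  proof (induction rule: complex_vector.span_induct_alt)
    case base then show ?case by (simp add: bops_0[OF assms(1)])
  next
    case (step c b' x)
    then show ?case using assms(2) that by (simp add: bops_add[OF assms(1)] bops_scaleC[OF assms(1)] cinner_linear)
  qed
  show ?thesis using assms(3)
    by (induction rule: complex_vector.span_induct_alt) (simp_all add: cinner_linear *)
qed

text \<open>Preimages of every order are required so that forms at level \<open>n\<close> can be
  tested on a preimage at level 0. By \<open>commutant_uhf_image_subset\<close> the commutant of
  \<open>uhf_image N S\<close> lies in this set.\<close>

definition uhf_range :: "('a \<Rightarrow> 'a) set" where
  "uhf_range = {Y \<in> bops UNIV UNIV. \<forall>n. \<exists>Z\<in>bops UNIV UNIV. Y = (\<rho> ^^ n) Z}"

lemma uhf_range_bops: "Y \<in> uhf_range \<Longrightarrow> Y \<in> bops UNIV UNIV"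
  by (simp add: uhf_range_def)

text \<open>\<open>Ab 0\<close> is invariant under the \<open>Sd i\<close>, so the matrix of
  \<open>\<rho> Y\<close> on it depends on the matrix of \<open>Y\<close> through one linear map
  that is the same for all \<open>Y\<close>.\<close>

lemma \<rho>_annihilator_Ab_0:
  "\<exists>q. q \<noteq> 0 \<and> (\<forall>Y\<in>bops UNIV UNIV. \<forall>y\<in>Ab 0. \<forall>x\<in>Ab 0.
    cinner y (poly_sum q (\<lambda>k. (\<rho> ^^ k) Y x)) = 0)"
proof -
  obtain B\<^sub>0 where B\<^sub>0: "finite B\<^sub>0" "cspan B\<^sub>0 = Ab 0" "B\<^sub>0 \<subseteq> Ab 0" using finite_basis_Ab_0 by blast
  have "\<exists>s. Sd i b = (\<Sum>b'\<in>B\<^sub>0. s b' *\<^sub>C b')" if "i < N" "b \<in> B\<^sub>0" for i b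
  proof -
    have "Sd i b \<in> cspan B\<^sub>0" using that B\<^sub>0 absorbed_0_Sd by auto
    then show ?thesis using complex_vector.span_finite[OF B\<^sub>0(1)] by auto
  qed
  then obtain s where s: "\<And>i b. i < N \<Longrightarrow> b \<in> B\<^sub>0 \<Longrightarrow> Sd i b = (\<Sum>b'\<in>B\<^sub>0. s i b b' *\<^sub>C b')" by metis
  define X where "X = B\<^sub>0 \<times> B\<^sub>0"
  \<comment> \<open>The matrix of \<open>\<rho>\<close> in the coordinates
    \<open>cinner b (Y b')\<close>, obtained by expanding \<open>Sd i b\<close> and
    \<open>Sd i b'\<close> in \<open>B\<^sub>0\<close>; the conjugate belongs to the first
    slot.\<close>
  define C where "C p p' = (\<Sum>i<N. cnj (s i (fst p) (fst p')) * s i (snd p) (snd p'))" for p p'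
  define \<Phi> where "\<Phi> = (\<lambda>g p. \<Sum>p'\<in>X. C p p' * g p')"
  define G where "G Y p = cinner (fst p) (Y (snd p))" for Y and p :: "'a \<times> 'a"
  have step: "G (\<rho> Y) p = (\<Sum>p'\<in>X. C p p' * G Y p')" if Y: "Y \<in> bops UNIV UNIV" and p: "p \<in> X" for Y p
  proof -
    obtain b\<^sub>1 b\<^sub>2 where b: "p = (b\<^sub>1, b\<^sub>2)" "b\<^sub>1 \<in> B\<^sub>0" "b\<^sub>2 \<in> B\<^sub>0" using p by (auto simp: X_def)
    have "G (\<rho> Y) p = (\<Sum>i<N. \<Sum>b\<^sub>1'\<in>B\<^sub>0. \<Sum>b\<^sub>2'\<in>B\<^sub>0. cnj (s i b\<^sub>1 b\<^sub>1') * s i b\<^sub>2 b\<^sub>2' * cinner b\<^sub>1' (Y b\<^sub>2'))"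
      using b by (simp add: G_def cinner_\<rho> s cinner_linear bops_sum[OF Y] bops_scaleC[OF Y]
          sum_distrib_left mult.assoc cong: sum.cong_simp)
        (rule sum.cong[OF refl], subst sum.swap, simp add: mult_ac)
    also have "\<dots> = (\<Sum>i<N. \<Sum>p'\<in>X. cnj (s i b\<^sub>1 (fst p')) * s i b\<^sub>2 (snd p') * G Y p')"
      by (simp add: X_def sum.cartesian_product G_def case_prod_beta)
    also have "\<dots> = (\<Sum>p'\<in>X. C p p' * G Y p')"
      by (subst sum.swap) (simp add: C_def b sum_distrib_right)
    finally show ?thesis .
  qed
  have pow: "G ((\<rho> ^^ k) Y) p = (\<Phi> ^^ k) (G Y) p" if Y: "Y \<in> bops UNIV UNIV" and p: "p \<in> X" for Y p k
    using p
  proof (induction k arbitrary: p)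
    case (Suc k)
    have "G ((\<rho> ^^ Suc k) Y) p = (\<Sum>p'\<in>X. C p p' * G ((\<rho> ^^ k) Y) p')"
      using step[OF \<rho>_pow_bops[OF Y] Suc.prems] by simp
    also have "\<dots> = (\<Sum>p'\<in>X. C p p' * (\<Phi> ^^ k) (G Y) p')"
      by (intro sum.cong refl) (simp only: Suc.IH)
    finally show ?case by (simp add: \<Phi>_def)
  qed simp
  obtain q where q: "q \<noteq> 0" "\<And>g p. p \<in> X \<Longrightarrow> (\<Sum>k\<le>degree q. coeff q k * (\<Phi> ^^ k) g p) = 0"
    using matrix_annihilator[of X C] B\<^sub>0(1) unfolding \<Phi>_def X_def by blast
  have "cinner y (poly_sum q (\<lambda>k. (\<rho> ^^ k) Y x)) = 0"
    if Y: "Y \<in> bops UNIV UNIV" and yx: "y \<in> Ab 0" "x \<in> Ab 0" for Y y x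
  proof (rule cspan_form_vanish[where Z = "\<lambda>x. poly_sum q (\<lambda>k. (\<rho> ^^ k) Y x)" and B\<^sub>0 = B\<^sub>0])
    show "(\<lambda>x. poly_sum q (\<lambda>k. (\<rho> ^^ k) Y x)) \<in> bops UNIV UNIV"
      unfolding poly_sum_def by (intro bops_UNIV_sum bops_UNIV_scaleC \<rho>_pow_bops Y)
    fix b b' assume b: "b \<in> B\<^sub>0" "b' \<in> B\<^sub>0"
    have "cinner b (poly_sum q (\<lambda>k. (\<rho> ^^ k) Y b')) = (\<Sum>k\<le>degree q. coeff q k * G ((\<rho> ^^ k) Y) (b, b'))"
      by (simp add: poly_sum_def cinner_linear G_def)
    also have "\<dots> = 0" using pow[OF Y, of "(b, b')"] q(2)[of "(b, b')"] b by (simp add: X_def)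
    finally show "cinner b (poly_sum q (\<lambda>k. (\<rho> ^^ k) Y b')) = 0" .
  qed (use yx B\<^sub>0 in auto)
  then show ?thesis using q(1) by blast
qed

lemma \<rho>_pow_poly_sum:
  "(\<rho> ^^ n) (\<lambda>x. poly_sum q (\<lambda>k. (\<rho> ^^ k) Y x)) = (\<lambda>x. poly_sum q (\<lambda>k. (\<rho> ^^ k) ((\<rho> ^^ n) Y) x))"
proof -
  have "(\<rho> ^^ n) ((\<rho> ^^ k) Y) = (\<rho> ^^ k) ((\<rho> ^^ n) Y)" for k
    by (simp add: add.commute flip: funpow_add[THEN fun_cong, unfolded o_apply])
  then show ?thesis unfolding poly_sum_def by (simp add: \<rho>_pow_lincomb)
qed

text \<open>For \<open>Y = (\<rho> ^^ n) Z\<close> the polynomial in \<open>\<rho>\<close> may be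
  applied to \<open>Z\<close> first, where it vanishes on \<open>Ab 0\<close>;
  \<open>\<rho> ^^ n\<close> carries this to \<open>Ab n\<close>. As \<open>n\<close> is arbitrary,
  density finishes.\<close>

lemma \<rho>_annihilator:
  "\<exists>q. q \<noteq> 0 \<and> (\<forall>Y\<in>uhf_range. \<forall>x. poly_sum q (\<lambda>k. (\<rho> ^^ k) Y x) = 0)"
proof -
  obtain q where q: "q \<noteq> 0" "\<And>Y y x. Y \<in> bops UNIV UNIV \<Longrightarrow> y \<in> Ab 0 \<Longrightarrow> x \<in> Ab 0 \<Longrightarrow>
      cinner y (poly_sum q (\<lambda>k. (\<rho> ^^ k) Y x)) = 0" using \<rho>_annihilator_Ab_0 by blast
  have "poly_sum q (\<lambda>k. (\<rho> ^^ k) Y x) = 0" if Y: "Y \<in> uhf_range" for Y x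
  proof (rule form_vanish[where Y = "\<lambda>x. poly_sum q (\<lambda>k. (\<rho> ^^ k) Y x)"])
    show "(\<lambda>x. poly_sum q (\<lambda>k. (\<rho> ^^ k) Y x)) \<in> bops UNIV UNIV"
      unfolding poly_sum_def by (intro bops_UNIV_sum bops_UNIV_scaleC \<rho>_pow_bops uhf_range_bops Y)
    fix n y x assume yx: "y \<in> Ab n" "x \<in> Ab n"
    obtain Z where Z: "Z \<in> bops UNIV UNIV" "Y = (\<rho> ^^ n) Z" using Y by (auto simp: uhf_range_def)
    have "cinner y ((\<rho> ^^ n) (\<lambda>x. poly_sum q (\<lambda>k. (\<rho> ^^ k) Z x)) x) = 0"
      using yx by (intro \<rho>_pow_vanish q(2) Z(1))
    then show "cinner y (poly_sum q (\<lambda>k. (\<rho> ^^ k) Y x)) = 0" by (simp add: \<rho>_pow_poly_sum Z(2))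
  qed
  then show ?thesis using q(1) by blast
qed

lemma Eig_subset_uhf_range: "c \<noteq> 0 \<Longrightarrow> Eig c \<subseteq> uhf_range"
proof
  fix X assume c: "c \<noteq> 0" and X: "X \<in> Eig c"
  have pow: "(\<rho> ^^ n) (\<lambda>x. d *\<^sub>C X x) = (\<lambda>x. (c ^ n * d) *\<^sub>C X x)" for n d
  proof (induction n)
    case (Suc n)
    have "(\<rho> ^^ Suc n) (\<lambda>x. d *\<^sub>C X x) = \<rho> (\<lambda>x. (c ^ n * d) *\<^sub>C X x)" using Suc by simp
    also have "\<dots> = (\<lambda>x. (c ^ Suc n * d) *\<^sub>C X x)"
      by (rule ext) (simp add: \<rho>_scale Eig_\<rho>[OF X] scaleC_scaleC mult_ac)
    finally show ?case .
  qed simp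
  \<comment> \<open>An eigenvector with nonzero eigenvalue is its own preimage up to a
    scalar.\<close>
  have "X = (\<rho> ^^ n) (\<lambda>x. inverse (c ^ n) *\<^sub>C X x)" for n using c by (simp add: pow)
  then show "X \<in> uhf_range"
    unfolding uhf_range_def using Eig_bops[OF X] bops_UNIV_scaleC[OF Eig_bops[OF X]] by blast
qed

lemma Eig_root:
  assumes "q \<noteq> 0" and q: "\<And>Y x. Y \<in> uhf_range \<Longrightarrow> poly_sum q (\<lambda>k. (\<rho> ^^ k) Y x) = 0"
    and c: "c \<noteq> 0" and X: "X \<in> Eig c" "X x \<noteq> 0"
  shows "poly q c = 0"
proof -
  have "(\<rho> ^^ k) X = (\<lambda>x. c ^ k *\<^sub>C X x)" for k
  proof (induction k)
    case (Suc k)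
    have "(\<rho> ^^ Suc k) X = \<rho> (\<lambda>x. c ^ k *\<^sub>C X x)" using Suc by simp
    also have "\<dots> = (\<lambda>x. c ^ Suc k *\<^sub>C X x)"
      by (rule ext) (simp add: \<rho>_scale Eig_\<rho>[OF X(1)] scaleC_scaleC mult_ac)
    finally show ?case .
  qed simp
  then have "poly_sum q (\<lambda>k. (\<rho> ^^ k) X x) = poly q c *\<^sub>C X x"
    by (simp add: poly_sum_def poly_altdef scaleC_scaleC complex_vector.scale_sum_left)
  then show ?thesis using q[of X x] Eig_subset_uhf_range[OF c] X by auto
qed

text \<open>By dimension some polynomial in \<open>X\<close> has zero matrix on \<open>Ab 0\<close>.
  This operator is fixed by \<open>\<rho>\<close>, so the vanishing spreads to every
  \<open>Ab n\<close>.\<close>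

lemma commutant_polynomial:
  assumes X: "X \<in> Eig 1"
  shows "\<exists>q. q \<noteq> 0 \<and> (\<forall>x. poly_sum q (\<lambda>k. (X ^^ k) x) = 0)"
proof -
  obtain B\<^sub>0 where B\<^sub>0: "finite B\<^sub>0" "cspan B\<^sub>0 = Ab 0" using finite_basis_Ab_0 by blast
  obtain q where q: "q \<noteq> 0"
    "\<And>b b'. b \<in> B\<^sub>0 \<Longrightarrow> b' \<in> B\<^sub>0 \<Longrightarrow> (\<Sum>k\<le>degree q. coeff q k * cinner b ((X ^^ k) b')) = 0"
    using exists_polynomial_relation[of "B\<^sub>0 \<times> B\<^sub>0" "\<lambda>k (b, b'). cinner b ((X ^^ k) b')"] B\<^sub>0(1) by auto
  define Z where "Z x = poly_sum q (\<lambda>k. (X ^^ k) x)" for x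
  have Xk: "X ^^ k \<in> Eig 1" for k using Eig_funpow[OF X, of k] by simp
  have Zb: "Z \<in> bops UNIV UNIV"
    unfolding Z_def[abs_def] poly_sum_def by (intro bops_UNIV_sum bops_UNIV_scaleC Eig_bops[OF Xk])
  have "\<rho> Z = Z"
    unfolding Z_def[abs_def] poly_sum_def by (rule ext, subst \<rho>_sum) (simp add: \<rho>_scale Eig_\<rho>[OF Xk])
  then have \<rho>Z: "(\<rho> ^^ n) Z = Z" for n by (induction n) auto
  have "cinner y (Z x) = 0" if "y \<in> Ab 0" "x \<in> Ab 0" for y x
  proof (rule cspan_form_vanish[OF Zb])
    fix b b' assume "b \<in> B\<^sub>0" "b' \<in> B\<^sub>0"
    then show "cinner b (Z b') = 0" using q(2) by (simp add: Z_def poly_sum_def cinner_linear)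
  qed (use that B\<^sub>0 in auto)
  then have "Z x = 0" for x using \<rho>_pow_vanish[of Z] \<rho>Z by (intro form_vanish[OF Zb]) metis
  then show ?thesis using q(1) by (auto simp: Z_def)
qed

lemma scalar_if_irreducible:
  assumes irr: "irreducible_on (cuntz_image N S) UNIV" and X: "X \<in> Eig 1"
  shows "\<exists>c. X = (\<lambda>x. c *\<^sub>C x)"
proof -
  have Xb: "X \<in> bops UNIV UNIV" using X by (rule Eig_bops)
  obtain x\<^sub>0 :: 'a where x\<^sub>0: "x\<^sub>0 \<noteq> 0" using irr by (auto simp: irreducible_on_def)
  obtain q where "q \<noteq> 0" and q: "\<forall>x. poly_sum q (\<lambda>k. (X ^^ k) x) = 0"
    using commutant_polynomial[OF X] by blast
  from this show ?thesis
  proof (induction q rule: nonzero_poly_induct)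
    case (const c)
    then show ?case using x\<^sub>0 by (auto simp: poly_sum_def)
  next
    case (root r q)
    let ?L = "{x. X x = r *\<^sub>C x}"
    have "csubspace ?L"
      by (rule complex_vector.subspaceI)
        (auto simp: bops_0[OF Xb] bops_add[OF Xb] bops_scaleC[OF Xb] scaleC_add_right scaleC_scaleC mult.commute)
    moreover have "closed ?L"
      by (intro closed_Collect_eq bops_continuous[OF Xb]
          bounded_linear.continuous_on[OF bounded_linear_scaleC_right] continuous_on_id)
    moreover have "A ` ?L \<subseteq> ?L" if A: "A \<in> cuntz_image N S" for A
    proof -
      have "A \<in> bops UNIV UNIV" using A by (simp add: cuntz_image_def op_closed_span_def)
      moreover have "X (A x) = A (X x)" for x
        using X A by (auto simp: commutant_def fun_eq_iff simp flip: commutant_eq_Eig)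
      ultimately show ?thesis by (auto simp: bops_scaleC)
    qed
    ultimately consider "?L = {0}" | "?L = UNIV" using irr unfolding irreducible_on_def by blast
    then show ?case
    proof cases
      case 1
      have "poly_sum q (\<lambda>k. (X ^^ k) x) = 0" for x
      proof -
        have "X (poly_sum q (\<lambda>k. (X ^^ k) x)) - r *\<^sub>C poly_sum q (\<lambda>k. (X ^^ k) x) =
            poly_sum q (\<lambda>k. (X ^^ Suc k) x - r *\<^sub>C (X ^^ k) x)"
          by (simp add: poly_sum_def bops_sum[OF Xb] bops_scaleC[OF Xb] complex_vector.scale_sum_right
              complex_vector.scale_right_diff_distrib sum_subtractf scaleC_scaleC mult.commute)
        also have "\<dots> = 0" using root.prems by (simp only: poly_sum_mult_root)
        finally have "poly_sum q (\<lambda>k. (X ^^ k) x) \<in> ?L" by simp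
        then show ?thesis using 1 by blast
      qed
      then show ?thesis using root.IH by blast
    qed auto
  qed
qed

text \<open>\<open>cuntz_image N S\<close> contains the adjoints, so the projection onto an
  invariant subspace lies in the commutant and is a scalar, equal to 1 as soon as the subspace is
  nonzero.\<close>

lemma irreducible_if_scalar:
  assumes "\<And>X. X \<in> Eig 1 \<Longrightarrow> \<exists>c. X = (\<lambda>x. c *\<^sub>C x)" and nontrivial: "(UNIV :: 'a set) \<noteq> {0}"
  shows "irreducible_on (cuntz_image N S) UNIV"
  unfolding irreducible_on_def
proof (intro conjI allI impI)
  fix L :: "'a set"
  assume L: "csubspace L \<and> closed L \<and> L \<subseteq> UNIV \<and> (\<forall>A\<in>cuntz_image N S. A ` L \<subseteq> L)"
  interpret L: closed_csubspace L by standard (use L in auto)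
  have "L.P (S i x) = S i (L.P x)" if "i < N" for i x
    using L that S_in_cuntz_image Sd_in_cuntz_image S_bops by (intro commute_orth_proj) auto
  then have "L.P \<in> Eig 1" using L.proj_bops_UNIV by (simp add: Eig_iff)
  then obtain c where c: "L.P = (\<lambda>x. c *\<^sub>C x)" using assms(1) by blast
  show "L = {0} \<or> L = UNIV"
  proof (rule disjCI)
    assume "L \<noteq> UNIV"
    have "v = 0" if v: "v \<in> L" for v
    proof (rule ccontr)
      assume "v \<noteq> 0"
      have "c *\<^sub>C v = 1 *\<^sub>C v" using L.proj_ident[OF v] c by simp
      then have "c = 1" using \<open>v \<noteq> 0\<close> by (simp only: complex_vector.scale_cancel_right) simp
      then have "x \<in> L" for x using L.proj_in[of x] c by simp
      then show False using \<open>L \<noteq> UNIV\<close> by auto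
    qed
    then show "L = {0}" using csubspace_0[of L] L by auto
  qed
qed (rule nontrivial)

end

text \<open>Multiplication by \<open>c\<close> permutes the set, so comparing the products of all
  elements gives \<open>c ^ card \<Gamma> = 1\<close>; counting roots turns the inclusion into
  equality.\<close>

lemma finite_circle_group_eq_roots_of_unity:
  fixes \<Gamma> :: "complex set"
  assumes fin: "finite \<Gamma>" and one: "1 \<in> \<Gamma>" and mult: "\<And>c d. c \<in> \<Gamma> \<Longrightarrow> d \<in> \<Gamma> \<Longrightarrow> c * d \<in> \<Gamma>"
    and nz: "0 \<notin> \<Gamma>"
  shows "\<Gamma> = {z. z ^ card \<Gamma> = 1}"
proof -
  have k: "card \<Gamma> > 0" using fin one card_gt_0_iff by blast
  have "c ^ card \<Gamma> = 1" if c: "c \<in> \<Gamma>" for c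
  proof -
    have "c \<noteq> 0" using c nz by auto
    then have inj: "inj_on ((*) c) \<Gamma>" by (auto intro: inj_onI)
    have "(*) c ` \<Gamma> = \<Gamma>"
      by (rule card_subset_eq[OF fin]) (use mult c card_image[OF inj] in auto)
    then have "(\<Prod>d\<in>\<Gamma>. d) = (\<Prod>d\<in>\<Gamma>. c * d)" using prod.reindex[OF inj, of "\<lambda>d. d"] by simp
    also have "\<dots> = c ^ card \<Gamma> * (\<Prod>d\<in>\<Gamma>. d)" by (simp add: prod.distrib)
    finally show ?thesis using fin nz by (auto simp: prod_zero_iff)
  qed
  then have "\<Gamma> \<subseteq> {z. z ^ card \<Gamma> = 1}" by blast
  then show ?thesis
    using k by (intro card_subset_eq) (simp_all add: card_roots_unity_eq finite_roots_unity)
qed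

section \<open>Peripheral eigenvectors of an irreducible representation\<close>

locale irreducible_family = absorbed_family +
  assumes irreducible: "irreducible_on (cuntz_image N S) UNIV"
begin

text \<open>The unimodular point spectrum of \<open>\<rho>\<close>;
  \<open>peripheral_spectrum_\<sigma>\<close> identifies it with the peripheral spectrum of
  \<open>\<sigma>\<close>.\<close>

definition \<Gamma> :: "complex set" where
  "\<Gamma> = {c. cmod c = 1 \<and> (\<exists>X\<in>Eig c. \<exists>x. X x \<noteq> 0)}"

lemma nontrivial: "\<exists>x::'a. x \<noteq> 0"
  using irreducible by (auto simp: irreducible_on_def)

lemma N_pos: "0 < N"
proof (rule ccontr)
  assume "\<not> 0 < N"
  then have "x = 0" for x :: 'a using sum_S_Sd[of x] by simp
  then show False using nontrivial by blast
qed

lemma scalar: "X \<in> Eig 1 \<Longrightarrow> \<exists>c. X = (\<lambda>x. c *\<^sub>C x)"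
  using scalar_if_irreducible[OF irreducible] .

text \<open>\<open>hadj X \<circ> X\<close> and \<open>X \<circ> hadj X\<close> lie in
  \<open>Eig 1\<close> and are scalars, so a nonzero peripheral eigenvector is a positive multiple
  of a unitary.\<close>

lemma Eig_unitary:
  assumes X: "X \<in> Eig c" and c: "cmod c = 1" and nz: "X x\<^sub>0 \<noteq> 0"
  obtains r :: real where "r > 0" "\<And>x. hadj X (X x) = complex_of_real r *\<^sub>C x"
    "\<And>x. X (hadj X x) = complex_of_real r *\<^sub>C x"
proof -
  have Xb: "X \<in> bops UNIV UNIV" using X by (rule Eig_bops)
  have cc: "cnj c * c = 1" "c * cnj c = 1" using c complex_norm_square[of c] by (simp_all add: mult.commute)
  have "hadj X \<circ> X \<in> Eig 1" "X \<circ> hadj X \<in> Eig 1"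
    using Eig_comp[OF Eig_hadj[OF X] X] Eig_comp[OF X Eig_hadj[OF X]] cc by simp_all
  then obtain s t where s: "\<And>x. hadj X (X x) = s *\<^sub>C x" and t: "\<And>x. X (hadj X x) = t *\<^sub>C x"
    using scalar by (metis o_apply)
  have "complex_of_real ((norm (X x\<^sub>0))\<^sup>2) = s * complex_of_real ((norm x\<^sub>0)\<^sup>2)"
    unfolding cinner_self[symmetric] by (simp add: cinner_hadj[OF Xb] s cinner_linear)
  moreover have "x\<^sub>0 \<noteq> 0" using nz bops_0[OF Xb] by auto
  ultimately have s_eq: "s = complex_of_real ((norm (X x\<^sub>0))\<^sup>2 / (norm x\<^sub>0)\<^sup>2)"
    by (simp add: field_simps)
  \<comment> \<open>Evaluating \<open>X (hadj X (X x\<^sub>0))\<close> in two ways identifies the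
    two scalars.\<close>
  have "s *\<^sub>C X x\<^sub>0 = t *\<^sub>C X x\<^sub>0" using t[of "X x\<^sub>0"] s[of x\<^sub>0] by (simp add: bops_scaleC[OF Xb])
  then have "s = t" using nz by simp
  then show thesis using that[of "(norm (X x\<^sub>0))\<^sup>2 / (norm x\<^sub>0)\<^sup>2"] s t s_eq \<open>x\<^sub>0 \<noteq> 0\<close> nz by simp
qed

text \<open>\<open>hadj X \<circ> Y\<close> lies in \<open>Eig 1\<close> and is a scalar; applying
  \<open>X\<close> and dividing by \<open>r\<close> solves for \<open>Y\<close>.\<close>

lemma Eig_unique:
  assumes X: "X \<in> Eig c" "X x\<^sub>0 \<noteq> 0" and c: "cmod c = 1" and Y: "Y \<in> Eig c"
  shows "\<exists>t. \<forall>x. Y x = t *\<^sub>C X x"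
proof -
  obtain r :: real where r: "r > 0" "\<And>x. X (hadj X x) = complex_of_real r *\<^sub>C x"
    using Eig_unitary[OF X(1) c X(2)] by metis
  have "cnj c * c = 1" using c complex_norm_square[of c] by (simp add: mult.commute)
  then have "hadj X \<circ> Y \<in> Eig 1" using Eig_comp[OF Eig_hadj[OF X(1)] Y] by simp
  then obtain s where s: "\<And>x. hadj X (Y x) = s *\<^sub>C x" using scalar by (metis o_apply)
  have "complex_of_real r *\<^sub>C Y x = s *\<^sub>C X x" for x
    using r(2)[of "Y x"] by (simp add: s bops_scaleC[OF Eig_bops[OF X(1)]])
  then have "inverse (complex_of_real r) *\<^sub>C complex_of_real r *\<^sub>C Y x = (inverse (complex_of_real r) * s) *\<^sub>C X x" for x
    by (simp add: scaleC_scaleC)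
  then show ?thesis using r(1) by (intro exI[of _ "inverse (complex_of_real r) * s"]) (simp add: scaleC_scaleC)
qed

lemma one_in_\<Gamma>: "1 \<in> \<Gamma>"
  using nontrivial Eig_id by (auto simp: \<Gamma>_def intro!: bexI[of _ id])

lemma mult_in_\<Gamma>: assumes "c \<in> \<Gamma>" "d \<in> \<Gamma>" shows "c * d \<in> \<Gamma>"
proof -
  obtain X x where X: "cmod c = 1" "X \<in> Eig c" "X x \<noteq> 0" using assms by (auto simp: \<Gamma>_def)
  obtain Y y where Y: "cmod d = 1" "Y \<in> Eig d" "Y y \<noteq> 0" using assms by (auto simp: \<Gamma>_def)
  obtain r :: real where r: "r > 0" "\<And>x. hadj X (X x) = complex_of_real r *\<^sub>C x"
    using Eig_unitary[OF X(2,1,3)] by metis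
  have "X (Y y) \<noteq> 0"
  proof
    assume "X (Y y) = 0"
    then have "complex_of_real r *\<^sub>C Y y = 0" using r(2)[of "Y y"] bops_0[OF hadj_bops[OF Eig_bops[OF X(2)]]] by simp
    then show False using r(1) Y(3) by simp
  qed
  then show ?thesis using Eig_comp[OF X(2) Y(2)] X(1) Y(1) by (auto simp: \<Gamma>_def norm_mult intro!: bexI[of _ "X \<circ> Y"])
qed

text \<open>All these eigenvalues are roots of the one polynomial that annihilates
  \<open>\<rho>\<close> on \<open>uhf_range\<close>.\<close>

lemma finite_\<Gamma>: "finite \<Gamma>"
proof -
  obtain q where q: "q \<noteq> 0" "\<And>Y x. Y \<in> uhf_range \<Longrightarrow> poly_sum q (\<lambda>k. (\<rho> ^^ k) Y x) = 0"
    using \<rho>_annihilator by blast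
  have "\<Gamma> \<subseteq> {c. poly q c = 0}" 
  proof
    fix c assume "c \<in> \<Gamma>"
    then obtain X x where "cmod c = 1" "X \<in> Eig c" "X x \<noteq> 0" by (auto simp: \<Gamma>_def)
    moreover from this have "c \<noteq> 0" by auto
    ultimately show "c \<in> {c. poly q c = 0}" using Eig_root[OF q] by blast
  qed
  then show ?thesis using poly_roots_finite[OF q(1)] finite_subset by blast
qed

abbreviation k where "k \<equiv> card \<Gamma>"

lemma k_pos: "k > 0"
  using finite_\<Gamma> one_in_\<Gamma> card_gt_0_iff by blast

lemma \<Gamma>_eq: "\<Gamma> = {z. z ^ k = 1}"
  by (rule finite_circle_group_eq_roots_of_unity)
    (use finite_\<Gamma> one_in_\<Gamma> mult_in_\<Gamma> in \<open>auto simp: \<Gamma>_def\<close>)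

definition \<omega> :: complex where "\<omega> = cis (2 * pi / k)"

lemma \<omega>_pow: "\<omega> ^ l = cis (2 * pi * l / k)"
  unfolding \<omega>_def Complex.DeMoivre by (simp add: mult_ac)

lemma bij_\<omega>: "bij_betw (\<lambda>l. \<omega> ^ l) {..<k} \<Gamma>"
  using Complex.bij_betw_roots_unity[OF k_pos] \<Gamma>_eq by (simp add: \<omega>_pow)

lemma \<omega>_k: "\<omega> ^ k = 1"
  using k_pos unfolding \<omega>_pow by simp

lemma \<omega>_in_\<Gamma>: "\<omega> ^ l \<in> \<Gamma>"
proof -
  have "(\<omega> ^ l) ^ k = (\<omega> ^ k) ^ l" by (simp only: power_mult[symmetric] mult.commute)
  then show ?thesis by (subst \<Gamma>_eq) (simp add: \<omega>_k)
qed

lemma cmod_\<omega>: "cmod \<omega> = 1" "\<omega> \<noteq> 0" "cmod (\<omega> ^ l) = 1"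
  by (simp_all add: \<omega>_def norm_power)

lemma \<omega>_inj: "i < k \<Longrightarrow> j < k \<Longrightarrow> \<omega> ^ i = \<omega> ^ j \<Longrightarrow> i = j"
  using bij_betw_imp_inj_on[OF bij_\<omega>] by (auto dest: inj_onD)

text \<open>\<open>X ^^ k\<close> is a scalar \<open>s\<close>, and rescaling by a k-th root of
  \<open>inverse s\<close> makes it the identity. This already forces unitarity:
  \<open>(cmod t)\<^sup>2 * r\<close> is a positive number whose k-th power is 1.\<close>

lemma exists_grading_unitary:
  "\<exists>X\<in>Eig \<omega>. X ^^ k = id \<and> (\<forall>x y. cinner (X x) (X y) = cinner x y)"
proof -
  obtain X x\<^sub>0 where X: "X \<in> Eig \<omega>" "X x\<^sub>0 \<noteq> 0" using \<omega>_in_\<Gamma>[of 1] by (auto simp: \<Gamma>_def)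
  have Xb: "X \<in> bops UNIV UNIV" using X Eig_bops by blast
  obtain r :: real where r: "r > 0" "\<And>x. hadj X (X x) = complex_of_real r *\<^sub>C x"
    using Eig_unitary[OF X(1) cmod_\<omega>(1) X(2)] by metis
  have norm_X: "cinner (X x) (X y) = complex_of_real r * cinner x y" for x y
    by (simp add: cinner_hadj[OF Xb] r(2) cinner_linear)
  have norm_Xn: "cinner ((X ^^ n) x) ((X ^^ n) y) = complex_of_real r ^ n * cinner x y" for n x y
    by (induction n) (simp_all add: norm_X mult_ac)
  have "X ^^ k \<in> Eig 1" using Eig_funpow[OF X(1), of k] by (simp add: \<omega>_k)
  then obtain s where s: "X ^^ k = (\<lambda>x. s *\<^sub>C x)" using scalar by blast
  obtain x :: 'a where x: "x \<noteq> 0" using nontrivial by blast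
  have "cnj s * s * cinner x x = complex_of_real r ^ k * cinner x x"
    using norm_Xn[of k x x] by (simp add: s cinner_linear mult_ac)
  then have ss: "cnj s * s = complex_of_real r ^ k" using x by (simp add: cinner_self)
  then have "s \<noteq> 0" using r(1) by auto
  obtain t where t: "t ^ k = inverse s"
  proof -
    have "\<exists>t. t ^ k = inverse s"
      by (rule exI[of _ "exp (Ln (inverse s) / of_nat k)"]) (use \<open>s \<noteq> 0\<close> k_pos in \<open>simp flip: exp_of_nat_mult\<close>)
    then show thesis using that by blast
  qed
  define Y where "Y x = t *\<^sub>C X x" for x
  have Y: "Y \<in> Eig \<omega>" unfolding Y_def[abs_def] using X(1) by (rule Eig_scale)
  have Yn: "(Y ^^ n) x = t ^ n *\<^sub>C (X ^^ n) x" for n x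
    by (induction n) (simp_all add: Y_def bops_scaleC[OF Xb] scaleC_scaleC)
  have Yk: "Y ^^ k = id"
    using \<open>s \<noteq> 0\<close> by (intro ext) (simp add: Yn t s scaleC_scaleC)
  have "(cmod t) ^ k = inverse (cmod s)" using t by (metis norm_inverse norm_power)
  moreover have "(cmod s)\<^sup>2 = r ^ k"
    using ss by (metis complex_norm_square mult.commute of_real_eq_iff of_real_power)
  ultimately have one_k: "((cmod t)\<^sup>2 * r) ^ k = 1"
  proof -
    assume "(cmod t) ^ k = inverse (cmod s)" "(cmod s)\<^sup>2 = r ^ k"
    then have "((cmod t)\<^sup>2 * r) ^ k = (inverse (cmod s))\<^sup>2 * (cmod s)\<^sup>2"
      by (simp add: power_mult_distrib power_mult[symmetric] mult.commute[of 2 k])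
        (simp add: power_mult)
    then show ?thesis using \<open>s \<noteq> 0\<close> by (simp add: power_mult_distrib[symmetric])
  qed
  have one: "(cmod t)\<^sup>2 * r = 1" using power_eq_1_iff[OF one_k] r(1) k_pos by (simp add: abs_mult)
  have "cinner (Y x) (Y y) = cinner x y" for x y
  proof -
    have "cinner (Y x) (Y y) = (cnj t * t * complex_of_real r) * cinner x y"
      by (simp add: Y_def cinner_linear norm_X mult_ac)
    also have "cnj t * t * complex_of_real r = complex_of_real ((cmod t)\<^sup>2 * r)"
      by (simp only: of_real_mult complex_norm_square mult.commute[of t])
    finally show ?thesis using one by simp
  qed
  then show ?thesis using Y Yk by blast
qed

section \<open>The action of the canonical endomorphism on \<open>uhf_range\<close>\<close>

lemma uhf_range_\<rho>: "Y \<in> uhf_range \<Longrightarrow> \<rho> Y \<in> uhf_range"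
proof -
  assume Y: "Y \<in> uhf_range"
  have "\<exists>Z\<in>bops UNIV UNIV. \<rho> Y = (\<rho> ^^ n) Z" for n
  proof -
    obtain Z where "Z \<in> bops UNIV UNIV" "Y = (\<rho> ^^ n) Z" using Y by (auto simp: uhf_range_def)
    then show ?thesis by (intro bexI[of _ "\<rho> Z"]) (auto simp: \<rho>_bops funpow_swap1)
  qed
  then show ?thesis using Y by (auto simp: uhf_range_def \<rho>_bops)
qed

lemma uhf_range_diff_scale:
  assumes "Y \<in> uhf_range" "Y' \<in> uhf_range" shows "(\<lambda>x. Y x - r *\<^sub>C Y' x) \<in> uhf_range"
proof -
  have "\<exists>Z\<in>bops UNIV UNIV. (\<lambda>x. Y x - r *\<^sub>C Y' x) = (\<rho> ^^ n) Z" for n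
  proof -
    obtain Z where Z1: "Z \<in> bops UNIV UNIV" "Y = (\<rho> ^^ n) Z" using assms(1) by (auto simp: uhf_range_def)
    obtain Z' where Z2: "Z' \<in> bops UNIV UNIV" "Y' = (\<rho> ^^ n) Z'" using assms(2) by (auto simp: uhf_range_def)
    note Z = Z1 Z2
    have "(\<rho> ^^ n) (\<lambda>x. Z x - r *\<^sub>C Z' x) = (\<lambda>x. (\<rho> ^^ n) Z x - r *\<^sub>C (\<rho> ^^ n) Z' x)"
    proof (induction n)
      case (Suc n)
      then show ?case by (intro ext) (simp add: \<rho>_diff \<rho>_scale)
    qed simp
    then show ?thesis using Z by (intro bexI[of _ "\<lambda>x. Z x - r *\<^sub>C Z' x"]) (auto intro: bops_UNIV_diff bops_UNIV_scaleC)
  qed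
  then show ?thesis
    using assms by (auto simp: uhf_range_def intro: bops_UNIV_diff bops_UNIV_scaleC)
qed

text \<open>\<open>\<rho>\<close> does not increase the norm, and on the range of \<open>S 0\<close>
  the operator \<open>\<rho> Y\<close> is an isometric copy of \<open>Y\<close>.\<close>

lemma op_norm_\<rho>: assumes Y: "Y \<in> bops UNIV UNIV" shows "op_norm UNIV (\<rho> Y) = op_norm UNIV Y"
proof (rule antisym)
  have nonneg: "0 \<le> op_norm UNIV Y" "0 \<le> op_norm UNIV (\<rho> Y)"
    using op_norm_nonneg[OF Y] op_norm_nonneg[OF \<rho>_bops[OF Y]] by auto
  have "norm (Y x) \<le> op_norm UNIV Y * norm x" for x using op_norm_bound[OF Y] by simp
  then show "op_norm UNIV (\<rho> Y) \<le> op_norm UNIV Y"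
    using nonneg by (intro op_norm_least \<rho>_bound) auto
  have "norm (Y x) \<le> op_norm UNIV (\<rho> Y) * norm x" for x
    using op_norm_bound[OF \<rho>_bops[OF Y], of "S 0 x"] N_pos by (simp add: \<rho>_S[OF _ Y] norm_S)
  then show "op_norm UNIV Y \<le> op_norm UNIV (\<rho> Y)" using nonneg by (intro op_norm_least) auto
qed

text \<open>\<open>\<rho>\<close> preserves the operator norm, while on an eigenvector it multiplies
  the norm by \<open>cmod c\<close>.\<close>

lemma unimodular_eigenvalue:
  assumes Y: "Y \<in> Eig c" and nz: "Y x \<noteq> 0" shows "cmod c = 1"
proof -
  have Yb: "Y \<in> bops UNIV UNIV" using Y by (rule Eig_bops)
  have "op_norm UNIV (\<rho> Y) = cmod c * op_norm UNIV Y"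
  proof (rule antisym)
    have "0 \<le> op_norm UNIV Y" "0 \<le> op_norm UNIV (\<rho> Y)"
      using op_norm_nonneg[OF Yb] op_norm_nonneg[OF \<rho>_bops[OF Yb]] by auto
    then show "op_norm UNIV (\<rho> Y) \<le> cmod c * op_norm UNIV Y"
      using op_norm_bound[OF Yb] by (intro op_norm_least) (auto simp: Eig_\<rho>[OF Y] mult.assoc intro: mult_left_mono)
    show "cmod c * op_norm UNIV Y \<le> op_norm UNIV (\<rho> Y)"
    proof (cases "c = 0")
      case True then show ?thesis using \<open>0 \<le> op_norm UNIV (\<rho> Y)\<close> by simp
    next
      case False
      have "norm (Y x) \<le> op_norm UNIV (\<rho> Y) / cmod c * norm x" for x
        using op_norm_bound[OF \<rho>_bops[OF Yb], of x] False by (simp add: Eig_\<rho>[OF Y] field_simps)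
      then have "op_norm UNIV Y \<le> op_norm UNIV (\<rho> Y) / cmod c"
        using \<open>0 \<le> op_norm UNIV (\<rho> Y)\<close> by (intro op_norm_least) auto
      then show ?thesis using False by (simp add: field_simps)
    qed
  qed
  moreover have "op_norm UNIV Y \<noteq> 0" using op_norm_eq_0[OF Yb, of x] nz by auto
  ultimately show ?thesis using op_norm_\<rho>[OF Yb] by simp
qed

text \<open>A Jordan block of size two. The second term grows linearly in \<open>n\<close> when
  \<open>cmod r = 1\<close>, which the boundedness of the powers of \<open>\<rho>\<close> rules out
  unless \<open>R = 0\<close>.\<close>

lemma \<rho>_jordan_pow:
  assumes Y: "\<And>x. \<rho> Y x = r *\<^sub>C Y x + R x" and R: "\<And>x. \<rho> R x = r *\<^sub>C R x"
  shows "(\<rho> ^^ Suc n) Y x = r ^ Suc n *\<^sub>C Y x + (of_nat (Suc n) * r ^ n) *\<^sub>C R x"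
proof (induction n arbitrary: x)
  case (Suc n)
  have "(\<rho> ^^ Suc (Suc n)) Y x = \<rho> (\<lambda>x. r ^ Suc n *\<^sub>C Y x + (of_nat (Suc n) * r ^ n) *\<^sub>C R x) x"
  proof -
    have eq: "(\<rho> ^^ Suc n) Y = (\<lambda>x. r ^ Suc n *\<^sub>C Y x + (of_nat (Suc n) * r ^ n) *\<^sub>C R x)"
      using Suc by (intro ext)
    have "(\<rho> ^^ Suc (Suc n)) Y x = \<rho> ((\<rho> ^^ Suc n) Y) x" by simp
    then show ?thesis by (simp only: eq)
  qed
  also have "\<dots> = r ^ Suc n *\<^sub>C (r *\<^sub>C Y x + R x) + (of_nat (Suc n) * r ^ n) *\<^sub>C r *\<^sub>C R x"
    by (subst \<rho>_add) (simp only: \<rho>_scale Y R)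
  also have "\<dots> = r ^ Suc (Suc n) *\<^sub>C Y x + (of_nat (Suc (Suc n)) * r ^ Suc n) *\<^sub>C R x"
  proof -
    have "of_nat (Suc (Suc n)) * r ^ Suc n = r ^ Suc n + (of_nat (Suc n) * r ^ n) * r"
      by (simp add: algebra_simps)
    then show ?thesis
      by (simp only: scaleC_add_right scaleC_scaleC scaleC_add_left add.assoc power_Suc2[of r "Suc n"])
  qed
  finally show ?case .
qed (simp add: Y)

definition span_pow :: "('a \<Rightarrow> 'a) \<Rightarrow> ('a \<Rightarrow> 'a) set" where
  "span_pow X = {Y. \<exists>z. \<forall>x. Y x = (\<Sum>l<k. z l *\<^sub>C (X ^^ l) x)}"

context
  fixes X :: "'a \<Rightarrow> 'a"
  assumes X: "X \<in> Eig \<omega>" and X_k: "X ^^ k = id" and X_unitary: "\<And>x y. cinner (X x) (X y) = cinner x y"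
begin

lemma Xl_Eig: "X ^^ l \<in> Eig (\<omega> ^ l)"
  using X by (rule Eig_funpow)

lemma Xl_unitary: "cinner ((X ^^ l) x) ((X ^^ l) y) = cinner x y"
  by (induction l) (simp_all add: X_unitary)

lemma Eig_in_span_pow:
  assumes Y: "Y \<in> Eig c" "Y x\<^sub>0 \<noteq> 0" shows "Y \<in> span_pow X"
proof -
  have "c \<in> \<Gamma>" using Y unimodular_eigenvalue[OF Y] by (auto simp: \<Gamma>_def)
  then obtain j where j: "j < k" "c = \<omega> ^ j" using bij_betw_imp_surj_on[OF bij_\<omega>] by auto
  obtain x :: 'a where "x \<noteq> 0" using nontrivial by blast
  then have "(X ^^ j) x \<noteq> 0" using Xl_unitary[of j x x] by (auto simp: cinner_self)
  then obtain t where "\<And>x. Y x = t *\<^sub>C (X ^^ j) x"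
    using Eig_unique[OF Xl_Eig[of j]] Y(1) j(2) cmod_\<omega>(3) by metis
  then have "Y x = (\<Sum>l<k. (if l = j then t else 0) *\<^sub>C (X ^^ l) x)" for x
    using j(1) by (simp add: if_distrib[of "\<lambda>c. c *\<^sub>C _"] cong: if_cong)
  then show ?thesis
    unfolding span_pow_def by (intro CollectI exI[of _ "\<lambda>l. if l = j then t else 0"] allI)
qed

lemma \<rho>_lincomb: "\<rho> (\<lambda>x. \<Sum>l<k. w l *\<^sub>C (X ^^ l) x) x = (\<Sum>l<k. (w l * \<omega> ^ l) *\<^sub>C (X ^^ l) x)"
  by (subst \<rho>_sum) (simp add: \<rho>_scale Eig_\<rho>[OF Xl_Eig] scaleC_scaleC)

lemma lincomb_bops: "(\<lambda>x. \<Sum>l<k. w l *\<^sub>C (X ^^ l) x) \<in> bops UNIV UNIV"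
  by (intro bops_UNIV_sum bops_UNIV_scaleC Eig_bops[OF Xl_Eig])

text \<open>A particular solution of the equation is subtracted mode by mode. Only modes with
  \<open>\<omega> ^ l = r\<close> resist; they would make a Jordan block, and once these are
  excluded the rest of \<open>Y\<close> is an eigenvector.\<close>

lemma span_pow_step:
  assumes Y: "Y \<in> bops UNIV UNIV" and step: "\<And>x. \<rho> Y x - r *\<^sub>C Y x = (\<Sum>l<k. z l *\<^sub>C (X ^^ l) x)"
  shows "Y \<in> span_pow X"
proof -
  \<comment> \<open>Dividing by \<open>\<omega> ^ l - r\<close> solves the equation in mode
    \<open>l\<close>; in a resonant mode the weight is 0 and the term is kept in
    \<open>R\<close>.\<close>
  define w where "w l = (if \<omega> ^ l = r then 0 else z l / (\<omega> ^ l - r))" for l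
  define R where "R x = (\<Sum>l<k. (if \<omega> ^ l = r then z l else 0) *\<^sub>C (X ^^ l) x)" for x
  define Y' where "Y' x = Y x - (\<Sum>l<k. w l *\<^sub>C (X ^^ l) x)" for x
  have Y'b: "Y' \<in> bops UNIV UNIV" unfolding Y'_def[abs_def] by (intro bops_UNIV_diff Y lincomb_bops)
  have \<rho>Y': "\<rho> Y' x = r *\<^sub>C Y' x + R x" for x
  proof -
    have coeff: "z l - w l * \<omega> ^ l + r * w l = (if \<omega> ^ l = r then z l else 0)" for l
    proof (cases "\<omega> ^ l = r")
      case False
      then have "w l * (\<omega> ^ l - r) = z l" by (simp add: w_def)
      then show ?thesis using False by (simp add: algebra_simps)
    qed (simp add: w_def)
    have "\<rho> Y' x - r *\<^sub>C Y' x = (\<rho> Y x - r *\<^sub>C Y x) - (\<Sum>l<k. (w l * \<omega> ^ l) *\<^sub>C (X ^^ l) x)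
        + (\<Sum>l<k. (r * w l) *\<^sub>C (X ^^ l) x)"
      unfolding Y'_def[abs_def]
      by (subst \<rho>_diff) (simp add: \<rho>_lincomb complex_vector.scale_right_diff_distrib
          complex_vector.scale_sum_right scaleC_scaleC)
    also have "\<dots> = (\<Sum>l<k. (z l - w l * \<omega> ^ l + r * w l) *\<^sub>C (X ^^ l) x)"
      by (simp add: step scaleC_add_left complex_vector.scale_left_diff_distrib sum.distrib sum_subtractf)
    finally have "\<rho> Y' x - r *\<^sub>C Y' x = R x" unfolding coeff R_def .
    then show ?thesis by (simp add: algebra_simps)
  qed
  have \<rho>R: "\<rho> R x = r *\<^sub>C R x" for x
    unfolding R_def[abs_def] \<rho>_lincomb complex_vector.scale_sum_right scaleC_scaleC
    by (intro sum.cong) auto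
  \<comment> \<open>A nonzero \<open>R\<close> needs \<open>r\<close> to be some
    \<open>\<omega> ^ l\<close>, hence of modulus one; then \<open>norm (R x)\<close> times
    \<open>Suc n\<close> stays bounded in \<open>n\<close>.\<close>
  have R0: "R x = 0" for x
  proof (cases "cmod r = 1")
    case False
    then have "\<omega> ^ l \<noteq> r" for l using cmod_\<omega>(3) by metis
    then show ?thesis by (simp add: R_def)
  next
    case True
    let ?C = "op_norm UNIV Y'"
    have C: "?C \<ge> 0" using op_norm_nonneg[OF Y'b] by simp
    have bound: "norm ((\<rho> ^^ n) Y' x) \<le> ?C * norm x" for n x
    proof (induction n arbitrary: x)
      case 0 then show ?case using op_norm_bound[OF Y'b] by simp
    next
      case (Suc n) then show ?case using \<rho>_bound[OF C, of "(\<rho> ^^ n) Y'"] by simp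
    qed
    have le: "real (Suc n) * norm (R x) \<le> 2 * (?C * norm x)" for n
    proof -
      have "(of_nat (Suc n) * r ^ n) *\<^sub>C R x = (\<rho> ^^ Suc n) Y' x - r ^ Suc n *\<^sub>C Y' x"
        by (simp only: \<rho>_jordan_pow[of Y' r R, OF \<rho>Y' \<rho>R] add_diff_cancel_left')
      then have "norm ((of_nat (Suc n) * r ^ n) *\<^sub>C R x) \<le> norm ((\<rho> ^^ Suc n) Y' x) + norm (r ^ Suc n *\<^sub>C Y' x)"
        by (simp only: norm_triangle_ineq4)
      then have "real (Suc n) * norm (R x) \<le> norm ((\<rho> ^^ Suc n) Y' x) + norm (Y' x)"
        using True by (simp only: norm_scaleC norm_mult norm_power norm_of_nat power_one mult_1 mult_1_right)
      then show ?thesis using bound[of "Suc n" x] bound[of 0 x] by simp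
    qed
    show ?thesis
    proof (rule ccontr)
      assume "R x \<noteq> 0"
      then obtain n where "2 * (?C * norm x) < real n * norm (R x)"
        using reals_Archimedean3[of "norm (R x)"] by auto
      also have "\<dots> \<le> real (Suc n) * norm (R x)" by (intro mult_right_mono) auto
      finally show False using le[of n] by simp
    qed
  qed
  have "Y' \<in> Eig r" using Y'b \<rho>Y' R0 by (auto simp: Eig_def)
  then have "Y' \<in> span_pow X"
  proof (cases "\<exists>x. Y' x \<noteq> 0")
    case False
    then show ?thesis unfolding span_pow_def by (intro CollectI exI[of _ "\<lambda>_. 0"]) simp
  qed (auto intro: Eig_in_span_pow)
  then obtain u where "\<And>x. Y' x = (\<Sum>l<k. u l *\<^sub>C (X ^^ l) x)" by (auto simp: span_pow_def)
  then have "Y x = (\<Sum>l<k. (u l + w l) *\<^sub>C (X ^^ l) x)" for x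
    unfolding Y'_def by (simp add: scaleC_add_left sum.distrib diff_eq_eq)
  then show ?thesis unfolding span_pow_def by (intro CollectI exI[of _ "\<lambda>l. u l + w l"]) simp
qed

text \<open>Induction over the linear factors of the annihilating polynomial:
  \<open>Y' = \<rho> Y - r Y\<close> stays in \<open>uhf_range\<close> and is killed by the
  remaining factors, and \<open>span_pow_step\<close> returns from \<open>Y'\<close> to
  \<open>Y\<close>.\<close>

lemma uhf_range_subset_span_pow: "uhf_range \<subseteq> span_pow X"
proof -
  obtain q where "q \<noteq> 0" and q: "\<And>Y x. Y \<in> uhf_range \<Longrightarrow> poly_sum q (\<lambda>k. (\<rho> ^^ k) Y x) = 0"
    using \<rho>_annihilator by blast
  have "Y \<in> span_pow X" if "Y \<in> uhf_range" "\<And>x. poly_sum q (\<lambda>k. (\<rho> ^^ k) Y x) = 0" for Y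
    using \<open>q \<noteq> 0\<close> that
  proof (induction q arbitrary: Y rule: nonzero_poly_induct)
    case (const c)
    then have "Y x = 0" for x by (simp add: poly_sum_def)
    then show ?case unfolding span_pow_def by (intro CollectI exI[of _ "\<lambda>_. 0"]) simp
  next
    case (root r q)
    define Y' where "Y' x = \<rho> Y x - r *\<^sub>C Y x" for x
    have pow: "(\<rho> ^^ n) Y' x = (\<rho> ^^ Suc n) Y x - r *\<^sub>C (\<rho> ^^ n) Y x" for n x
    proof (induction n arbitrary: x)
      case (Suc n)
      then have "(\<rho> ^^ n) Y' = (\<lambda>x. (\<rho> ^^ Suc n) Y x - r *\<^sub>C (\<rho> ^^ n) Y x)" by (intro ext)
      then have "(\<rho> ^^ Suc n) Y' x = \<rho> (\<lambda>x. (\<rho> ^^ Suc n) Y x - r *\<^sub>C (\<rho> ^^ n) Y x) x" by simp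
      then show ?case by (simp add: \<rho>_diff \<rho>_scale)
    qed (simp add: Y'_def)
    have Y': "Y' \<in> uhf_range"
      unfolding Y'_def[abs_def] using root.prems(1) by (intro uhf_range_diff_scale uhf_range_\<rho>)
    have "poly_sum q (\<lambda>k. (\<rho> ^^ k) Y' x) = 0" for x
      using root.prems(2)[of x] by (simp only: poly_sum_mult_root pow)
    then have "Y' \<in> span_pow X" by (rule root.IH[OF Y'])
    then obtain z where "\<And>x. \<rho> Y x - r *\<^sub>C Y x = (\<Sum>l<k. z l *\<^sub>C (X ^^ l) x)"
      unfolding span_pow_def Y'_def by blast
    then show ?case by (rule span_pow_step[OF uhf_range_bops[OF root.prems(1)]])
  qed
  then show ?thesis using q by blast
qed

end

section \<open>The commutant of the UHF algebra and the decomposition\<close>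

lemma uhf_words_conj:
  assumes "g \<in> uhf_words N S" shows "S 0 \<circ> g \<circ> Sd 0 \<in> uhf_words N S"
proof -
  obtain I J where IJ: "g = op_word S I \<circ> hadj (op_word S J)"
    "set I \<subseteq> {..<N}" "set J \<subseteq> {..<N}" "length I = length J" using assms by (auto simp: uhf_words_def)
  have J: "set (0 # J) \<subseteq> {..<N}" "set (0 # I) \<subseteq> {..<N}" using IJ N_pos by auto
  have "S 0 \<circ> g \<circ> Sd 0 = op_word S (0 # I) \<circ> hadj (op_word S (0 # J))"
    unfolding hadj_op_word_Cons[OF J(1)] IJ(1) by (simp add: o_assoc)
  then show ?thesis unfolding uhf_words_def mem_Collect_eq using J IJ(4)
    by (intro exI[of _ "0 # I"] exI[of _ "0 # J"]) simp
qed

lemma S_Sd_uhf_words: "i < N \<Longrightarrow> S i \<circ> Sd 0 \<in> uhf_words N S"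
proof -
  assume i: "i < N"
  have "op_word S [i] \<circ> hadj (op_word S [0]) = S i \<circ> Sd 0" by simp
  then show ?thesis unfolding uhf_words_def mem_Collect_eq using i N_pos
    by (intro exI[of _ "[i]"] exI[of _ "[0]"]) simp
qed

text \<open>Cutting an element of the commutant of \<open>UHF\<^sub>N\<close> down by one generator inverts \<open>\<rho>\<close>.\<close>

lemma commutant_uhf_image_subset: "commutant (uhf_image N S) \<subseteq> uhf_range"
proof -
  have step: "\<exists>Z\<in>commutant (uhf_image N S). Y = \<rho> Z" if Y: "Y \<in> commutant (uhf_image N S)" for Y
  proof
    have Yb: "Y \<in> bops UNIV UNIV" and comm: "\<And>g x. g \<in> uhf_words N S \<Longrightarrow> Y (g x) = g (Y x)"
      using Y by (auto simp: commutant_uhf_image)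
    define Z where "Z = Sd 0 \<circ> (Y \<circ> S 0)"
    have Zb: "Z \<in> bops UNIV UNIV"
      unfolding Z_def using N_pos by (intro bops_comp[OF Sd_bops bops_comp[OF Yb S_bops]])
    show "Y = \<rho> Z"
    proof
      fix x
      \<comment> \<open>\<open>Y\<close> commutes with \<open>S i \<circ> Sd 0\<close>, here
        evaluated at \<open>S 0 (Sd i x)\<close>, where \<open>Sd 0\<close> cancels
        \<open>S 0\<close>.\<close>
      have "S i (Z (Sd i x)) = Y (S i (Sd i x))" if "i < N" for i
        using comm[OF S_Sd_uhf_words[OF that], of "S 0 (Sd i x)"] N_pos by (simp add: Z_def Sd_S)
      then have "\<rho> Z x = Y (\<Sum>i<N. S i (Sd i x))"
        by (subst bops_sum[OF Yb]) (auto simp: \<rho>_def)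
      then show "Y x = \<rho> Z x" by (simp add: sum_S_Sd)
    qed
    \<comment> \<open>Conjugating a balanced word by \<open>S 0\<close> gives a balanced word, so
      \<open>Z\<close> inherits the commutation and the argument can be iterated.\<close>
    have "Z (g x) = g (Z x)" if "g \<in> uhf_words N S" for g x
      using comm[OF uhf_words_conj[OF that], of "S 0 x"] N_pos by (simp add: Z_def Sd_S)
    then show "Z \<in> commutant (uhf_image N S)" using Zb by (auto simp: commutant_uhf_image)
  qed
  have "\<exists>Z\<in>commutant (uhf_image N S). Y = (\<rho> ^^ n) Z" if "Y \<in> commutant (uhf_image N S)" for Y n
    using that
  proof (induction n arbitrary: Y)
    case (Suc n)
    obtain Z where Z: "Z \<in> commutant (uhf_image N S)" "Y = \<rho> Z" using step[OF Suc.prems] by blast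
    obtain W where "W \<in> commutant (uhf_image N S)" "Z = (\<rho> ^^ n) W" using Suc.IH[OF Z(1)] by blast
    then show ?case using Z(2) by (intro bexI[of _ W]) auto
  qed auto
  then show ?thesis unfolding uhf_range_def commutant_def by blast
qed

lemma \<omega>_pow_k: "(\<omega> ^ j) ^ k = 1"
proof -
  have "(\<omega> ^ j) ^ k = (\<omega> ^ k) ^ j" by (simp only: power_mult[symmetric] mult.commute)
  then show ?thesis by (simp add: \<omega>_k)
qed

theorem uhf_splits: "splits_into_disjoint_irreducibles (uhf_image N S) k"
proof -
  obtain X where X: "X \<in> Eig \<omega>" and Xk: "X ^^ k = id" and Xu: "\<And>x y. cinner (X x) (X y) = cinner x y"
    using exists_grading_unitary by blast
  have Xb: "X \<in> bops UNIV UNIV" using X by (rule Eig_bops)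
  have \<omega>i: "inverse \<omega> * \<omega> = 1" using cmod_\<omega>(2) by simp
  have X_S: "X (S i x) = inverse \<omega> *\<^sub>C S i (X x)" if "i < N" for i x
    using X that cmod_\<omega>(2) by (simp add: Eig_iff)
  \<comment> \<open>Each \<open>S i\<close> contributes a factor \<open>inverse \<omega>\<close> and
    each adjoint a factor \<open>\<omega>\<close>; in a balanced word they cancel.\<close>
  have X_word: "X (op_word S I x) = inverse \<omega> ^ length I *\<^sub>C op_word S I (X x)" if "set I \<subseteq> {..<N}" for I x
    using that by (induction I) (simp_all add: X_S bops_scaleC[OF S_bops] scaleC_scaleC)
  have X_hword: "X (hadj (op_word S I) x) = \<omega> ^ length I *\<^sub>C hadj (op_word S I) (X x)"
    if "set I \<subseteq> {..<N}" for I x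
    using that
  proof (induction I arbitrary: x)
    case Nil then show ?case by (simp add: hadj_id[unfolded id_def] id_def)
  next
    case (Cons i I)
    then have I: "set I \<subseteq> {..<N}" "i < N" by auto
    show ?case
      unfolding hadj_op_word_Cons[OF Cons.prems]
      using Cons.IH[OF I(1)] by (simp add: Eig_Sd[OF X I(2)] scaleC_scaleC mult.commute
          bops_scaleC[OF hadj_bops[OF op_word_bops[OF I(1)]]])
  qed
  have "X (g x) = g (X x)" if g: "g \<in> uhf_words N S" for g x
  proof -
    obtain I J where IJ: "g = op_word S I \<circ> hadj (op_word S J)"
      "set I \<subseteq> {..<N}" "set J \<subseteq> {..<N}" "length I = length J" using g by (auto simp: uhf_words_def)
    then have "X (g x) = (inverse \<omega> ^ length J * \<omega> ^ length J) *\<^sub>C g (X x)"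
      by (simp add: X_word X_hword bops_scaleC[OF op_word_bops] scaleC_scaleC)
    then show ?thesis by (simp only: power_mult_distrib[symmetric] \<omega>i power_one) simp
  qed
  then have "X \<in> commutant (uhf_image N S)" using Xb by (auto simp: commutant_uhf_image)
  then have X_comm: "X (A x) = A (X x)" if "A \<in> uhf_image N S" for A x
    using that by (auto simp: commutant_def fun_eq_iff)
  have span: "\<exists>z. \<forall>x. Y x = (\<Sum>l<k. z l *\<^sub>C (X ^^ l) x)" if "Y \<in> commutant (uhf_image N S)" for Y
    using that commutant_uhf_image_subset uhf_range_subset_span_pow[OF X Xk Xu] by (auto simp: span_pow_def)
  define M where "M j = {x. X x = \<omega> ^ j *\<^sub>C x}" for j
  have Xl_M: "(X ^^ l) x = (\<omega> ^ j) ^ l *\<^sub>C x" if "x \<in> M j" for l j x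
    using that by (induction l) (simp_all add: M_def bops_scaleC[OF Xb] scaleC_scaleC mult.commute)
  have sub: "csubspace (M j)" for j
    unfolding M_def by (rule complex_vector.subspaceI)
      (auto simp: bops_0[OF Xb] bops_add[OF Xb] bops_scaleC[OF Xb] scaleC_add_right scaleC_scaleC mult.commute)
  have closed: "closed (M j)" for j
    unfolding M_def by (intro closed_Collect_eq bops_continuous[OF Xb]
        bounded_linear.continuous_on[OF bounded_linear_scaleC_right] continuous_on_id)
  have inv: "A ` M j \<subseteq> M j" if A: "A \<in> uhf_image N S" for A j
  proof -
    have "A \<in> bops UNIV UNIV" using A by (simp add: uhf_image_def op_closed_span_def)
    then show ?thesis using X_comm[OF A] by (auto simp: M_def bops_scaleC)
  qed
  \<comment> \<open>The spectral projection of \<open>X\<close> for the eigenvalue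
    \<open>\<omega> ^ j\<close>, as a discrete Fourier average over the powers of
    \<open>X\<close>.\<close>
  define Pr where "Pr j x = (1 / of_nat k) *\<^sub>C (\<Sum>l<k. inverse (\<omega> ^ j) ^ l *\<^sub>C (X ^^ l) x)" for j x
  have Pr_M: "Pr j x \<in> M j" for j x
  proof -
    let ?f = "\<lambda>l. inverse (\<omega> ^ j) ^ l *\<^sub>C (X ^^ l) x"
    have \<omega>j: "\<omega> ^ j \<noteq> 0" using cmod_\<omega>(2) by simp
    have shift: "X (?f l) = \<omega> ^ j *\<^sub>C ?f (Suc l)" for l
      using \<omega>j by (simp add: bops_scaleC[OF Xb] scaleC_scaleC)
    have "(inverse (\<omega> ^ j)) ^ k = 1"
      by (simp add: power_inverse \<omega>_pow_k)
    then have "?f k = ?f 0" using Xk by simp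
    then have "(\<Sum>l<k. ?f (Suc l)) = (\<Sum>l<k. ?f l)"
      using sum.lessThan_Suc_shift[of ?f k] sum.lessThan_Suc[of ?f k] by simp
    then have "X (\<Sum>l<k. ?f l) = \<omega> ^ j *\<^sub>C (\<Sum>l<k. ?f l)"
      by (subst bops_sum[OF Xb csubspace_UNIV]) (simp_all only: shift UNIV_I complex_vector.scale_sum_right[symmetric])
    then show ?thesis by (simp add: M_def Pr_def bops_scaleC[OF Xb] scaleC_scaleC mult.commute)
  qed
  have sum_Pr: "(\<Sum>j<k. Pr j x) = x" for x
  proof -
    \<comment> \<open>A nontrivial k-th root of unity has vanishing geometric sum.\<close>
    have root_sum: "(\<Sum>j<k. inverse (\<omega> ^ j) ^ l) = (if l = 0 then of_nat k else 0)" if "l < k" for l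
    proof (cases "l = 0")
      case False
      define u where "u = inverse (\<omega> ^ l)"
      have eq: "inverse (\<omega> ^ j) ^ l = u ^ j" for j
        by (simp add: u_def power_inverse mult.commute flip: power_mult)
      have "u \<noteq> 1" using \<omega>_inj[of l 0] that False k_pos by (auto simp: u_def)
      moreover have "u ^ k = 1"
        by (simp add: u_def power_inverse \<omega>_pow_k)
      ultimately show ?thesis using False by (simp add: eq geometric_sum)
    qed simp
    have "(\<Sum>j<k. Pr j x) = (1 / of_nat k) *\<^sub>C (\<Sum>j<k. \<Sum>l<k. inverse (\<omega> ^ j) ^ l *\<^sub>C (X ^^ l) x)"
      by (simp only: Pr_def complex_vector.scale_sum_right)
    also have "\<dots> = (1 / of_nat k) *\<^sub>C (\<Sum>l<k. (\<Sum>j<k. inverse (\<omega> ^ j) ^ l) *\<^sub>C (X ^^ l) x)"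
      by (subst sum.swap) (simp only: complex_vector.scale_sum_left)
    also have "(\<Sum>l<k. (\<Sum>j<k. inverse (\<omega> ^ j) ^ l) *\<^sub>C (X ^^ l) x) = (\<Sum>l<k. if l = 0 then of_nat k *\<^sub>C x else 0)"
      using root_sum by (intro sum.cong) auto
    also have "\<dots> = of_nat k *\<^sub>C x" using k_pos by simp
    finally show ?thesis using k_pos by (simp add: scaleC_scaleC)
  qed
  have Pr_id: "Pr j x = x" if "x \<in> M j" for j x
  proof -
    have "inverse (\<omega> ^ j) ^ l *\<^sub>C (X ^^ l) x = x" for l
      using cmod_\<omega>(2) by (simp add: Xl_M[OF that] scaleC_scaleC flip: power_mult_distrib)
    then show ?thesis using k_pos
      by (simp add: Pr_def) (simp add: scaleR_scaleC scaleC_scaleC sum_constant_scaleR)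
  qed
  have orth: "cinner x y = 0" if "x \<in> M i" "y \<in> M j" "i < k" "j < k" "i \<noteq> j" for x y i j
  proof -
    have "cinner x y = cnj (\<omega> ^ i) * \<omega> ^ j * cinner x y"
      using Xu[of x y] that(1,2)
      unfolding M_def mem_Collect_eq by (simp only: cinner_scaleC_left cinner_scaleC_right mult_ac)
    moreover have "cnj (\<omega> ^ i) = inverse (\<omega> ^ i)"
      using cmod_\<omega>(3)[of i] by (simp add: inverse_eq_divide divide_conv_cnj)
    ultimately have "cinner x y = 0 \<or> inverse (\<omega> ^ i) * \<omega> ^ j = 1" by auto
    moreover have "inverse (\<omega> ^ i) * \<omega> ^ j \<noteq> 1"
      using \<omega>_inj[OF that(3,4)] that(5) cmod_\<omega>(2) by (auto simp: field_simps)
    ultimately show ?thesis by blast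
  qed
  \<comment> \<open>\<open>S 0\<close> is injective and multiplies eigenvalues of \<open>X\<close>
    by \<open>inverse \<omega>\<close>, so from any nonzero component \<open>Pr i x\<close> every
    eigenvalue is reached.\<close>
  have nz: "M j \<noteq> {0}" if j: "j < k" for j
  proof -
    obtain x :: 'a where "x \<noteq> 0" using nontrivial by blast
    then obtain i where i: "Pr i x \<noteq> 0" using sum_Pr[of x] by (metis sum.neutral)
    have "\<exists>y. y \<noteq> 0 \<and> X y = (\<omega> ^ i * inverse \<omega> ^ m) *\<^sub>C y" for m
    proof (induction m)
      case 0 then show ?case using i Pr_M[of i x] by (auto simp: M_def)
    next
      case (Suc m)
      then obtain y where y: "y \<noteq> 0" "X y = (\<omega> ^ i * inverse \<omega> ^ m) *\<^sub>C y" by blast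
      have "S 0 y \<noteq> 0" using y(1) norm_S[OF N_pos, of y] by auto
      moreover have "X (S 0 y) = (\<omega> ^ i * inverse \<omega> ^ Suc m) *\<^sub>C S 0 y"
        using y(2) by (simp add: X_S[OF N_pos] bops_scaleC[OF S_bops[OF N_pos]] scaleC_scaleC mult_ac)
      ultimately show ?case by blast
    qed
    \<comment> \<open>The exponent is \<open>i - j\<close> modulo \<open>k\<close>, written with
      \<open>k - j\<close> to stay among the natural numbers.\<close>
    then obtain y where y: "y \<noteq> 0" "X y = (\<omega> ^ i * inverse \<omega> ^ (i + (k - j))) *\<^sub>C y" by blast
    have "\<omega> ^ j * \<omega> ^ (i + (k - j)) = \<omega> ^ i * \<omega> ^ k"
      using j by (simp flip: power_add)
    then have "\<omega> ^ i * inverse \<omega> ^ (i + (k - j)) = \<omega> ^ j"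
      using cmod_\<omega>(2) by (simp add: \<omega>_k power_inverse field_simps)
    then show ?thesis using y by (auto simp: M_def)
  qed
  show ?thesis
    unfolding splits_into_disjoint_irreducibles_def
  proof (intro exI[of _ M] conjI allI impI ballI)
    fix j assume j: "j < k"
    show "irreducible_on (uhf_image N S) (M j)"
      unfolding irreducible_on_def
    proof (intro conjI allI impI nz[OF j])
      fix L assume L: "csubspace L \<and> closed L \<and> L \<subseteq> M j \<and> (\<forall>A\<in>uhf_image N S. A ` L \<subseteq> L)"
      interpret L: closed_csubspace L by standard (use L in auto)
      have words: "g \<in> uhf_image N S" if "g \<in> uhf_words N S" for g
        unfolding uhf_image_eq using that uhf_words_bops by (intro op_closed_span_base) auto
      have "L.P (g x) = g (L.P x)" if "g \<in> uhf_words N S" for g x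
        using L that words hadj_uhf_words uhf_words_bops by (intro commute_orth_proj) auto
      then have "L.P \<in> commutant (uhf_image N S)" using L.proj_bops_UNIV by (auto simp: commutant_uhf_image)
      \<comment> \<open>The projection onto \<open>L\<close> is a combination of powers of
        \<open>X\<close>, hence a scalar \<open>t\<close> on the eigenspace
        \<open>M j\<close>.\<close>
      then obtain z where z: "\<And>x. L.P x = (\<Sum>l<k. z l *\<^sub>C (X ^^ l) x)" using span by blast
      define t where "t = (\<Sum>l<k. z l * (\<omega> ^ j) ^ l)"
      have t: "L.P x = t *\<^sub>C x" if "x \<in> M j" for x
        by (simp add: z Xl_M[OF that] scaleC_scaleC t_def complex_vector.scale_sum_left)
      show "L = {0} \<or> L = M j"
      proof (rule disjCI)
        assume ne: "L \<noteq> M j"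
        have "v = 0" if v: "v \<in> L" for v
        proof (rule ccontr)
          assume "v \<noteq> 0"
          have "t *\<^sub>C v = 1 *\<^sub>C v" using L.proj_ident[OF v] t[of v] v L by auto
          then have "t = 1" using \<open>v \<noteq> 0\<close> by (simp only: complex_vector.scale_cancel_right) simp
          then have "x \<in> L" if "x \<in> M j" for x using L.proj_in[of x] t[OF that] by simp
          then show False using ne L by auto
        qed
        then show "L = {0}" using csubspace_0[of L] L by auto
      qed
    qed
  next
    fix i j assume ij: "i < k" "j < k" "i \<noteq> j"
    show "disjoint_on (uhf_image N S) (M i) (M j)"
      unfolding disjoint_on_def
    proof (intro ballI impI)
      fix Y x assume Y: "Y \<in> bops (M i) (M j)" and Yc: "\<forall>A\<in>uhf_image N S. \<forall>x\<in>M i. Y (A x) = A (Y x)" and x: "x \<in> M i"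
      have Pr_comm: "Pr i (A x) = A (Pr i x)" if A: "A \<in> uhf_image N S" for A x
      proof -
        have Ab: "A \<in> bops UNIV UNIV" using A by (simp add: uhf_image_def op_closed_span_def)
        have "(X ^^ l) (A x) = A ((X ^^ l) x)" for l by (induction l) (simp_all add: X_comm[OF A])
        then show ?thesis by (simp add: Pr_def bops_scaleC[OF Ab] bops_sum[OF Ab])
      qed
      have Prb: "Pr i \<in> bops UNIV (M i)"
      proof -
        have "Pr i \<in> bops UNIV UNIV"
          unfolding Pr_def[abs_def] by (intro bops_UNIV_scaleC bops_UNIV_sum bops_funpow Xb)
        then show ?thesis using Pr_M by (auto simp: bops_def PiE_iff)
      qed
      \<comment> \<open>\<open>Y\<close> is extended by zero to the other summands. The extension is
        a combination of powers of \<open>X\<close>, so it maps \<open>M i\<close> into itself,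
        whereas \<open>Y\<close> has values in the orthogonal space \<open>M j\<close>.\<close>
      have "Y \<circ> Pr i \<in> commutant (uhf_image N S)"
        unfolding commutant_def using Yc Pr_M Pr_comm bops_codomain_mono[OF bops_comp[OF Y Prb] subset_UNIV]
        by (auto simp: fun_eq_iff)
      then obtain z where z: "\<And>x. Y (Pr i x) = (\<Sum>l<k. z l *\<^sub>C (X ^^ l) x)" using span by fastforce
      have "Y x = (\<Sum>l<k. z l * (\<omega> ^ i) ^ l) *\<^sub>C x"
        using z[of x] by (simp add: Pr_id[OF x] Xl_M[OF x] scaleC_scaleC complex_vector.scale_sum_left)
      then have "Y x \<in> M i" using sub x by (simp add: csubspace_scaleC)
      then show "Y x = 0" using orth[OF _ bops_in[OF Y x] ij, of "Y x"] by (simp add: cinner_self)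
    qed
  next
    fix x show "\<exists>y. (\<forall>i<k. y i \<in> M i) \<and> x = (\<Sum>i<k. y i)"
      using Pr_M sum_Pr[of x] by (intro exI[of _ "\<lambda>i. Pr i x"]) auto
  qed (use sub closed inv orth in auto)
qed

end

section \<open>Fourier analysis on the torus\<close>

definition torus_point :: "real^'n \<Rightarrow> complex^'n" where
  "torus_point t = (\<chi> i. cis (2 * pi * t $ i))"

lemma torus_point_nth [simp]: "torus_point t $ i = cis (2 * pi * t $ i)"
  by (simp add: torus_point_def)

lemma torus_point_in [simp]: "torus_point t \<in> torus"
  by (simp add: torus_def)

lemma torus_nonzero: "z \<in> torus \<Longrightarrow> z $ i \<noteq> 0"
  by (auto simp: torus_def dest: spec[of _ i])

lemma compact_torus: "compact (torus :: (complex^'n) set)"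
proof -
  have "closed (\<Inter>i. {z :: complex^'n. cmod (z $ i) = 1})"
    by (intro closed_INT ballI closed_Collect_eq continuous_intros)
  then have "closed (torus :: (complex^'n) set)" by (simp add: torus_def Collect_all_eq)
  moreover have "norm z \<le> (\<Sum>i\<in>(UNIV :: 'n set). 1)" if "z \<in> torus" for z :: "complex^'n"
  proof -
    have "norm z \<le> (\<Sum>i\<in>UNIV. norm (z $ i))" unfolding norm_vec_def by (rule L2_set_le_sum) simp
    also have "\<dots> = (\<Sum>i\<in>(UNIV :: 'n set). 1)" using that by (simp add: torus_def)
    finally show ?thesis .
  qed
  then have "bounded (torus :: (complex^'n) set)" by (auto simp: bounded_iff)
  ultimately show ?thesis by (simp add: compact_eq_bounded_closed)
qed

lemma continuous_torus_point: "continuous_on X torus_point"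
  unfolding torus_point_def by (intro continuous_intros)

lemma torus_point_measurable [measurable]: "torus_point \<in> borel_measurable borel"
  by (intro borel_measurable_continuous_onI continuous_torus_point)

lemma torus_measure_eq: "torus_measure = distr (restrict_space lborel (cbox 0 1)) borel torus_point"
  by (simp add: torus_measure_def torus_point_def[abs_def])

lemma sets_torus_measure [measurable_cong, simp]: "sets torus_measure = sets borel"
  and space_torus_measure [simp]: "space torus_measure = UNIV"
  by (simp_all add: torus_measure_eq)

lemma torus_point_measurable_restrict: "torus_point \<in> restrict_space lborel (cbox 0 1) \<rightarrow>\<^sub>M borel"
  by (intro measurable_restrict_space1) simp

lemma emeasure_unit_cube: "emeasure lborel (cbox 0 (1::real^'n)) = 1"
proof -
  have "emeasure lborel (cbox 0 (1::real^'n)) = (\<Prod>b\<in>(Basis :: (real^'n) set). (1 - 0) \<bullet> b)"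
    by (rule emeasure_lborel_cbox) (auto simp: Basis_vec_def inner_axis)
  also have "(\<Prod>b\<in>(Basis :: (real^'n) set). (1 - 0) \<bullet> b) = 1"
    by (rule prod.neutral) (auto simp: Basis_vec_def inner_axis)
  finally show ?thesis by simp
qed

lemma emeasure_torus_measure: "emeasure torus_measure (UNIV :: (complex^'n::finite) set) = 1"
  unfolding torus_measure_eq
  by (subst emeasure_distr[OF torus_point_measurable_restrict])
    (simp_all add: space_restrict_space emeasure_restrict_space emeasure_unit_cube)

interpretation torus_measure: finite_measure "torus_measure :: (complex^'n::finite) measure"
  by (rule finite_measureI) (simp add: emeasure_torus_measure)

lemma torus_borel: "torus \<in> sets borel"
  by (simp add: compact_torus borel_closed compact_imp_closed)

lemma AE_torus: "AE z in torus_measure. z \<in> torus"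
  unfolding torus_measure_eq
  by (subst AE_distr_iff) (auto intro: torus_point_measurable_restrict simp: torus_borel)

lemma monomial_fun_measurable [measurable]:
  fixes n :: "int^'n" shows "monomial_fun n \<in> borel_measurable borel"
proof -
  have "(\<lambda>z :: complex^'n. z $ i) \<in> borel_measurable borel" for i
    by (intro borel_measurable_continuous_onI continuous_intros)
  then have "(\<lambda>z :: complex^'n. (z $ i) powi (n $ i)) \<in> borel_measurable borel" for i
    unfolding power_int_def by (cases "n $ i \<ge> 0") (auto intro!: borel_measurable_power borel_measurable_inverse)
  then show ?thesis unfolding monomial_fun_def[abs_def] by (intro borel_measurable_prod)
qed

lemma cmod_monomial: "z \<in> torus \<Longrightarrow> cmod (monomial_fun n z) = 1"
  by (simp add: monomial_fun_def torus_def norm_power_int flip: prod_norm)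

lemma monomial_add: "z \<in> torus \<Longrightarrow> monomial_fun (m + n) z = monomial_fun m z * monomial_fun n z"
  by (simp add: monomial_fun_def torus_nonzero power_int_add prod.distrib)

lemma monomial_0 [simp]: "monomial_fun 0 z = 1"
  by (simp add: monomial_fun_def)

lemma monomial_cnj: "z \<in> torus \<Longrightarrow> cnj (monomial_fun n z) = monomial_fun (- n) z"
proof -
  assume z: "z \<in> torus"
  have "cnj (z $ i) = inverse (z $ i)" for i
    using z by (simp add: torus_def inverse_eq_divide divide_conv_cnj)
  then show ?thesis by (simp add: monomial_fun_def power_int_minus power_int_inverse)
qed

lemma monomial_diff:
  "z \<in> torus \<Longrightarrow> monomial_fun (m - n) z = monomial_fun m z * cnj (monomial_fun n z)"
  using monomial_add[of z m "- n"] by (simp add: monomial_cnj)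

lemma monomial_torus_point:
  "monomial_fun n (torus_point t) = (\<Prod>i\<in>UNIV. cis (2 * pi * of_int (n $ i) * t $ i))"
  by (simp add: monomial_fun_def cis_power_int mult_ac)

lemma integrable_bounded_torus:
  fixes f :: "complex^'n::finite \<Rightarrow> 'b::{banach,second_countable_topology}"
  assumes "finite_measure M" "sets M = sets borel" "AE z in M. z \<in> torus"
    and "f \<in> borel_measurable borel" "\<And>z. z \<in> torus \<Longrightarrow> norm (f z) \<le> C"
  shows "integrable M f"
proof (rule finite_measure.integrable_const_bound[OF assms(1), of _ C])
  show "AE z in M. norm (f z) \<le> C" using assms(3) by eventually_elim (rule assms(5))
  show "f \<in> borel_measurable M" using assms(4) by (simp add: measurable_cong_sets[OF assms(2) refl])
qed

lemma integrable_monomial: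
  assumes "finite_measure M" "sets M = sets borel" "AE z in M. z \<in> torus"
  shows "integrable M (monomial_fun n)"
  by (rule integrable_bounded_torus[OF assms, where C = 1]) (simp_all add: cmod_monomial)

lemma integral_cis_period:
  "(\<integral>x. indicator {0..1} x *\<^sub>R cis (2 * pi * of_int n * x) \<partial>lborel) = (if n = 0 then 1 else 0)"
proof (cases "n = 0")
  case True
  have "(\<integral>x. indicator {0..1::real} x *\<^sub>R (1::complex) \<partial>lborel) = of_real 1 - of_real 0"
    by (rule integral_FTC_Icc[where F = complex_of_real and f = "\<lambda>_. 1"]) (auto intro!: derivative_eq_intros continuous_intros)
  then show ?thesis using True by simp
next
  case False
  define a where "a = 2 * pi * of_int n"
  have a: "a \<noteq> 0" using False by (simp add: a_def)
  define F where "F x = cis (a * x) / (\<i> * complex_of_real a)" for x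
  have "(\<integral>x. indicator {0..1} x *\<^sub>R cis (a * x) \<partial>lborel) = F 1 - F 0"
  proof (rule integral_FTC_Icc)
    fix x :: real
    show "(F has_vector_derivative cis (a * x)) (at x within {0..1})"
      unfolding F_def cis_conv_exp using a
      by (auto intro!: derivative_eq_intros has_vector_derivative_real_field simp: field_simps)
  qed (auto intro!: continuous_intros)
  also have "\<dots> = 0" using cis_multiple_2pi[of n] by (simp add: F_def a_def mult_ac Ints_of_int)
  finally show ?thesis using False by (simp add: a_def)
qed

lemma integral_monomial:
  "(\<integral>z. monomial_fun n z \<partial>torus_measure) = (if n = (0 :: int^'n::finite) then 1 else 0)"
proof -
  interpret lb: product_sigma_finite "\<lambda>_ :: real^'n. lborel :: real measure" by standard
  \<comment> \<open>Lebesgue measure splits as a product over \<open>Basis\<close>, so the factors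
    are indexed by basis vectors; the sum over \<open>i\<close> recovers the exponent
    \<open>n $ i\<close> from \<open>axis i 1\<close>.\<close>
  define g :: "real^'n \<Rightarrow> real \<Rightarrow> complex" where
    "g b x = indicator {0..1} x *\<^sub>R cis (2 * pi * of_int (\<Sum>i\<in>UNIV. if b = axis i 1 then n $ i else 0) * x)" for b x
  have g_axis: "g (axis i 1) x = indicator {0..1} x *\<^sub>R cis (2 * pi * of_int (n $ i) * x)" for i x
    by (simp add: g_def axis_eq_axis)
  have g_integral: "(\<integral>x. g (axis i 1) x \<partial>lborel) = (if n $ i = 0 then 1 else 0)" for i
    by (simp only: g_axis integral_cis_period)
  have inj: "inj (\<lambda>i :: 'n. axis i (1::real))" by (auto intro: injI simp: axis_eq_axis)
  have Basis: "(Basis :: (real^'n) set) = range (\<lambda>i. axis i 1)" by (auto simp: Basis_vec_def)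
  have "(\<integral>z. monomial_fun n z \<partial>torus_measure) =
      (\<integral>t. monomial_fun n (torus_point t) \<partial>restrict_space lborel (cbox 0 1))"
    unfolding torus_measure_eq by (rule integral_distr[OF torus_point_measurable_restrict]) simp
  also have "\<dots> = (\<integral>t. indicator (cbox 0 1) t *\<^sub>R monomial_fun n (torus_point t) \<partial>lborel)"
    by (subst integral_restrict_space) simp_all
  also have "\<dots> = (\<integral>t. (\<Prod>b\<in>Basis. g b (t \<bullet> b)) \<partial>lborel)"
  proof (rule Bochner_Integration.integral_cong)
    fix t :: "real^'n"
    have "(\<Prod>b\<in>Basis. g b (t \<bullet> b)) = (\<Prod>i\<in>UNIV. g (axis i 1) (t \<bullet> axis i 1))"
      unfolding Basis by (subst prod.reindex[OF inj]) simp
    also have "\<dots> = (\<Prod>i\<in>UNIV. of_real (indicator {0..1} (t $ i)) * cis (2 * pi * of_int (n $ i) * t $ i))"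
      by (simp add: g_axis inner_axis scaleR_conv_of_real)
    also have "\<dots> = of_real (\<Prod>i\<in>UNIV. indicator {0..1} (t $ i)) * monomial_fun n (torus_point t)"
      by (simp add: prod.distrib monomial_torus_point)
    also have "(\<Prod>i\<in>UNIV. indicator {0..1} (t $ i)) = (indicator (cbox 0 1) t :: real)"
    proof (cases "t \<in> cbox 0 1")
      case True then show ?thesis by (simp add: mem_box_cart)
    next
      case False
      then obtain i where "t $ i \<notin> {0..1}" by (auto simp: mem_box_cart)
      then have "indicator {0..1} (t $ i) = (0::real)" by simp
      then have "(\<Prod>i\<in>UNIV. indicator {0..1} (t $ i)) = (0::real)"
        by (intro prod_zero bexI[of _ i]) simp_all
      then show ?thesis using False by simp
    qed
    finally show "indicator (cbox 0 1) t *\<^sub>R monomial_fun n (torus_point t) = (\<Prod>b\<in>Basis. g b (t \<bullet> b))"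
      by (simp add: scaleR_conv_of_real)
  qed simp
  also have "\<dots> = (\<integral>x. (\<Prod>b\<in>Basis. g b ((\<Sum>b\<in>Basis. x b *\<^sub>R b) \<bullet> b)) \<partial>(\<Pi>\<^sub>M b\<in>Basis. lborel))"
  proof (subst lborel_eq, rule integral_distr)
    show "(\<lambda>f. \<Sum>b\<in>Basis. f b *\<^sub>R b) \<in> (\<Pi>\<^sub>M b\<in>(Basis :: (real^'n) set). lborel) \<rightarrow>\<^sub>M borel" by measurable
    show "(\<lambda>t. \<Prod>b\<in>Basis. g b (t \<bullet> b)) \<in> borel_measurable borel"
      unfolding g_def
    proof (intro borel_measurable_prod borel_measurable_scaleR)
      fix b :: "real^'n"
      show "(\<lambda>t. indicat_real {0..1} (t \<bullet> b)) \<in> borel_measurable borel" by measurable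
      show "(\<lambda>t. cis (2 * pi * of_int (\<Sum>i\<in>UNIV. if b = axis i 1 then n $ i else 0) * (t \<bullet> b)))
          \<in> borel_measurable borel"
        by (intro borel_measurable_continuous_onI continuous_intros)
    qed
  qed
  also have "\<dots> = (\<integral>x. (\<Prod>b\<in>Basis. g b (x b)) \<partial>(\<Pi>\<^sub>M b\<in>Basis. lborel))"
    by (intro Bochner_Integration.integral_cong refl prod.cong) (simp_all add: inner_sum_left_Basis)
  also have "\<dots> = (\<Prod>b\<in>Basis. \<integral>x. g b x \<partial>lborel)"
  proof (rule lb.product_integral_prod)
    show "integrable lborel (g b)" for b
      unfolding g_def by (rule borel_integrable_compact) (auto intro!: continuous_intros)
  qed simp
  also have "\<dots> = (\<Prod>i\<in>UNIV. if n $ i = 0 then 1 else 0)"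
    unfolding Basis by (subst prod.reindex[OF inj]) (simp add: g_integral)
  also have "\<dots> = (if n = 0 then 1 else 0)"
    by (auto simp: vec_eq_iff prod_zero_iff)
  finally show ?thesis .
qed

text \<open>The rule \<open>cong\<close> is included because \<open>monomial_add\<close> and
  \<open>monomial_cnj\<close> speak of points of the torus only.\<close>

inductive torus_poly :: "(complex^'n \<Rightarrow> complex) \<Rightarrow> bool" where
  monomial: "torus_poly (monomial_fun n)"
| add: "torus_poly f \<Longrightarrow> torus_poly g \<Longrightarrow> torus_poly (\<lambda>z. f z + g z)"
| scale: "torus_poly f \<Longrightarrow> torus_poly (\<lambda>z. c * f z)"
| cong: "torus_poly f \<Longrightarrow> (\<And>z. z \<in> torus \<Longrightarrow> f z = g z) \<Longrightarrow> torus_poly g"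

lemma torus_poly_mult_monomial: "torus_poly f \<Longrightarrow> torus_poly (\<lambda>z. monomial_fun n z * f z)"
proof (induction rule: torus_poly.induct)
  case (monomial m)
  show ?case
    by (rule torus_poly.cong[OF torus_poly.monomial[of "n + m"]]) (rule monomial_add)
next
  case (add f g)
  then have "torus_poly (\<lambda>z. monomial_fun n z * f z + monomial_fun n z * g z)" by (intro torus_poly.add) auto
  then show ?case by (simp add: distrib_left)
next
  case (scale f c)
  then have "torus_poly (\<lambda>z. c * (monomial_fun n z * f z))" by (intro torus_poly.scale) auto
  then show ?case by (simp add: mult.left_commute)
next
  case (cong f g)
  show ?case by (rule torus_poly.cong[OF cong.IH]) (simp add: cong.hyps)
qed

lemma torus_poly_mult: "torus_poly f \<Longrightarrow> torus_poly g \<Longrightarrow> torus_poly (\<lambda>z. f z * g z)"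
proof (induction rule: torus_poly.induct)
  case (monomial m)
  then show ?case by (rule torus_poly_mult_monomial)
next
  case (add f h)
  then have "torus_poly (\<lambda>z. f z * g z + h z * g z)" by (intro torus_poly.add) auto
  then show ?case by (simp add: distrib_right)
next
  case (scale f c)
  then have "torus_poly (\<lambda>z. c * (f z * g z))" by (intro torus_poly.scale) auto
  then show ?case by (simp add: mult.assoc)
next
  case (cong f h)
  then have "torus_poly (\<lambda>z. f z * g z)" by auto
  then show ?case by (rule torus_poly.cong) (simp add: cong.hyps)
qed

lemma torus_poly_cnj: "torus_poly f \<Longrightarrow> torus_poly (\<lambda>z. cnj (f z))"
proof (induction rule: torus_poly.induct)
  case (monomial m)
  show ?case by (rule torus_poly.cong[OF torus_poly.monomial[of "- m"]]) (rule monomial_cnj[symmetric])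
next
  case (add f h)
  then have "torus_poly (\<lambda>z. cnj (f z) + cnj (h z))" by (intro torus_poly.add) auto
  then show ?case by simp
next
  case (scale f c)
  then have "torus_poly (\<lambda>z. cnj c * cnj (f z))" by (intro torus_poly.scale) auto
  then show ?case by simp
next
  case (cong f h)
  show ?case by (rule torus_poly.cong[OF cong.IH]) (simp add: cong.hyps)
qed

lemma torus_poly_const: "torus_poly (\<lambda>z. c)"
  by (rule torus_poly.cong[OF torus_poly.scale[OF torus_poly.monomial[of 0], of c]]) simp

lemma torus_poly_trig_poly:
  "torus_poly f \<Longrightarrow> \<exists>D c. finite D \<and> (\<forall>z\<in>torus. f z = trig_poly D c z)"
proof (induction rule: torus_poly.induct)
  case (monomial m)
  show ?case by (intro exI[of _ "{m}"] exI[of _ "\<lambda>_. 1"]) (simp add: trig_poly_def)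
next
  case (add f g)
  then obtain D c E d where *: "finite D" "\<And>z. z \<in> torus \<Longrightarrow> f z = trig_poly D c z"
    "finite E" "\<And>z. z \<in> torus \<Longrightarrow> g z = trig_poly E d z" by metis
  let ?c = "\<lambda>n. (if n \<in> D then c n else 0) + (if n \<in> E then d n else 0)"
  have "trig_poly (D \<union> E) ?c z
      = trig_poly D c z + trig_poly E d z" for z
  proof -
    have "(\<Sum>n\<in>D \<union> E. (if n \<in> D then c n else 0) * monomial_fun n z) = trig_poly D c z"
      unfolding trig_poly_def using *(1,3) by (intro sum.mono_neutral_cong_right) auto
    moreover have "(\<Sum>n\<in>D \<union> E. (if n \<in> E then d n else 0) * monomial_fun n z) = trig_poly E d z"
      unfolding trig_poly_def using *(1,3) by (intro sum.mono_neutral_cong_right) auto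
    ultimately show ?thesis
      unfolding trig_poly_def[of "D \<union> E"] distrib_right sum.distrib by simp
  qed
  then show ?case using * by (intro exI[of _ "D \<union> E"] exI[of _ ?c] conjI) auto
next
  case (scale f c)
  then obtain D d where "finite D" "\<forall>z\<in>torus. f z = trig_poly D d z" by blast
  then show ?case
    by (intro exI[of _ D] exI[of _ "\<lambda>n. c * d n"]) (simp add: trig_poly_def sum_distrib_left mult.assoc)
next
  case (cong f g)
  then show ?case by auto
qed

lemma trig_poly_measurable [measurable]: "trig_poly D c \<in> borel_measurable borel"
  unfolding trig_poly_def[abs_def] by (intro borel_measurable_sum borel_measurable_times) simp_all

lemma continuous_on_monomial: "continuous_on torus (monomial_fun n)"
  unfolding monomial_fun_def[abs_def]
  by (intro continuous_on_prod continuous_on_power_int continuous_intros) (auto simp: torus_nonzero)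

lemma continuous_on_torus_poly: "torus_poly f \<Longrightarrow> continuous_on torus f"
proof (induction rule: torus_poly.induct)
  case (cong f g)
  then show ?case using continuous_on_cong[of torus torus f g] by auto
qed (auto intro: continuous_on_monomial continuous_intros)

text \<open>Real Stone-Weierstrass for the real functions that agree on the torus with trigonometric
  polynomials; real and imaginary parts of the coordinates separate points.\<close>

lemma trig_poly_approximation:
  fixes f :: "complex^'n::finite \<Rightarrow> real"
  assumes "continuous_on torus f" "e > 0"
  shows "\<exists>D c. finite D \<and> (\<forall>z\<in>torus. \<bar>f z - Re (trig_poly D c z)\<bar> < e)"
proof -
  define R where "R = {g :: complex^'n \<Rightarrow> real. torus_poly (\<lambda>z. complex_of_real (g z))}"
  interpret function_ring_on R torus
  proof
    show "compact (torus :: (complex^'n) set)" by (rule compact_torus)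
    show "continuous_on torus g" if "g \<in> R" for g
      using continuous_on_Re[OF continuous_on_torus_poly, of "\<lambda>z. complex_of_real (g z)"] that
      by (simp add: R_def)
    show "(\<lambda>z. g z + h z) \<in> R" "(\<lambda>z. g z * h z) \<in> R" if "g \<in> R" "h \<in> R" for g h
      using that by (auto simp: R_def intro: torus_poly.add torus_poly_mult)
    show "(\<lambda>_. c) \<in> R" for c by (simp add: R_def torus_poly_const)
    fix x y :: "complex^'n" assume "x \<in> torus" "y \<in> torus" "x \<noteq> y"
    then obtain i where i: "x $ i \<noteq> y $ i" by (auto simp: vec_eq_iff)
    have coord: "torus_poly (\<lambda>z :: complex^'n. z $ i)"
    proof (rule torus_poly.cong[OF torus_poly.monomial[of "axis i 1"]])
      fix z :: "complex^'n"
      have "monomial_fun (axis i 1) z = (\<Prod>j\<in>UNIV. if j = i then z $ i else 1)"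
        unfolding monomial_fun_def by (intro prod.cong) (auto simp: axis_def)
      then show "monomial_fun (axis i 1) z = z $ i" by simp
    qed
    have "torus_poly (\<lambda>z. (1/2) * (z $ i + cnj (z $ i)))"
      by (intro torus_poly.scale torus_poly.add torus_poly_cnj coord)
    then have re: "(\<lambda>z. Re (z $ i)) \<in> R"
      unfolding R_def by (auto elim!: torus_poly.cong simp: complex_add_cnj)
    have "torus_poly (\<lambda>z. (- \<i>/2) * (z $ i + (-1) * cnj (z $ i)))"
      by (intro torus_poly.scale torus_poly.add torus_poly_cnj coord)
    then have im: "(\<lambda>z. Im (z $ i)) \<in> R"
      unfolding R_def by (auto elim!: torus_poly.cong simp: complex_eq_iff)
    show "\<exists>f\<in>R. f x \<noteq> f y" using re im i by (metis complex_eqI)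
  qed
  obtain g where g: "g \<in> R" "\<And>z. z \<in> torus \<Longrightarrow> \<bar>f z - g z\<bar> < e"
    using Stone_Weierstrass_basic[OF assms] by blast
  then obtain D c where "finite D" "\<forall>z\<in>torus. complex_of_real (g z) = trig_poly D c z"
    using torus_poly_trig_poly unfolding R_def by blast
  then show ?thesis using g(2) by (intro exI[of _ D] exI[of _ c]) (metis Re_complex_of_real)
qed

section \<open>Uniqueness of Fourier coefficients\<close>

lemma space_UNIV_if_sets_borel: "sets M = sets borel \<Longrightarrow> space M = UNIV"
  using sets_eq_imp_space_eq[of M borel] by simp

lemma integral_continuous_eq:
  fixes M M' :: "(complex^'n::finite) measure" and f :: "complex^'n \<Rightarrow> real"
  assumes M: "finite_measure M" "sets M = sets borel" "AE z in M. z \<in> torus"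
    and M': "finite_measure M'" "sets M' = sets borel" "AE z in M'. z \<in> torus"
    and eq: "\<And>n. (\<integral>z. monomial_fun n z \<partial>M) = (\<integral>z. monomial_fun n z \<partial>M')"
    and f: "continuous_on UNIV f"
  shows "(\<integral>z. f z \<partial>M) = (\<integral>z. f z \<partial>M')"
proof -
  have fb: "f \<in> borel_measurable borel" using f by (rule borel_measurable_continuous_onI)
  have ft: "continuous_on torus f" using f continuous_on_subset by blast
  have mass: "measure M UNIV = measure M' UNIV"
  proof -
    have "space M = UNIV" "space M' = UNIV" by (rule space_UNIV_if_sets_borel[OF M(2)] space_UNIV_if_sets_borel[OF M'(2)])+
    then show ?thesis using eq[of 0] by simp
  qed
  obtain C where C: "\<And>z. z \<in> torus \<Longrightarrow> norm (f z) \<le> C"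
    using compact_imp_bounded[OF compact_continuous_image[OF ft compact_torus]] by (auto simp: bounded_iff)
  have "\<bar>(\<integral>z. f z \<partial>M) - (\<integral>z. f z \<partial>M')\<bar> \<le> 0 + e" if "e > 0" for e :: real
  proof -
    define m where "m = measure M UNIV"
    \<comment> \<open>Each of the two integrals is off by at most \<open>d * m\<close>;
      \<open>m + 1\<close> covers total mass 0.\<close>
    define d where "d = e / (2 * (m + 1))"
    have m: "m \<ge> 0" by (simp add: m_def)
    have d: "d > 0" using that m by (simp add: d_def)
    obtain D c where Dc: "finite D" "\<And>z. z \<in> torus \<Longrightarrow> \<bar>f z - Re (trig_poly D c z)\<bar> < d"
      using trig_poly_approximation[OF ft d] by metis
    let ?p = "trig_poly D c"
    have close: "\<bar>(\<integral>z. f z \<partial>K) - Re (\<integral>z. ?p z \<partial>K)\<bar> \<le> d * m"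
      if K: "finite_measure K" "sets K = sets borel" "AE z in K. z \<in> torus" "measure K UNIV = m" for K
    proof -
      have sp: "space K = UNIV" by (rule space_UNIV_if_sets_borel[OF K(2)])
      have int_f: "integrable K f" by (rule integrable_bounded_torus[OF K(1-3) fb C])
      have int_p: "integrable K ?p"
        unfolding trig_poly_def[abs_def]
        by (intro Bochner_Integration.integrable_sum integrable_mult_right integrable_monomial K)
      have int_d: "integrable K (\<lambda>z. d)" by (rule finite_measure.integrable_const[OF K(1)])
      have int: "integrable K (\<lambda>z. f z - Re (?p z))" using int_f int_p by auto
      have "(\<integral>z. f z \<partial>K) - Re (\<integral>z. ?p z \<partial>K) = (\<integral>z. f z - Re (?p z) \<partial>K)"
        using int_f int_p by (subst Bochner_Integration.integral_diff) (auto simp: integral_Re)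
      also have "\<bar>\<dots>\<bar> \<le> (\<integral>z. \<bar>f z - Re (?p z)\<bar> \<partial>K)" by (rule integral_abs_bound)
      also have "\<dots> \<le> (\<integral>z. d \<partial>K)"
        using K(3) Dc(2) int int_d by (intro integral_mono_AE) (auto elim!: eventually_mono intro: less_imp_le)
      also have "\<dots> = d * m" using K(4) sp by simp
      finally show ?thesis .
    qed
    have p_eq: "(\<integral>z. ?p z \<partial>M) = (\<integral>z. ?p z \<partial>M')"
      unfolding trig_poly_def[abs_def]
      by (subst (1 2) Bochner_Integration.integral_sum)
        (auto intro!: integrable_mult_right integrable_monomial M M' simp: eq)
    have "\<bar>(\<integral>z. f z \<partial>M) - (\<integral>z. f z \<partial>M')\<bar> \<le> 2 * (d * m)"
      using close[OF M] close[OF M'] mass p_eq by (simp add: m_def)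
    also have "\<dots> \<le> e" using m that by (simp add: d_def field_simps)
    finally show ?thesis by simp
  qed
  then have "\<bar>(\<integral>z. f z \<partial>M) - (\<integral>z. f z \<partial>M')\<bar> \<le> 0" by (rule field_le_epsilon)
  then show ?thesis by simp
qed

text \<open>Continuous cut-offs of the distance converge to the indicator of a closed set, and
  closed sets form an intersection-stable generator. Stated for measures, the result serves both the
  totality of the characters and the invariance of Haar measure.\<close>

lemma measure_eq_if_fourier_eq:
  fixes M M' :: "(complex^'n::finite) measure"
  assumes M: "finite_measure M" "sets M = sets borel" "AE z in M. z \<in> torus"
    and M': "finite_measure M'" "sets M' = sets borel" "AE z in M'. z \<in> torus"
    and eq: "\<And>n. (\<integral>z. monomial_fun n z \<partial>M) = (\<integral>z. monomial_fun n z \<partial>M')"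
  shows "M = M'"
proof -
  \<comment> \<open>Nonemptiness matters here: \<open>infdist\<close> to the empty set is 0, which
    would turn every cut-off into the constant 1.\<close>
  have closed_eq: "measure M C = measure M' C" if C: "closed C" "C \<noteq> {}" for C
  proof -
    define f where "f n z = max 0 (1 - real n * infdist z C)" for n z
    have lim: "(\<lambda>n. f n z) \<longlonglongrightarrow> indicator C z" for z
    proof (cases "z \<in> C")
      case True then show ?thesis by (simp add: f_def)
    next
      case False
      then have pos: "infdist z C > 0" using C infdist_pos_not_in_closed by blast
      then obtain n\<^sub>0 where n\<^sub>0: "1 < real n\<^sub>0 * infdist z C" using reals_Archimedean3 by blast
      have "f n z = 0" if "n \<ge> n\<^sub>0" for n
      proof -
        have "real n\<^sub>0 * infdist z C \<le> real n * infdist z C" using that pos by (intro mult_right_mono) auto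
        then show ?thesis using n\<^sub>0 by (simp add: f_def)
      qed
      then show ?thesis using False
        by (intro tendsto_eventually eventually_sequentiallyI[of n\<^sub>0]) simp
    qed
    have cont: "continuous_on UNIV (f n)" for n
      unfolding f_def by (intro continuous_intros)
    have int_lim: "(\<lambda>n. \<integral>z. f n z \<partial>K) \<longlonglongrightarrow> measure K C"
      if K: "finite_measure K" "sets K = sets borel" for K :: "(complex^'n) measure"
    proof -
      have sp: "space K = UNIV" by (rule space_UNIV_if_sets_borel[OF K(2)])
      have "(\<lambda>n. \<integral>z. f n z \<partial>K) \<longlonglongrightarrow> (\<integral>z. indicator C z \<partial>K)"
      proof (rule integral_dominated_convergence[where w = "\<lambda>_. 1"])
        show "indicat_real C \<in> borel_measurable K" using borel_closed[OF C(1)] by (intro borel_measurable_indicator) (simp add: K(2))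
        show "f n \<in> borel_measurable K" for n
          using borel_measurable_continuous_onI[OF cont] by (simp add: measurable_cong_sets[OF K(2) refl])
        show "integrable K (\<lambda>_. 1 :: real)" by (rule finite_measure.integrable_const[OF K(1)])
        show "AE z in K. norm (f n z) \<le> 1" for n by (auto simp: f_def infdist_nonneg)
      qed (simp add: lim)
      then show ?thesis using sp by simp
    qed
    have "(\<integral>z. f n z \<partial>M) = (\<integral>z. f n z \<partial>M')" for n
      by (rule integral_continuous_eq[OF M M' eq cont])
    then show ?thesis using int_lim[OF M(1,2)] int_lim[OF M'(1,2)] LIMSEQ_unique by simp
  qed
  show ?thesis
  proof (rule measure_eqI_generator_eq[where E = "Collect closed" and \<Omega> = UNIV and A = "\<lambda>_. UNIV"])
    show "Int_stable (Collect closed :: (complex^'n) set set)" by (auto intro!: Int_stableI)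
    show "sets M = sigma_sets UNIV (Collect closed)" "sets M' = sigma_sets UNIV (Collect closed)"
      using M(2) M'(2) borel_eq_closed by (metis sets_measure_of Pow_UNIV subset_UNIV)+
    show "emeasure M X = emeasure M' X" if "X \<in> Collect closed" for X
      using closed_eq[of X] that M(1) M'(1)
      by (cases "X = {}") (simp_all add: finite_measure.emeasure_eq_measure)
    show "emeasure M UNIV \<noteq> \<infinity>" using M(1) by (simp add: finite_measure.emeasure_eq_measure)
  qed auto
qed

text \<open>The positive and negative parts of \<open>g\<close> are densities of two finite measures
  with the same Fourier coefficients.\<close>

lemma AE_zero_if_fourier_zero_real:
  fixes g :: "complex^'n::finite \<Rightarrow> real"
  assumes g: "integrable torus_measure g"
    and zero: "\<And>n. (\<integral>z. monomial_fun n z * complex_of_real (g z) \<partial>torus_measure) = 0"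
  shows "AE z in torus_measure. g z = 0"
proof -
  have [measurable]: "g \<in> borel_measurable borel" using borel_measurable_integrable[OF g] by simp
  have dens: "finite_measure (density torus_measure (\<lambda>z. ennreal (h z)))"
      "AE z in density torus_measure (\<lambda>z. ennreal (h z)). z \<in> torus"
      "(\<integral>z. monomial_fun n z \<partial>density torus_measure (\<lambda>z. ennreal (h z))) = (\<integral>z. h z *\<^sub>R monomial_fun n z \<partial>torus_measure)"
    if h: "integrable torus_measure h" "\<And>z. h z \<ge> 0" for h :: "complex^'n \<Rightarrow> real" and n
  proof -
    have hm [measurable]: "h \<in> borel_measurable torus_measure" using h(1) by auto
    have "(\<integral>\<^sup>+z. ennreal (h z) \<partial>torus_measure) < \<infinity>"
      using h by (simp add: nn_integral_eq_integral)
    then show "finite_measure (density torus_measure (\<lambda>z. ennreal (h z)))"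
      by (intro finite_measureI) (simp add: emeasure_density)
    show "AE z in density torus_measure (\<lambda>z. ennreal (h z)). z \<in> torus"
      by (subst AE_density) (use AE_torus in \<open>auto elim: eventually_mono\<close>)
    show "(\<integral>z. monomial_fun n z \<partial>density torus_measure (\<lambda>z. ennreal (h z))) = (\<integral>z. h z *\<^sub>R monomial_fun n z \<partial>torus_measure)"
      by (rule integral_density) (use h in auto)
  qed
  let ?p = "\<lambda>z. max 0 (g z)" and ?m = "\<lambda>z. max 0 (- g z)"
  have int: "integrable torus_measure ?p" "integrable torus_measure ?m" using g by auto
  have int_mono: "integrable torus_measure (\<lambda>z. h z *\<^sub>R monomial_fun n z)"
    if h: "integrable torus_measure h" for h :: "complex^'n \<Rightarrow> real" and n
  proof (rule Bochner_Integration.integrable_bound[OF h])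
    show "(\<lambda>z. h z *\<^sub>R monomial_fun n z) \<in> borel_measurable torus_measure" using h by (intro borel_measurable_scaleR) auto
    show "AE z in torus_measure. norm (h z *\<^sub>R monomial_fun n z) \<le> norm (h z)"
      using AE_torus by eventually_elim (simp add: cmod_monomial)
  qed
  have "density torus_measure (\<lambda>z. ennreal (?p z)) = density torus_measure (\<lambda>z. ennreal (?m z))"
  proof (rule measure_eq_if_fourier_eq)
    fix n
    have "(\<integral>z. ?p z *\<^sub>R monomial_fun n z \<partial>torus_measure) - (\<integral>z. ?m z *\<^sub>R monomial_fun n z \<partial>torus_measure)
      = (\<integral>z. ?p z *\<^sub>R monomial_fun n z - ?m z *\<^sub>R monomial_fun n z \<partial>torus_measure)"
      by (rule Bochner_Integration.integral_diff[symmetric]) (intro int_mono int)+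
    also have "\<dots> = (\<integral>z. monomial_fun n z * complex_of_real (g z) \<partial>torus_measure)"
      by (intro Bochner_Integration.integral_cong) (auto simp: max_def scaleR_conv_of_real)
    finally show "(\<integral>z. monomial_fun n z \<partial>density torus_measure (\<lambda>z. ennreal (?p z))) =
        (\<integral>z. monomial_fun n z \<partial>density torus_measure (\<lambda>z. ennreal (?m z)))"
      using zero by (simp add: dens(3) int)
  qed (use dens int in auto)
  then have "AE z in torus_measure. ennreal (?p z) = ennreal (?m z)"
    by (intro torus_measure.density_unique) auto
  then show ?thesis by eventually_elim (auto simp: max_def split: if_splits)
qed

lemma AE_zero_if_fourier_zero:
  fixes f :: "complex^'n::finite \<Rightarrow> complex"
  assumes f: "integrable torus_measure f"
    and zero: "\<And>n. (\<integral>z. monomial_fun n z * f z \<partial>torus_measure) = 0"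
  shows "AE z in torus_measure. f z = 0"
proof -
  have int: "integrable torus_measure (\<lambda>z. monomial_fun n z * f z)" for n
  proof (rule Bochner_Integration.integrable_bound[OF f])
    show "(\<lambda>z. monomial_fun n z * f z) \<in> borel_measurable torus_measure"
      using f by (intro borel_measurable_times) auto
    show "AE z in torus_measure. norm (monomial_fun n z * f z) \<le> norm (f z)"
      using AE_torus by eventually_elim (simp add: norm_mult cmod_monomial)
  qed
  have cnj_zero: "(\<integral>z. monomial_fun n z * cnj (f z) \<partial>torus_measure) = 0"
    and cnj_int: "integrable torus_measure (\<lambda>z. monomial_fun n z * cnj (f z))" for n
  proof -
    have ae: "AE z in torus_measure. cnj (monomial_fun (- n) z * f z) = monomial_fun n z * cnj (f z)"
      using AE_torus by eventually_elim (simp add: monomial_cnj)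
    have m: "(\<lambda>z. monomial_fun n z * cnj (f z)) \<in> borel_measurable torus_measure"
      using f by (intro borel_measurable_times borel_measurable_continuous_on[of cnj]) (auto intro: continuous_intros)
    have c: "integrable torus_measure (\<lambda>z. cnj (monomial_fun (- n) z * f z))"
      using int[of "- n"] by (simp only: integrable_cnj)
    show "integrable torus_measure (\<lambda>z. monomial_fun n z * cnj (f z))"
      using c m ae by (rule integrable_cong_AE_imp) 
    have "(\<integral>z. monomial_fun n z * cnj (f z) \<partial>torus_measure) = (\<integral>z. cnj (monomial_fun (- n) z * f z) \<partial>torus_measure)"
      using ae m c by (intro integral_cong_AE) auto
    also have "\<dots> = 0" using zero[of "- n"] by (simp only: Bochner_Integration.integral_cnj) simp
    finally show "(\<integral>z. monomial_fun n z * cnj (f z) \<partial>torus_measure) = 0" .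
  qed
  have "AE z in torus_measure. Re (f z) = 0"
  proof (rule AE_zero_if_fourier_zero_real)
    show "integrable torus_measure (\<lambda>z. Re (f z))" using f by auto
    fix n
    have "(\<integral>z. monomial_fun n z * complex_of_real (Re (f z)) \<partial>torus_measure) =
      (\<integral>z. (monomial_fun n z * f z + monomial_fun n z * cnj (f z)) / 2 \<partial>torus_measure)"
      by (intro Bochner_Integration.integral_cong) (simp_all add: complex_add_cnj flip: distrib_left)
    then show "(\<integral>z. monomial_fun n z * complex_of_real (Re (f z)) \<partial>torus_measure) = 0"
      using int cnj_int zero cnj_zero by simp
  qed
  moreover have "AE z in torus_measure. Im (f z) = 0"
  proof (rule AE_zero_if_fourier_zero_real)
    show "integrable torus_measure (\<lambda>z. Im (f z))" using f by auto
    fix n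
    have "(\<integral>z. monomial_fun n z * complex_of_real (Im (f z)) \<partial>torus_measure) =
      (\<integral>z. (monomial_fun n z * f z - monomial_fun n z * cnj (f z)) / (2 * \<i>) \<partial>torus_measure)"
    proof (intro Bochner_Integration.integral_cong refl)
      fix z
      have "f z - cnj (f z) = (2 * \<i>) * complex_of_real (Im (f z))" by (simp add: complex_eq_iff)
      then show "monomial_fun n z * complex_of_real (Im (f z)) =
          (monomial_fun n z * f z - monomial_fun n z * cnj (f z)) / (2 * \<i>)"
        unfolding right_diff_distrib[symmetric] by (simp only:) (simp add: field_simps)
    qed
    then show "(\<integral>z. monomial_fun n z * complex_of_real (Im (f z)) \<partial>torus_measure) = 0"
      using int cnj_int zero cnj_zero by simp
  qed
  ultimately show ?thesis by eventually_elim (simp add: complex_eq_iff)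
qed

section \<open>The Hilbert space of the torus\<close>

abbreviation SI :: "(complex^'n::finite \<Rightarrow> complex) \<Rightarrow> bool" where
  "SI \<equiv> square_integrable torus_measure"

lemma L2_rel_refl [simp]: "L2_rel f f \<longleftrightarrow> SI f"
  by (simp add: L2_rel_def)

lemma abs_rep_L2 [simp]: "abs_torus_L2 (rep_torus_L2 x) = x"
  by (rule Quotient3_abs_rep[OF Quotient3_torus_L2])

lemma SI_rep [simp]: "SI (rep_torus_L2 x)"
  using Quotient3_rel_rep[OF Quotient3_torus_L2, of x x] by simp

lemma abs_L2_eqI: "SI f \<Longrightarrow> SI g \<Longrightarrow> AE z in torus_measure. f z = g z \<Longrightarrow> abs_torus_L2 f = abs_torus_L2 g"
  using Quotient3_rel[OF Quotient3_torus_L2, of f g] by (simp add: L2_rel_def)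

lemma rep_abs_AE: "SI f \<Longrightarrow> AE z in torus_measure. rep_torus_L2 (abs_torus_L2 f) z = f z"
  using Quotient3_rep_abs[OF Quotient3_torus_L2, of f] by (simp add: L2_rel_def)

lemma abs_L2_add: "SI f \<Longrightarrow> SI g \<Longrightarrow> abs_torus_L2 f + abs_torus_L2 g = abs_torus_L2 (\<lambda>z. f z + g z)"
  by (rule plus_torus_L2.abs_eq) simp_all

lemma abs_L2_scaleC: "SI f \<Longrightarrow> c *\<^sub>C abs_torus_L2 f = abs_torus_L2 (\<lambda>z. c * f z)"
  by (rule scaleC_torus_L2.abs_eq) simp

lemma SI_diff: "SI f \<Longrightarrow> SI g \<Longrightarrow> SI (\<lambda>z. f z - g z)"
  using square_integrable_add[of torus_measure f "\<lambda>z. (-1) * g z"] square_integrable_cmult[of torus_measure g "-1"] by simp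

lemma abs_L2_diff: "SI f \<Longrightarrow> SI g \<Longrightarrow> abs_torus_L2 f - abs_torus_L2 g = abs_torus_L2 (\<lambda>z. f z - g z)"
proof -
  assume f: "SI f" and g: "SI g"
  have neg: "- abs_torus_L2 g = abs_torus_L2 (\<lambda>z. - g z)" "SI (\<lambda>z. - g z)"
    using abs_L2_scaleC[OF g, of "-1"] square_integrable_cmult[OF g, of "-1"] by simp_all
  have "abs_torus_L2 f - abs_torus_L2 g = abs_torus_L2 f + (- abs_torus_L2 g)" by simp
  also have "\<dots> = abs_torus_L2 (\<lambda>z. f z + - g z)" unfolding neg(1) by (rule abs_L2_add[OF f neg(2)])
  finally show ?thesis by simp
qed

lemma abs_L2_zero: "abs_torus_L2 (\<lambda>z. 0) = 0"
  by (simp add: zero_torus_L2_def)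

lemma cinner_abs_L2:
  "SI f \<Longrightarrow> SI g \<Longrightarrow> cinner (abs_torus_L2 f) (abs_torus_L2 g) = (\<integral>z. cnj (f z) * g z \<partial>torus_measure)"
  by (rule cinner_torus_L2.abs_eq) simp_all

lemma norm_abs_L2: "SI f \<Longrightarrow> (norm (abs_torus_L2 f))\<^sup>2 = (\<integral>z. (cmod (f z))\<^sup>2 \<partial>torus_measure)"
proof -
  assume f: "SI f"
  have "complex_of_real ((norm (abs_torus_L2 f))\<^sup>2) = (\<integral>z. cnj (f z) * f z \<partial>torus_measure)"
    using f by (simp only: cinner_self[symmetric] cinner_abs_L2)
  also have "\<dots> = (\<integral>z. complex_of_real ((cmod (f z))\<^sup>2) \<partial>torus_measure)"
    by (intro Bochner_Integration.integral_cong refl) (simp only: complex_norm_square mult.commute)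
  also have "\<dots> = complex_of_real (\<integral>z. (cmod (f z))\<^sup>2 \<partial>torus_measure)"
    by (rule integral_complex_of_real)
  finally show ?thesis by (simp only: of_real_eq_iff)
qed

section \<open>Completeness of the square integrable functions\<close>

lemma SI_measurable: "SI f \<Longrightarrow> f \<in> borel_measurable borel"
  by (simp add: square_integrable_def measurable_cong_sets[OF sets_torus_measure refl])

text \<open>On a space of mass 1 the differences have summable integrals of their moduli, so almost
  everywhere the telescoping series converges absolutely.\<close>

lemma L2_AE_convergent_subsequence:
  fixes f :: "nat \<Rightarrow> complex^'n::finite \<Rightarrow> complex"
  assumes f: "\<And>k. SI (f k)" and le: "\<And>k. norm (abs_torus_L2 (f (Suc k)) - abs_torus_L2 (f k)) \<le> (1/2) ^ k"
  shows "AE z in torus_measure. convergent (\<lambda>k. f k z)"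
proof -
  define h where "h k z = f (Suc k) z - f k z" for k z
  have h: "SI (h k)" for k unfolding h_def[abs_def] by (intro SI_diff f)
  have [measurable]: "h k \<in> borel_measurable borel" for k by (rule SI_measurable[OF h])
  have int2: "integrable torus_measure (\<lambda>z. (cmod (h k z))\<^sup>2)" for k using h by (simp add: square_integrable_def)
  have int_h: "(\<integral>\<^sup>+z. ennreal (cmod (h k z)) \<partial>torus_measure) \<le> ennreal ((1/2) ^ k)" for k
  proof -
    define c :: real where "c = (1/2) ^ k"
    have c: "c > 0" by (simp add: c_def)
    \<comment> \<open>The arithmetic-geometric mean inequality weighted by the L2 bound
      \<open>c\<close> itself, so that after integration both terms are at most
      \<open>c / 2\<close>.\<close>
    have pt: "cmod w \<le> (cmod w)\<^sup>2 / (2 * c) + c / 2" for w :: complex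
    proof -
      have "0 \<le> (cmod w - c)\<^sup>2 / (2 * c)" using c by simp
      also have "(cmod w - c)\<^sup>2 / (2 * c) = (cmod w)\<^sup>2 / (2 * c) + c / 2 - cmod w"
        using c by (simp add: power2_diff field_simps power2_eq_square)
      finally show ?thesis by simp
    qed
    have sq: "(\<integral>z. (cmod (h k z))\<^sup>2 \<partial>torus_measure) \<le> c\<^sup>2"
    proof -
      have diff: "abs_torus_L2 (h k) = abs_torus_L2 (f (Suc k)) - abs_torus_L2 (f k)"
        by (subst abs_L2_diff[OF f f]) (simp add: h_def[abs_def])
      have "(norm (abs_torus_L2 (h k)))\<^sup>2 \<le> c\<^sup>2"
        unfolding diff c_def by (rule power_mono[OF le norm_ge_zero])
      then show ?thesis unfolding norm_abs_L2[OF h] .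
    qed
    have int_r: "integrable torus_measure (\<lambda>z. (cmod (h k z))\<^sup>2 / (2 * c) + c / 2)" using int2 by auto
    have "(\<integral>\<^sup>+z. ennreal (cmod (h k z)) \<partial>torus_measure)
        \<le> (\<integral>\<^sup>+z. ennreal ((cmod (h k z))\<^sup>2 / (2 * c) + c / 2) \<partial>torus_measure)"
      by (intro nn_integral_mono ennreal_leI pt)
    also have "\<dots> = ennreal (\<integral>z. (cmod (h k z))\<^sup>2 / (2 * c) + c / 2 \<partial>torus_measure)"
      using c by (intro nn_integral_eq_integral int_r) auto
    also have "(\<integral>z. (cmod (h k z))\<^sup>2 / (2 * c) + c / 2 \<partial>torus_measure)
        = (\<integral>z. (cmod (h k z))\<^sup>2 \<partial>torus_measure) / (2 * c) + c / 2"
      using int2 by (simp add: measure_def emeasure_torus_measure)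
    also have "ennreal \<dots> \<le> ennreal (c\<^sup>2 / (2 * c) + c / 2)"
      using sq c by (intro ennreal_leI add_right_mono divide_right_mono) auto
    also have "c\<^sup>2 / (2 * c) + c / 2 = c" using c by (simp add: power2_eq_square)
    finally show ?thesis by (simp add: c_def)
  qed
  have "(\<integral>\<^sup>+z. (\<Sum>k. ennreal (cmod (h k z))) \<partial>torus_measure) = (\<Sum>k. \<integral>\<^sup>+z. ennreal (cmod (h k z)) \<partial>torus_measure)"
    by (rule nn_integral_suminf) simp
  also have "\<dots> \<le> (\<Sum>k. ennreal ((1/2) ^ k))" by (intro suminf_le int_h) auto
  also have "\<dots> = ennreal (\<Sum>k. (1/2) ^ k)" by (intro suminf_ennreal2) auto
  also have "\<dots> < \<infinity>" by simp
  finally have "AE z in torus_measure. (\<Sum>k. ennreal (cmod (h k z))) \<noteq> \<infinity>"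
    by (intro nn_integral_PInf_AE) auto
  then show ?thesis
  proof eventually_elim
    fix z assume "(\<Sum>k. ennreal (cmod (h k z))) \<noteq> \<infinity>"
    then have "summable (\<lambda>k. cmod (h k z))" by (intro summable_suminf_not_top) auto
    then have "summable (\<lambda>k. h k z)" by (rule summable_norm_cancel)
    then have "convergent (\<lambda>n. \<Sum>k<n. h k z)" by (simp add: summable_iff_convergent)
    moreover have "(\<Sum>k<n. h k z) = f n z - f 0 z" for n
      unfolding h_def by (rule sum_lessThan_telescope)
    ultimately have "convergent (\<lambda>n. f n z - f 0 z)" by simp
    then show "convergent (\<lambda>n. f n z)" using convergent_add[OF _ convergent_const[of "f 0 z"]] by fastforce
  qed
qed

lemma L2_complete:
  fixes X :: "nat \<Rightarrow> 'n::finite torus_L2"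
  assumes "Cauchy X" shows "convergent X"
proof -
  have "\<exists>M. \<forall>m\<ge>M. \<forall>n\<ge>M. dist (X m) (X n) < (1/2) ^ k" for k :: nat
    using metric_CauchyD[OF assms, of "(1/2) ^ k"] by simp
  then obtain M where M: "\<And>k m n. m \<ge> M k \<Longrightarrow> n \<ge> M k \<Longrightarrow> dist (X m) (X n) < (1/2) ^ k" by metis
  \<comment> \<open>A sum in place of \<open>M k\<close>, so that \<open>r l\<close> dominates
    \<open>M k\<close> for every \<open>k \<le> l\<close>.\<close>
  define r where "r k = (\<Sum>j\<le>k. M j)" for k
  have r_ge: "M k \<le> r l" if "k \<le> l" for k l
    unfolding r_def by (rule member_le_sum) (use that in auto)
  define f where "f k = rep_torus_L2 (X (r k))" for k
  have f: "SI (f k)" "abs_torus_L2 (f k) = X (r k)" for k by (simp_all add: f_def)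
  have dist_f: "norm (X (r m) - X (r k)) \<le> (1/2) ^ k" if "k \<le> m" for k m
    using M[of k "r m" "r k"] r_ge[of k m] r_ge[of k k] that by (simp add: dist_norm)
  have ae: "AE z in torus_measure. convergent (\<lambda>k. f k z)"
    by (rule L2_AE_convergent_subsequence) (use f dist_f[of _ "Suc _"] in auto)
  define F where "F z = lim (\<lambda>k. f k z)" for z
  have fm [measurable]: "f k \<in> borel_measurable borel" for k by (rule SI_measurable[OF f(1)])
  have [measurable]: "F \<in> borel_measurable borel"
    unfolding F_def[abs_def] by (rule borel_measurable_lim_metric) simp
  have ae_lim: "AE z in torus_measure. (\<lambda>k. f k z) \<longlonglongrightarrow> F z"
    using ae by eventually_elim (simp add: F_def convergent_LIMSEQ_iff)
  \<comment> \<open>Fatou's lemma along \<open>m\<close>, with \<open>k\<close> fixed.\<close>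
  have bound: "(\<integral>\<^sup>+z. ennreal ((cmod (F z - f k z))\<^sup>2) \<partial>torus_measure) \<le> ennreal (((1/2) ^ k)\<^sup>2)" for k
  proof -
    have "(\<integral>\<^sup>+z. ennreal ((cmod (F z - f k z))\<^sup>2) \<partial>torus_measure)
        = (\<integral>\<^sup>+z. liminf (\<lambda>m. ennreal ((cmod (f m z - f k z))\<^sup>2)) \<partial>torus_measure)"
    proof (rule nn_integral_cong_AE)
      show "AE z in torus_measure. ennreal ((cmod (F z - f k z))\<^sup>2) = liminf (\<lambda>m. ennreal ((cmod (f m z - f k z))\<^sup>2))"
        using ae_lim
      proof eventually_elim
        fix z assume "(\<lambda>k. f k z) \<longlonglongrightarrow> F z"
        then have "(\<lambda>m. ennreal ((cmod (f m z - f k z))\<^sup>2)) \<longlonglongrightarrow> ennreal ((cmod (F z - f k z))\<^sup>2)"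
          by (intro tendsto_ennrealI tendsto_intros)
        then show "ennreal ((cmod (F z - f k z))\<^sup>2) = liminf (\<lambda>m. ennreal ((cmod (f m z - f k z))\<^sup>2))"
          using lim_imp_Liminf[OF trivial_limit_sequentially] by metis
      qed
    qed
    also have "\<dots> \<le> liminf (\<lambda>m. \<integral>\<^sup>+z. ennreal ((cmod (f m z - f k z))\<^sup>2) \<partial>torus_measure)"
      by (rule nn_integral_liminf) simp
    also have "\<dots> \<le> ennreal (((1/2) ^ k)\<^sup>2)"
    proof (rule Liminf_le)
      show "\<forall>\<^sub>F m in sequentially. (\<integral>\<^sup>+z. ennreal ((cmod (f m z - f k z))\<^sup>2) \<partial>torus_measure) \<le> ennreal (((1/2) ^ k)\<^sup>2)"
      proof (rule eventually_sequentiallyI[of k])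
        fix m assume "k \<le> m"
        have s: "SI (\<lambda>z. f m z - f k z)" by (intro SI_diff f)
        have "(\<integral>\<^sup>+z. ennreal ((cmod (f m z - f k z))\<^sup>2) \<partial>torus_measure) = ennreal ((norm (X (r m) - X (r k)))\<^sup>2)"
        proof -
          have "abs_torus_L2 (\<lambda>z. f m z - f k z) = X (r m) - X (r k)"
            by (simp only: abs_L2_diff[OF f(1) f(1), symmetric] f(2))
          then show ?thesis
            using s norm_abs_L2[OF s] by (subst nn_integral_eq_integral) (auto simp: square_integrable_def)
        qed
        also have "\<dots> \<le> ennreal (((1/2) ^ k)\<^sup>2)"
          using dist_f[OF \<open>k \<le> m\<close>] by (intro ennreal_leI power_mono) auto
        finally show "(\<integral>\<^sup>+z. ennreal ((cmod (f m z - f k z))\<^sup>2) \<partial>torus_measure) \<le> ennreal (((1/2) ^ k)\<^sup>2)" .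
      qed
    qed simp
    finally show ?thesis .
  qed
  have SI_Ff: "SI (\<lambda>z. F z - f k z)" for k
  proof -
    have "(\<integral>\<^sup>+z. ennreal ((cmod (F z - f k z))\<^sup>2) \<partial>torus_measure) < \<infinity>"
      using bound[of k] by (rule le_less_trans) simp
    then show ?thesis
      by (auto simp: square_integrable_def intro!: integrableI_bounded)
  qed
  have F: "SI F" using square_integrable_add[OF SI_Ff[of 0] f(1)[of 0]] by simp
  have close: "norm (abs_torus_L2 F - X (r k)) \<le> (1/2) ^ k" for k
  proof -
    have "ennreal ((norm (abs_torus_L2 F - X (r k)))\<^sup>2) = (\<integral>\<^sup>+z. ennreal ((cmod (F z - f k z))\<^sup>2) \<partial>torus_measure)"
    proof -
      have "abs_torus_L2 (\<lambda>z. F z - f k z) = abs_torus_L2 F - X (r k)"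
        by (simp only: abs_L2_diff[OF F f(1), symmetric] f(2))
      then show ?thesis
        using SI_Ff[of k] norm_abs_L2[OF SI_Ff[of k]]
        by (subst nn_integral_eq_integral) (auto simp: square_integrable_def)
    qed
    then have "ennreal ((norm (abs_torus_L2 F - X (r k)))\<^sup>2) \<le> ennreal (((1/2) ^ k)\<^sup>2)" using bound[of k] by simp
    then have "(norm (abs_torus_L2 F - X (r k)))\<^sup>2 \<le> ((1/2) ^ k)\<^sup>2" by (subst (asm) ennreal_le_iff) simp_all
    then show ?thesis by (rule power2_le_imp_le) simp
  qed
  have "X \<longlonglongrightarrow> abs_torus_L2 F"
  proof (rule metric_LIMSEQ_I)
    fix e :: real assume "e > 0"
    then obtain k where k: "(1/2) ^ k < e / 2" using real_arch_pow_inv[of "e / 2" "1/2"] by auto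
    have "dist (X n) (abs_torus_L2 F) < e" if "n \<ge> M k" for n
    proof -
      have "dist (X n) (abs_torus_L2 F) \<le> dist (X n) (X (r k)) + dist (X (r k)) (abs_torus_L2 F)" by (rule dist_triangle)
      also have "\<dots> < e"
        using M[OF that r_ge[of k k]] close[of k] k by (simp add: dist_norm norm_minus_commute)
      finally show ?thesis .
    qed
    then show "\<exists>n\<^sub>0. \<forall>n\<ge>n\<^sub>0. dist (X n) (abs_torus_L2 F) < e" by blast
  qed
  then show ?thesis by (rule convergentI)
qed

instance torus_L2 :: (finite) complete_space
  by standard (rule L2_complete)

section \<open>The Fourier vectors as a total orthonormal system\<close>

lemma SI_bounded:
  assumes "f \<in> borel_measurable borel" "\<And>z. z \<in> torus \<Longrightarrow> cmod (f z) \<le> C"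
  shows "SI (f :: complex^'n::finite \<Rightarrow> complex)"
proof -
  have "(cmod (f z))\<^sup>2 \<le> C\<^sup>2" if "z \<in> torus" for z using assms(2)[OF that] by (intro power_mono) auto
  then show ?thesis
    using assms(1) torus_measure.finite_measure_axioms
    by (auto simp: square_integrable_def intro!: integrable_bounded_torus[where C = "C\<^sup>2"] AE_torus)
qed

lemma SI_monomial [simp]: "SI (monomial_fun n)"
  by (rule SI_bounded[where C = 1]) (simp_all add: cmod_monomial)

lemma cmod_trig_poly: "z \<in> torus \<Longrightarrow> cmod (trig_poly D c z) \<le> (\<Sum>n\<in>D. cmod (c n))"
  unfolding trig_poly_def by (rule order_trans[OF norm_sum]) (simp add: norm_mult cmod_monomial)

lemma SI_trig_poly [simp]: "SI (trig_poly D c)"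
  by (rule SI_bounded[OF _ cmod_trig_poly]) simp_all

lemma cinner_fourier_vec: "cinner (fourier_vec m) (fourier_vec n) = (if m = n then 1 else 0)"
proof -
  have "cinner (fourier_vec m) (fourier_vec n) = (\<integral>z. cnj (monomial_fun m z) * monomial_fun n z \<partial>torus_measure)"
    unfolding fourier_vec_def by (rule cinner_abs_L2) simp_all
  also have "\<dots> = (\<integral>z. monomial_fun (n - m) z \<partial>torus_measure)"
  proof (rule integral_cong_AE)
    show "AE z in torus_measure. cnj (monomial_fun m z) * monomial_fun n z = monomial_fun (n - m) z"
      using AE_torus by eventually_elim (simp add: monomial_diff mult.commute)
  qed (auto intro!: borel_measurable_times borel_measurable_continuous_on[of cnj] continuous_intros)
  finally show ?thesis by (auto simp: integral_monomial)
qed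

lemma fourier_vec_inj: "fourier_vec m = fourier_vec n \<longleftrightarrow> m = n"
  using cinner_fourier_vec[of m n] cinner_fourier_vec[of m m] by (auto split: if_splits)

lemma fourier_vec_total:
  assumes "\<And>n. cinner (fourier_vec n) x = 0" shows "x = 0"
proof -
  let ?f = "rep_torus_L2 x"
  have one: "SI (\<lambda>z. 1)" by (rule SI_bounded[where C = 1]) auto
  have "integrable torus_measure (\<lambda>z. cnj 1 * ?f z)" by (rule square_integrable_mult[OF one]) simp
  then have int: "integrable torus_measure ?f" by simp
  have "(\<integral>z. monomial_fun n z * ?f z \<partial>torus_measure) = 0" for n
  proof -
    have "cinner (fourier_vec (- n)) (abs_torus_L2 ?f) = (\<integral>z. cnj (monomial_fun (- n) z) * ?f z \<partial>torus_measure)"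
      unfolding fourier_vec_def by (rule cinner_abs_L2) simp_all
    also have "\<dots> = (\<integral>z. monomial_fun n z * ?f z \<partial>torus_measure)"
    proof (rule integral_cong_AE)
      show "AE z in torus_measure. cnj (monomial_fun (- n) z) * ?f z = monomial_fun n z * ?f z"
        using AE_torus by eventually_elim (simp add: monomial_cnj)
    qed (use SI_rep[of x, unfolded square_integrable_def] in \<open>auto intro!: borel_measurable_times borel_measurable_continuous_on[of cnj] continuous_intros\<close>)
    finally show ?thesis using assms[of "- n"] by simp
  qed
  then have "AE z in torus_measure. ?f z = 0" by (rule AE_zero_if_fourier_zero[OF int])
  then have "abs_torus_L2 ?f = abs_torus_L2 (\<lambda>z. 0)" by (intro abs_L2_eqI) (auto simp: square_integrable_zero)
  then show ?thesis by (simp add: abs_L2_zero)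
qed

lemma fourier_vec_ext: "(\<And>n. cinner (fourier_vec n) x = cinner (fourier_vec n) y) \<Longrightarrow> x = y"
  using fourier_vec_total[of "x - y"] by (simp add: cinner_diff_right)

lemma closure_fourier: "closure (cspan (range fourier_vec)) = (UNIV :: 'n::finite torus_L2 set)"
  by (rule closure_eq_UNIV_if_orthogonal_trivial) (auto intro!: fourier_vec_total complex_vector.span_base)

lemma bops_fourier_ext:
  fixes A B :: "'n::finite torus_L2 \<Rightarrow> 'b::complex_inner"
  assumes A: "A \<in> bops UNIV UNIV" and B: "B \<in> bops UNIV UNIV"
    and eq: "\<And>n. A (fourier_vec n) = B (fourier_vec n)"
  shows "A = B"
proof (rule bops_eq_on_dense[OF A B closure_fourier])
  fix x :: "'n torus_L2" assume "x \<in> cspan (range fourier_vec)"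
  then show "A x = B x"
    by (induction rule: complex_vector.span_induct_alt)
      (auto simp: bops_0[OF A] bops_0[OF B] bops_add[OF A] bops_add[OF B] bops_scaleC[OF A] bops_scaleC[OF B] eq)
qed

lemma abs_trig_poly: "abs_torus_L2 (trig_poly D c) = (\<Sum>n\<in>D. c n *\<^sub>C fourier_vec n)"
proof (induction D rule: infinite_finite_induct)
  case (insert m D)
  have "trig_poly (insert m D) c = (\<lambda>z. c m * monomial_fun m z + trig_poly D c z)"
    using insert by (auto simp: trig_poly_def)
  then have "abs_torus_L2 (trig_poly (insert m D) c) = c m *\<^sub>C fourier_vec m + abs_torus_L2 (trig_poly D c)"
    unfolding fourier_vec_def by (simp add: abs_L2_add abs_L2_scaleC square_integrable_cmult)
  then show ?case using insert by simp
qed (simp_all add: trig_poly_def[abs_def] abs_L2_zero)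

section \<open>The Cuntz relations for polynomial data\<close>

lemma torus_power_in: "z \<in> torus \<Longrightarrow> torus_power z A \<in> torus"
  by (simp add: torus_def torus_power_def norm_power_int flip: prod_norm)

lemma power_int_sum: "x \<noteq> (0::complex) \<Longrightarrow> (\<Prod>j\<in>J. x powi f j) = x powi (\<Sum>j\<in>J. f j)"
  by (induction J rule: infinite_finite_induct) (simp_all add: power_int_add)

lemma power_int_prod: "(\<Prod>j\<in>J. f j) powi n = (\<Prod>j\<in>J. (f j :: complex) powi n)"
  by (induction J rule: infinite_finite_induct) (simp_all add: power_int_mult_distrib)

lemma monomial_torus_power:
  assumes "z \<in> torus" shows "monomial_fun n (torus_power z A) = monomial_fun (A *v n) z"
proof -
  have "monomial_fun n (torus_power z A) = (\<Prod>j\<in>UNIV. \<Prod>i\<in>UNIV. (z $ i) powi (A $ i $ j * n $ j))"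
    by (simp add: monomial_fun_def torus_power_def power_int_prod power_int_mult)
  also have "\<dots> = (\<Prod>i\<in>UNIV. \<Prod>j\<in>UNIV. (z $ i) powi (A $ i $ j * n $ j))" by (rule prod.swap)
  also have "\<dots> = monomial_fun (A *v n) z"
    by (simp add: monomial_fun_def matrix_vector_mult_def power_int_sum torus_nonzero[OF assms])
  finally show ?thesis .
qed

lemma torus_power_measurable [measurable]: "(\<lambda>z :: complex^'n::finite. torus_power z A) \<in> borel_measurable borel"
proof -
  have "(\<lambda>z :: complex^'n. z $ i) \<in> borel_measurable borel" for i
    by (intro borel_measurable_continuous_onI continuous_intros)
  then have "(\<lambda>z :: complex^'n. (z $ i) powi k) \<in> borel_measurable borel" for i k
    unfolding power_int_def by (cases "k \<ge> 0") (auto intro!: borel_measurable_power borel_measurable_inverse)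
  then have "(\<lambda>z :: complex^'n. \<Prod>i\<in>UNIV. (z $ i) powi (A $ i $ j)) \<in> borel_measurable borel" for j
    by (intro borel_measurable_prod)
  then have "(\<lambda>z :: complex^'n. torus_power z A \<bullet> b) \<in> borel_measurable borel" if b: "b \<in> Basis" for b
  proof -
    assume *: "\<And>j. (\<lambda>z :: complex^'n. \<Prod>i\<in>UNIV. (z $ i) powi (A $ i $ j)) \<in> borel_measurable borel"
    obtain j u where "b = axis j u" using b by (auto simp: Basis_vec_def)
    then have "(\<lambda>z :: complex^'n. torus_power z A \<bullet> b) = (\<lambda>z. (\<Prod>i\<in>UNIV. (z $ i) powi (A $ i $ j)) \<bullet> u)"
      by (auto simp: inner_axis torus_power_def)
    then show ?thesis using * by (simp add: borel_measurable_inner)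
  qed
  then show ?thesis by (subst borel_measurable_euclidean_space) blast
qed

section \<open>The lattice map, its dual kernel and the invariance of Haar measure\<close>

lemma map_matrix_mult_vec:
  "map_matrix real_of_int A *v (\<chi> i. real_of_int (n $ i)) = (\<chi> i. real_of_int ((A *v n) $ i))"
  by (simp add: matrix_vector_mult_def vec_eq_iff map_matrix_def)

lemma det_map_matrix_of_int: "det (map_matrix real_of_int A) = real_of_int (det (A :: int^'n::finite^'n))"
  by (simp add: det_def map_matrix_def)

lemma exists_real_inverse:
  fixes A :: "int^'n::finite^'n"
  assumes "det A \<noteq> 0"
  obtains C where "C ** map_matrix real_of_int A = mat 1" "map_matrix real_of_int A ** C = mat 1"
proof -
  have "invertible (map_matrix real_of_int A)" using assms by (simp add: invertible_det_nz det_map_matrix_of_int)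
  then show thesis using that unfolding invertible_def by blast
qed

lemma int_matrix_inj:
  fixes A :: "int^'n::finite^'n"
  assumes "det A \<noteq> 0" shows "inj ((*v) A)"
proof (rule injI)
  fix m n assume eq: "A *v m = A *v n"
  obtain C where C: "C ** map_matrix real_of_int A = mat 1" using exists_real_inverse[OF assms] .
  have key: "(\<chi> i. real_of_int (k $ i)) = C *v (\<chi> i. real_of_int ((A *v k) $ i))" for k
    by (simp only: map_matrix_mult_vec[of A k, symmetric] matrix_vector_mul_assoc C matrix_vector_mul_lid)
  have "(\<chi> i. real_of_int (m $ i)) = (\<chi> i. real_of_int (n $ i))" by (simp only: key[of m] key[of n] eq)
  then show "m = n" by (simp add: vec_eq_iff)
qed

lemma cis_eq_1_Ints: "cis (2 * pi * x) = 1 \<Longrightarrow> x \<in> \<int>"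
proof -
  assume "cis (2 * pi * x) = 1"
  then have "cos (2 * pi * x) = 1" by (metis cis.sel(1) one_complex.sel(1))
  then obtain n :: int where "2 * pi * x = of_int n * 2 * pi" by (auto simp: cos_one_2pi_int)
  then have "x = of_int n" by simp
  then show ?thesis by simp
qed

lemma prod_cis: "(\<Prod>i\<in>I. cis (f i)) = cis (\<Sum>i\<in>I. f i)"
  by (induction I rule: infinite_finite_induct) (simp_all add: cis_mult)

text \<open>The characters trivial on the kernel of \<open>z \<mapsto> z\<^sup>A\<close> are the \<open>z \<mapsto> z\<^sup>A\<^sup>m\<close>; the kernel is tested on
  the points \<open>exp (2 \<pi> i t)\<close> with \<open>t\<close> a row of \<open>A\<^sup>-\<^sup>1\<close>.\<close>

lemma separating_kernel_element:
  fixes A :: "int^'n::finite^'n"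
  assumes "det A \<noteq> 0" "k \<notin> range ((*v) A)"
  shows "\<exists>g\<in>torus. torus_power g A = 1 \<and> monomial_fun k g \<noteq> 1"
proof (rule ccontr)
  assume neg: "\<not> ?thesis"
  let ?A = "map_matrix real_of_int A"
  obtain C where C: "C ** ?A = mat 1" "?A ** C = mat 1" using exists_real_inverse[OF assms(1)] .
  let ?k = "\<chi> i. real_of_int (k $ i)"
  have "(C *v ?k) $ l \<in> \<int>" for l
  proof -
    define g where "g = torus_point (C $ l)"
    have "torus_power g A $ j = 1" for j
    proof -
      have "torus_power g A $ j = (\<Prod>i\<in>UNIV. cis (2 * pi * (C $ l $ i * real_of_int (A $ i $ j))))"
        by (simp add: torus_power_def g_def cis_power_int mult_ac)
      also have "\<dots> = cis (2 * pi * (\<Sum>i\<in>UNIV. C $ l $ i * real_of_int (A $ i $ j)))"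
        by (simp add: prod_cis sum_distrib_left)
      also have "(\<Sum>i\<in>UNIV. C $ l $ i * real_of_int (A $ i $ j)) = (C ** ?A) $ l $ j"
        by (simp add: matrix_matrix_mult_def map_matrix_def)
      also have "cis (2 * pi * (C ** ?A) $ l $ j) = 1" unfolding C by (simp add: mat_def)
      finally show ?thesis .
    qed
    then have "torus_power g A = 1" by (simp add: vec_eq_iff)
    then have "monomial_fun k g = 1" using neg by (auto simp: g_def)
    moreover have "monomial_fun k g = cis (2 * pi * (C *v ?k) $ l)"
      by (simp add: g_def monomial_torus_point prod_cis matrix_vector_mult_def sum_distrib_left mult_ac)
    ultimately show ?thesis using cis_eq_1_Ints by simp
  qed
  then have "\<exists>m. (C *v ?k) $ l = real_of_int m" for l by (auto elim: Ints_cases)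
  then obtain m where m: "\<And>l. (C *v ?k) $ l = real_of_int (m l)" by metis
  have "(\<chi> i. real_of_int ((A *v (\<chi> l. m l)) $ i)) = ?A *v (C *v ?k)"
    unfolding map_matrix_mult_vec[symmetric] by (intro arg_cong[where f = "(*v) ?A"]) (simp add: vec_eq_iff m)
  also have "\<dots> = ?k" unfolding matrix_vector_mul_assoc C by simp
  finally have "A *v (\<chi> l. m l) = k" by (simp add: vec_eq_iff)
  then show False using assms(2) by blast
qed

text \<open>Substitution turns the coefficient at \<open>n\<close> into the one at
  \<open>A *v n\<close>, and by injectivity \<open>A *v n = 0\<close> only for \<open>n = 0\<close>.
  Uniqueness of Fourier coefficients takes the place of a change of variables.\<close>

lemma torus_power_measure_preserving:
  fixes A :: "int^'n::finite^'n"
  assumes "det A \<noteq> 0"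
  shows "distr torus_measure borel (\<lambda>z. torus_power z A) = torus_measure"
proof (rule measure_eq_if_fourier_eq)
  have meas: "(\<lambda>z. torus_power z A) \<in> torus_measure \<rightarrow>\<^sub>M borel" by measurable
  show "finite_measure (distr torus_measure borel (\<lambda>z. torus_power z A))"
    by (rule torus_measure.finite_measure_distr[OF meas])
  show "AE z in distr torus_measure borel (\<lambda>z. torus_power z A). z \<in> torus"
    using AE_torus by (subst AE_distr_iff[OF meas]) (auto simp: torus_borel torus_power_in elim: eventually_mono)
  fix n
  have "(\<integral>z. monomial_fun n z \<partial>distr torus_measure borel (\<lambda>z. torus_power z A))
      = (\<integral>z. monomial_fun n (torus_power z A) \<partial>torus_measure)"
    by (rule integral_distr[OF meas]) simp
  also have "\<dots> = (\<integral>z. monomial_fun (A *v n) z \<partial>torus_measure)"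
  proof (rule integral_cong_AE)
    show "AE z in torus_measure. monomial_fun n (torus_power z A) = monomial_fun (A *v n) z"
      using AE_torus by eventually_elim (rule monomial_torus_power)
  qed measurable
  also have "\<dots> = (\<integral>z. monomial_fun n z \<partial>torus_measure)"
    using int_matrix_inj[OF assms] injD[of "(*v) A" n 0] by (auto simp: integral_monomial)
  finally show "(\<integral>z. monomial_fun n z \<partial>distr torus_measure borel (\<lambda>z. torus_power z A))
      = (\<integral>z. monomial_fun n z \<partial>torus_measure)" .
qed (simp_all add: AE_torus torus_measure.finite_measure_axioms)

text \<open>The squared moduli of all entries are summed once by rows and once by columns. This
  supplies the number of points in a fibre.\<close>

lemma unitary_matrix_card:
  assumes "unitary_matrix I J U" shows "card I = card J"
proof -
  have "of_nat (card I) = (\<Sum>i\<in>I. \<Sum>j\<in>J. U i j * cnj (U i j))"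
    using assms by (simp add: unitary_matrix_def)
  also have "\<dots> = (\<Sum>j\<in>J. \<Sum>i\<in>I. cnj (U i j) * U i j)" by (subst sum.swap) (simp add: mult.commute)
  also have "\<dots> = of_nat (card J)" using assms by (simp add: unitary_matrix_def)
  finally show ?thesis by (simp only: of_nat_eq_iff)
qed

definition fiber :: "int^'n^'n \<Rightarrow> complex^'n \<Rightarrow> (complex^'n) set" where
  "fiber A z = {w \<in> torus. torus_power w A = z}"

text \<open>Closed form of the average of \<open>monomial_fun k\<close> over a nonempty finite fibre
  (\<open>sum_fiber_monomial\<close>); in this form it is defined for all \<open>z\<close> and
  visibly measurable.\<close>

definition avg_monomial :: "int^'n::finite^'n \<Rightarrow> int^'n \<Rightarrow> complex^'n \<Rightarrow> complex" where
  "avg_monomial A k z = (if k \<in> range ((*v) A) then monomial_fun (inv_into UNIV ((*v) A) k) z else 0)"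

text \<open>For \<open>k\<close> in the range of \<open>A\<close> the monomial is constant on the
  fibre. Otherwise multiplication by a kernel element \<open>g\<close> permutes the fibre and
  multiplies the sum by \<open>monomial_fun k g \<noteq> 1\<close>.\<close>

lemma sum_fiber_monomial:
  fixes A :: "int^'n::finite^'n"
  assumes det: "det A \<noteq> 0" and fin: "finite (fiber A z)"
  shows "(\<Sum>w\<in>fiber A z. monomial_fun k w) = of_nat (card (fiber A z)) * avg_monomial A k z"
proof (cases "k \<in> range ((*v) A)")
  case True
  then have k: "A *v inv_into UNIV ((*v) A) k = k" by (rule f_inv_into_f)
  have "monomial_fun k w = monomial_fun (inv_into UNIV ((*v) A) k) z" if "w \<in> fiber A z" for w
    using that monomial_torus_power[of w "inv_into UNIV ((*v) A) k" A] by (simp add: fiber_def k)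
  then show ?thesis using True by (simp add: avg_monomial_def)
next
  case False
  then obtain g where g: "g \<in> torus" "torus_power g A = 1" "monomial_fun k g \<noteq> 1"
    using separating_kernel_element[OF det] by blast
  define \<tau> where "\<tau> w = (\<chi> i. w $ i * g $ i)" for w :: "complex^'n"
  have g0: "g $ i \<noteq> 0" for i using torus_nonzero[OF g(1)] .
  have \<tau>_power: "torus_power (\<tau> w) A = torus_power w A" for w
  proof -
    have "torus_power (\<tau> w) A $ j = torus_power w A $ j * torus_power g A $ j" for j
      by (simp add: torus_power_def \<tau>_def power_int_mult_distrib prod.distrib)
    then show ?thesis by (simp add: vec_eq_iff g(2))
  qed
  have \<tau>_in: "\<tau> w \<in> fiber A z" if "w \<in> fiber A z" for w
    using that g(1) by (auto simp: fiber_def \<tau>_power) (simp add: torus_def \<tau>_def norm_mult)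
  have inj: "inj_on \<tau> (fiber A z)" by (auto intro!: inj_onI simp: \<tau>_def vec_eq_iff g0)
  have img: "\<tau> ` fiber A z = fiber A z"
    by (rule card_subset_eq[OF fin]) (use \<tau>_in card_image[OF inj] in auto)
  have "(\<Sum>w\<in>fiber A z. monomial_fun k w) = (\<Sum>w\<in>fiber A z. monomial_fun k (\<tau> w))"
    using sum.reindex[OF inj, of "monomial_fun k"] img by simp
  also have "\<dots> = (\<Sum>w\<in>fiber A z. monomial_fun k w) * monomial_fun k g"
    by (simp add: monomial_fun_def \<tau>_def power_int_mult_distrib prod.distrib sum_distrib_right)
  finally have "(\<Sum>w\<in>fiber A z. monomial_fun k w) = 0" using g(3) by simp
  then show ?thesis using False by (simp add: avg_monomial_def)
qed

lemma avg_monomial_measurable [measurable]: "avg_monomial A k \<in> borel_measurable borel"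
  by (cases "k \<in> range ((*v) A)") (simp_all add: avg_monomial_def[abs_def])

lemma integral_avg_monomial:
  fixes A :: "int^'n::finite^'n"
  assumes "det A \<noteq> 0"
  shows "(\<integral>z. avg_monomial A k z * cnj (avg_monomial A l z) \<partial>torus_measure)
    = (if k = l \<and> k \<in> range ((*v) A) then 1 else 0)"
proof (cases "k \<in> range ((*v) A) \<and> l \<in> range ((*v) A)")
  case True
  let ?i = "inv_into UNIV ((*v) A)"
  have inj: "?i k = ?i l \<longleftrightarrow> k = l" using True by (metis f_inv_into_f)
  have "(\<integral>z. avg_monomial A k z * cnj (avg_monomial A l z) \<partial>torus_measure)
      = (\<integral>z. monomial_fun (?i k - ?i l) z \<partial>torus_measure)"
  proof (rule integral_cong_AE)
    show "AE z in torus_measure. avg_monomial A k z * cnj (avg_monomial A l z) = monomial_fun (?i k - ?i l) z"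
      using AE_torus by eventually_elim (use True in \<open>simp add: avg_monomial_def monomial_diff\<close>)
  qed (auto intro!: borel_measurable_times borel_measurable_continuous_on[of cnj] continuous_intros)
  then show ?thesis using True inj by (simp add: integral_monomial)
qed (auto simp: avg_monomial_def)

lemma integrable_avg_monomial:
  "integrable torus_measure (\<lambda>z. avg_monomial A k z * cnj (avg_monomial A l z))"
proof -
  have "SI (avg_monomial A k)" for k
    by (rule SI_bounded[where C = 1]) (auto simp: avg_monomial_def cmod_monomial)
  from square_integrable_mult[OF this[of l] this[of k]] show ?thesis by (simp add: mult.commute)
qed

section \<open>Orthogonality relations for the coefficients\<close>

locale poly_data =
  fixes N :: nat and A :: "int^'n::finite^'n" and D :: "(int^'n) set" and a :: "nat \<Rightarrow> int^'n \<Rightarrow> complex"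
  assumes data: "polynomial_data N A D a"
begin

lemma N_ge: "N \<ge> 2" and finite_D: "finite D" and a_zero: "j < N \<Longrightarrow> n \<notin> D \<Longrightarrow> a j n = 0"
  using data by (auto simp: polynomial_data_def)

lemma det_A: "det A \<noteq> 0"
  using data by (auto simp: polynomial_data_def)

lemma inj_A: "inj ((*v) A)"
  by (rule int_matrix_inj[OF det_A])

lemma A_eq_iff: "A *v m = A *v n \<longleftrightarrow> m = n"
  using inj_A by (auto dest: injD)

lemma AE_unitary: "AE z in torus_measure. finite (fiber A z) \<and> card (fiber A z) = N \<and>
   (\<forall>i<N. \<forall>j<N. (\<Sum>w\<in>fiber A z. trig_poly D (a i) w * cnj (trig_poly D (a j) w)) = (if i = j then of_nat N else 0)) \<and>
   (\<forall>w\<in>fiber A z. \<forall>w'\<in>fiber A z. (\<Sum>i<N. cnj (trig_poly D (a i) w) * trig_poly D (a i) w') = (if w = w' then of_nat N else 0))"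
proof -
  have "AE z in torus_measure. unitary_matrix {..<N} (fiber A z)
      (\<lambda>i w. trig_poly D (a i) w / complex_of_real (sqrt (real N)))"
    using data by (simp add: polynomial_data_def unitarity_condition_def fiber_def)
  then show ?thesis
  proof eventually_elim
    fix z assume u: "unitary_matrix {..<N} (fiber A z) (\<lambda>i w. trig_poly D (a i) w / complex_of_real (sqrt (real N)))"
    have s: "complex_of_real (sqrt (real N)) * complex_of_real (sqrt (real N)) = of_nat N"
      by (simp flip: of_real_mult)
    have N0: "of_nat N \<noteq> (0::complex)" using N_ge by simp
    have mult: "x / complex_of_real (sqrt (real N)) * cnj (y / complex_of_real (sqrt (real N))) = x * cnj y / of_nat N"
      "cnj x / complex_of_real (sqrt (real N)) * (y / complex_of_real (sqrt (real N))) = cnj x * y / of_nat N" for x y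
      using s by simp_all
    have rows: "(\<Sum>w\<in>fiber A z. trig_poly D (a i) w * cnj (trig_poly D (a j) w)) / of_nat N = (if i = j then 1 else 0)"
      if "i < N" "j < N" for i j
      using u that unfolding unitary_matrix_def mult sum_divide_distrib[symmetric] by blast
    have cols: "(\<Sum>i<N. cnj (trig_poly D (a i) w) * trig_poly D (a i) w') / of_nat N = (if w = w' then 1 else 0)"
      if "w \<in> fiber A z" "w' \<in> fiber A z" for w w'
    proof -
      have "(\<Sum>i<N. cnj (trig_poly D (a i) w / complex_of_real (sqrt (real N))) *
          (trig_poly D (a i) w' / complex_of_real (sqrt (real N)))) = (if w = w' then 1 else 0)"
        using u that unfolding unitary_matrix_def by blast
      then show ?thesis
        by (simp only: complex_cnj_divide complex_cnj_complex_of_real mult sum_divide_distrib)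
    qed
    show "finite (fiber A z) \<and> card (fiber A z) = N \<and>
     (\<forall>i<N. \<forall>j<N. (\<Sum>w\<in>fiber A z. trig_poly D (a i) w * cnj (trig_poly D (a j) w)) = (if i = j then of_nat N else 0)) \<and>
     (\<forall>w\<in>fiber A z. \<forall>w'\<in>fiber A z. (\<Sum>i<N. cnj (trig_poly D (a i) w) * trig_poly D (a i) w') = (if w = w' then of_nat N else 0))"
    proof (intro conjI allI impI ballI)
      show "finite (fiber A z)" using u by (simp add: unitary_matrix_def)
      show "card (fiber A z) = N" using unitary_matrix_card[OF u] by simp
      show "(\<Sum>w\<in>fiber A z. trig_poly D (a i) w * cnj (trig_poly D (a j) w)) = (if i = j then of_nat N else 0)"
        if "i < N" "j < N" for i j using rows[OF that] N0 by (simp add: divide_eq_eq split: if_splits)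
      show "(\<Sum>i<N. cnj (trig_poly D (a i) w) * trig_poly D (a i) w') = (if w = w' then of_nat N else 0)"
        if "w \<in> fiber A z" "w' \<in> fiber A z" for w w' using cols[OF that] N0 by (simp add: divide_eq_eq split: if_splits)
    qed
  qed
qed

text \<open>The Fourier coefficient at \<open>r\<close> of the row relations. Fibre sums of
  characters become \<open>avg_monomial\<close>, and the character of frequency \<open>r\<close> is
  written as the average of frequency \<open>A *v r\<close> so that
  \<open>integral_avg_monomial\<close> evaluates everything.\<close>

lemma row_identity:
  assumes ij: "i < N" "j < N"
  shows "(\<Sum>p\<in>D. \<Sum>q\<in>D. a i p * cnj (a j q) * (if p - q = A *v r then 1 else 0)) = (if i = j \<and> r = 0 then 1 else 0)"
proof -
  let ?c = "\<lambda>k. avg_monomial A k"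
  have Ar: "A *v r \<in> range ((*v) A)" "0 \<in> range ((*v) A)"
    by (auto intro: range_eqI[of _ _ 0])
  have ae: "AE z in torus_measure. (\<Sum>p\<in>D. \<Sum>q\<in>D. a i p * cnj (a j q) * (?c (p - q) z * cnj (?c (A *v r) z)))
      = (if i = j then 1 else 0) * (?c 0 z * cnj (?c (A *v r) z))"
    using AE_unitary AE_torus
  proof eventually_elim
    fix z assume z: "finite (fiber A z) \<and> card (fiber A z) = N \<and>
       (\<forall>i<N. \<forall>j<N. (\<Sum>w\<in>fiber A z. trig_poly D (a i) w * cnj (trig_poly D (a j) w)) = (if i = j then of_nat N else 0)) \<and>
       (\<forall>w\<in>fiber A z. \<forall>w'\<in>fiber A z. (\<Sum>i<N. cnj (trig_poly D (a i) w) * trig_poly D (a i) w') = (if w = w' then of_nat N else 0))"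
    have "(\<Sum>w\<in>fiber A z. trig_poly D (a i) w * cnj (trig_poly D (a j) w))
       = (\<Sum>w\<in>fiber A z. \<Sum>p\<in>D. \<Sum>q\<in>D. a i p * cnj (a j q) * monomial_fun (p - q) w)"
    proof (rule sum.cong[OF refl])
      fix w assume "w \<in> fiber A z"
      then have w: "w \<in> torus" by (simp add: fiber_def)
      show "trig_poly D (a i) w * cnj (trig_poly D (a j) w) = (\<Sum>p\<in>D. \<Sum>q\<in>D. a i p * cnj (a j q) * monomial_fun (p - q) w)"
        by (simp add: trig_poly_def sum_product monomial_diff[OF w] mult_ac)
    qed
    also have "\<dots> = (\<Sum>p\<in>D. \<Sum>w\<in>fiber A z. \<Sum>q\<in>D. a i p * cnj (a j q) * monomial_fun (p - q) w)" by (rule sum.swap)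
    also have "\<dots> = (\<Sum>p\<in>D. \<Sum>q\<in>D. \<Sum>w\<in>fiber A z. a i p * cnj (a j q) * monomial_fun (p - q) w)"
      by (intro sum.cong refl) (rule sum.swap)
    also have "\<dots> = (\<Sum>p\<in>D. \<Sum>q\<in>D. a i p * cnj (a j q) * (of_nat N * ?c (p - q) z))"
      using z by (simp only: sum_distrib_left[symmetric] sum_fiber_monomial[OF det_A])
    also have "\<dots> = of_nat N * (\<Sum>p\<in>D. \<Sum>q\<in>D. a i p * cnj (a j q) * ?c (p - q) z)"
      by (simp add: sum_distrib_left mult_ac)
    finally have "of_nat N * (\<Sum>p\<in>D. \<Sum>q\<in>D. a i p * cnj (a j q) * ?c (p - q) z) = (if i = j then of_nat N else 0)"
      using z ij by simp
    then have eq: "(\<Sum>p\<in>D. \<Sum>q\<in>D. a i p * cnj (a j q) * ?c (p - q) z) = (if i = j then 1 else 0)"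
      using N_ge by (auto split: if_splits)
    have c0: "?c 0 z = 1"
    proof -
      have "inv_into UNIV ((*v) A) 0 = 0" using inv_f_f[OF inj_A, of 0] by simp
      then show ?thesis using Ar by (simp add: avg_monomial_def)
    qed
    have "(\<Sum>p\<in>D. \<Sum>q\<in>D. a i p * cnj (a j q) * (?c (p - q) z * cnj (?c (A *v r) z)))
        = (\<Sum>p\<in>D. \<Sum>q\<in>D. a i p * cnj (a j q) * ?c (p - q) z) * cnj (?c (A *v r) z)"
      by (simp add: sum_distrib_right mult.assoc)
    then show "(\<Sum>p\<in>D. \<Sum>q\<in>D. a i p * cnj (a j q) * (?c (p - q) z * cnj (?c (A *v r) z)))
      = (if i = j then 1 else 0) * (?c 0 z * cnj (?c (A *v r) z))" using eq c0 by simp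
  qed
  have int: "integrable torus_measure (\<lambda>z. c * (?c k z * cnj (?c l z)))" for c k l
    by (intro integrable_mult_right integrable_avg_monomial)
  have "(\<integral>z. (\<Sum>p\<in>D. \<Sum>q\<in>D. a i p * cnj (a j q) * (?c (p - q) z * cnj (?c (A *v r) z))) \<partial>torus_measure)
      = (\<integral>z. (if i = j then 1 else 0) * (?c 0 z * cnj (?c (A *v r) z)) \<partial>torus_measure)"
    using ae by (intro integral_cong_AE borel_measurable_integrable Bochner_Integration.integrable_sum int)
  moreover have "(\<integral>z. (\<Sum>p\<in>D. \<Sum>q\<in>D. a i p * cnj (a j q) * (?c (p - q) z * cnj (?c (A *v r) z))) \<partial>torus_measure)
      = (\<Sum>p\<in>D. \<Sum>q\<in>D. a i p * cnj (a j q) * (\<integral>z. ?c (p - q) z * cnj (?c (A *v r) z) \<partial>torus_measure))"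
    by (simp only: Bochner_Integration.integral_sum Bochner_Integration.integrable_sum int integral_mult_right_zero)
  ultimately have "(\<Sum>p\<in>D. \<Sum>q\<in>D. a i p * cnj (a j q) * (\<integral>z. ?c (p - q) z * cnj (?c (A *v r) z) \<partial>torus_measure))
     = (if i = j then 1 else 0) * (\<integral>z. ?c 0 z * cnj (?c (A *v r) z) \<partial>torus_measure)"
    by (simp only: integral_mult_right_zero)
  moreover have "(\<integral>z. ?c k z * cnj (?c (A *v r) z) \<partial>torus_measure) = (if k = A *v r then 1 else 0)" for k
    using Ar by (auto simp: integral_avg_monomial[OF det_A])
  moreover have "0 = A *v r \<longleftrightarrow> r = 0" using A_eq_iff[of r 0] by auto
  ultimately show ?thesis by (auto split: if_splits)
qed

text \<open>A matrix with orthonormal columns preserves the length of the vector of values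
  \<open>monomial_fun n w\<close> on a fibre. Integrating over \<open>z\<close> kills the mixed
  terms and leaves the squared coefficients of one residue class modulo \<open>A\<close>.\<close>

lemma column_identity: "(\<Sum>i<N. \<Sum>p\<in>{p \<in> D. n - p \<in> range ((*v) A)}. (cmod (a i p))\<^sup>2) = 1"
proof -
  let ?c = "\<lambda>k. avg_monomial A k"
  have ae: "AE z in torus_measure. (\<Sum>i<N. \<Sum>p\<in>D. \<Sum>q\<in>D. cnj (a i p) * a i q * (?c (n - p) z * cnj (?c (n - q) z))) = 1"
    using AE_unitary AE_torus
  proof eventually_elim
    fix z assume z: "finite (fiber A z) \<and> card (fiber A z) = N \<and>
       (\<forall>i<N. \<forall>j<N. (\<Sum>w\<in>fiber A z. trig_poly D (a i) w * cnj (trig_poly D (a j) w)) = (if i = j then of_nat N else 0)) \<and>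
       (\<forall>w\<in>fiber A z. \<forall>w'\<in>fiber A z. (\<Sum>i<N. cnj (trig_poly D (a i) w) * trig_poly D (a i) w') = (if w = w' then of_nat N else 0))"
    let ?F = "fiber A z"
    have torus: "w \<in> torus" if "w \<in> ?F" for w using that by (simp add: fiber_def)
    \<comment> \<open>The component of that vector along the i-th row. The row is not normalised,
      which gives one factor \<open>N\<close>; the other is the number of points in the
      fibre.\<close>
    define u where "u i = (\<Sum>w\<in>?F. monomial_fun n w * cnj (trig_poly D (a i) w))" for i
    have u: "u i = of_nat N * (\<Sum>p\<in>D. cnj (a i p) * ?c (n - p) z)" for i
    proof -
      have "u i = (\<Sum>w\<in>?F. \<Sum>p\<in>D. cnj (a i p) * monomial_fun (n - p) w)"
        unfolding u_def
        by (intro sum.cong refl) (simp add: trig_poly_def sum_distrib_left monomial_diff torus mult_ac)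
      also have "\<dots> = (\<Sum>p\<in>D. cnj (a i p) * (\<Sum>w\<in>?F. monomial_fun (n - p) w))"
        by (subst sum.swap) (simp add: sum_distrib_left)
      also have "\<dots> = of_nat N * (\<Sum>p\<in>D. cnj (a i p) * ?c (n - p) z)"
        using z by (simp add: sum_fiber_monomial[OF det_A] sum_distrib_left mult_ac)
      finally show ?thesis .
    qed
    have "(\<Sum>i<N. u i * cnj (u i)) = (\<Sum>i<N. \<Sum>w\<in>?F. \<Sum>w'\<in>?F.
        monomial_fun n w * cnj (monomial_fun n w') * (cnj (trig_poly D (a i) w) * trig_poly D (a i) w'))"
      by (simp add: u_def sum_product mult_ac)
    also have "\<dots> = (\<Sum>w\<in>?F. \<Sum>i<N. \<Sum>w'\<in>?F.
        monomial_fun n w * cnj (monomial_fun n w') * (cnj (trig_poly D (a i) w) * trig_poly D (a i) w'))" by (rule sum.swap)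
    also have "\<dots> = (\<Sum>w\<in>?F. \<Sum>w'\<in>?F. monomial_fun n w * cnj (monomial_fun n w') *
        (\<Sum>i<N. cnj (trig_poly D (a i) w) * trig_poly D (a i) w'))"
      by (rule sum.cong[OF refl], subst sum.swap) (simp only: sum_distrib_left)
    also have "\<dots> = (\<Sum>w\<in>?F. \<Sum>w'\<in>?F. if w' = w then monomial_fun n w * cnj (monomial_fun n w) * of_nat N else 0)"
      using z by (intro sum.cong refl) auto
    also have "\<dots> = (\<Sum>w\<in>?F. of_nat N)"
    proof (rule sum.cong[OF refl])
      fix w assume w: "w \<in> ?F"
      have "monomial_fun n w * cnj (monomial_fun n w) = 1"
        using cmod_monomial[OF torus[OF w], of n] complex_norm_square[of "monomial_fun n w"] by simp
      then show "(\<Sum>w'\<in>?F. if w' = w then monomial_fun n w * cnj (monomial_fun n w) * of_nat N else 0) = of_nat N"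
        using w z by simp
    qed
    also have "\<dots> = of_nat N * of_nat N" using z by simp
    finally have "(\<Sum>i<N. u i * cnj (u i)) = of_nat N * of_nat N" .
    moreover have "(\<Sum>i<N. u i * cnj (u i)) = of_nat N * of_nat N *
        (\<Sum>i<N. \<Sum>p\<in>D. \<Sum>q\<in>D. cnj (a i p) * a i q * (?c (n - p) z * cnj (?c (n - q) z)))"
    proof -
      have "u i * cnj (u i) = of_nat N * of_nat N * (\<Sum>p\<in>D. \<Sum>q\<in>D. cnj (a i p) * a i q * (?c (n - p) z * cnj (?c (n - q) z)))" for i
      proof -
        have "u i * cnj (u i) = of_nat N * of_nat N * ((\<Sum>p\<in>D. cnj (a i p) * ?c (n - p) z) * (\<Sum>q\<in>D. a i q * cnj (?c (n - q) z)))"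
          by (simp add: u mult_ac)
        also have "(\<Sum>p\<in>D. cnj (a i p) * ?c (n - p) z) * (\<Sum>q\<in>D. a i q * cnj (?c (n - q) z))
            = (\<Sum>p\<in>D. \<Sum>q\<in>D. cnj (a i p) * a i q * (?c (n - p) z * cnj (?c (n - q) z)))"
          unfolding sum_product by (intro sum.cong refl) (simp add: mult_ac)
        finally show ?thesis .
      qed
      then show ?thesis by (simp only: sum_distrib_left)
    qed
    ultimately show "(\<Sum>i<N. \<Sum>p\<in>D. \<Sum>q\<in>D. cnj (a i p) * a i q * (?c (n - p) z * cnj (?c (n - q) z))) = 1"
      using N_ge by simp
  qed
  have int: "integrable torus_measure (\<lambda>z. c * (?c k z * cnj (?c l z)))" for c k l
    by (intro integrable_mult_right integrable_avg_monomial)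
  have "(\<integral>z. (\<Sum>i<N. \<Sum>p\<in>D. \<Sum>q\<in>D. cnj (a i p) * a i q * (?c (n - p) z * cnj (?c (n - q) z))) \<partial>torus_measure)
     = (\<integral>z. 1 \<partial>(torus_measure :: (complex^'n) measure))"
  proof (rule integral_cong_AE[OF _ _ ae])
    show "(\<lambda>z. (\<Sum>i<N. \<Sum>p\<in>D. \<Sum>q\<in>D. cnj (a i p) * a i q * (?c (n - p) z * cnj (?c (n - q) z))))
        \<in> borel_measurable torus_measure"
      by (intro borel_measurable_integrable Bochner_Integration.integrable_sum int)
  qed simp
  moreover have "(\<integral>z. (\<Sum>i<N. \<Sum>p\<in>D. \<Sum>q\<in>D. cnj (a i p) * a i q * (?c (n - p) z * cnj (?c (n - q) z))) \<partial>torus_measure)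
    = (\<Sum>i<N. \<Sum>p\<in>D. \<Sum>q\<in>D. cnj (a i p) * a i q * (\<integral>z. ?c (n - p) z * cnj (?c (n - q) z) \<partial>torus_measure))"
    by (simp only: Bochner_Integration.integral_sum Bochner_Integration.integrable_sum int integral_mult_right_zero)
  moreover have "(\<Sum>q\<in>D. cnj (a i p) * a i q * (\<integral>z. ?c (n - p) z * cnj (?c (n - q) z) \<partial>torus_measure))
      = (if n - p \<in> range ((*v) A) then complex_of_real ((cmod (a i p))\<^sup>2) else 0)" if "p \<in> D" for i p
  proof -
    have "(\<Sum>q\<in>D. cnj (a i p) * a i q * (\<integral>z. ?c (n - p) z * cnj (?c (n - q) z) \<partial>torus_measure))
      = (\<Sum>q\<in>D. if q = p then (if n - p \<in> range ((*v) A) then cnj (a i p) * a i p else 0) else 0)"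
      by (intro sum.cong refl) (auto simp: integral_avg_monomial[OF det_A])
    also have "\<dots> = (if n - p \<in> range ((*v) A) then cnj (a i p) * a i p else 0)"
      using that finite_D by simp
    finally show ?thesis by (simp only: complex_norm_square mult.commute)
  qed
  ultimately have "(\<Sum>i<N. \<Sum>p\<in>D. if n - p \<in> range ((*v) A) then complex_of_real ((cmod (a i p))\<^sup>2) else 0) = 1"
    by (simp add: measure_def emeasure_torus_measure cong: sum.cong_simp)
  then have "complex_of_real (\<Sum>i<N. \<Sum>p\<in>{p \<in> D. n - p \<in> range ((*v) A)}. (cmod (a i p))\<^sup>2) = 1"
    using finite_D by (simp only: of_real_sum sum.inter_filter if_distrib[of complex_of_real] of_real_0)
  then show ?thesis by (simp only: of_real_eq_1_iff)
qed

section \<open>The operators on the Fourier modes and the Cuntz relations\<close>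

abbreviation S where "S \<equiv> poly_rep A D a"

lemma comp_measurable:
  assumes "f \<in> borel_measurable borel" shows "(\<lambda>z. f (torus_power z A)) \<in> borel_measurable borel"
  using measurable_compose[OF torus_power_measurable assms] .

lemma comp_SI:
  assumes f: "SI f"
  shows "SI (\<lambda>z. f (torus_power z A))"
    and "(\<integral>z. (cmod (f (torus_power z A)))\<^sup>2 \<partial>torus_measure) = (\<integral>z. (cmod (f z))\<^sup>2 \<partial>torus_measure)"
proof -
  have fm: "f \<in> borel_measurable borel" by (rule SI_measurable[OF f])
  have meas: "(\<lambda>z. torus_power z A) \<in> torus_measure \<rightarrow>\<^sub>M borel" by measurable
  have fm2: "(\<lambda>z. (cmod (f z))\<^sup>2) \<in> borel_measurable borel" using fm by measurable
  have "integrable (distr torus_measure borel (\<lambda>z. torus_power z A)) (\<lambda>z. (cmod (f z))\<^sup>2)"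
    using f unfolding torus_power_measure_preserving[OF det_A] square_integrable_def by blast
  then have "integrable torus_measure (\<lambda>z. (cmod (f (torus_power z A)))\<^sup>2)"
    by (subst (asm) integrable_distr_eq[OF meas fm2])
  then show "SI (\<lambda>z. f (torus_power z A))"
    using comp_measurable[OF fm] by (simp add: square_integrable_def measurable_cong_sets[OF sets_torus_measure refl])
  show "(\<integral>z. (cmod (f (torus_power z A)))\<^sup>2 \<partial>torus_measure) = (\<integral>z. (cmod (f z))\<^sup>2 \<partial>torus_measure)"
    using integral_distr[OF meas fm2] unfolding torus_power_measure_preserving[OF det_A] by simp
qed

text \<open>Preimages of null sets are null because Haar measure is preserved. This makes
  \<open>poly_rep\<close> independent of the chosen representative.\<close>

lemma comp_AE:
  assumes "SI f" "SI g" "AE z in torus_measure. f z = g z"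
  shows "AE z in torus_measure. f (torus_power z A) = g (torus_power z A)"
proof -
  have meas: "(\<lambda>z. torus_power z A) \<in> torus_measure \<rightarrow>\<^sub>M borel" by measurable
  have "(\<lambda>z. f z - g z) \<in> borel_measurable borel"
    by (intro borel_measurable_diff SI_measurable assms)
  from measurable_sets[OF this, of "{0}"] have "{z. f z = g z} \<in> sets borel" by (simp add: vimage_def)
  then show ?thesis
    using assms(3) AE_distr_iff[OF meas, of "\<lambda>z. f z = g z"] unfolding torus_power_measure_preserving[OF det_A] by simp
qed

lemma mult_SI:
  fixes f :: "complex^'n \<Rightarrow> complex"
  assumes "SI f" shows "SI (\<lambda>z. trig_poly D c z * f z)"
    and "(\<integral>z. (cmod (trig_poly D c z * f z))\<^sup>2 \<partial>torus_measure) \<le> (\<Sum>n\<in>D. cmod (c n))\<^sup>2 * (\<integral>z. (cmod (f z))\<^sup>2 \<partial>torus_measure)"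
proof -
  let ?C = "\<Sum>n\<in>D. cmod (c n)"
  have fm: "f \<in> borel_measurable borel" by (rule SI_measurable[OF assms])
  have int: "integrable torus_measure (\<lambda>z. ?C\<^sup>2 * (cmod (f z))\<^sup>2)" using assms by (simp add: square_integrable_def)
  have le: "AE z in torus_measure. (cmod (trig_poly D c z * f z))\<^sup>2 \<le> ?C\<^sup>2 * (cmod (f z))\<^sup>2"
    using AE_torus
  proof eventually_elim
    fix z :: "complex^'n" assume "z \<in> torus"
    then have "cmod (trig_poly D c z) \<le> ?C" by (rule cmod_trig_poly)
    then show "(cmod (trig_poly D c z * f z))\<^sup>2 \<le> ?C\<^sup>2 * (cmod (f z))\<^sup>2"
      by (simp add: norm_mult power_mult_distrib power_mono mult_right_mono)
  qed
  have m: "(\<lambda>z. trig_poly D c z * f z) \<in> borel_measurable torus_measure"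
    using fm by (intro borel_measurable_times) (simp_all add: measurable_cong_sets[OF sets_torus_measure refl])
  have int': "integrable torus_measure (\<lambda>z. (cmod (trig_poly D c z * f z))\<^sup>2)"
  proof (rule Bochner_Integration.integrable_bound[OF int])
    show "(\<lambda>z. (cmod (trig_poly D c z * f z))\<^sup>2) \<in> borel_measurable torus_measure"
      using m by measurable
    show "AE z in torus_measure. norm ((cmod (trig_poly D c z * f z))\<^sup>2) \<le> norm (?C\<^sup>2 * (cmod (f z))\<^sup>2)"
      using le by eventually_elim simp
  qed
  show "SI (\<lambda>z. trig_poly D c z * f z)" using m int' by (simp add: square_integrable_def)
  show "(\<integral>z. (cmod (trig_poly D c z * f z))\<^sup>2 \<partial>torus_measure) \<le> ?C\<^sup>2 * (\<integral>z. (cmod (f z))\<^sup>2 \<partial>torus_measure)"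
    using integral_mono_AE[OF int' int le] by simp
qed

lemma poly_rep_SI: "SI f \<Longrightarrow> SI (\<lambda>z. trig_poly D (a j) z * f (torus_power z A))"
  by (rule mult_SI[OF comp_SI(1)])

lemma poly_rep_abs:
  assumes "SI f"
  shows "S j (abs_torus_L2 f) = abs_torus_L2 (\<lambda>z. trig_poly D (a j) z * f (torus_power z A))"
  unfolding poly_rep_def
proof (rule abs_L2_eqI)
  show "AE z in torus_measure. trig_poly D (a j) z * rep_torus_L2 (abs_torus_L2 f) (torus_power z A)
      = trig_poly D (a j) z * f (torus_power z A)"
    using comp_AE[OF SI_rep assms rep_abs_AE[OF assms]] by eventually_elim simp
qed (auto intro: poly_rep_SI assms)

lemma poly_rep_bops: "S j \<in> bops UNIV UNIV"
proof (rule bopsI[where C = "\<Sum>n\<in>D. cmod (a j n)"])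
  fix x y :: "'n torus_L2" and c
  define f g where "f = rep_torus_L2 x" and "g = rep_torus_L2 y"
  have f: "SI f" "x = abs_torus_L2 f" and g: "SI g" "y = abs_torus_L2 g" by (simp_all add: f_def g_def)
  show "S j (x + y) = S j x + S j y"
    unfolding f g by (simp add: abs_L2_add poly_rep_abs poly_rep_SI square_integrable_add f(1) g(1) distrib_left)
  show "S j (c *\<^sub>C x) = c *\<^sub>C S j x"
    unfolding f by (simp add: abs_L2_scaleC poly_rep_abs poly_rep_SI square_integrable_cmult f(1) mult.left_commute)
  have "(norm (S j x))\<^sup>2 \<le> ((\<Sum>n\<in>D. cmod (a j n)) * norm x)\<^sup>2"
    unfolding f poly_rep_abs[OF f(1)] norm_abs_L2[OF poly_rep_SI[OF f(1)]] power_mult_distrib norm_abs_L2[OF f(1)]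
    using mult_SI(2)[OF comp_SI(1)[OF f(1)], of "a j"] comp_SI(2)[OF f(1)] by simp
  then show "norm (S j x) \<le> (\<Sum>n\<in>D. cmod (a j n)) * norm x"
    by (rule power2_le_imp_le) (simp add: sum_nonneg)
qed auto

lemma poly_rep_fourier: "S j (fourier_vec n) = (\<Sum>p\<in>D. a j p *\<^sub>C fourier_vec (p + A *v n))"
proof -
  define c where "c q = a j (q - A *v n)" for q
  let ?D = "(\<lambda>p. p + A *v n) ` D"
  have inj: "inj_on (\<lambda>p. p + A *v n) D" by (auto intro: inj_onI)
  have "S j (fourier_vec n) = abs_torus_L2 (\<lambda>z. trig_poly D (a j) z * monomial_fun n (torus_power z A))"
    unfolding fourier_vec_def by (rule poly_rep_abs) simp
  also have "\<dots> = abs_torus_L2 (trig_poly ?D c)"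
  proof (rule abs_L2_eqI)
    show "AE z in torus_measure. trig_poly D (a j) z * monomial_fun n (torus_power z A) = trig_poly ?D c z"
      using AE_torus
    proof eventually_elim
      fix z :: "complex^'n" assume z: "z \<in> torus"
      show "trig_poly D (a j) z * monomial_fun n (torus_power z A) = trig_poly ?D c z"
        by (simp add: trig_poly_def sum.reindex[OF inj] c_def monomial_torus_power[OF z] monomial_add[OF z]
            sum_distrib_right mult.assoc)
    qed
  qed (simp_all add: poly_rep_SI)
  also have "\<dots> = (\<Sum>q\<in>?D. c q *\<^sub>C fourier_vec q)" by (rule abs_trig_poly)
  also have "\<dots> = (\<Sum>p\<in>D. a j p *\<^sub>C fourier_vec (p + A *v n))"
    by (simp add: sum.reindex[OF inj] c_def)
  finally show ?thesis .
qed

lemma cinner_hadj_fourier: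
  assumes "j < N"
  shows "cinner (fourier_vec m) (hadj (S j) (fourier_vec n)) = cnj (a j (n - A *v m))"
proof -
  have "cinner (fourier_vec m) (hadj (S j) (fourier_vec n)) = cinner (S j (fourier_vec m)) (fourier_vec n)"
    by (simp add: cinner_hadj[OF poly_rep_bops])
  also have "\<dots> = (\<Sum>p\<in>D. if p = n - A *v m then cnj (a j p) else 0)"
    unfolding poly_rep_fourier cinner_sum_left cinner_scaleC_left
    by (intro sum.cong refl) (auto simp: cinner_fourier_vec algebra_simps)
  also have "\<dots> = cnj (a j (n - A *v m))"
    using finite_D a_zero[OF assms, of "n - A *v m"] by simp
  finally show ?thesis .
qed

lemma cinner_S_S:
  assumes "i < N" "j < N"
  shows "cinner (S i (fourier_vec m)) (S j (fourier_vec n)) = (if i = j \<and> m = n then 1 else 0)"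
proof -
  have "cinner (S i (fourier_vec m)) (S j (fourier_vec n))
      = (\<Sum>p\<in>D. \<Sum>q\<in>D. cnj (a i p) * a j q * (if p + A *v m = q + A *v n then 1 else 0))"
    unfolding poly_rep_fourier cinner_sum_left cinner_scaleC_left
    unfolding cinner_sum_right cinner_scaleC_right sum_distrib_left cinner_fourier_vec mult.assoc ..
  also have "\<dots> = (\<Sum>q\<in>D. \<Sum>p\<in>D. a j q * cnj (a i p) * (if q - p = A *v (m - n) then 1 else 0))"
  proof (subst sum.swap, intro sum.cong refl)
    fix p q
    have "p + A *v m = q + A *v n \<longleftrightarrow> q - p = A *v (m - n)"
      by (auto simp: matrix_vector_mult_diff_distrib algebra_simps)
    then show "cnj (a i p) * a j q * (if p + A *v m = q + A *v n then 1 else 0)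
        = a j q * cnj (a i p) * (if q - p = A *v (m - n) then 1 else 0)" by (simp add: mult.commute)
  qed
  also have "\<dots> = (if i = j \<and> m = n then 1 else 0)"
    using row_identity[OF assms(2,1), of "m - n"] by auto
  finally show ?thesis .
qed

lemma hadj_S_S:
  assumes "i < N" "j < N" shows "hadj (S i) (S j x) = (if i = j then x else 0)"
proof -
  have "hadj (S i) \<circ> S j = (if i = j then (\<lambda>x. x) else (\<lambda>x. 0))"
  proof (rule bops_fourier_ext)
    show "hadj (S i) \<circ> S j \<in> bops UNIV UNIV" by (intro bops_comp[OF hadj_bops] poly_rep_bops)
    show "(if i = j then (\<lambda>x. x) else (\<lambda>x. 0)) \<in> bops UNIV (UNIV :: 'n torus_L2 set)"
      by (simp add: bops_ident bops_UNIV_zero)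
    fix n show "(hadj (S i) \<circ> S j) (fourier_vec n) = (if i = j then (\<lambda>x. x) else (\<lambda>x. 0)) (fourier_vec n)"
      by (rule fourier_vec_ext)
        (use assms in \<open>simp add: cinner_hadj[OF poly_rep_bops, symmetric] cinner_S_S cinner_fourier_vec\<close>)
  qed
  then show ?thesis by (auto simp: fun_eq_iff split: if_splits)
qed

text \<open>By injectivity of \<open>A\<close> each adjoint image of a Fourier vector has finitely
  many nonzero coefficients; reindexing their squares by \<open>p = n - A *v m\<close> leads to
  \<open>column_identity\<close>.\<close>

lemma sum_norm_hadj_fourier: "(\<Sum>j<N. (norm (hadj (S j) (fourier_vec n)))\<^sup>2) = 1"
proof -
  have "(norm (hadj (S j) (fourier_vec n)))\<^sup>2 = (\<Sum>p\<in>{p \<in> D. n - p \<in> range ((*v) A)}. (cmod (a j p))\<^sup>2)"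
    if j: "j < N" for j
  proof -
    let ?M = "{m. n - A *v m \<in> D}"
    have inj: "inj_on (\<lambda>m. n - A *v m) ?M" by (auto intro!: inj_onI simp: A_eq_iff)
    have img: "(\<lambda>m. n - A *v m) ` ?M = {p \<in> D. n - p \<in> range ((*v) A)}"
    proof (intro Set.set_eqI iffI)
      fix p assume "p \<in> {p \<in> D. n - p \<in> range ((*v) A)}"
      then obtain m where "p \<in> D" "n - p = A *v m" by auto
      moreover from this have "p = n - A *v m" by (metis diff_diff_eq2 add_diff_cancel_left')
      ultimately show "p \<in> (\<lambda>m. n - A *v m) ` ?M" by auto
    qed auto
    have fin: "finite ?M" using finite_imageD[OF _ inj] finite_D img by simp
    define v where "v = (\<Sum>m\<in>?M. cnj (a j (n - A *v m)) *\<^sub>C fourier_vec m)"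
    have v: "hadj (S j) (fourier_vec n) = v"
    proof (rule fourier_vec_ext)
      fix l
      have "cinner (fourier_vec l) v = (\<Sum>m\<in>?M. if m = l then cnj (a j (n - A *v m)) else 0)"
        unfolding v_def cinner_sum_right cinner_scaleC_right
        by (intro sum.cong refl) (simp add: cinner_fourier_vec)
      also have "\<dots> = cnj (a j (n - A *v l))" using fin a_zero[OF j, of "n - A *v l"] by simp
      finally show "cinner (fourier_vec l) (hadj (S j) (fourier_vec n)) = cinner (fourier_vec l) v"
        by (simp add: cinner_hadj_fourier[OF j])
    qed
    have "complex_of_real ((norm v)\<^sup>2) = (\<Sum>m\<in>?M. cnj (a j (n - A *v m)) * cinner v (fourier_vec m))"
      unfolding cinner_self[symmetric] by (subst (2) v_def) (simp add: cinner_sum_right cinner_scaleC_right)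
    also have "\<dots> = (\<Sum>m\<in>?M. complex_of_real ((cmod (a j (n - A *v m)))\<^sup>2))"
    proof (rule sum.cong[OF refl])
      fix m
      have "cinner v (fourier_vec m) = a j (n - A *v m)"
        using cinner_hadj_fourier[OF j, of m n] unfolding v
        by (subst cinner_commute) simp
      then show "cnj (a j (n - A *v m)) * cinner v (fourier_vec m) = complex_of_real ((cmod (a j (n - A *v m)))\<^sup>2)"
        by (simp only: complex_norm_square mult.commute)
    qed
    finally have "(norm v)\<^sup>2 = (\<Sum>m\<in>?M. (cmod (a j (n - A *v m)))\<^sup>2)" by (simp only: of_real_sum[symmetric] of_real_eq_iff)
    also have "\<dots> = (\<Sum>p\<in>{p \<in> D. n - p \<in> range ((*v) A)}. (cmod (a j p))\<^sup>2)"
      using sum.reindex[OF inj, of "\<lambda>p. (cmod (a j p))\<^sup>2"] img by simp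
    finally show ?thesis by (simp add: v)
  qed
  then show ?thesis using column_identity[of n] by simp
qed

text \<open>Knowing the lengths of the adjoint images is enough: the sum \<open>?Q\<close> at a
  Fourier vector \<open>?e\<close> satisfies \<open>cinner ?e ?Q = cinner ?Q ?Q = 1\<close>, so
  \<open>?Q - ?e\<close> has norm zero.\<close>

lemma sum_S_hadj: "(\<Sum>j<N. S j (hadj (S j) x)) = x"
proof -
  have "(\<lambda>x. \<Sum>j<N. (S j \<circ> hadj (S j)) x) = (\<lambda>x. x)"
  proof (rule bops_fourier_ext)
    show "(\<lambda>x. \<Sum>j<N. (S j \<circ> hadj (S j)) x) \<in> bops UNIV UNIV"
      by (intro bops_UNIV_sum bops_comp[OF poly_rep_bops] hadj_bops poly_rep_bops)
    show "(\<lambda>x :: 'n torus_L2. x) \<in> bops UNIV UNIV" by (rule bops_ident)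
    fix n
    let ?e = "fourier_vec n :: 'n torus_L2"
    define w where "w j = hadj (S j) ?e" for j
    let ?Q = "\<Sum>j<N. S j (w j)"
    have w1: "(\<Sum>j<N. cinner (w j) (w j)) = 1"
      using arg_cong[OF sum_norm_hadj_fourier[of n], of complex_of_real] by (simp add: cinner_self w_def)
    have eQ: "cinner ?e ?Q = 1"
      using w1 by (simp add: cinner_sum_right cinner_hadj'[OF poly_rep_bops] w_def)
    have "cinner ?Q ?Q = (\<Sum>i<N. \<Sum>j<N. cinner (w i) (hadj (S i) (S j (w j))))"
      unfolding cinner_sum_left unfolding cinner_sum_right by (simp add: cinner_hadj[OF poly_rep_bops])
    also have "\<dots> = (\<Sum>i<N. \<Sum>j<N. if j = i then cinner (w i) (w i) else 0)"
      by (intro sum.cong refl) (auto simp: hadj_S_S)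
    also have "\<dots> = 1" using w1 by simp
    finally have QQ: "cinner ?Q ?Q = 1" .
    have Qe: "cinner ?Q ?e = 1" using eQ by (subst cinner_commute) simp
    have "cinner (?Q - ?e) (?Q - ?e) = 0"
      by (simp add: cinner_diff_left cinner_diff_right QQ Qe eQ cinner_fourier_vec)
    then have "?Q = ?e" by (simp add: cinner_self)
    then show "(\<Sum>j<N. (S j \<circ> hadj (S j)) ?e) = ?e" by (simp add: w_def)
  qed
  then show ?thesis by (simp add: fun_eq_iff)
qed

theorem cuntz_rep_poly_rep: "cuntz_rep N S"
  unfolding cuntz_rep_def
  by (intro conjI allI impI poly_rep_bops hadj_bops hadj_S_S sum_S_hadj)

end

section \<open>The peripheral spectrum\<close>

lemma cspan_op_expand:
  assumes B: "finite B" "orthonormal B" and A: "A \<in> bops (cspan B) (cspan B)" and x: "x \<in> cspan B"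
  shows "A x = (\<Sum>p\<in>B \<times> B. cinner (fst p) (A (snd p)) *\<^sub>C cinner (snd p) x *\<^sub>C fst p)"
proof -
  have b: "b \<in> cspan B" if "b \<in> B" for b using that by (rule complex_vector.span_base)
  have "A x = A (\<Sum>b'\<in>B. cinner b' x *\<^sub>C b')" by (simp add: orthonormal_expand[OF B x])
  also have "\<dots> = (\<Sum>b'\<in>B. cinner b' x *\<^sub>C A b')"
    using A b by (subst bops_sum[OF A]) (auto simp: bops_scaleC csubspace_scaleC)
  also have "\<dots> = (\<Sum>b'\<in>B. cinner b' x *\<^sub>C (\<Sum>b\<in>B. cinner b (A b') *\<^sub>C b))"
    using A b by (intro sum.cong refl) (simp add: orthonormal_expand[OF B] bops_in)
  also have "\<dots> = (\<Sum>b\<in>B. \<Sum>b'\<in>B. cinner b (A b') *\<^sub>C cinner b' x *\<^sub>C b)"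
    by (subst sum.swap) (simp add: complex_vector.scale_sum_right scaleC_scaleC mult.commute)
  finally show ?thesis by (simp add: sum.cartesian_product case_prod_beta)
qed

text \<open>The images of the matrix units together with a given target are linearly dependent, and
  injectivity forces the target to occur in the relation.\<close>

lemma bops_inj_imp_surj:
  assumes B: "finite B" "orthonormal B" and K: "K = cspan B"
    and L: "\<And>A. A \<in> bops K K \<Longrightarrow> L A \<in> bops K K"
    and add: "\<And>A A'. A \<in> bops K K \<Longrightarrow> A' \<in> bops K K \<Longrightarrow> L (op_add K A A') = op_add K (L A) (L A')"
    and scale: "\<And>c A. A \<in> bops K K \<Longrightarrow> L (op_scale K c A) = op_scale K c (L A)"
    and inj: "inj_on L (bops K K)"
  shows "L ` bops K K = bops K K"
proof
  show "L ` bops K K \<subseteq> bops K K" using L by blast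
  show "bops K K \<subseteq> L ` bops K K"
  proof
    fix A assume A: "A \<in> bops K K"
    have sub: "csubspace K" by (simp add: K)
    have bK: "b \<in> K" if "b \<in> B" for b unfolding K using that by (rule complex_vector.span_base)
    define X where "X = B \<times> B"
    define E where "E p = (\<lambda>x\<in>K. cinner (snd p) x *\<^sub>C fst p)" for p :: "'a \<times> 'a"
    have E: "E p \<in> bops K K" if "p \<in> X" for p
      unfolding E_def
    proof (rule bops_restrictI[OF sub, where C = "norm (snd p) * norm (fst p)"])
      fix x
      show "norm (cinner (snd p) x *\<^sub>C fst p) \<le> norm (snd p) * norm (fst p) * norm x"
        using mult_right_mono[OF cmod_cinner_le[of "snd p" x], of "norm (fst p)"] by (simp add: mult_ac)
    qed (use that bK sub in \<open>auto simp: X_def csubspace_scaleC cinner_linear scaleC_add_left scaleC_scaleC\<close>)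
    have zero: "(\<lambda>x\<in>K. 0) \<in> bops K K" using sub by (intro bops_zero_op)
    have comb: "(\<lambda>x\<in>K. \<Sum>p\<in>F. c p *\<^sub>C E p x) \<in> bops K K \<and>
        L (\<lambda>x\<in>K. \<Sum>p\<in>F. c p *\<^sub>C E p x) = (\<lambda>x\<in>K. \<Sum>p\<in>F. c p *\<^sub>C L (E p) x)"
      if "finite F" "F \<subseteq> X" for F c
      using that
    proof induction
      case empty
      have h: "op_scale K 0 Y = (\<lambda>x\<in>K. 0)" for Y :: "'a \<Rightarrow> 'a" by (rule ext) (simp add: op_scale_def)
      have "L (\<lambda>x\<in>K. 0) = (\<lambda>x\<in>K. 0)" using scale[OF zero, of 0] unfolding h .
      then show ?case using zero by (simp only: sum.empty)
    next
      case (insert p F)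
      let ?Z = "\<lambda>x\<in>K. \<Sum>p\<in>F. c p *\<^sub>C E p x"
      have eq: "(\<lambda>x\<in>K. \<Sum>p\<in>insert p F. c p *\<^sub>C E p x) = op_add K (op_scale K (c p) (E p)) ?Z"
        using insert(1,2) by (intro ext) (simp add: op_add_def op_scale_def)
      have IH: "?Z \<in> bops K K" "L ?Z = (\<lambda>x\<in>K. \<Sum>p\<in>F. c p *\<^sub>C L (E p) x)"
        using conjunct1[OF insert(3)] conjunct2[OF insert(3)] insert(4) by blast+
      have p: "op_scale K (c p) (E p) \<in> bops K K" using insert E sub by (intro bops_scale_op) auto
      have "L (op_add K (op_scale K (c p) (E p)) ?Z) = op_add K (op_scale K (c p) (L (E p))) (L ?Z)"
        using p IH(1) E insert by (simp add: add scale)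
      also have "\<dots> = (\<lambda>x\<in>K. \<Sum>p\<in>insert p F. c p *\<^sub>C L (E p) x)"
        unfolding IH(2) using insert(1,2) by (intro ext) (simp add: op_add_def op_scale_def)
      finally show ?case unfolding eq using p IH(1) sub by (auto intro: bops_add_op)
    qed
    have fin: "finite X" using B by (simp add: X_def)
    \<comment> \<open>\<open>None\<close> tags the target \<open>A\<close> and
      \<open>Some p'\<close> the image of a matrix unit, one vector more than there are
      equations.\<close>
    define f where "f i p = (case i of None \<Rightarrow> cinner (fst p) (A (snd p)) | Some p' \<Rightarrow> cinner (fst p) (L (E p') (snd p)))"
      for i and p :: "'a \<times> 'a"
    let ?I = "insert None (Some ` X)"
    have "card ?I = Suc (card X)" using fin by (simp add: card_image)
    then obtain c where c: "\<exists>i\<in>?I. c i \<noteq> 0" "\<And>p. p \<in> X \<Longrightarrow> (\<Sum>i\<in>?I. c i * f i p) = 0"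
      using exists_linear_relation[OF fin, of ?I f] fin by auto
    define Z where "Z = (\<lambda>x\<in>K. \<Sum>p\<in>X. c (Some p) *\<^sub>C E p x)"
    have Z: "Z \<in> bops K K" "L Z = (\<lambda>x\<in>K. \<Sum>p\<in>X. c (Some p) *\<^sub>C L (E p) x)"
      unfolding Z_def using comb[OF fin subset_refl, of "\<lambda>p. c (Some p)"] by auto
    define R where "R = op_add K (op_scale K (c None) A) (L Z)"
    have R: "R \<in> bops K K" unfolding R_def using A L[OF Z(1)] sub by (intro bops_add_op bops_scale_op)
    have "cinner b (R b') = 0" if "b \<in> B" "b' \<in> B" for b b'
    proof -
      have "(\<Sum>i\<in>?I. c i * f i (b, b')) = cinner b (R b')"
        using fin bK that by (simp add: sum.reindex f_def R_def op_add_def op_scale_def Z(2) cinner_linear)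
      then show ?thesis using c(2)[of "(b, b')"] that by (simp add: X_def)
    qed
    then have R0: "R x = 0" if "x \<in> K" for x
      using cspan_op_expand[OF B, of R x] R that by (simp add: K X_def) (intro sum.neutral, auto)
    have "c None \<noteq> 0"
    proof
      assume n: "c None = 0"
      have "L Z = L (\<lambda>x\<in>K. 0)"
      proof (rule bops_eqI[OF L[OF Z(1)] L[OF zero]])
        fix x assume x: "x \<in> K"
        have "L (\<lambda>x\<in>K. 0) x = 0" using comb[of "{}" "\<lambda>_. 0"] x by simp
        then show "L Z x = L (\<lambda>x\<in>K. 0) x" using R0[OF x] n x by (simp add: R_def op_add_def op_scale_def)
      qed
      then have Z0: "Z = (\<lambda>x\<in>K. 0)" using inj Z(1) zero by (auto dest: inj_onD)
      have "c (Some p) = 0" if p: "p \<in> X" for p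
      proof -
        have ps: "fst p \<in> B" "snd p \<in> B" using p by (auto simp: X_def)
        have "cinner (fst p) (Z (snd p)) = (\<Sum>p'\<in>X. if p' = p then c (Some p) else 0)"
          unfolding Z_def using bK[OF ps(2)] B(2) ps
          by (simp add: cinner_linear E_def) (intro sum.cong refl, auto simp: X_def orthonormal_def prod_eq_iff)
        then show ?thesis using fin p Z0 bK[OF ps(2)] by simp
      qed
      then show False using c(1) n by auto
    qed
    have "A = L (op_scale K (- 1 / c None) Z)"
    proof (rule bops_eqI[OF A])
      show "L (op_scale K (- 1 / c None) Z) \<in> bops K K" using Z sub by (intro L bops_scale_op)
      fix x assume x: "x \<in> K"
      have "c None *\<^sub>C A x = - L Z x" using R0[OF x] x by (simp add: R_def op_add_def op_scale_def eq_neg_iff_add_eq_0)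
      then have "(1 / c None) *\<^sub>C c None *\<^sub>C A x = (1 / c None) *\<^sub>C (- L Z x)" by simp
      then show "A x = L (op_scale K (- 1 / c None) Z) x"
        using \<open>c None \<noteq> 0\<close> x unfolding scale[OF Z(1)] by (simp add: op_scale_def scaleC_scaleC)
    qed
    then show "A \<in> L ` bops K K" using Z sub by (intro image_eqI[where x = "op_scale K (- 1 / c None) Z"] bops_scale_op)
  qed
qed

text \<open>\<open>bops_inj_imp_surj\<close> reduces bijectivity to injectivity, and a nonzero
  kernel element of \<open>c - \<Phi>\<close> is an eigenvector.\<close>

lemma map_spectrum_iff_eigenvector:
  assumes B: "finite B" "orthonormal B" and K: "K = cspan B"
    and \<Phi>: "\<And>A. A \<in> bops K K \<Longrightarrow> \<Phi> A \<in> bops K K"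
    and add: "\<And>A A'. A \<in> bops K K \<Longrightarrow> A' \<in> bops K K \<Longrightarrow> \<Phi> (op_add K A A') = op_add K (\<Phi> A) (\<Phi> A')"
    and scale: "\<And>c A. A \<in> bops K K \<Longrightarrow> \<Phi> (op_scale K c A) = op_scale K c (\<Phi> A)"
  shows "c \<in> map_spectrum K \<Phi> \<longleftrightarrow> (\<exists>A\<in>bops K K. (\<exists>x\<in>K. A x \<noteq> 0) \<and> (\<forall>x\<in>K. \<Phi> A x = c *\<^sub>C A x))"
proof -
  let ?L = "\<lambda>A. \<lambda>x\<in>K. c *\<^sub>C A x - \<Phi> A x"
  have sub: "csubspace K" by (simp add: K)
  have L: "?L A \<in> bops K K" if A: "A \<in> bops K K" for A
  proof -
    have "?L A = op_add K (op_scale K c A) (op_scale K (-1) (\<Phi> A))"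
      by (intro ext) (simp add: op_add_def op_scale_def)
    then show ?thesis using A \<Phi> sub by (auto intro: bops_add_op bops_scale_op)
  qed
  have Ladd: "?L (op_add K A A') = op_add K (?L A) (?L A')" if "A \<in> bops K K" "A' \<in> bops K K" for A A'
    using that by (intro ext) (simp add: add, simp add: op_add_def scaleC_add_right)
  have Lscale: "?L (op_scale K d A) = op_scale K d (?L A)" if "A \<in> bops K K" for d A
    using that by (intro ext) (simp add: scale, simp add: op_scale_def complex_vector.scale_right_diff_distrib
        scaleC_scaleC mult.commute)
  have zero: "(\<lambda>x\<in>K. 0) \<in> bops K K" using sub by (intro bops_zero_op)
  have inj_iff: "inj_on ?L (bops K K) \<longleftrightarrow> \<not> (\<exists>A\<in>bops K K. (\<exists>x\<in>K. A x \<noteq> 0) \<and> (\<forall>x\<in>K. \<Phi> A x = c *\<^sub>C A x))"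
  proof
    assume inj: "inj_on ?L (bops K K)"
    show "\<not> (\<exists>A\<in>bops K K. (\<exists>x\<in>K. A x \<noteq> 0) \<and> (\<forall>x\<in>K. \<Phi> A x = c *\<^sub>C A x))"
    proof
      assume "\<exists>A\<in>bops K K. (\<exists>x\<in>K. A x \<noteq> 0) \<and> (\<forall>x\<in>K. \<Phi> A x = c *\<^sub>C A x)"
      then obtain A x where A: "A \<in> bops K K" "x \<in> K" "A x \<noteq> 0" "\<forall>x\<in>K. \<Phi> A x = c *\<^sub>C A x" by blast
      have h: "op_scale K 0 Y = (\<lambda>x\<in>K. 0)" for Y :: "'a \<Rightarrow> 'a" by (rule ext) (simp add: op_scale_def)
      have "?L (\<lambda>x\<in>K. 0) = (\<lambda>x\<in>K. 0)" using Lscale[OF zero, of 0] unfolding h .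
      moreover have "?L A = (\<lambda>x\<in>K. 0)" using A(4) by (intro ext) simp
      ultimately have "?L A = ?L (\<lambda>x\<in>K. 0)" by simp
      then have "A = (\<lambda>x\<in>K. 0)" by (rule inj_onD[OF inj _ A(1) zero])
      then show False using A(2,3) by simp
    qed
  next
    assume no: "\<not> (\<exists>A\<in>bops K K. (\<exists>x\<in>K. A x \<noteq> 0) \<and> (\<forall>x\<in>K. \<Phi> A x = c *\<^sub>C A x))"
    show "inj_on ?L (bops K K)"
    proof (rule inj_onI)
      fix A A' assume A: "A \<in> bops K K" "A' \<in> bops K K" and eq: "?L A = ?L A'"
      let ?D = "op_add K A (op_scale K (-1) A')"
      have A'': "op_scale K (-1) A' \<in> bops K K" using A sub by (intro bops_scale_op)
      have D: "?D \<in> bops K K" using A A'' sub by (intro bops_add_op)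
      have "?L ?D = op_add K (?L A) (op_scale K (-1) (?L A'))"
        by (simp only: Ladd[OF A(1) A''] Lscale[OF A(2)])
      then have e: "\<And>x. ?L ?D x = op_add K (?L A) (op_scale K (-1) (?L A')) x" by (rule fun_cong)
      have z: "op_add K (?L A) (op_scale K (-1) (?L A')) x = 0" if "x \<in> K" for x
        using fun_cong[OF eq, of x] that by (simp add: op_add_def op_scale_def)
      have "?L ?D x = 0" if "x \<in> K" for x by (simp only: e z[OF that])
      then have "\<forall>x\<in>K. \<Phi> ?D x = c *\<^sub>C ?D x" by simp
      then have "\<forall>x\<in>K. ?D x = 0" using no D by blast
      then show "A = A'" by (intro bops_eqI[OF A]) (auto simp: op_add_def op_scale_def)
    qed
  qed
  have "bij_betw ?L (bops K K) (bops K K) \<longleftrightarrow> inj_on ?L (bops K K)"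
  proof
    assume "inj_on ?L (bops K K)"
    moreover from this have "?L ` bops K K = bops K K"
      by (intro bops_inj_imp_surj[OF B K, where L = ?L] L Ladd Lscale)
    ultimately show "bij_betw ?L (bops K K) (bops K K)" by (simp add: bij_betw_def)
  qed (simp add: bij_betw_def)
  then show ?thesis unfolding map_spectrum_def using inj_iff by simp
qed

lemma group_circle: "group circle_group"
proof (rule groupI)
  fix x assume "x \<in> carrier circle_group"
  then show "\<exists>y\<in>carrier circle_group. y \<otimes>\<^bsub>circle_group\<^esub> x = \<one>\<^bsub>circle_group\<^esub>"
    by (intro bexI[of _ "inverse x"]) (auto simp: circle_group_def norm_inverse intro!: left_inverse)
qed (auto simp: circle_group_def norm_mult)

lemma inv_circle: "cmod x = 1 \<Longrightarrow> inv\<^bsub>circle_group\<^esub> x = inverse x"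
  by (rule group.inv_equality[OF group_circle]) (auto simp: circle_group_def norm_inverse intro!: left_inverse)

context irreducible_family
begin

lemma subgroup_\<Gamma>: "subgroup \<Gamma> circle_group"
proof
  show "\<Gamma> \<subseteq> carrier circle_group" by (auto simp: circle_group_def \<Gamma>_def)
  show "x \<otimes>\<^bsub>circle_group\<^esub> y \<in> \<Gamma>" if "x \<in> \<Gamma>" "y \<in> \<Gamma>" for x y
    using that mult_in_\<Gamma> by (simp add: circle_group_def)
  show "\<one>\<^bsub>circle_group\<^esub> \<in> \<Gamma>" by (simp add: circle_group_def one_in_\<Gamma>)
  fix x assume x: "x \<in> \<Gamma>"
  then have "x ^ k = 1" "cmod x = 1" using \<Gamma>_eq by (auto simp: \<Gamma>_def)
  then show "inv\<^bsub>circle_group\<^esub> x \<in> \<Gamma>"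
    by (subst \<Gamma>_eq) (simp add: inv_circle power_inverse)
qed

lemma cyclic_\<Gamma>: "cyclic_group (circle_group\<lparr>carrier := \<Gamma>\<rparr>)"
proof -
  let ?G = "circle_group\<lparr>carrier := \<Gamma>\<rparr>"
  interpret G: group ?G by (rule subgroup.subgroup_is_group[OF subgroup_\<Gamma> group_circle])
  have pow: "\<omega> [^]\<^bsub>?G\<^esub> (n::nat) = \<omega> ^ n" for n
    by (induction n) (simp_all add: circle_group_def)
  have "carrier ?G = range (\<lambda>n::int. \<omega> [^]\<^bsub>?G\<^esub> n)"
  proof
    have \<omega>: "\<omega> \<in> carrier ?G" using \<omega>_in_\<Gamma>[of 1] by simp
    show "range (\<lambda>n::int. \<omega> [^]\<^bsub>?G\<^esub> n) \<subseteq> carrier ?G" using G.int_pow_closed[OF \<omega>] by blast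
    show "carrier ?G \<subseteq> range (\<lambda>n::int. \<omega> [^]\<^bsub>?G\<^esub> n)"
    proof
      fix x assume "x \<in> carrier ?G"
      then obtain l where "x = \<omega> ^ l" using bij_betw_imp_surj_on[OF bij_\<omega>] by auto
      then have "x = \<omega> [^]\<^bsub>?G\<^esub> (int l)" by (simp add: pow int_pow_int)
      then show "x \<in> range (\<lambda>n::int. \<omega> [^]\<^bsub>?G\<^esub> n)" by blast
    qed
  qed
  then show ?thesis unfolding G.cyclic_group using \<omega>_in_\<Gamma>[of 1] by auto
qed

end

section \<open>The compressed operators and the transfer map\<close>

lemma transfer_map_cong:
  assumes "\<And>i. i < N \<Longrightarrow> W i = W' i" "\<And>i. i < N \<Longrightarrow> V i = V' i"
  shows "transfer_map N K W V = transfer_map N K W' V'"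
  by (intro ext) (simp add: transfer_map_def assms cong: sum.cong_simp)

context absorbed_family
begin

definition Vs :: "nat \<Rightarrow> 'a \<Rightarrow> 'a" where
  "Vs i = (\<lambda>x\<in>K. P (Sd i x))"

definition W :: "nat \<Rightarrow> 'a \<Rightarrow> 'a" where
  "W i = op_adj K K (Vs i)"

definition \<sigma> :: "('a \<Rightarrow> 'a) \<Rightarrow> 'a \<Rightarrow> 'a" where
  "\<sigma> = transfer_map N K W Vs"

lemma Vs_bops: "i < N \<Longrightarrow> Vs i \<in> bops K K"
proof -
  assume i: "i < N"
  have "P \<circ> Sd i \<in> bops UNIV K" by (rule bops_comp[OF proj_bops Sd_bops[OF i]])
  then obtain C where "\<And>x. norm ((P \<circ> Sd i) x) \<le> C * norm x" by (metis bops_bound UNIV_I)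
  then show ?thesis unfolding Vs_def using Sd_bops[OF i]
    by (intro bops_restrictI[where C = C]) (auto simp: proj_add proj_scaleC bops_add bops_scaleC)
qed

lemma W_bops: "i < N \<Longrightarrow> W i \<in> bops K K"
  unfolding W_def by (rule op_adj_bops[OF csub closed_K csub Vs_bops])

lemma W_in_K: "i < N \<Longrightarrow> x \<in> K \<Longrightarrow> W i x \<in> K"
  using W_bops by (rule bops_in)

lemma cinner_W: "i < N \<Longrightarrow> y \<in> K \<Longrightarrow> x \<in> K \<Longrightarrow> cinner y (W i x) = cinner (Sd i y) x"
  using cinner_op_adj[OF csub closed_K csub Vs_bops, of i y x] by (simp add: W_def Vs_def cinner_proj')

lemma \<sigma>_bops:
  assumes "A \<in> bops K K" shows "\<sigma> A \<in> bops K K"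
proof -
  have "(\<lambda>x\<in>K. \<Sum>i\<in>I. W i (A (Vs i x))) \<in> bops K K" if "finite I" "I \<subseteq> {..<N}" for I
    using that
  proof induction
    case empty
    have "(\<lambda>x\<in>K. 0) \<in> bops K K" by (rule bops_zero_op) auto
    then show ?case by (simp only: sum.empty)
  next
    case (insert i I)
    let ?Z = "\<lambda>x\<in>K. \<Sum>i\<in>I. W i (A (Vs i x))" and ?Y = "\<lambda>x\<in>K. W i (A (Vs i x))"
    have i: "i < N" using insert by simp
    have Y: "?Y \<in> bops K K"
    proof -
      have "(W i \<circ> (A \<circ> (Vs i \<circ> P))) \<in> bops UNIV K"
        using i assms by (intro bops_comp[OF W_bops] bops_comp[of A K K] bops_comp[OF Vs_bops] proj_bops) auto
      then obtain C where C: "\<And>x. norm ((W i \<circ> (A \<circ> (Vs i \<circ> P))) x) \<le> C * norm x" by (metis bops_bound UNIV_I)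
      have "norm (W i (A (Vs i x))) \<le> C * norm x" if "x \<in> K" for x using C[of x] that by simp
      then show ?thesis using i assms Vs_bops[OF i] W_bops[OF i]
        by (intro bops_restrictI[where C = C]) (auto simp: bops_add bops_scaleC bops_in)
    qed
    have "(\<lambda>x\<in>K. \<Sum>i\<in>insert i I. W i (A (Vs i x))) = op_add K ?Y ?Z"
      using insert(1,2) by (intro ext) (simp add: op_add_def)
    moreover have "?Z \<in> bops K K" using insert.IH insert.prems by blast
    ultimately show ?case using Y by (simp only:) (intro bops_add_op csub)
  qed
  then show ?thesis by (simp add: \<sigma>_def transfer_map_def)
qed

lemma \<sigma>_add:
  assumes "A \<in> bops K K" "A' \<in> bops K K"
  shows "\<sigma> (op_add K A A') = op_add K (\<sigma> A) (\<sigma> A')"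
  by (intro ext) (simp add: \<sigma>_def transfer_map_def op_add_def sum.distrib bops_in[OF Vs_bops]
      bops_in[OF assms(1)] bops_in[OF assms(2)] bops_add[OF W_bops] cong: sum.cong_simp)

lemma \<sigma>_scale:
  assumes "A \<in> bops K K"
  shows "\<sigma> (op_scale K c A) = op_scale K c (\<sigma> A)"
  by (intro ext) (simp add: \<sigma>_def transfer_map_def op_scale_def complex_vector.scale_sum_right
      bops_in[OF Vs_bops] bops_in[OF assms] bops_scaleC[OF W_bops] cong: sum.cong_simp)

end

context absorbed_pair
begin

lemma Fix_eq: "Fix = {V \<in> bops X.K Y.K. \<forall>x\<in>X.K. \<gamma> *\<^sub>C transfer_map N X.K Y.W X.Vs V x = V x}"
proof -
  have "V \<in> Fix \<longleftrightarrow> (\<forall>x\<in>X.K. \<gamma> *\<^sub>C transfer_map N X.K Y.W X.Vs V x = V x)" if "V \<in> bops X.K Y.K" for V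
    using that by (rule Fix_iff_transfer) (auto simp: X.Vs_def Y.W_in_K Y.cinner_W)
  then show ?thesis using Fix_bops by blast
qed

text \<open>Both sides of the fixed point equation are \<open>undefined\<close> off
  \<open>X.K\<close>, so equality on \<open>X.K\<close> is equality of functions.\<close>

lemma Fix_1_eq:
  assumes "\<gamma> = 1"
  shows "Fix = {V \<in> bops X.K Y.K. transfer_map N X.K Y.W X.Vs V = V}"
proof -
  have "(\<forall>x\<in>X.K. transfer_map N X.K Y.W X.Vs V x = V x) \<longleftrightarrow> transfer_map N X.K Y.W X.Vs V = V"
    if "V \<in> bops X.K Y.K" for V
    using bops_undefined[OF that] by (auto simp: fun_eq_iff transfer_map_def)
  then show ?thesis unfolding Fix_eq unfolding assms by auto
qed

end

lemma isometric_linear_iso_cong: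
  assumes "isometric_linear_iso M \<A> L \<B> \<phi>"
    and "\<And>A. A \<in> \<A> \<Longrightarrow> \<psi> A = \<phi> A"
    and "\<And>A B. A \<in> \<A> \<Longrightarrow> B \<in> \<A> \<Longrightarrow> op_add M A B \<in> \<A>" "\<And>c A. A \<in> \<A> \<Longrightarrow> op_scale M c A \<in> \<A>"
  shows "isometric_linear_iso M \<A> L \<B> \<psi>"
  using assms unfolding isometric_linear_iso_def by (auto simp: cong: bij_betw_cong)

context absorbed_family
begin

interpretation self: absorbed_pair N S B S B 1
  by (rule absorbed_pair_self) simp

lemma commutant_eq_Intw: "commutant (cuntz_image N S) = self.Intw"
  by (auto simp: commutant_cuntz_image self.Intw_iff)

lemma fixed_eq_Fix: "{A \<in> bops K K. \<sigma> A = A} = self.Fix"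
  by (simp add: self.Fix_1_eq \<sigma>_def)

lemma commutant_iso_exists:
  "\<exists>\<phi>. isometric_linear_iso UNIV (commutant (cuntz_image N S)) K {A \<in> bops K K. \<sigma> A = A} \<phi> \<and>
     (\<forall>X \<in> commutant (cuntz_image N S). \<forall>Y \<in> commutant (cuntz_image N S).
        op_le UNIV X Y \<longleftrightarrow> op_le K (\<phi> X) (\<phi> Y))"
  unfolding commutant_eq_Intw fixed_eq_Fix using self.compression_iso compression_order_iso by blast

lemma coinvariant_imp_absorbed: "coinvariant N S K \<Longrightarrow> K \<subseteq> Ab 0"
  by (auto simp: coinvariant_def intro: absorbed_0_I)

lemma id_Intw: "(\<lambda>x. x) \<in> self.Intw"
  by (simp add: self.Intw_iff bops_ident)

text \<open>The compression of the identity need not be the identity of \<open>K\<close>. Here it is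
  a multiple \<open>d\<close> of it, nonzero because compression is injective, and an operator that
  compresses to the multiple \<open>c\<close> must be the scalar \<open>c / d\<close>.\<close>

lemma irreducible_if_fixed_scalar:
  assumes fixed: "{A \<in> bops K K. \<sigma> A = A} = {\<lambda>x\<in>K. c *\<^sub>C x | c. True}" and nontrivial: "(UNIV :: 'a set) \<noteq> {0}"
  shows "irreducible_on (cuntz_image N S) UNIV"
proof (rule irreducible_if_scalar[OF _ nontrivial])
  fix X assume "X \<in> Eig 1"
  then have X: "X \<in> self.Intw" by (simp add: commutant_eq_Eig[symmetric] commutant_eq_Intw)
  have scalar: "\<exists>c. self.compression Y = (\<lambda>x\<in>K. c *\<^sub>C x)" if "Y \<in> self.Intw" for Y
    using self.compression_Fix[OF that] fixed unfolding fixed_eq_Fix by auto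
  have iso: "inj_on self.compression self.Intw"
    "\<And>c Y. Y \<in> self.Intw \<Longrightarrow> self.compression (op_scale UNIV c Y) = op_scale K c (self.compression Y)"
    using self.compression_iso by (auto simp: isometric_linear_iso_def bij_betw_def)
  obtain d where d: "self.compression (\<lambda>x. x) = (\<lambda>x\<in>K. d *\<^sub>C x)" using scalar[OF id_Intw] by blast
  obtain c where c: "self.compression X = (\<lambda>x\<in>K. c *\<^sub>C x)" using scalar[OF X] by blast
  have eq: "op_scale UNIV d X = op_scale UNIV c (\<lambda>x. x)"
  proof (rule inj_onD[OF iso(1)])
    show "self.compression (op_scale UNIV d X) = self.compression (op_scale UNIV c (\<lambda>x. x))"
      unfolding iso(2)[OF X] iso(2)[OF id_Intw] c d by (intro ext) (simp add: op_scale_def scaleC_scaleC mult.commute)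
  qed (intro self.Intw_scale X id_Intw)+
  have "d \<noteq> 0"
  proof
    assume "d = 0"
    then have "self.compression (\<lambda>x. x) = self.compression (op_scale UNIV 0 (\<lambda>x. x))"
      unfolding iso(2)[OF id_Intw] d by (intro ext) (simp add: op_scale_def)
    then have "(\<lambda>x::'a. x) = op_scale UNIV 0 (\<lambda>x. x)"
      by (rule inj_onD[OF iso(1)]) (intro self.Intw_scale id_Intw)+
    then have "x = 0" for x :: 'a by (simp add: fun_eq_iff op_scale_def)
    then show False using nontrivial by blast
  qed
  have "X x = (c / d) *\<^sub>C x" for x
  proof -
    have "(1 / d) *\<^sub>C d *\<^sub>C X x = (1 / d) *\<^sub>C c *\<^sub>C x" using fun_cong[OF eq, of x] by (simp add: op_scale_def)
    then show ?thesis using \<open>d \<noteq> 0\<close> by (simp add: scaleC_scaleC)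
  qed
  then show "\<exists>c. X = (\<lambda>x. c *\<^sub>C x)" by blast
qed

text \<open>Coinvariance makes compression the literal cut-down to \<open>K\<close>, so scalars
  compress to the same scalars.\<close>

lemma fixed_scalar_if_irreducible:
  assumes irr: "irreducible_on (cuntz_image N S) UNIV" and co: "coinvariant N S K"
  shows "{A \<in> bops K K. \<sigma> A = A} = {\<lambda>x\<in>K. c *\<^sub>C x | c. True}"
proof -
  have comp: "self.compression (\<lambda>x. c *\<^sub>C x) = (\<lambda>x\<in>K. c *\<^sub>C x)" if "(\<lambda>x. c *\<^sub>C x) \<in> self.Intw" for c
    using self.compression_coinvariant[OF coinvariant_imp_absorbed[OF co] coinvariant_imp_absorbed[OF co] that]
    by (simp add: fun_eq_iff csubspace_scaleC)
  have Intw: "self.Intw = {\<lambda>x. c *\<^sub>C x | c. True}"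
  proof (intro subset_antisym subsetI)
    fix X assume "X \<in> self.Intw"
    then have "X \<in> Eig 1" by (simp add: commutant_eq_Eig[symmetric] commutant_eq_Intw)
    then show "X \<in> {\<lambda>x. c *\<^sub>C x | c. True}" using scalar_if_irreducible[OF irr] by blast
  next
    fix X :: "'a \<Rightarrow> 'a" assume "X \<in> {\<lambda>x. c *\<^sub>C x | c. True}"
    then show "X \<in> self.Intw" using self.Intw_scale[OF id_Intw] by (auto simp: op_scale_def restrict_UNIV)
  qed
  have "self.Fix = self.compression ` self.Intw"
    using self.compression_iso by (auto simp: isometric_linear_iso_def bij_betw_def)
  also have "\<dots> = {\<lambda>x\<in>K. c *\<^sub>C x | c. True}"
    using comp unfolding Intw by (auto simp: image_iff) metis
  finally show ?thesis by (simp add: fixed_eq_Fix)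
qed

end

context irreducible_family
begin

lemma peripheral_spectrum_\<sigma>: "peripheral_spectrum K \<sigma> = \<Gamma>"
proof (intro Set.set_eqI)
  fix c
  show "c \<in> peripheral_spectrum K \<sigma> \<longleftrightarrow> c \<in> \<Gamma>"
  proof (cases "cmod c = 1")
    case True
    \<comment> \<open>With twist \<open>inverse c\<close> the invariant operators are the
      c-eigenvectors of \<open>\<rho>\<close> and their partners are the c-eigenvectors of
      \<open>\<sigma>\<close>.\<close>
    interpret tw: absorbed_pair N S B S B "inverse c"
      by (rule absorbed_pair_self) (simp add: norm_inverse True)
    have c0: "c \<noteq> 0" using True by auto
    have Intw: "tw.Intw = Eig c" by (auto simp: tw.Intw_iff Eig_iff[OF c0])
    have Fix: "tw.Fix = {A \<in> bops K K. \<forall>x\<in>K. \<sigma> A x = c *\<^sub>C A x}"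
    proof -
      have "inverse c *\<^sub>C y = z \<longleftrightarrow> y = c *\<^sub>C z" for y z :: 'a using c0 by (auto simp: scaleC_scaleC)
      then show ?thesis unfolding tw.Fix_eq \<sigma>_def by simp
    qed
    \<comment> \<open>The isometry keeps eigenvectors nonzero in both directions.\<close>
    have zero: "(\<exists>x. X x \<noteq> 0) \<longleftrightarrow> (\<exists>x\<in>K. tw.compression X x \<noteq> 0)" if X: "X \<in> tw.Intw" for X
    proof -
      have norm: "op_norm K (tw.compression X) = op_norm UNIV X"
        using tw.compression_iso X by (simp add: isometric_linear_iso_def)
      have Xb: "X \<in> bops UNIV UNIV" and Yb: "tw.compression X \<in> bops K K"
        using X tw.Intw_bops tw.Fix_bops[OF tw.compression_Fix] by auto
      have *: "(\<forall>x\<in>M. A x = 0) \<longleftrightarrow> op_norm M A = 0" if "A \<in> bops M L" "csubspace M" for M L and A :: "'a \<Rightarrow> 'a"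
      proof
        assume "\<forall>x\<in>M. A x = 0"
        moreover from this have "op_norm M A \<le> 0" using that by (intro op_norm_least) auto
        ultimately show "op_norm M A = 0" using op_norm_nonneg[OF that(1)] that by (auto intro: antisym)
      next
        assume "op_norm M A = 0"
        then show "\<forall>x\<in>M. A x = 0" using op_norm_eq_0 that by blast
      qed
      show ?thesis using *[OF Xb] *[OF Yb] norm by auto
    qed
    have "c \<in> map_spectrum K \<sigma> \<longleftrightarrow> (\<exists>A\<in>bops K K. (\<exists>x\<in>K. A x \<noteq> 0) \<and> (\<forall>x\<in>K. \<sigma> A x = c *\<^sub>C A x))"
      by (rule map_spectrum_iff_eigenvector[OF finite_B orthonormal_B refl \<sigma>_bops \<sigma>_add \<sigma>_scale])
    also have "\<dots> \<longleftrightarrow> (\<exists>A\<in>tw.Fix. \<exists>x\<in>K. A x \<noteq> 0)" unfolding Fix by blast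
    also have "\<dots> \<longleftrightarrow> (\<exists>X\<in>tw.Intw. \<exists>x\<in>K. tw.compression X x \<noteq> 0)"
    proof -
      have "tw.Fix = tw.compression ` tw.Intw"
        using tw.compression_iso by (auto simp: isometric_linear_iso_def bij_betw_def)
      then show ?thesis by auto
    qed
    also have "\<dots> \<longleftrightarrow> c \<in> \<Gamma>" using zero True by (auto simp: \<Gamma>_def simp flip: Intw)
    finally show ?thesis using True by (simp add: peripheral_spectrum_def)
  qed (simp add: peripheral_spectrum_def \<Gamma>_def)
qed

end

section \<open>Absorbing sets of Fourier modes\<close>

locale absorbing_poly_data = poly_data N A D a for N and A :: "int^'n::finite^'n" and D a +
  fixes H :: "(int^'n) set"
  assumes absorbing: "absorbing N S H"

text \<open>Each Fourier vector is absorbed at a level of its own. The levels increase, so their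
  union is a subspace and contains the dense span of all Fourier vectors.\<close>

sublocale absorbing_poly_data \<subseteq> absorbed_family N "poly_rep A D a" "fourier_vec ` H"
proof -
  interpret cuntz_family N "poly_rep A D a" by standard (rule cuntz_rep_poly_rep)
  let ?K = "cspan (fourier_vec ` H)"
  have finite_H: "finite H" using absorbing by (simp add: absorbing_def)
  have level: "\<exists>M. fourier_vec n \<in> absorbed ?K M" for n
  proof -
    obtain M where M: "\<And>I. set I \<subseteq> {..<N} \<Longrightarrow> M \<le> length I \<Longrightarrow> hadj (op_word S I) (fourier_vec n) \<in> ?K"
      using absorbing unfolding absorbing_def fourier_span_def by metis
    then have "fourier_vec n \<in> absorbed ?K M" by (auto simp: absorbed_def simp flip: hadj_op_word)
    then show ?thesis ..
  qed
  have sub: "csubspace (\<Union>M. absorbed ?K M)"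
  proof (rule complex_vector.subspaceI)
    have s: "csubspace (absorbed ?K M)" for M by (rule csubspace_absorbed) simp
    show "0 \<in> (\<Union>M. absorbed ?K M)" using csubspace_0[OF s] by auto
    show "c *\<^sub>C x \<in> (\<Union>M. absorbed ?K M)" if "x \<in> (\<Union>M. absorbed ?K M)" for x c
      using that csubspace_scaleC[OF s] by auto
    fix x y assume "x \<in> (\<Union>M. absorbed ?K M)" "y \<in> (\<Union>M. absorbed ?K M)"
    then obtain M M' where "x \<in> absorbed ?K M" "y \<in> absorbed ?K M'" by auto
    then have "x \<in> absorbed ?K (max M M')" "y \<in> absorbed ?K (max M M')"
      using absorbed_mono[of M "max M M'" ?K] absorbed_mono[of M' "max M M'" ?K] by auto
    then show "x + y \<in> (\<Union>M. absorbed ?K M)" using csubspace_add[OF s] by blast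
  qed
  have "cspan (range fourier_vec) \<subseteq> (\<Union>M. absorbed ?K M)"
    by (rule complex_vector.span_minimal[OF _ sub]) (use level in auto)
  then have "closure (\<Union>M. absorbed ?K M) = UNIV" using closure_mono closure_fourier by blast
  then show "absorbed_family N (poly_rep A D a) (fourier_vec ` H)"
    using finite_H by unfold_locales (auto simp: orthonormal_def cinner_fourier_vec fourier_vec_inj)
qed

context absorbing_poly_data
begin

lemma finite_H: "finite H"
  using absorbing by (simp add: absorbing_def)

lemma inj_fourier_vec: "inj_on fourier_vec H"
  by (rule inj_onI) (simp add: fourier_vec_inj)

lemma Vs_fourier:
  assumes "j < N" "n \<in> H"
  shows "Vs j (fourier_vec n) = (\<Sum>m\<in>H. cnj (a j (n - A *v m)) *\<^sub>C fourier_vec m)"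
  using assms by (simp add: Vs_def complex_vector.span_base proj_expand sum.reindex[OF inj_fourier_vec]
      cinner_hadj_fourier)

text \<open>Whether or not \<open>K\<close> is coinvariant, the explicit matrix is that of the
  compression of \<open>hadj (S j)\<close>: its entries are the coefficients in
  \<open>cinner_hadj_fourier\<close>.\<close>

lemma V_adj_eq_Vs: assumes j: "j < N" shows "V_adj A a H j = Vs j"
proof
  fix x
  show "V_adj A a H j x = Vs j x"
  proof (cases "x \<in> K")
    case True
    have "Vs j x = Vs j (\<Sum>b\<in>fourier_vec ` H. cinner b x *\<^sub>C b)"
      by (simp add: orthonormal_expand[OF finite_B orthonormal_B True])
    also have "\<dots> = (\<Sum>b\<in>fourier_vec ` H. cinner b x *\<^sub>C Vs j b)"
      by (subst bops_sum[OF Vs_bops[OF j]])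
        (auto simp: bops_scaleC[OF Vs_bops[OF j]] csubspace_scaleC complex_vector.span_base)
    also have "\<dots> = (\<Sum>n\<in>H. cinner (fourier_vec n) x *\<^sub>C (\<Sum>m\<in>H. cnj (a j (n - A *v m)) *\<^sub>C fourier_vec m))"
      using j by (simp add: sum.reindex[OF inj_fourier_vec] Vs_fourier)
    finally show ?thesis using True by (simp add: V_adj_def fourier_span_def)
  qed (simp add: V_adj_def Vs_def fourier_span_def)
qed

lemma V_op_eq_W: "j < N \<Longrightarrow> V_op A a H j = W j"
  by (simp add: V_op_def W_def V_adj_eq_Vs fourier_span_def)

lemma sigma_map_eq: "sigma_map N A a H = \<sigma>"
  unfolding sigma_map_def \<sigma>_def fourier_span_def by (intro transfer_map_cong V_op_eq_W V_adj_eq_Vs)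

text \<open>Substitution of \<open>p = n - A *v m\<close>, with inverse
  \<open>sigma_inv A p n\<close>; terms whose frequency falls outside \<open>D\<close> have
  coefficient 0.\<close>

lemma sum_sigma_inv:
  assumes j: "j < N"
  shows "(\<Sum>m\<in>H. cnj (a j (n - A *v m)) *\<^sub>C fourier_vec m) =
    (\<Sum>p | p \<in> D \<and> n - p \<in> range ((*v) A) \<and> sigma_inv A p n \<in> H. cnj (a j p) *\<^sub>C fourier_vec (sigma_inv A p n))"
proof -
  have inv: "sigma_inv A (n - A *v m) n = m" for m by (simp add: sigma_inv_def inj_A)
  have inv': "n - A *v sigma_inv A p n = p" if "n - p \<in> range ((*v) A)" for p
    using that by (simp add: sigma_inv_def f_inv_into_f)
  have "(\<Sum>m\<in>H. cnj (a j (n - A *v m)) *\<^sub>C fourier_vec m)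
      = (\<Sum>m | m \<in> H \<and> n - A *v m \<in> D. cnj (a j (n - A *v m)) *\<^sub>C fourier_vec m)"
    by (rule sum.mono_neutral_right) (use finite_H a_zero[OF j] in auto)
  also have "\<dots> = (\<Sum>p | p \<in> D \<and> n - p \<in> range ((*v) A) \<and> sigma_inv A p n \<in> H.
      cnj (a j p) *\<^sub>C fourier_vec (sigma_inv A p n))"
    by (rule sum.reindex_bij_witness[where i = "\<lambda>p. sigma_inv A p n" and j = "\<lambda>m. n - A *v m"])
      (auto simp: inv inv')
  finally show ?thesis .
qed

end

lemma torus_L2_nontrivial: "(UNIV :: 'n::finite torus_L2 set) \<noteq> {0}"
proof -
  have "cinner (fourier_vec 0) (fourier_vec 0 :: 'n torus_L2) \<noteq> 0" by (simp add: cinner_fourier_vec)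
  then have "(fourier_vec 0 :: 'n torus_L2) \<noteq> 0" by auto
  then show ?thesis by blast
qed

theorem corollary3p3:
  fixes N :: nat
    and A :: "int^'n^'n" and D :: "(int^'n::finite) set" and a :: "nat \<Rightarrow> int^'n \<Rightarrow> complex"
    and S :: "nat \<Rightarrow> 'n torus_L2 \<Rightarrow> 'n torus_L2" and H :: "(int^'n) set" and K :: "'n torus_L2 set"
  assumes data: "polynomial_data N A D a"
    and S_def: "S = poly_rep A D a"
    and H: "minimal_absorbing N S H"
    and K_def: "K = fourier_span H"
  shows
    "(cyclic_for (cuntz_image N S) K \<and> finitely_correlated N S) \<and>

     (\<forall>j<N. V_adj A a H j \<in> bops K K \<and>
        (\<forall>n\<in>H. V_adj A a H j (fourier_vec n) =
                 (\<Sum>m\<in>H. cnj (a j (n - A *v m)) *\<^sub>C fourier_vec m) \<and>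
               (\<Sum>m\<in>H. cnj (a j (n - A *v m)) *\<^sub>C fourier_vec m) =
                 (\<Sum>p | p \<in> D \<and> n - p \<in> range ((*v) A) \<and> sigma_inv A p n \<in> H.
                    cnj (a j p) *\<^sub>C fourier_vec (sigma_inv A p n)))) \<and>

     (\<exists>\<phi>. isometric_linear_iso UNIV (commutant (cuntz_image N S)) K (sigma_fixed N A a H) \<phi> \<and>
        (\<forall>X \<in> commutant (cuntz_image N S). \<forall>Y \<in> commutant (cuntz_image N S).
           op_le UNIV X Y \<longleftrightarrow> op_le K (\<phi> X) (\<phi> Y))) \<and>

     (sigma_fixed N A a H = {\<lambda>x\<in>K. c *\<^sub>C x | c. True} \<longrightarrow> irreducible_on (cuntz_image N S) UNIV) \<and>
     (coinvariant N S K \<longrightarrow>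
        (irreducible_on (cuntz_image N S) UNIV \<longleftrightarrow>
         sigma_fixed N A a H = {\<lambda>x\<in>K. c *\<^sub>C x | c. True})) \<and>
     (irreducible_on (cuntz_image N S) UNIV \<longrightarrow>
        (let \<Gamma> = peripheral_spectrum K (sigma_map N A a H) in
           finite \<Gamma> \<and> subgroup \<Gamma> circle_group \<and> cyclic_group (circle_group\<lparr>carrier := \<Gamma>\<rparr>) \<and>
           splits_into_disjoint_irreducibles (uhf_image N S) (card \<Gamma>))) \<and>

     (\<forall>(A\<^sub>1 :: int^'m^'m) (D\<^sub>1 :: (int^'m::finite) set) a\<^sub>1 T H\<^sub>1 K\<^sub>1.
        polynomial_data N A\<^sub>1 D\<^sub>1 a\<^sub>1 \<and> T = poly_rep A\<^sub>1 D\<^sub>1 a\<^sub>1 \<and>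
        minimal_absorbing N T H\<^sub>1 \<and> K\<^sub>1 = fourier_span H\<^sub>1 \<and>
        coinvariant N S K \<and> coinvariant N T K\<^sub>1 \<longrightarrow>
          isometric_linear_iso UNIV (intertwiners N S T) K
            {V \<in> bops K K\<^sub>1. transfer_map N K (V_op A\<^sub>1 a\<^sub>1 H\<^sub>1) (V_adj A a H) V = V}
            (\<lambda>U. restrict (orth_proj K\<^sub>1 \<circ> U \<circ> orth_proj K) K))"
proof -
  interpret X: absorbing_poly_data N A D a H
    using data H by unfold_locales (simp_all add: S_def minimal_absorbing_def)
  have K: "K = X.K" by (simp add: K_def fourier_span_def)
  have fixed: "sigma_fixed N A a H = {A \<in> bops K K. X.\<sigma> A = A}"
    by (simp add: sigma_fixed_def X.sigma_map_eq K_def)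
  have cyclic: "cyclic_for (cuntz_image N S) K"
    \<comment> \<open>\<open>K\<close> contains its coinvariant part \<open>Ab 0\<close>, which is
      already cyclic.\<close>
    unfolding K S_def by (rule X.cyclic_if_Ab_0_subset) (rule X.absorbed_0_subset)
  have correlated: "finitely_correlated N S"
    unfolding S_def by (rule X.finitely_correlated)
  have V: "V_adj A a H j \<in> bops K K \<and>
      (\<forall>n\<in>H. V_adj A a H j (fourier_vec n) = (\<Sum>m\<in>H. cnj (a j (n - A *v m)) *\<^sub>C fourier_vec m) \<and>
        (\<Sum>m\<in>H. cnj (a j (n - A *v m)) *\<^sub>C fourier_vec m) =
          (\<Sum>p | p \<in> D \<and> n - p \<in> range ((*v) A) \<and> sigma_inv A p n \<in> H.
            cnj (a j p) *\<^sub>C fourier_vec (sigma_inv A p n)))" if "j < N" for j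
    unfolding X.V_adj_eq_Vs[OF that] K
    using X.Vs_bops[OF that] X.Vs_fourier[OF that] X.sum_sigma_inv[OF that] by blast
  have iso: "\<exists>\<phi>. isometric_linear_iso UNIV (commutant (cuntz_image N S)) K (sigma_fixed N A a H) \<phi> \<and>
        (\<forall>X \<in> commutant (cuntz_image N S). \<forall>Y \<in> commutant (cuntz_image N S).
           op_le UNIV X Y \<longleftrightarrow> op_le K (\<phi> X) (\<phi> Y))"
    using X.commutant_iso_exists unfolding fixed unfolding K S_def .
  have irr1: "irreducible_on (cuntz_image N S) UNIV" if "sigma_fixed N A a H = {\<lambda>x\<in>K. c *\<^sub>C x | c. True}"
    using that unfolding fixed unfolding K S_def by (rule X.irreducible_if_fixed_scalar[OF _ torus_L2_nontrivial])
  have irr2: "sigma_fixed N A a H = {\<lambda>x\<in>K. c *\<^sub>C x | c. True}"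
    if "coinvariant N S K" "irreducible_on (cuntz_image N S) UNIV"
    using that(2,1) unfolding fixed unfolding K S_def by (rule X.fixed_scalar_if_irreducible)
  have per: "let \<Gamma> = peripheral_spectrum K (sigma_map N A a H) in
      finite \<Gamma> \<and> subgroup \<Gamma> circle_group \<and> cyclic_group (circle_group\<lparr>carrier := \<Gamma>\<rparr>) \<and>
      splits_into_disjoint_irreducibles (uhf_image N S) (card \<Gamma>)"
    if "irreducible_on (cuntz_image N S) UNIV"
  proof -
    interpret I: irreducible_family N S "fourier_vec ` H"
      using that X.absorbed_family_axioms
      by (intro irreducible_family.intro irreducible_family_axioms.intro) (simp_all add: S_def)
    have "peripheral_spectrum K (sigma_map N A a H) = I.\<Gamma>"
      unfolding K X.sigma_map_eq using I.peripheral_spectrum_\<sigma> unfolding S_def .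
    then show ?thesis using I.finite_\<Gamma> I.subgroup_\<Gamma> I.cyclic_\<Gamma> I.uhf_splits by (simp add: Let_def)
  qed
  have intertw: "isometric_linear_iso UNIV (intertwiners N S T) K
      {V \<in> bops K K\<^sub>1. transfer_map N K (V_op A\<^sub>1 a\<^sub>1 H\<^sub>1) (V_adj A a H) V = V}
      (\<lambda>U. restrict (orth_proj K\<^sub>1 \<circ> U \<circ> orth_proj K) K)"
    if data\<^sub>1: "polynomial_data N A\<^sub>1 D\<^sub>1 a\<^sub>1" and T: "T = poly_rep A\<^sub>1 D\<^sub>1 a\<^sub>1"
      and H\<^sub>1: "minimal_absorbing N T H\<^sub>1" and K\<^sub>1: "K\<^sub>1 = fourier_span H\<^sub>1"
      and co: "coinvariant N S K" "coinvariant N T K\<^sub>1"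
    for A\<^sub>1 :: "int^'m^'m" and D\<^sub>1 :: "(int^'m::finite) set" and a\<^sub>1 T H\<^sub>1 K\<^sub>1
  proof -
    interpret Y: absorbing_poly_data N A\<^sub>1 D\<^sub>1 a\<^sub>1 H\<^sub>1
      using data\<^sub>1 H\<^sub>1 by unfold_locales (simp_all add: T minimal_absorbing_def)
    interpret XY: absorbed_pair N "poly_rep A D a" "fourier_vec ` H" "poly_rep A\<^sub>1 D\<^sub>1 a\<^sub>1" "fourier_vec ` H\<^sub>1" 1
      by (intro absorbed_pair.intro X.absorbed_family_axioms Y.absorbed_family_axioms absorbed_pair_axioms.intro) simp
    have K1: "K\<^sub>1 = Y.K" by (simp add: K\<^sub>1 fourier_span_def)
    have "intertwiners N S T = XY.Intw"
      by (auto simp: intertwiners_def XY.Intw_iff S_def T fun_eq_iff)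
    moreover have "transfer_map N K (V_op A\<^sub>1 a\<^sub>1 H\<^sub>1) (V_adj A a H) = transfer_map N X.K Y.W X.Vs"
      unfolding K by (intro transfer_map_cong Y.V_op_eq_W X.V_adj_eq_Vs)
    moreover have "isometric_linear_iso UNIV XY.Intw X.K XY.Fix (\<lambda>U. restrict (Y.P \<circ> U \<circ> X.P) X.K)"
    proof (rule isometric_linear_iso_cong[OF XY.compression_iso _ XY.Intw_add XY.Intw_scale])
      fix U assume "U \<in> XY.Intw"
      then show "restrict (Y.P \<circ> U \<circ> X.P) X.K = XY.compression U"
        using co X.coinvariant_imp_absorbed Y.coinvariant_imp_absorbed unfolding K K1 S_def T
        by (intro XY.compression_coinvariant[symmetric])
    qed
    ultimately show ?thesis by (simp add: XY.Fix_1_eq K K1)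
  qed
  show ?thesis
    using cyclic correlated V iso irr1 irr2 per intertw by blast
qed

end
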